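(* Let $(\Theta,T)$ be a 2-theory with associated natural number $k$, and let $I$ be a small pseudo $T$-algebra. The 2-category $\mathcal{C}$ of pseudo $(\Theta,T)$-algebras over $I^k$ admits pseudo limits: every pseudo functor $F:\mathcal{J}\to\mathcal{C}$ from a small 1-category $\mathcal{J}$ admits a pseudo limit in $\mathcal{C}$.
   Context: Pseudo limits. $Cat$ is the 2-category of small categories; pseudo functors and pseudo natural transformations have invertible coherence 2-cells. For a pseudo functor $F:\mathcal{J}\to\mathcal{C}$, a pseudo limit is an object $W$ of $\mathcal{C}$ with a pseudo natural transformation $\pi:\Delta_W\Rightarrow F$ from the constant 2-functor such that for every object $C$ the functor $(\pi\circ):Mor_{\mathcal{C}}(C,W)\to PseudoCone(C,F)$ is an isomorphism of categories, where $PseudoCone(C,F)$ has as objects the pseudo natural transformations $\Delta_C\Rightarrow F$ and as morphisms the modifications. Theories. A theory $T$ is a category with objects $0,1,2,\dots$ in which $n$ is the product of $n$ copies of $1$, with chosen projections $pr_i:n\to 1$. Put $T(n)=Mor_T(n,1)$. For a function $f:\{1,\dots,p\}\to\{1,\dots,\ell\}$ let $f':\ell\to p$ be the morphism with $pr_i f'=pr_{f(i)}$, and put $w_f=w\circ f'$ for $w\in T(p)$. For $w\in T(p)$, $w_i\in T(n_i)$ put $\gamma(w,w_1,\dots,w_p)=w\circ(w_1,\dots,w_p)$, where $(w_1,\dots,w_p):n_1+\dots+n_p\to p$ has $i$-th component $(w_i)_{\iota_i}$, $\iota_i$ the inclusion onto the $i$-th block. The unit $1\in T(1)$ is the projection $1\to1$.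 For a category $I$, on functors $F\in Functors(I^p,I)$ put $\gamma(F,F_1,\dots,F_p)=F\circ(F_1\times\dots\times F_p)$ and $F_f(x_1,\dots,x_\ell)=F(x_{f1},\dots,x_{fp})$; similarly on natural transformations. Pseudo $T$-algebras. A pseudo $T$-algebra is a category $I$ with functions $\Phi:T(n)\to Functors(I^n,I)$, $n\ge0$, and natural isomorphisms $c_{w,w_1,\dots,w_p}:\Phi(\gamma(w,w_1,\dots,w_p))\Rightarrow\gamma(\Phi(w),\Phi(w_1),\dots,\Phi(w_p))$, $\mathrm{I}:\Phi(1)\Rightarrow1_I$, $s_{w,f}:\Phi(w_f)\Rightarrow\Phi(w)_f$ such that (1) $\gamma(c_{w,w_1,\dots,w_p},i,\dots,i)\circ c_{\gamma(w,w_1,\dots,w_p),w_{11},\dots}=\gamma(i,c_{w_1,w_{11},\dots},\dots,c_{w_p,w_{p1},\dots})\circ c_{w,\gamma(w_1,w_{11},\dots),\dots}$; (2) $\gamma(i,\mathrm{I},\dots,\mathrm{I})\circ c_{w,1,\dots,1}=i$; (3) $\gamma(\mathrm{I},i)\circ c_{1,w}=i$; (4) $(c_{w,w_{f1},\dots,w_{fp}})_{\bar f}\circ s_{\gamma(w,w_{f1},\dots,w_{fp}),\bar f}=\gamma(s_{w,f},i,\dots,i)\circ c_{w_f,w_1,\dots,w_\ell}$, where $\bar f$ carries the $i$-th block (of length the arity of $w_{f(i)}$) identically onto the $f(i)$-th block; (5) $(c_{w,w_1,\dots,w_p})_g\circ s_{\gamma(w,w_1,\dots,w_p),g}=\gamma(i,s_{w_1,g_1},\dots,s_{w_p,g_p})\circ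 c_{w,(w_1)_{g_1},\dots,(w_p)_{g_p}}$ with $g=g_1+\dots+g_p$ the block sum; (6) $(s_{w,f})_g\circ s_{w_f,g}=s_{w,g\circ f}$; (7) $s_{w,id}$ is the identity. 2-theories. A 2-theory $(\Theta,T)$ is a natural number $k$, a theory $T$ and a contravariant functor $\Theta:T\to Cat$ such that: $Obj\,\Theta(m)=\coprod_{n\ge0}Mor_{T^k}(m,n)$, where $T^k$ is the theory with the objects of $T$ and $Mor_{T^k}(m,n)=Mor_T(m,n)^k$; for $w_1,\dots,w_n\in T^k(m):=Mor_{T^k}(m,1)$ the morphism $m\to n$ of $T^k$ with components $w_1,\dots,w_n$ is the product $\prod_{i=1}^nw_i$ in $\Theta(m)$; and for $u\in Mor_T(m,n)$ the functor $\Theta(u):\Theta(n)\to\Theta(m)$ is $v\mapsto v\circ u^{\times k}$ on objects, preserving the product projections. Write $\Theta(w;w_1,\dots,w_n)=Mor_{\Theta(m)}(\prod_iw_i,w)$ for $w,w_i\in T^k(m)$. Operations on these sets: (O1) the unit $1_w\in\Theta(w;w)$; (O2) composition $\gamma(\alpha;\alpha_1,\dots,\alpha_q)\in\Theta(w;w_{11},\dots,w_{qp_q})$ for $\alpha\in\Theta(w;w_1,\dots,w_q)$, $\alpha_i\in\Theta(w_i;w_{i1},\dots,w_{ip_i})$, i.e. $\alpha\circ(\alpha_1\times\dots\times\alpha_q)$; (O3) $\Theta$-functoriality: for $\iota:\{1,\dots,p\}\to\{1,\dots,q\}$, $\alpha\mapsto\alpha^\iota$ from $\Theta(w;w_{\iota(1)},\dots,w_{\iota(p)})$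 to $\Theta(w;w_1,\dots,w_q)$, precomposition with the induced $\prod_{i=1}^qw_i\to\prod_{i=1}^pw_{\iota(i)}$; (O4) $T$-functoriality: for $f:\{1,\dots,m\}\to\{1,\dots,\ell\}$, $\alpha\mapsto\alpha_f=\Theta(f')(\alpha)\in\Theta(w_f;(w_1)_f,\dots,(w_q)_f)$ (substitution componentwise in the $k$ entries); (O5) $T$-substitution: for $u_i\in T(k_i)$, $i=1,\dots,m$, $\alpha\mapsto(u_1,\dots,u_m)^*\alpha=\Theta((u_1,\dots,u_m))(\alpha)\in\Theta(v;v_1,\dots,v_q)$, with $v=\gamma^{\times k}(w;u_1^{\times k},\dots,u_m^{\times k})$ and $v_j=\gamma^{\times k}(w_j;u_1^{\times k},\dots,u_m^{\times k})$. Relations: (R1) composition is associative and (R2) unital; (R3) $(\alpha^\iota)^\theta=\alpha^{\theta\iota}$, $\alpha^{id}=\alpha$; (R4) $\gamma(\alpha^\iota;\alpha_1,\dots,\alpha_q)=\gamma(\alpha;\alpha_{\iota(1)},\dots,\alpha_{\iota(p)})^{\bar\iota}$; (R5) $\gamma(\alpha;\alpha_1^{\iota_1},\dots,\alpha_q^{\iota_q})=\gamma(\alpha;\alpha_1,\dots,\alpha_q)^{\iota_1+\dots+\iota_q}$; (R6) $(\alpha_f)_g=\alpha_{g\circ f}$, $\alpha_{id}=\alpha$; (R7) $(s_{11},\dots,s_{mk_m})^*(t_1,\dots,t_m)^*\alpha=(r_1,\dots,r_m)^*\alpha$ with $r_i=\gamma(t_i,s_{i1},\dots,s_{ik_i})$;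 (R8) $(1,\dots,1)^*\alpha=\alpha$; (R9) $\gamma(\alpha_f;(\alpha_1)_f,\dots,(\alpha_q)_f)=\gamma(\alpha;\alpha_1,\dots,\alpha_q)_f$; (R10) $(\alpha^\iota)_f=(\alpha_f)^\iota$; (R11) $(u_1,\dots,u_m)^*(\alpha^\iota)=((u_1,\dots,u_m)^*\alpha)^\iota$; (R12) $((u_1)_{f_1},\dots,(u_m)_{f_m})^*\alpha=((u_1,\dots,u_m)^*\alpha)_{f_1+\dots+f_m}$; (R13) $(u_1,\dots,u_\ell)^*(\alpha_f)=((u_{f1},\dots,u_{fm})^*\alpha)_{\bar f}$; (R14) $(u_1,\dots,u_m)^*\gamma(\alpha;\alpha_1,\dots,\alpha_q)=\gamma(\beta;\beta_1,\dots,\beta_q)$ with $\beta=(u_1,\dots,u_m)^*\alpha$, $\beta_j=(u_1,\dots,u_m)^*\alpha_j$. $End(X)$. Let $X:I^k\to Cat$ be a strict 2-functor, $I^k$ having only identity 2-cells. For a $k$-tuple $a=(a^1,\dots,a^k)$ of functors $I^m\to I$ let $\langle a\rangle:I^m\to I^k$ be the induced functor. $End(X)(a;a_1,\dots,a_n)$ is the set of natural transformations $X\langle a_1\rangle\times\dots\times X\langle a_n\rangle\Rightarrow X\langle a\rangle$ of functors $I^m\to Cat$. It carries operations (O1)-(O5) satisfying (R1)-(R14) (with $End(I)$ in place of $T$): composition of natural transformations, precomposition with projections/diagonals, and whiskering with functors $I^\ell\to I^m$. For $w=(w^1,\dots,w^k)\in T^k(m)$ put $\Phi(w)=(\Phi(w^1),\dots,\Phi(w^k))$.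 Pseudo $(\Theta,T)$-algebras over $I^k$. Fix the small pseudo $T$-algebra $I$. A pseudo $(\Theta,T)$-algebra over $I^k$ is a strict 2-functor $X:I^k\to Cat$ with maps $\phi:\Theta(w;w_1,\dots,w_n)\to End(X)(\Phi(w);\Phi(w_1),\dots,\Phi(w_n))$ and, for each operation, invertible coherence modifications: $\phi(1_w)\cong1_{\Phi(w)}$; $\phi(\gamma(\alpha;\alpha_1,\dots,\alpha_q))\cong\gamma(\phi\alpha;\phi\alpha_1,\dots,\phi\alpha_q)$; $\phi(\alpha^\iota)\cong\phi(\alpha)^\iota$; $X(s_{w,f})\circ\phi(\alpha_f)\cong\phi(\alpha)_f\circ\prod_jX(s_{w_j,f})$; $X(c)\circ\phi((u_1,\dots,u_m)^*\alpha)\cong(\Phi(u_1),\dots,\Phi(u_m))^*\phi(\alpha)\circ\prod_jX(c)$, where $X(s)$, $X(c)$ are the natural isomorphisms obtained by applying $X$ to the coherence isomorphisms $s$, $c$ of $I$. They satisfy one coherence diagram for each relation (R1)-(R14): when the relation equates two composite operations $P(\alpha,\dots)=Q(\alpha,\dots)$, the two invertible modifications from $\phi(P(\alpha,\dots))=\phi(Q(\alpha,\dots))$ to $P(\phi\alpha,\dots)=Q(\phi\alpha,\dots)$ (transported along $X$ of the coherence isomorphisms of $I$), obtained by successively moving $\phi$ past the constituent operations of $P$, respectively of $Q$, coincide. A morphism $H:X\to Y$ is a strict 2-natural transformation $H:X\Rightarrow Y$ with, for each $\alpha\in\Theta(w;w_1,\dots,w_n)$, an invertible modification $\rho_\alpha$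 between $(H*i_{\langle\Phi(w)\rangle})\circ\phi_X(\alpha)$ and $\phi_Y(\alpha)\circ\prod_j(H*i_{\langle\Phi(w_j)\rangle})$, commuting with all coherence modifications of $X$ and $Y$. A 2-cell $\sigma:G\Rightarrow H$ is a modification from $G$ to $H$ commuting with the $\rho^G_\alpha$ and $\rho^H_\alpha$. These form the 2-category of pseudo $(\Theta,T)$-algebras over $I^k$. *)

theory Defs
  imports "HOL-Library.FuncSet" "HOL-Library.Equipollence"
begin

section \<open>Size\<close>

text \<open>
  HOL has no universe of sets. A type \<open>'u\<close> whose cardinality is a strongly inaccessible
  cardinal plays the role of a Grothendieck universe: a set, of whatever type, is small if its
  cardinality is less than that of \<open>'u\<close>. Every small category is isomorphic to one whose objects
  and arrows are elements of \<open>'u\<close>; those are the objects of Cat below.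
\<close>

definition inaccessible :: "'u itself \<Rightarrow> bool" where
  "inaccessible _ \<longleftrightarrow>
     (UNIV :: nat set) \<prec> (UNIV :: 'u set) \<and>
     (\<forall>A :: 'u set. A \<prec> (UNIV :: 'u set) \<longrightarrow> Pow A \<prec> (UNIV :: 'u set)) \<and>
     (\<forall>F :: 'u set set. F \<prec> (UNIV :: 'u set) \<and> (\<forall>A\<in>F. A \<prec> (UNIV :: 'u set))
        \<longrightarrow> \<Union>F \<prec> (UNIV :: 'u set))"

definition small :: "'u itself \<Rightarrow> 'a set \<Rightarrow> bool" where
  "small _ A \<longleftrightarrow> A \<prec> (UNIV :: 'u set)"


section \<open>Categories, functors, natural transformations\<close>

record ('o, 'a) cat =
  Ob :: "'o set"
  Ar :: "'a set"
  Dom :: "'a \<Rightarrow> 'o"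
  Cod :: "'a \<Rightarrow> 'o"
  Ident :: "'o \<Rightarrow> 'a"
  Comp :: "'a \<Rightarrow> 'a \<Rightarrow> 'a"  (infixr \<open>\<cdot>\<index>\<close> 70)

definition hom :: "('o, 'a, 'z) cat_scheme \<Rightarrow> 'o \<Rightarrow> 'o \<Rightarrow> 'a set" where
  "hom C x y = {f \<in> Ar C. Dom C f = x \<and> Cod C f = y}"

definition category :: "('o, 'a, 'z) cat_scheme \<Rightarrow> bool" where
  "category C \<longleftrightarrow>
     (\<forall>f\<in>Ar C. Dom C f \<in> Ob C \<and> Cod C f \<in> Ob C) \<and>
     (\<forall>x\<in>Ob C. Ident C x \<in> hom C x x) \<and>
     (\<forall>f\<in>Ar C. \<forall>g\<in>Ar C. Cod C f = Dom C g \<longrightarrow> g \<cdot>\<^bsub>C\<^esub> f \<in> hom C (Dom C f) (Cod C g)) \<and>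
     (\<forall>f\<in>Ar C. f \<cdot>\<^bsub>C\<^esub> Ident C (Dom C f) = f \<and> Ident C (Cod C f) \<cdot>\<^bsub>C\<^esub> f = f) \<and>
     (\<forall>f\<in>Ar C. \<forall>g\<in>Ar C. \<forall>h\<in>Ar C. Cod C f = Dom C g \<and> Cod C g = Dom C h
        \<longrightarrow> h \<cdot>\<^bsub>C\<^esub> (g \<cdot>\<^bsub>C\<^esub> f) = (h \<cdot>\<^bsub>C\<^esub> g) \<cdot>\<^bsub>C\<^esub> f)"

definition small_category :: "'u itself \<Rightarrow> ('o, 'a, 'z) cat_scheme \<Rightarrow> bool" where
  "small_category U C \<longleftrightarrow> category C \<and> small U (Ob C) \<and> small U (Ar C)"

definition iso_in :: "('o, 'a, 'z) cat_scheme \<Rightarrow> 'a \<Rightarrow> bool" where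
  "iso_in C f \<longleftrightarrow> f \<in> Ar C \<and>
     (\<exists>g\<in>hom C (Cod C f) (Dom C f).
        g \<cdot>\<^bsub>C\<^esub> f = Ident C (Dom C f) \<and> f \<cdot>\<^bsub>C\<^esub> g = Ident C (Cod C f))"

definition op_cat :: "('o, 'a, 'z) cat_scheme \<Rightarrow> ('o, 'a) cat" where
  "op_cat C = \<lparr>Ob = Ob C, Ar = Ar C, Dom = Cod C, Cod = Dom C, Ident = Ident C,
     Comp = (\<lambda>g f. f \<cdot>\<^bsub>C\<^esub> g)\<rparr>"

definition prod_cat :: "('o, 'a) cat list \<Rightarrow> ('o list, 'a list) cat" where
  "prod_cat Cs = \<lparr>
     Ob = {xs. list_all2 (\<lambda>C x. x \<in> Ob C) Cs xs},
     Ar = {fs. list_all2 (\<lambda>C f. f \<in> Ar C) Cs fs},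
     Dom = map2 Dom Cs,
     Cod = map2 Cod Cs,
     Ident = map2 Ident Cs,
     Comp = (\<lambda>gs fs. map (\<lambda>i. gs ! i \<cdot>\<^bsub>Cs ! i\<^esub> fs ! i) [0..<length Cs])\<rparr>"

definition pow_cat :: "('o, 'a) cat \<Rightarrow> nat \<Rightarrow> ('o list, 'a list) cat" where
  "pow_cat C n = prod_cat (replicate n C)"

record ('o, 'a, 'p, 'b) func =
  FO :: "'o \<Rightarrow> 'p"
  FA :: "'a \<Rightarrow> 'b"

definition is_functor ::
    "('o, 'a, 'y) cat_scheme \<Rightarrow> ('p, 'b, 'z) cat_scheme \<Rightarrow> ('o, 'a, 'p, 'b) func \<Rightarrow> bool" where
  "is_functor C D F \<longleftrightarrow>
     (\<forall>x\<in>Ob C. FO F x \<in> Ob D) \<and>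
     (\<forall>f\<in>Ar C. FA F f \<in> hom D (FO F (Dom C f)) (FO F (Cod C f))) \<and>
     (\<forall>x\<in>Ob C. FA F (Ident C x) = Ident D (FO F x)) \<and>
     (\<forall>f\<in>Ar C. \<forall>g\<in>Ar C. Cod C f = Dom C g \<longrightarrow> FA F (g \<cdot>\<^bsub>C\<^esub> f) = FA F g \<cdot>\<^bsub>D\<^esub> FA F f)"

text \<open>Equality of functors on \<open>C\<close>: values outside \<open>C\<close> are irrelevant.\<close>

definition func_eq :: "('o, 'a, 'z) cat_scheme \<Rightarrow> ('o, 'a, 'p, 'b) func \<Rightarrow> ('o, 'a, 'p, 'b) func \<Rightarrow> bool"
  where
  "func_eq C F G \<longleftrightarrow> (\<forall>x\<in>Ob C. FO F x = FO G x) \<and> (\<forall>f\<in>Ar C. FA F f = FA G f)"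

definition func_ext :: "('o, 'a, 'z) cat_scheme \<Rightarrow> ('o, 'a, 'p, 'b) func \<Rightarrow> bool" where
  "func_ext C F \<longleftrightarrow> FO F \<in> extensional (Ob C) \<and> FA F \<in> extensional (Ar C)"

definition id_func :: "('o, 'a, 'o, 'a) func" where
  "id_func = \<lparr>FO = (\<lambda>x. x), FA = (\<lambda>f. f)\<rparr>"

definition comp_func :: "('p, 'b, 'q, 'c) func \<Rightarrow> ('o, 'a, 'p, 'b) func \<Rightarrow> ('o, 'a, 'q, 'c) func" where
  "comp_func G F = \<lparr>FO = (\<lambda>x. FO G (FO F x)), FA = (\<lambda>f. FA G (FA F f))\<rparr>"

definition restrict_func :: "('o, 'a, 'z) cat_scheme \<Rightarrow> ('o, 'a, 'p, 'b) func \<Rightarrow> ('o, 'a, 'p, 'b) func" where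
  "restrict_func C F = \<lparr>FO = restrict (FO F) (Ob C), FA = restrict (FA F) (Ar C)\<rparr>"

definition prod_func :: "('o, 'a, 'p, 'b) func list \<Rightarrow> ('o list, 'a list, 'p list, 'b list) func" where
  "prod_func Fs = \<lparr>FO = map2 FO Fs, FA = map2 FA Fs\<rparr>"

definition nat_trans ::
    "('o, 'a, 'y) cat_scheme \<Rightarrow> ('p, 'b, 'z) cat_scheme \<Rightarrow> ('o, 'a, 'p, 'b) func \<Rightarrow>
     ('o, 'a, 'p, 'b) func \<Rightarrow> ('o \<Rightarrow> 'b) \<Rightarrow> bool" where
  "nat_trans C D F G \<eta> \<longleftrightarrow>
     (\<forall>x\<in>Ob C. \<eta> x \<in> hom D (FO F x) (FO G x)) \<and>
     (\<forall>f\<in>Ar C. \<eta> (Cod C f) \<cdot>\<^bsub>D\<^esub> FA F f = FA G f \<cdot>\<^bsub>D\<^esub> \<eta> (Dom C f))"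

definition nat_iso ::
    "('o, 'a, 'y) cat_scheme \<Rightarrow> ('p, 'b, 'z) cat_scheme \<Rightarrow> ('o, 'a, 'p, 'b) func \<Rightarrow>
     ('o, 'a, 'p, 'b) func \<Rightarrow> ('o \<Rightarrow> 'b) \<Rightarrow> bool" where
  "nat_iso C D F G \<eta> \<longleftrightarrow> nat_trans C D F G \<eta> \<and> (\<forall>x\<in>Ob C. iso_in D (\<eta> x))"

definition iso_of_cats ::
    "('o, 'a, 'y) cat_scheme \<Rightarrow> ('p, 'b, 'z) cat_scheme \<Rightarrow> ('o, 'a, 'p, 'b) func \<Rightarrow> bool" where
  "iso_of_cats C D F \<longleftrightarrow>
     is_functor C D F \<and> bij_betw (FO F) (Ob C) (Ob D) \<and> bij_betw (FA F) (Ar C) (Ar D)"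

definition is_product ::
    "('o, 'a, 'z) cat_scheme \<Rightarrow> 'o \<Rightarrow> 'o list \<Rightarrow> (nat \<Rightarrow> 'a) \<Rightarrow> bool" where
  "is_product C P As p \<longleftrightarrow>
     P \<in> Ob C \<and>
     (\<forall>i<length As. p i \<in> hom C P (As ! i)) \<and>
     (\<forall>B\<in>Ob C. \<forall>fs. length fs = length As \<and> (\<forall>i<length As. fs ! i \<in> hom C B (As ! i)) \<longrightarrow>
        (\<exists>!f. f \<in> hom C B P \<and> (\<forall>i<length As. p i \<cdot>\<^bsub>C\<^esub> f = fs ! i)))"

text \<open>The morphism \<open>B \<rightarrow> P\<close> whose components along \<open>p\<close> are \<open>fs\<close>.\<close>

definition tuple ::
    "('o, 'a, 'z) cat_scheme \<Rightarrow> 'o \<Rightarrow> 'o \<Rightarrow> (nat \<Rightarrow> 'a) \<Rightarrow> 'a list \<Rightarrow> 'a" where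
  "tuple C B P p fs = (THE f. f \<in> hom C B P \<and> (\<forall>i<length fs. p i \<cdot>\<^bsub>C\<^esub> f = fs ! i))"


section \<open>Functors to Cat\<close>

text \<open>
  The categories they are defined on have only identity 2-cells, so strict 2-functors to Cat are
  functors, and strict 2-natural transformations are natural transformations.
\<close>

record ('o, 'a, 'p, 'b) catfun =
  XO :: "'o \<Rightarrow> ('p, 'b) cat"
  XA :: "'a \<Rightarrow> ('p, 'b, 'p, 'b) func"

definition functor_to_Cat ::
    "'u itself \<Rightarrow> ('o, 'a, 'z) cat_scheme \<Rightarrow> ('o, 'a, 'p, 'b) catfun \<Rightarrow> bool" where
  "functor_to_Cat U C X \<longleftrightarrow>
     (\<forall>x\<in>Ob C. small_category U (XO X x)) \<and>
     (\<forall>f\<in>Ar C. is_functor (XO X (Dom C f)) (XO X (Cod C f)) (XA X f)) \<and>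
     (\<forall>x\<in>Ob C. func_eq (XO X x) (XA X (Ident C x)) id_func) \<and>
     (\<forall>f\<in>Ar C. \<forall>g\<in>Ar C. Cod C f = Dom C g \<longrightarrow>
        func_eq (XO X (Dom C f)) (XA X (g \<cdot>\<^bsub>C\<^esub> f)) (comp_func (XA X g) (XA X f)))"

definition nat_to_Cat ::
    "('o, 'a, 'z) cat_scheme \<Rightarrow> ('o, 'a, 'p, 'b) catfun \<Rightarrow> ('o, 'a, 'q, 'c) catfun \<Rightarrow>
     ('o \<Rightarrow> ('p, 'b, 'q, 'c) func) \<Rightarrow> bool" where
  "nat_to_Cat C X Y \<theta> \<longleftrightarrow>
     (\<forall>x\<in>Ob C. is_functor (XO X x) (XO Y x) (\<theta> x)) \<and>
     (\<forall>f\<in>Ar C. func_eq (XO X (Dom C f))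
        (comp_func (\<theta> (Cod C f)) (XA X f)) (comp_func (XA Y f) (\<theta> (Dom C f))))"

definition modif ::
    "('o, 'a, 'z) cat_scheme \<Rightarrow> ('o, 'a, 'p, 'b) catfun \<Rightarrow> ('o, 'a, 'q, 'c) catfun \<Rightarrow>
     ('o \<Rightarrow> ('p, 'b, 'q, 'c) func) \<Rightarrow> ('o \<Rightarrow> ('p, 'b, 'q, 'c) func) \<Rightarrow>
     ('o \<Rightarrow> 'p \<Rightarrow> 'c) \<Rightarrow> bool" where
  "modif C X Y \<theta> \<theta>' \<Gamma> \<longleftrightarrow>
     (\<forall>x\<in>Ob C. nat_trans (XO X x) (XO Y x) (\<theta> x) (\<theta>' x) (\<Gamma> x)) \<and>
     (\<forall>f\<in>Ar C. \<forall>y\<in>Ob (XO X (Dom C f)).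
        FA (XA Y f) (\<Gamma> (Dom C f) y) = \<Gamma> (Cod C f) (FO (XA X f) y))"

definition inv_modif ::
    "('o, 'a, 'z) cat_scheme \<Rightarrow> ('o, 'a, 'p, 'b) catfun \<Rightarrow> ('o, 'a, 'q, 'c) catfun \<Rightarrow>
     ('o \<Rightarrow> ('p, 'b, 'q, 'c) func) \<Rightarrow> ('o \<Rightarrow> ('p, 'b, 'q, 'c) func) \<Rightarrow>
     ('o \<Rightarrow> 'p \<Rightarrow> 'c) \<Rightarrow> bool" where
  "inv_modif C X Y \<theta> \<theta>' \<Gamma> \<longleftrightarrow>
     modif C X Y \<theta> \<theta>' \<Gamma> \<and> (\<forall>x\<in>Ob C. \<forall>y\<in>Ob (XO X x). iso_in (XO Y x) (\<Gamma> x y))"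

definition prod_catfun :: "('o, 'a, 'p, 'b) catfun list \<Rightarrow> ('o, 'a, 'p list, 'b list) catfun" where
  "prod_catfun Xs = \<lparr>XO = (\<lambda>x. prod_cat (map (\<lambda>X. XO X x) Xs)),
                      XA = (\<lambda>f. prod_func (map (\<lambda>X. XA X f) Xs))\<rparr>"


section \<open>2-categories and pseudo limits\<close>

text \<open>
  A 2-category is given by hom categories (\<open>cmp1 A B D g f\<close> is the composite of \<open>f: A \<rightarrow> B\<close> and
  \<open>g: B \<rightarrow> D\<close>, \<open>cmp2\<close> is horizontal composition).
\<close>

record ('o, 'm, 'c) cat2 =
  Ob2 :: "'o set"
  Mor2 :: "'o \<Rightarrow> 'o \<Rightarrow> ('m, 'c) cat"
  one1 :: "'o \<Rightarrow> 'm"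
  cmp1 :: "'o \<Rightarrow> 'o \<Rightarrow> 'o \<Rightarrow> 'm \<Rightarrow> 'm \<Rightarrow> 'm"
  cmp2 :: "'o \<Rightarrow> 'o \<Rightarrow> 'o \<Rightarrow> 'c \<Rightarrow> 'c \<Rightarrow> 'c"

definition whisk_l :: "('o, 'm, 'c) cat2 \<Rightarrow> 'o \<Rightarrow> 'o \<Rightarrow> 'o \<Rightarrow> 'm \<Rightarrow> 'c \<Rightarrow> 'c" where
  "whisk_l K A B D g \<sigma> = cmp2 K A B D (Ident (Mor2 K B D) g) \<sigma>"

definition whisk_r :: "('o, 'm, 'c) cat2 \<Rightarrow> 'o \<Rightarrow> 'o \<Rightarrow> 'o \<Rightarrow> 'c \<Rightarrow> 'm \<Rightarrow> 'c" where
  "whisk_r K A B D \<tau> f = cmp2 K A B D \<tau> (Ident (Mor2 K A B) f)"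

text \<open>
  Pseudo functors on a 1-category: \<open>Pc F g f : F g \<circ> F f \<Rightarrow> F (g \<circ> f)\<close> and
  \<open>Pu F j : 1 \<Rightarrow> F 1\<close>.
\<close>

record ('jo, 'ja, 'o, 'm, 'c) pseudo =
  P0 :: "'jo \<Rightarrow> 'o"
  P1 :: "'ja \<Rightarrow> 'm"
  Pc :: "'ja \<Rightarrow> 'ja \<Rightarrow> 'c"
  Pu :: "'jo \<Rightarrow> 'c"

definition pseudo_functor ::
    "('jo, 'ja) cat \<Rightarrow> ('o, 'm, 'c) cat2 \<Rightarrow> ('jo, 'ja, 'o, 'm, 'c) pseudo \<Rightarrow> bool" where
  "pseudo_functor J K F \<longleftrightarrow>
     (\<forall>j\<in>Ob J. P0 F j \<in> Ob2 K) \<and>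
     (\<forall>f\<in>Ar J. P1 F f \<in> Ob (Mor2 K (P0 F (Dom J f)) (P0 F (Cod J f)))) \<and>
     (\<forall>j\<in>Ob J. let M = Mor2 K (P0 F j) (P0 F j) in
        Pu F j \<in> hom M (one1 K (P0 F j)) (P1 F (Ident J j)) \<and> iso_in M (Pu F j)) \<and>
     (\<forall>f\<in>Ar J. \<forall>g\<in>Ar J. Cod J f = Dom J g \<longrightarrow>
        (let A = P0 F (Dom J f); B = P0 F (Cod J f); D = P0 F (Cod J g); M = Mor2 K A D in
         Pc F g f \<in> hom M (cmp1 K A B D (P1 F g) (P1 F f)) (P1 F (g \<cdot>\<^bsub>J\<^esub> f)) \<and>
         iso_in M (Pc F g f))) \<and>
     (\<forall>f\<in>Ar J. let A = P0 F (Dom J f); B = P0 F (Cod J f); M = Mor2 K A B in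
        Pc F f (Ident J (Dom J f)) \<cdot>\<^bsub>M\<^esub> whisk_l K A A B (P1 F f) (Pu F (Dom J f))
          = Ident M (P1 F f) \<and>
        Pc F (Ident J (Cod J f)) f \<cdot>\<^bsub>M\<^esub> whisk_r K A B B (Pu F (Cod J f)) (P1 F f)
          = Ident M (P1 F f)) \<and>
     (\<forall>f\<in>Ar J. \<forall>g\<in>Ar J. \<forall>h\<in>Ar J. Cod J f = Dom J g \<and> Cod J g = Dom J h \<longrightarrow>
        (let A = P0 F (Dom J f); B = P0 F (Cod J f); D = P0 F (Cod J g); E = P0 F (Cod J h);
             M = Mor2 K A E in
         Pc F (h \<cdot>\<^bsub>J\<^esub> g) f \<cdot>\<^bsub>M\<^esub> whisk_r K A B E (Pc F h g) (P1 F f)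
         = Pc F h (g \<cdot>\<^bsub>J\<^esub> f) \<cdot>\<^bsub>M\<^esub> whisk_l K A D E (P1 F h) (Pc F g f)))"

definition const_pseudo :: "('o, 'm, 'c) cat2 \<Rightarrow> 'o \<Rightarrow> ('jo, 'ja, 'o, 'm, 'c) pseudo" where
  "const_pseudo K W = \<lparr>P0 = (\<lambda>_. W), P1 = (\<lambda>_. one1 K W),
     Pc = (\<lambda>_ _. Ident (Mor2 K W W) (one1 K W)),
     Pu = (\<lambda>_. Ident (Mor2 K W W) (one1 K W))\<rparr>"

text \<open>
  Pseudo natural transformations \<open>F \<Rightarrow> G\<close>: 1-cells \<open>N1 j : F j \<rightarrow> G j\<close> and invertible 2-cells
  \<open>N2 f : G f \<circ> N1 j \<Rightarrow> N1 j' \<circ> F f\<close> for \<open>f: j \<rightarrow> j'\<close>.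
\<close>

record ('jo, 'ja, 'm, 'c) pnt =
  N1 :: "'jo \<Rightarrow> 'm"
  N2 :: "'ja \<Rightarrow> 'c"

definition pseudo_nat ::
    "('jo, 'ja) cat \<Rightarrow> ('o, 'm, 'c) cat2 \<Rightarrow> ('jo, 'ja, 'o, 'm, 'c) pseudo \<Rightarrow>
     ('jo, 'ja, 'o, 'm, 'c) pseudo \<Rightarrow> ('jo, 'ja, 'm, 'c) pnt \<Rightarrow> bool" where
  "pseudo_nat J K F G \<alpha> \<longleftrightarrow>
     N1 \<alpha> \<in> extensional (Ob J) \<and> N2 \<alpha> \<in> extensional (Ar J) \<and>
     (\<forall>j\<in>Ob J. N1 \<alpha> j \<in> Ob (Mor2 K (P0 F j) (P0 G j))) \<and>
     (\<forall>f\<in>Ar J. let i = Dom J f; j = Cod J f; M = Mor2 K (P0 F i) (P0 G j) in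
        N2 \<alpha> f \<in> hom M (cmp1 K (P0 F i) (P0 G i) (P0 G j) (P1 G f) (N1 \<alpha> i))
                       (cmp1 K (P0 F i) (P0 F j) (P0 G j) (N1 \<alpha> j) (P1 F f)) \<and>
        iso_in M (N2 \<alpha> f)) \<and>
     (\<forall>j\<in>Ob J. let M = Mor2 K (P0 F j) (P0 G j) in
        N2 \<alpha> (Ident J j) \<cdot>\<^bsub>M\<^esub> whisk_r K (P0 F j) (P0 G j) (P0 G j) (Pu G j) (N1 \<alpha> j)
        = whisk_l K (P0 F j) (P0 F j) (P0 G j) (N1 \<alpha> j) (Pu F j)) \<and>
     (\<forall>f\<in>Ar J. \<forall>g\<in>Ar J. Cod J f = Dom J g \<longrightarrow>
        (let i = Dom J f; j = Cod J f; l = Cod J g; M = Mor2 K (P0 F i) (P0 G l) in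
         N2 \<alpha> (g \<cdot>\<^bsub>J\<^esub> f) \<cdot>\<^bsub>M\<^esub> whisk_r K (P0 F i) (P0 G i) (P0 G l) (Pc G g f) (N1 \<alpha> i)
         = whisk_l K (P0 F i) (P0 F l) (P0 G l) (N1 \<alpha> l) (Pc F g f)
           \<cdot>\<^bsub>M\<^esub> whisk_r K (P0 F i) (P0 F j) (P0 G l) (N2 \<alpha> g) (P1 F f)
           \<cdot>\<^bsub>M\<^esub> whisk_l K (P0 F i) (P0 G j) (P0 G l) (P1 G g) (N2 \<alpha> f)))"

definition modification ::
    "('jo, 'ja) cat \<Rightarrow> ('o, 'm, 'c) cat2 \<Rightarrow> ('jo, 'ja, 'o, 'm, 'c) pseudo \<Rightarrow>
     ('jo, 'ja, 'o, 'm, 'c) pseudo \<Rightarrow> ('jo, 'ja, 'm, 'c) pnt \<Rightarrow> ('jo, 'ja, 'm, 'c) pnt \<Rightarrow>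
     ('jo \<Rightarrow> 'c) \<Rightarrow> bool" where
  "modification J K F G \<alpha> \<beta> \<Lambda> \<longleftrightarrow>
     \<Lambda> \<in> extensional (Ob J) \<and>
     (\<forall>j\<in>Ob J. \<Lambda> j \<in> hom (Mor2 K (P0 F j) (P0 G j)) (N1 \<alpha> j) (N1 \<beta> j)) \<and>
     (\<forall>f\<in>Ar J. let i = Dom J f; j = Cod J f; M = Mor2 K (P0 F i) (P0 G j) in
        N2 \<beta> f \<cdot>\<^bsub>M\<^esub> whisk_l K (P0 F i) (P0 G i) (P0 G j) (P1 G f) (\<Lambda> i)
        = whisk_r K (P0 F i) (P0 F j) (P0 G j) (\<Lambda> j) (P1 F f) \<cdot>\<^bsub>M\<^esub> N2 \<alpha> f)"

definition PseudoCone ::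
    "('jo, 'ja) cat \<Rightarrow> ('o, 'm, 'c) cat2 \<Rightarrow> 'o \<Rightarrow> ('jo, 'ja, 'o, 'm, 'c) pseudo \<Rightarrow>
     (('jo, 'ja, 'm, 'c) pnt,
      ('jo, 'ja, 'm, 'c) pnt \<times> ('jo, 'ja, 'm, 'c) pnt \<times> ('jo \<Rightarrow> 'c)) cat" where
  "PseudoCone J K A F = (let M = (\<lambda>j. Mor2 K A (P0 F j)) in
     \<lparr>Ob = {\<alpha>. pseudo_nat J K (const_pseudo K A) F \<alpha>},
      Ar = {(\<alpha>, \<beta>, \<Lambda>). pseudo_nat J K (const_pseudo K A) F \<alpha> \<and>
              pseudo_nat J K (const_pseudo K A) F \<beta> \<and>
              modification J K (const_pseudo K A) F \<alpha> \<beta> \<Lambda>},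
      Dom = (\<lambda>(\<alpha>, \<beta>, \<Lambda>). \<alpha>),
      Cod = (\<lambda>(\<alpha>, \<beta>, \<Lambda>). \<beta>),
      Ident = (\<lambda>\<alpha>. (\<alpha>, \<alpha>, \<lambda>j\<in>Ob J. Ident (M j) (N1 \<alpha> j))),
      Comp = (\<lambda>(\<beta>, \<delta>, \<Xi>) (\<alpha>, \<beta>', \<Lambda>). (\<alpha>, \<delta>, \<lambda>j\<in>Ob J. \<Xi> j \<cdot>\<^bsub>M j\<^esub> \<Lambda> j))\<rparr>)"

definition cone_comp1 ::
    "('jo, 'ja) cat \<Rightarrow> ('o, 'm, 'c) cat2 \<Rightarrow> ('jo, 'ja, 'o, 'm, 'c) pseudo \<Rightarrow> 'o \<Rightarrow>
     ('jo, 'ja, 'm, 'c) pnt \<Rightarrow> 'o \<Rightarrow> 'm \<Rightarrow> ('jo, 'ja, 'm, 'c) pnt" where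
  "cone_comp1 J K F W \<pi> A b =
     \<lparr>N1 = (\<lambda>j\<in>Ob J. cmp1 K A W (P0 F j) (N1 \<pi> j) b),
      N2 = (\<lambda>f\<in>Ar J. whisk_r K A W (P0 F (Cod J f)) (N2 \<pi> f) b)\<rparr>"

text \<open>The functor \<open>\<pi>\<circ> : Mor(A, W) \<rightarrow> PseudoCone(A, F)\<close>.\<close>

definition cone_comp ::
    "('jo, 'ja) cat \<Rightarrow> ('o, 'm, 'c) cat2 \<Rightarrow> ('jo, 'ja, 'o, 'm, 'c) pseudo \<Rightarrow> 'o \<Rightarrow>
     ('jo, 'ja, 'm, 'c) pnt \<Rightarrow> 'o \<Rightarrow>
     ('m, 'c, ('jo, 'ja, 'm, 'c) pnt,
      ('jo, 'ja, 'm, 'c) pnt \<times> ('jo, 'ja, 'm, 'c) pnt \<times> ('jo \<Rightarrow> 'c)) func" where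
  "cone_comp J K F W \<pi> A =
     \<lparr>FO = cone_comp1 J K F W \<pi> A,
      FA = (\<lambda>\<sigma>. (cone_comp1 J K F W \<pi> A (Dom (Mor2 K A W) \<sigma>),
                 cone_comp1 J K F W \<pi> A (Cod (Mor2 K A W) \<sigma>),
                 \<lambda>j\<in>Ob J. whisk_l K A W (P0 F j) (N1 \<pi> j) \<sigma>))\<rparr>"

definition is_pseudo_limit ::
    "('jo, 'ja) cat \<Rightarrow> ('o, 'm, 'c) cat2 \<Rightarrow> ('jo, 'ja, 'o, 'm, 'c) pseudo \<Rightarrow> 'o \<Rightarrow>
     ('jo, 'ja, 'm, 'c) pnt \<Rightarrow> bool" where
  "is_pseudo_limit J K F W \<pi> \<longleftrightarrow>
     W \<in> Ob2 K \<and> pseudo_nat J K (const_pseudo K W) F \<pi> \<and>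
     (\<forall>A\<in>Ob2 K. iso_of_cats (Mor2 K A W) (PseudoCone J K A F) (cone_comp J K F W \<pi> A))"


section \<open>Index functions\<close>

text \<open>
  A function from a \<open>p\<close>-element to an \<open>l\<close>-element index set is the list of its values; indices are
  counted from 0. For a list \<open>ns\<close> of block lengths, \<open>blk ns i\<close> is the inclusion of the \<open>i\<close>-th block
  and \<open>blocks ns\<close> cuts a list into its blocks.
\<close>

definition index_maps :: "nat \<Rightarrow> nat \<Rightarrow> nat list set" where
  "index_maps p l = {f. length f = p \<and> set f \<subseteq> {..<l}}"

definition pick :: "'x list \<Rightarrow> nat list \<Rightarrow> 'x list" where
  "pick xs f = map (\<lambda>i. xs ! i) f"

text \<open>\<open>pick xs f\<close> is \<open>(x\<^sub>f\<^sub>1, \<dots>, x\<^sub>f\<^sub>p)\<close>; in particular \<open>pick g f\<close> is the composite of index functions \<open>g \<circ> f\<close>.\<close>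

fun blocks :: "nat list \<Rightarrow> 'x list \<Rightarrow> 'x list list" where
  "blocks [] xs = []"
| "blocks (n # ns) xs = take n xs # blocks ns (drop n xs)"

definition blk :: "nat list \<Rightarrow> nat \<Rightarrow> nat list" where
  "blk ns i = [sum_list (take i ns) ..< sum_list (take (Suc i) ns)]"

text \<open>\<open>bar ns f\<close> carries the \<open>i\<close>-th block, of length \<open>n\<^sub>f\<^sub>i\<close>, identically onto the \<open>f i\<close>-th block.\<close>

definition bar :: "nat list \<Rightarrow> nat list \<Rightarrow> nat list" where
  "bar ns f = concat (map (blk ns) f)"

text \<open>The block sum of functions \<open>f\<^sub>i\<close> with target lengths \<open>ls\<close>.\<close>

definition block_sum :: "nat list \<Rightarrow> nat list list \<Rightarrow> nat list" where
  "block_sum ls fs =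
     concat (map (\<lambda>i. map (\<lambda>a. sum_list (take i ls) + a) (fs ! i)) [0..<length fs])"


section \<open>Theories\<close>

record 't thy = "(nat, 't) cat" +
  pr :: "nat \<Rightarrow> nat \<Rightarrow> 't"  \<comment> \<open>\<open>pr T n i : n \<rightarrow> 1\<close> for \<open>i < n\<close>\<close>

definition lawvere_theory :: "'t thy \<Rightarrow> bool" where
  "lawvere_theory T \<longleftrightarrow>
     category T \<and> Ob T = UNIV \<and> (\<forall>n. is_product T n (replicate n 1) (pr T n))"

definition words :: "'t thy \<Rightarrow> nat \<Rightarrow> 't set" where
  "words T n = hom T n 1"

definition tup :: "'t thy \<Rightarrow> nat \<Rightarrow> 't list \<Rightarrow> 't" where
  "tup T m ws = tuple T m (length ws) (pr T (length ws)) ws"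

definition ind :: "'t thy \<Rightarrow> nat \<Rightarrow> nat list \<Rightarrow> 't" where
  "ind T l f = tup T l (map (pr T l) f)"

definition tsub :: "'t thy \<Rightarrow> nat \<Rightarrow> 't \<Rightarrow> nat list \<Rightarrow> 't" where
  "tsub T l w f = w \<cdot>\<^bsub>T\<^esub> ind T l f"

text \<open>Lists of words of arbitrary arities.\<close>

definition word_list :: "'t thy \<Rightarrow> 't list \<Rightarrow> bool" where
  "word_list T ws \<longleftrightarrow> (\<forall>v\<in>set ws. v \<in> words T (Dom T v))"

abbreviation ars :: "'t thy \<Rightarrow> 't list \<Rightarrow> nat list" where
  "ars T ws \<equiv> map (Dom T) ws"

definition par :: "'t thy \<Rightarrow> 't list \<Rightarrow> 't" where
  "par T ws = (let N = sum_list (ars T ws) in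
     tup T N (map (\<lambda>i. tsub T N (ws ! i) (blk (ars T ws) i)) [0..<length ws]))"

definition tgam :: "'t thy \<Rightarrow> 't \<Rightarrow> 't list \<Rightarrow> 't" where
  "tgam T w ws = w \<cdot>\<^bsub>T\<^esub> par T ws"

definition tunit :: "'t thy \<Rightarrow> 't" where
  "tunit T = pr T 1 0"


section \<open>Pseudo algebras over a theory\<close>

text \<open>
  The operations on functors of several variables, \<open>\<gamma>(F, F\<^sub>1, \<dots>, F\<^sub>p)\<close> with \<open>ns\<close> the arities of the
  \<open>F\<^sub>i\<close>, and \<open>F\<^sub>f\<close>. They also serve for functors on products of different categories.
\<close>

definition gamF ::
    "nat list \<Rightarrow> ('y list, 'b list, 'z, 'c) func \<Rightarrow> ('x list, 'a list, 'y, 'b) func list \<Rightarrow>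
     ('x list, 'a list, 'z, 'c) func" where
  "gamF ns F Fs = \<lparr>FO = (\<lambda>xs. FO F (map2 FO Fs (blocks ns xs))),
                   FA = (\<lambda>hs. FA F (map2 FA Fs (blocks ns hs)))\<rparr>"

definition subF :: "nat list \<Rightarrow> ('x list, 'a list, 'z, 'c) func \<Rightarrow> ('x list, 'a list, 'z, 'c) func" where
  "subF f F = \<lparr>FO = (\<lambda>xs. FO F (pick xs f)), FA = (\<lambda>hs. FA F (pick hs f))\<rparr>"

text \<open>The identity of a category, as a functor in one variable.\<close>

definition oneF :: "('x list, 'a list, 'x, 'a) func" where
  "oneF = \<lparr>FO = hd, FA = hd\<rparr>"

text \<open>\<open>cc w ws\<close>, \<open>uu\<close> and \<open>ss l w f\<close> are the coherence isomorphisms \<open>c\<close>, \<open>I\<close> and \<open>s\<close> (for \<open>f\<close> with target length \<open>l\<close>).\<close>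

record ('t, 'o, 'a) palg =
  car :: "('o, 'a) cat"
  Phi :: "'t \<Rightarrow> ('o list, 'a list, 'o, 'a) func"
  cc :: "'t \<Rightarrow> 't list \<Rightarrow> 'o list \<Rightarrow> 'a"
  uu :: "'o list \<Rightarrow> 'a"
  ss :: "nat \<Rightarrow> 't \<Rightarrow> nat list \<Rightarrow> 'o list \<Rightarrow> 'a"

text \<open>\<open>(\<Phi>(w\<^sub>1) \<times> \<dots> \<times> \<Phi>(w\<^sub>p))(x)\<close>\<close>

definition PhiS :: "'t thy \<Rightarrow> ('t, 'o, 'a) palg \<Rightarrow> 't list \<Rightarrow> 'o list \<Rightarrow> 'o list" where
  "PhiS T I ws x = map2 (\<lambda>w. FO (Phi I w)) ws (blocks (ars T ws) x)"

definition pseudo_T_algebra :: "'t thy \<Rightarrow> ('t, 'o, 'a) palg \<Rightarrow> bool" where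
  "pseudo_T_algebra T I \<longleftrightarrow>
     category (car I) \<and>
     (\<forall>n. \<forall>w\<in>words T n. is_functor (pow_cat (car I) n) (car I) (Phi I w)) \<and>
     (\<forall>p. \<forall>w\<in>words T p. \<forall>ws. length ws = p \<and> word_list T ws \<longrightarrow>
        nat_iso (pow_cat (car I) (sum_list (ars T ws))) (car I)
          (Phi I (tgam T w ws)) (gamF (ars T ws) (Phi I w) (map (Phi I) ws)) (cc I w ws)) \<and>
     nat_iso (pow_cat (car I) 1) (car I) (Phi I (tunit T)) oneF (uu I) \<and>
     (\<forall>p l. \<forall>w\<in>words T p. \<forall>f\<in>index_maps p l.
        nat_iso (pow_cat (car I) l) (car I) (Phi I (tsub T l w f)) (subF f (Phi I w)) (ss I l w f)) \<and>
     \<comment> \<open>[associativity]\<close>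
     (\<forall>p. \<forall>w\<in>words T p. \<forall>ws wss.
        length ws = p \<and> word_list T ws \<and>
        map length wss = ars T ws \<and> (\<forall>vs\<in>set wss. word_list T vs) \<longrightarrow>
        (\<forall>x\<in>Ob (pow_cat (car I) (sum_list (ars T (concat wss)))).
           cc I w ws (PhiS T I (concat wss) x) \<cdot>\<^bsub>car I\<^esub> cc I (tgam T w ws) (concat wss) x
           = FA (Phi I w) (map (\<lambda>i. cc I (ws ! i) (wss ! i)
                    (blocks (map (\<lambda>vs. sum_list (ars T vs)) wss) x ! i)) [0..<p])
             \<cdot>\<^bsub>car I\<^esub> cc I w (map2 (tgam T) ws wss) x)) \<and>
     \<comment> \<open>[right unit], [left unit]\<close>
     (\<forall>p. \<forall>w\<in>words T p. \<forall>x\<in>Ob (pow_cat (car I) p).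
        FA (Phi I w) (map (\<lambda>y. uu I [y]) x) \<cdot>\<^bsub>car I\<^esub> cc I w (replicate p (tunit T)) x
          = Ident (car I) (FO (Phi I w) x) \<and>
        uu I [FO (Phi I w) x] \<cdot>\<^bsub>car I\<^esub> cc I (tunit T) [w] x = Ident (car I) (FO (Phi I w) x)) \<and>
     \<comment> \<open>[outer substitution]\<close>
     (\<forall>p l. \<forall>w\<in>words T p. \<forall>f\<in>index_maps p l. \<forall>ws.
        length ws = l \<and> word_list T ws \<longrightarrow>
        (let N = sum_list (ars T ws); fb = bar (ars T ws) f in
         \<forall>x\<in>Ob (pow_cat (car I) N).
           cc I w (pick ws f) (pick x fb) \<cdot>\<^bsub>car I\<^esub> ss I N (tgam T w (pick ws f)) fb x
           = ss I l w f (PhiS T I ws x) \<cdot>\<^bsub>car I\<^esub> cc I (tsub T l w f) ws x)) \<and>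
     \<comment> \<open>[inner substitution], where \<open>ls ! i\<close> is the target length of \<open>g\<^sub>i = gs ! i\<close>\<close>
     (\<forall>p. \<forall>w\<in>words T p. \<forall>ws ls gs.
        length ws = p \<and> word_list T ws \<and>
        length ls = p \<and> length gs = p \<and> (\<forall>i<p. gs ! i \<in> index_maps (Dom T (ws ! i)) (ls ! i)) \<longrightarrow>
        (let N = sum_list ls; g = block_sum ls gs in
         \<forall>x\<in>Ob (pow_cat (car I) N).
           cc I w ws (pick x g) \<cdot>\<^bsub>car I\<^esub> ss I N (tgam T w ws) g x
           = FA (Phi I w) (map (\<lambda>i. ss I (ls ! i) (ws ! i) (gs ! i) (blocks ls x ! i)) [0..<p])
             \<cdot>\<^bsub>car I\<^esub> cc I w (map (\<lambda>i. tsub T (ls ! i) (ws ! i) (gs ! i)) [0..<p]) x)) \<and>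
     \<comment> \<open>[composite substitution]\<close>
     (\<forall>p l r. \<forall>w\<in>words T p. \<forall>f\<in>index_maps p l. \<forall>g\<in>index_maps l r.
        \<forall>x\<in>Ob (pow_cat (car I) r).
          ss I l w f (pick x g) \<cdot>\<^bsub>car I\<^esub> ss I r (tsub T l w f) g x = ss I r w (pick g f) x) \<and>
     \<comment> \<open>[identity substitution]\<close>
     (\<forall>p. \<forall>w\<in>words T p. \<forall>x\<in>Ob (pow_cat (car I) p).
        ss I p w [0..<p] x = Ident (car I) (FO (Phi I w) x))"


section \<open>2-theories\<close>

text \<open>
  Objects of \<open>\<Theta>(m)\<close> are pairs \<open>(n, v)\<close> with \<open>v\<close> a \<open>k\<close>-tuple of morphisms \<open>m \<rightarrow> n\<close> of \<open>T\<close>;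
  \<open>prj \<Theta> m ws i\<close> is the projection to \<open>w\<^sub>i\<close> of the product of \<open>ws = [w\<^sub>1, \<dots>, w\<^sub>n]\<close> in \<open>\<Theta>(m)\<close>.
\<close>

record ('t, 'h) thy2 =
  kk :: nat
  Th :: "'t thy"
  Tht :: "(nat, 't, nat \<times> 't list, 'h) catfun"
  prj :: "nat \<Rightarrow> 't list list \<Rightarrow> nat \<Rightarrow> 'h"

definition kwords :: "('t, 'h) thy2 \<Rightarrow> nat \<Rightarrow> 't list set" where
  "kwords \<Theta> m = {w. length w = kk \<Theta> \<and> set w \<subseteq> words (Th \<Theta>) m}"

text \<open>The morphism \<open>m \<rightarrow> n\<close> of \<open>T\<^sup>k\<close> with components \<open>ws\<close>, as an object of \<open>\<Theta>(m)\<close>.\<close>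

definition tobj :: "('t, 'h) thy2 \<Rightarrow> nat \<Rightarrow> 't list list \<Rightarrow> nat \<times> 't list" where
  "tobj \<Theta> m ws = (length ws, map (\<lambda>r. tup (Th \<Theta>) m (map (\<lambda>w. w ! r) ws)) [0..<kk \<Theta>])"

text \<open>Composition \<open>w \<circ> u\<^sup>\<times>\<^sup>k\<close>, substitution \<open>w\<^sub>f\<close> and \<open>\<gamma>\<^sup>\<times>\<^sup>k(w; us\<^sup>\<times>\<^sup>k)\<close>, componentwise in the \<open>k\<close> entries.\<close>

definition kcomp :: "('t, 'h) thy2 \<Rightarrow> 't list \<Rightarrow> 't \<Rightarrow> 't list" where
  "kcomp \<Theta> w u = map (\<lambda>v. v \<cdot>\<^bsub>Th \<Theta>\<^esub> u) w"

definition ksub :: "('t, 'h) thy2 \<Rightarrow> nat \<Rightarrow> nat list \<Rightarrow> 't list \<Rightarrow> 't list" where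
  "ksub \<Theta> l f w = map (\<lambda>v. tsub (Th \<Theta>) l v f) w"

definition kgam :: "('t, 'h) thy2 \<Rightarrow> 't list \<Rightarrow> 't list \<Rightarrow> 't list" where
  "kgam \<Theta> us w = map (\<lambda>v. tgam (Th \<Theta>) v us) w"

definition two_theory :: "'u itself \<Rightarrow> ('t, 'h) thy2 \<Rightarrow> bool" where
  "two_theory U \<Theta> \<longleftrightarrow>
     lawvere_theory (Th \<Theta>) \<and>
     functor_to_Cat U (op_cat (Th \<Theta>)) (Tht \<Theta>) \<and>
     (\<forall>m. Ob (XO (Tht \<Theta>) m) = {(n, v). length v = kk \<Theta> \<and> set v \<subseteq> hom (Th \<Theta>) m n}) \<and>
     (\<forall>m ws. set ws \<subseteq> kwords \<Theta> m \<longrightarrow>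
        is_product (XO (Tht \<Theta>) m) (tobj \<Theta> m ws) (map (Pair 1) ws) (prj \<Theta> m ws)) \<and>
     (\<forall>m n. \<forall>u\<in>hom (Th \<Theta>) m n.
        (\<forall>(q, v)\<in>Ob (XO (Tht \<Theta>) n). FO (XA (Tht \<Theta>) u) (q, v) = (q, kcomp \<Theta> v u)) \<and>
        (\<forall>ws. set ws \<subseteq> kwords \<Theta> n \<longrightarrow> (\<forall>i<length ws.
           FA (XA (Tht \<Theta>) u) (prj \<Theta> n ws i) = prj \<Theta> m (map (\<lambda>w. kcomp \<Theta> w u) ws) i)))"

text \<open>The set \<open>\<Theta>(w; w\<^sub>1, \<dots>, w\<^sub>n)\<close> for \<open>w, w\<^sub>i \<in> T\<^sup>k(m)\<close>.\<close>

definition ThetaHom :: "('t, 'h) thy2 \<Rightarrow> nat \<Rightarrow> 't list \<Rightarrow> 't list list \<Rightarrow> 'h set" where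
  "ThetaHom \<Theta> m w ws =
     (if w \<in> kwords \<Theta> m \<and> set ws \<subseteq> kwords \<Theta> m
      then hom (XO (Tht \<Theta>) m) (tobj \<Theta> m ws) (1, w) else {})"

text \<open>\<open>\<alpha>\<^sub>i \<in> \<Theta>(w\<^sub>i; w\<^sub>i\<^sub>1, \<dots>)\<close> for all \<open>i\<close>.\<close>

definition ThetaHoms :: "('t, 'h) thy2 \<Rightarrow> nat \<Rightarrow> 'h list \<Rightarrow> 't list list \<Rightarrow> 't list list list \<Rightarrow> bool" where
  "ThetaHoms \<Theta> m \<alpha>s ws wss \<longleftrightarrow>
     length \<alpha>s = length ws \<and> length wss = length ws \<and>
     (\<forall>i<length ws. \<alpha>s ! i \<in> ThetaHom \<Theta> m (ws ! i) (wss ! i))"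

definition out :: "('t, 'h) thy2 \<Rightarrow> nat \<Rightarrow> 'h \<Rightarrow> 't list" where
  "out \<Theta> m \<alpha> = (THE w. \<exists>ws. \<alpha> \<in> ThetaHom \<Theta> m w ws)"

definition ins :: "('t, 'h) thy2 \<Rightarrow> nat \<Rightarrow> 'h \<Rightarrow> 't list list" where
  "ins \<Theta> m \<alpha> = (THE ws. \<exists>w. \<alpha> \<in> ThetaHom \<Theta> m w ws)"

definition ttup :: "('t, 'h) thy2 \<Rightarrow> nat \<Rightarrow> nat \<times> 't list \<Rightarrow> 't list list \<Rightarrow> 'h list \<Rightarrow> 'h" where
  "ttup \<Theta> m P ws fs = tuple (XO (Tht \<Theta>) m) P (tobj \<Theta> m ws) (prj \<Theta> m ws) fs"

text \<open>
  The source of \<open>1\<^sub>w\<close> is the one-fold product of \<open>w\<close>, which is \<open>w\<close> only up to the chosen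
  projection (if \<open>pr\<^sub>1 : 1 \<rightarrow> 1\<close> is not the identity); \<open>1\<^sub>w\<close> is that projection.
\<close>

definition Ounit :: "('t, 'h) thy2 \<Rightarrow> nat \<Rightarrow> 't list \<Rightarrow> 'h" where
  "Ounit \<Theta> m w = prj \<Theta> m [w] 0"

text \<open>\<open>Ofun \<Theta> m ws \<iota> \<alpha>\<close> is \<open>\<alpha>\<^sup>\<iota> \<in> \<Theta>(w; ws)\<close>.\<close>

definition Ofun :: "('t, 'h) thy2 \<Rightarrow> nat \<Rightarrow> 't list list \<Rightarrow> nat list \<Rightarrow> 'h \<Rightarrow> 'h" where
  "Ofun \<Theta> m ws \<iota> \<alpha> =
     \<alpha> \<cdot>\<^bsub>XO (Tht \<Theta>) m\<^esub> ttup \<Theta> m (tobj \<Theta> m ws) (pick ws \<iota>) (map (prj \<Theta> m ws) \<iota>)"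

text \<open>The \<open>i\<close>-th component of \<open>\<alpha>\<^sub>1 \<times> \<dots> \<times> \<alpha>\<^sub>q\<close> is \<open>\<alpha>\<^sub>i\<close> after the projection onto the \<open>i\<close>-th block.\<close>

definition Ocomp :: "('t, 'h) thy2 \<Rightarrow> nat \<Rightarrow> 'h \<Rightarrow> 'h list \<Rightarrow> 'h" where
  "Ocomp \<Theta> m \<alpha> \<alpha>s =
     (let wss = map (ins \<Theta> m) \<alpha>s; W = concat wss in
      \<alpha> \<cdot>\<^bsub>XO (Tht \<Theta>) m\<^esub> ttup \<Theta> m (tobj \<Theta> m W) (map (out \<Theta> m) \<alpha>s)
        (map (\<lambda>i. Ofun \<Theta> m W (blk (map length wss) i) (\<alpha>s ! i)) [0..<length \<alpha>s]))"

definition Osub :: "('t, 'h) thy2 \<Rightarrow> nat \<Rightarrow> nat list \<Rightarrow> 'h \<Rightarrow> 'h" where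
  "Osub \<Theta> l f \<alpha> = FA (XA (Tht \<Theta>) (ind (Th \<Theta>) l f)) \<alpha>"

definition Opull :: "('t, 'h) thy2 \<Rightarrow> 't list \<Rightarrow> 'h \<Rightarrow> 'h" where
  "Opull \<Theta> us \<alpha> = FA (XA (Tht \<Theta>) (par (Th \<Theta>) us)) \<alpha>"


section \<open>Pseudo algebras over a 2-theory\<close>

text \<open>
  \<open>phi m \<alpha>\<close> is \<open>\<phi>(\<alpha>)\<close> for \<open>\<alpha>\<close> in \<open>\<Theta>(m)\<close>. The coherence modifications belong to the unit,
  composition, functoriality in the inputs, \<open>f\<close>-substitution and \<open>T\<close>-substitution, in the order \<open>e_unit m w\<close>, \<open>e_comp m \<alpha> \<alpha>s\<close>, \<open>e_fun m ws \<iota> \<alpha>\<close>, \<open>e_sub l f \<alpha>\<close>, \<open>e_pull us \<alpha>\<close>.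
  They go from \<open>\<phi>\<close> of an operation to the operation on \<open>\<phi>\<close>.
\<close>

record ('io, 'ia, 't, 'h, 'u) alg =
  XX :: "('io list, 'ia list, 'u, 'u) catfun"
  phi :: "nat \<Rightarrow> 'h \<Rightarrow> 'io list \<Rightarrow> ('u list, 'u list, 'u, 'u) func"
  e_unit :: "nat \<Rightarrow> 't list \<Rightarrow> 'io list \<Rightarrow> 'u list \<Rightarrow> 'u"
  e_comp :: "nat \<Rightarrow> 'h \<Rightarrow> 'h list \<Rightarrow> 'io list \<Rightarrow> 'u list \<Rightarrow> 'u"
  e_fun :: "nat \<Rightarrow> 't list list \<Rightarrow> nat list \<Rightarrow> 'h \<Rightarrow> 'io list \<Rightarrow> 'u list \<Rightarrow> 'u"
  e_sub :: "nat \<Rightarrow> nat list \<Rightarrow> 'h \<Rightarrow> 'io list \<Rightarrow> 'u list \<Rightarrow> 'u"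
  e_pull :: "'t list \<Rightarrow> 'h \<Rightarrow> 'io list \<Rightarrow> 'u list \<Rightarrow> 'u"

text \<open>\<open>X\<langle>a\<rangle> : I\<^sup>m \<rightarrow> Cat\<close> for a \<open>k\<close>-tuple \<open>a\<close> of functors \<open>I\<^sup>m \<rightarrow> I\<close>.\<close>

definition along ::
    "('io list, 'ia list, 'u, 'u) catfun \<Rightarrow> ('io list, 'ia list, 'io, 'ia) func list \<Rightarrow>
     ('io list, 'ia list, 'u, 'u) catfun" where
  "along X a = \<lparr>XO = (\<lambda>x. XO X (map (\<lambda>F. FO F x) a)), XA = (\<lambda>h. XA X (map (\<lambda>F. FA F h) a))\<rparr>"

text \<open>\<open>X\<langle>\<Phi>(w)\<rangle>\<close>, and the product over \<open>j\<close> of the \<open>X\<langle>\<Phi>(w\<^sub>j)\<rangle>\<close>.\<close>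

definition Xw ::
    "('t, 'io, 'ia) palg \<Rightarrow> ('io list, 'ia list, 'u, 'u) catfun \<Rightarrow> 't list \<Rightarrow>
     ('io list, 'ia list, 'u, 'u) catfun" where
  "Xw I X w = along X (map (Phi I) w)"

definition Xws ::
    "('t, 'io, 'ia) palg \<Rightarrow> ('io list, 'ia list, 'u, 'u) catfun \<Rightarrow> 't list list \<Rightarrow>
     ('io list, 'ia list, 'u list, 'u list) catfun" where
  "Xws I X ws = prod_catfun (map (Xw I X) ws)"

text \<open>The components at \<open>x\<close> of \<open>X(s\<^bsub>w,f\<^esub>)\<close> and \<open>X(c\<^bsub>w,us\<^esub>)\<close>, and of their products over \<open>j\<close>.\<close>

definition Xs ::
    "('t, 'io, 'ia) palg \<Rightarrow> ('io list, 'ia list, 'u, 'u) catfun \<Rightarrow> nat \<Rightarrow> nat list \<Rightarrow> 't list \<Rightarrow>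
     'io list \<Rightarrow> ('u, 'u, 'u, 'u) func" where
  "Xs I X l f w x = XA X (map (\<lambda>v. ss I l v f x) w)"

definition Xc ::
    "('t, 'io, 'ia) palg \<Rightarrow> ('io list, 'ia list, 'u, 'u) catfun \<Rightarrow> 't list \<Rightarrow> 't list \<Rightarrow>
     'io list \<Rightarrow> ('u, 'u, 'u, 'u) func" where
  "Xc I X us w x = XA X (map (\<lambda>v. cc I v us x) w)"

definition Xss ::
    "('t, 'io, 'ia) palg \<Rightarrow> ('io list, 'ia list, 'u, 'u) catfun \<Rightarrow> nat \<Rightarrow> nat list \<Rightarrow> 't list list \<Rightarrow>
     'io list \<Rightarrow> ('u list, 'u list, 'u list, 'u list) func" where
  "Xss I X l f ws x = prod_func (map (\<lambda>w. Xs I X l f w x) ws)"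

definition Xcs ::
    "('t, 'io, 'ia) palg \<Rightarrow> ('io list, 'ia list, 'u, 'u) catfun \<Rightarrow> 't list \<Rightarrow> 't list list \<Rightarrow>
     'io list \<Rightarrow> ('u list, 'u list, 'u list, 'u list) func" where
  "Xcs I X us ws x = prod_func (map (\<lambda>w. Xc I X us w x) ws)"

definition alg_data :: "'u itself \<Rightarrow> ('t, 'h) thy2 \<Rightarrow> ('t, 'io, 'ia) palg \<Rightarrow> ('io, 'ia, 't, 'h, 'u) alg \<Rightarrow> bool"
  where
  "alg_data U \<Theta> I A \<longleftrightarrow> (let X = XX A; P = pow_cat (car I) in
     functor_to_Cat U (P (kk \<Theta>)) X \<and>
     (\<forall>m w ws. \<forall>\<alpha>\<in>ThetaHom \<Theta> m w ws. nat_to_Cat (P m) (Xws I X ws) (Xw I X w) (phi A m \<alpha>)) \<and>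
     (\<forall>m. \<forall>w\<in>kwords \<Theta> m.
        inv_modif (P m) (Xws I X [w]) (Xw I X w)
          (phi A m (Ounit \<Theta> m w)) (\<lambda>x. oneF) (e_unit A m w)) \<and>
     (\<forall>m w ws wss. \<forall>\<alpha>\<in>ThetaHom \<Theta> m w ws. \<forall>\<alpha>s. ThetaHoms \<Theta> m \<alpha>s ws wss \<longrightarrow>
        inv_modif (P m) (Xws I X (concat wss)) (Xw I X w)
          (phi A m (Ocomp \<Theta> m \<alpha> \<alpha>s))
          (\<lambda>x. gamF (map length wss) (phi A m \<alpha> x) (map (\<lambda>\<beta>. phi A m \<beta> x) \<alpha>s))
          (e_comp A m \<alpha> \<alpha>s)) \<and>
     (\<forall>m w ws p. \<forall>\<iota>\<in>index_maps p (length ws). \<forall>\<alpha>\<in>ThetaHom \<Theta> m w (pick ws \<iota>). set ws \<subseteq> kwords \<Theta> m \<longrightarrow>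
        inv_modif (P m) (Xws I X ws) (Xw I X w)
          (phi A m (Ofun \<Theta> m ws \<iota> \<alpha>)) (\<lambda>x. subF \<iota> (phi A m \<alpha> x)) (e_fun A m ws \<iota> \<alpha>)) \<and>
     (\<forall>m l w ws. \<forall>f\<in>index_maps m l. \<forall>\<alpha>\<in>ThetaHom \<Theta> m w ws.
        inv_modif (P l) (Xws I X (map (ksub \<Theta> l f) ws)) (along X (map (\<lambda>v. subF f (Phi I v)) w))
          (\<lambda>x. comp_func (Xs I X l f w x) (phi A l (Osub \<Theta> l f \<alpha>) x))
          (\<lambda>x. comp_func (phi A m \<alpha> (pick x f)) (Xss I X l f ws x))
          (e_sub A l f \<alpha>)) \<and>
     (\<forall>m w ws us. \<forall>\<alpha>\<in>ThetaHom \<Theta> m w ws.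
        length us = m \<and> word_list (Th \<Theta>) us \<longrightarrow>
        (let ns = ars (Th \<Theta>) us; N = sum_list ns in
         inv_modif (P N) (Xws I X (map (kgam \<Theta> us) ws))
           (along X (map (\<lambda>v. gamF ns (Phi I v) (map (Phi I) us)) w))
           (\<lambda>x. comp_func (Xc I X us w x) (phi A N (Opull \<Theta> us \<alpha>) x))
           (\<lambda>x. comp_func (phi A m \<alpha> (PhiS (Th \<Theta>) I us x)) (Xcs I X us ws x))
           (e_pull A us \<alpha>))))"


text \<open>\<open>(\<phi>(\<alpha>\<^sub>1) \<times> \<dots> \<times> \<phi>(\<alpha>\<^sub>q))(ys)\<close>, where \<open>wss\<close> are the inputs of the \<open>\<alpha>\<^sub>i\<close>.\<close>

definition phis ::
    "('io, 'ia, 't, 'h, 'u) alg \<Rightarrow> nat \<Rightarrow> 'h list \<Rightarrow> 't list list list \<Rightarrow> 'io list \<Rightarrow> 'u list \<Rightarrow> 'u list" where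
  "phis A m \<alpha>s wss x ys = map2 (\<lambda>\<beta>. FO (phi A m \<beta> x)) \<alpha>s (blocks (map length wss) ys)"

text \<open>
  The coherence diagrams. Each equates, at every object \<open>x\<close> of the power of \<open>I\<close> and every object
  \<open>ys\<close> of the source fibre, two arrows of the fibre over \<open>x\<close> of the target, obtained by moving
  \<open>\<phi>\<close> past the operations on either side of the relation. Where \<open>f\<close>-substitution or
  \<open>T\<close>-substitution occurs, the two sides are brought to a common source and target by \<open>X\<close> of the
  isomorphisms \<open>c\<close>, \<open>s\<close>, \<open>I\<close>; that the sources and targets then agree is an instance of one of the
  axioms of the pseudo \<open>T\<close>-algebra, named below by the bracketed label it carries there.
\<close>

text \<open>\<open>\<gamma>(\<gamma>(\<alpha>; \<alpha>s); \<alpha>ss) = \<gamma>(\<alpha>; \<gamma>(\<alpha>\<^sub>i; \<alpha>ss\<^sub>i))\<close>.\<close>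

definition coh_assoc :: "('t, 'h) thy2 \<Rightarrow> ('t, 'io, 'ia) palg \<Rightarrow> ('io, 'ia, 't, 'h, 'u) alg \<Rightarrow> bool" where
  "coh_assoc \<Theta> I A \<longleftrightarrow>
     (\<forall>m w ws wss vsss \<alpha>s \<alpha>ss. \<forall>\<alpha>\<in>ThetaHom \<Theta> m w ws.
        ThetaHoms \<Theta> m \<alpha>s ws wss \<and> length \<alpha>ss = length ws \<and> length vsss = length ws \<and>
        (\<forall>i<length ws. ThetaHoms \<Theta> m (\<alpha>ss ! i) (wss ! i) (vsss ! i)) \<longrightarrow>
        (\<forall>x\<in>Ob (pow_cat (car I) m). \<forall>ys\<in>Ob (XO (Xws I (XX A) (concat (concat vsss))) x).
           let C = XO (Xw I (XX A) w) x in
           e_comp A m \<alpha> \<alpha>s x (phis A m (concat \<alpha>ss) (concat vsss) x ys)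
             \<cdot>\<^bsub>C\<^esub> e_comp A m (Ocomp \<Theta> m \<alpha> \<alpha>s) (concat \<alpha>ss) x ys
           = FA (phi A m \<alpha> x) (map (\<lambda>i. e_comp A m (\<alpha>s ! i) (\<alpha>ss ! i) x
                  (blocks (map (\<lambda>vss. length (concat vss)) vsss) ys ! i)) [0..<length ws])
             \<cdot>\<^bsub>C\<^esub> e_comp A m \<alpha> (map2 (Ocomp \<Theta> m) \<alpha>s \<alpha>ss) x ys))"

text \<open>\<open>\<gamma>(\<alpha>; 1, \<dots>, 1) = \<alpha> = \<gamma>(1; \<alpha>)\<close>.\<close>

definition coh_unit :: "('t, 'h) thy2 \<Rightarrow> ('t, 'io, 'ia) palg \<Rightarrow> ('io, 'ia, 't, 'h, 'u) alg \<Rightarrow> bool" where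
  "coh_unit \<Theta> I A \<longleftrightarrow>
     (\<forall>m w ws. \<forall>\<alpha>\<in>ThetaHom \<Theta> m w ws.
        \<forall>x\<in>Ob (pow_cat (car I) m). \<forall>ys\<in>Ob (XO (Xws I (XX A) ws) x).
          let C = XO (Xw I (XX A) w) x in
          FA (phi A m \<alpha> x) (map2 (\<lambda>v y. e_unit A m v x [y]) ws ys)
            \<cdot>\<^bsub>C\<^esub> e_comp A m \<alpha> (map (Ounit \<Theta> m) ws) x ys
            = Ident C (FO (phi A m \<alpha> x) ys) \<and>
          e_unit A m w x [FO (phi A m \<alpha> x) ys] \<cdot>\<^bsub>C\<^esub> e_comp A m (Ounit \<Theta> m w) [\<alpha>] x ys
            = Ident C (FO (phi A m \<alpha> x) ys))"

text \<open>\<open>(\<alpha>\<^sup>\<iota>)\<^sup>\<theta> = \<alpha>\<^sup>\<theta>\<^sup>\<iota>, \<alpha>\<^sup>i\<^sup>d = \<alpha>\<close>.\<close>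

definition coh_fun_fun :: "('t, 'h) thy2 \<Rightarrow> ('t, 'io, 'ia) palg \<Rightarrow> ('io, 'ia, 't, 'h, 'u) alg \<Rightarrow> bool" where
  "coh_fun_fun \<Theta> I A \<longleftrightarrow>
     (\<forall>m w ws p q. \<forall>\<iota>\<in>index_maps p q. \<forall>\<theta>\<in>index_maps q (length ws).
        \<forall>\<alpha>\<in>ThetaHom \<Theta> m w (pick ws (pick \<theta> \<iota>)). set ws \<subseteq> kwords \<Theta> m \<longrightarrow>
        (\<forall>x\<in>Ob (pow_cat (car I) m). \<forall>ys\<in>Ob (XO (Xws I (XX A) ws) x).
           e_fun A m (pick ws \<theta>) \<iota> \<alpha> x (pick ys \<theta>)
             \<cdot>\<^bsub>XO (Xw I (XX A) w) x\<^esub> e_fun A m ws \<theta> (Ofun \<Theta> m (pick ws \<theta>) \<iota> \<alpha>) x ys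
           = e_fun A m ws (pick \<theta> \<iota>) \<alpha> x ys)) \<and>
     (\<forall>m w ws. \<forall>\<alpha>\<in>ThetaHom \<Theta> m w ws.
        \<forall>x\<in>Ob (pow_cat (car I) m). \<forall>ys\<in>Ob (XO (Xws I (XX A) ws) x).
          e_fun A m ws [0..<length ws] \<alpha> x ys
          = Ident (XO (Xw I (XX A) w) x) (FO (phi A m \<alpha> x) ys))"

text \<open>\<open>\<gamma>(\<alpha>\<^sup>\<iota>; \<alpha>s) = \<gamma>(\<alpha>; pick \<alpha>s \<iota>)\<^bsup>\<iota>b\<^esup>\<close>.\<close>

definition coh_fun_outer :: "('t, 'h) thy2 \<Rightarrow> ('t, 'io, 'ia) palg \<Rightarrow> ('io, 'ia, 't, 'h, 'u) alg \<Rightarrow> bool" where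
  "coh_fun_outer \<Theta> I A \<longleftrightarrow>
     (\<forall>m w ws wss p \<alpha>s. \<forall>\<iota>\<in>index_maps p (length ws). \<forall>\<alpha>\<in>ThetaHom \<Theta> m w (pick ws \<iota>).
        set ws \<subseteq> kwords \<Theta> m \<and> ThetaHoms \<Theta> m \<alpha>s ws wss \<longrightarrow>
        (\<forall>x\<in>Ob (pow_cat (car I) m). \<forall>ys\<in>Ob (XO (Xws I (XX A) (concat wss)) x).
           let C = XO (Xw I (XX A) w) x; \<iota>b = bar (map length wss) \<iota> in
           e_fun A m ws \<iota> \<alpha> x (phis A m \<alpha>s wss x ys)
             \<cdot>\<^bsub>C\<^esub> e_comp A m (Ofun \<Theta> m ws \<iota> \<alpha>) \<alpha>s x ys
           = e_comp A m \<alpha> (pick \<alpha>s \<iota>) x (pick ys \<iota>b)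
             \<cdot>\<^bsub>C\<^esub> e_fun A m (concat wss) \<iota>b (Ocomp \<Theta> m \<alpha> (pick \<alpha>s \<iota>)) x ys))"

text \<open>\<open>\<gamma>(\<alpha>; \<alpha>\<^sub>1\<^sup>\<iota>\<^sup>1, \<dots>, \<alpha>\<^sub>q\<^sup>\<iota>\<^sup>q) = \<gamma>(\<alpha>; \<alpha>s)\<^sup>\<kappa>\<close>. Here \<open>wss ! i\<close> is the list of inputs of \<open>\<alpha>\<^sub>i\<^sup>\<iota>\<^sup>i\<close>.\<close>

definition coh_fun_inner :: "('t, 'h) thy2 \<Rightarrow> ('t, 'io, 'ia) palg \<Rightarrow> ('io, 'ia, 't, 'h, 'u) alg \<Rightarrow> bool" where
  "coh_fun_inner \<Theta> I A \<longleftrightarrow>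
     (\<forall>m w ws wss \<iota>s \<alpha>s. \<forall>\<alpha>\<in>ThetaHom \<Theta> m w ws.
        length wss = length ws \<and> length \<iota>s = length ws \<and>
        (\<forall>i<length ws. set (wss ! i) \<subseteq> kwords \<Theta> m \<and>
           \<iota>s ! i \<in> index_maps (length (\<iota>s ! i)) (length (wss ! i))) \<and>
        ThetaHoms \<Theta> m \<alpha>s ws (map2 pick wss \<iota>s) \<longrightarrow>
        (\<forall>x\<in>Ob (pow_cat (car I) m). \<forall>ys\<in>Ob (XO (Xws I (XX A) (concat wss)) x).
           let C = XO (Xw I (XX A) w) x; \<kappa> = block_sum (map length wss) \<iota>s in
           FA (phi A m \<alpha> x) (map (\<lambda>i. e_fun A m (wss ! i) (\<iota>s ! i) (\<alpha>s ! i) x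
                  (blocks (map length wss) ys ! i)) [0..<length ws])
             \<cdot>\<^bsub>C\<^esub> e_comp A m \<alpha>
                  (map (\<lambda>i. Ofun \<Theta> m (wss ! i) (\<iota>s ! i) (\<alpha>s ! i)) [0..<length ws]) x ys
           = e_comp A m \<alpha> \<alpha>s x (pick ys \<kappa>)
             \<cdot>\<^bsub>C\<^esub> e_fun A m (concat wss) \<kappa> (Ocomp \<Theta> m \<alpha> \<alpha>s) x ys))"

text \<open>\<open>(\<alpha>\<^sub>f)\<^sub>g = \<alpha>\<^bsub>g \<circ> f\<^esub>, \<alpha>\<^sub>i\<^sub>d = \<alpha>\<close>. The endpoints agree by [composite substitution] and [identity substitution].\<close>

definition coh_sub_sub :: "('t, 'h) thy2 \<Rightarrow> ('t, 'io, 'ia) palg \<Rightarrow> ('io, 'ia, 't, 'h, 'u) alg \<Rightarrow> bool" where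
  "coh_sub_sub \<Theta> I A \<longleftrightarrow>
     (\<forall>m l r w ws. \<forall>f\<in>index_maps m l. \<forall>g\<in>index_maps l r. \<forall>\<alpha>\<in>ThetaHom \<Theta> m w ws.
        \<forall>x\<in>Ob (pow_cat (car I) r). \<forall>ys\<in>Ob (XO (Xws I (XX A) (map (ksub \<Theta> r (pick g f)) ws)) x).
          let x' = pick x g; C = XO (Xw I (XX A) w) (pick x' f) in
          e_sub A l f \<alpha> x' (FO (Xss I (XX A) r g (map (ksub \<Theta> l f) ws) x) ys)
            \<cdot>\<^bsub>C\<^esub> FA (Xs I (XX A) l f w x') (e_sub A r g (Osub \<Theta> l f \<alpha>) x ys)
          = e_sub A r (pick g f) \<alpha> x ys) \<and>
     (\<forall>m w ws. \<forall>\<alpha>\<in>ThetaHom \<Theta> m w ws.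
        \<forall>x\<in>Ob (pow_cat (car I) m). \<forall>ys\<in>Ob (XO (Xws I (XX A) ws) x).
          e_sub A m [0..<m] \<alpha> x ys = Ident (XO (Xw I (XX A) w) x) (FO (phi A m \<alpha> x) ys))"

text \<open>\<open>S\<^sup>* ts\<^sup>* \<alpha> = rs\<^sup>* \<alpha>\<close>.
  The isomorphisms \<open>\<kappa>\<close> of \<open>I\<^sup>m\<close> lead to the common target; the endpoints agree by [associativity].\<close>

definition coh_pull_pull :: "('t, 'h) thy2 \<Rightarrow> ('t, 'io, 'ia) palg \<Rightarrow> ('io, 'ia, 't, 'h, 'u) alg \<Rightarrow> bool" where
  "coh_pull_pull \<Theta> I A \<longleftrightarrow>
     (\<forall>m w ws ts sss. \<forall>\<alpha>\<in>ThetaHom \<Theta> m w ws.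
        length ts = m \<and> word_list (Th \<Theta>) ts \<and>
        map length sss = ars (Th \<Theta>) ts \<and> (\<forall>us\<in>set sss. word_list (Th \<Theta>) us) \<longrightarrow>
        (let rs = map2 (tgam (Th \<Theta>)) ts sss; S = concat sss;
             ns = map (\<lambda>us. sum_list (ars (Th \<Theta>) us)) sss in
         \<forall>x\<in>Ob (pow_cat (car I) (sum_list ns)).
         \<forall>ys\<in>Ob (XO (Xws I (XX A) (map (kgam \<Theta> rs) ws)) x).
           let x' = PhiS (Th \<Theta>) I S x;
               \<kappa> = map (\<lambda>i. cc I (ts ! i) (sss ! i) (blocks ns x ! i)) [0..<m];
               C = XO (Xw I (XX A) w) (PhiS (Th \<Theta>) I ts x') in
           e_pull A ts \<alpha> x' (FO (Xcs I (XX A) S (map (kgam \<Theta> ts) ws) x) ys)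
             \<cdot>\<^bsub>C\<^esub> FA (Xc I (XX A) ts w x') (e_pull A S (Opull \<Theta> ts \<alpha>) x ys)
           = FA (XA (Xw I (XX A) w) \<kappa>) (e_pull A rs \<alpha> x ys)))"

text \<open>\<open>(1, \<dots>, 1)\<^sup>* \<alpha> = \<alpha>\<close>. The endpoints agree by [right unit].\<close>

definition coh_pull_unit :: "('t, 'h) thy2 \<Rightarrow> ('t, 'io, 'ia) palg \<Rightarrow> ('io, 'ia, 't, 'h, 'u) alg \<Rightarrow> bool" where
  "coh_pull_unit \<Theta> I A \<longleftrightarrow>
     (\<forall>m w ws. \<forall>\<alpha>\<in>ThetaHom \<Theta> m w ws.
        \<forall>x\<in>Ob (pow_cat (car I) m). \<forall>ys\<in>Ob (XO (Xws I (XX A) ws) x).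
          FA (XA (Xw I (XX A) w) (map (\<lambda>y. uu I [y]) x))
             (e_pull A (replicate m (tunit (Th \<Theta>))) \<alpha> x ys)
          = Ident (XO (Xw I (XX A) w) x) (FO (phi A m \<alpha> x) ys))"

text \<open>\<open>\<gamma>(\<alpha>\<^sub>f; \<alpha>s') = \<gamma>(\<alpha>; \<alpha>s)\<^sub>f\<close>.\<close>

definition coh_comp_sub :: "('t, 'h) thy2 \<Rightarrow> ('t, 'io, 'ia) palg \<Rightarrow> ('io, 'ia, 't, 'h, 'u) alg \<Rightarrow> bool" where
  "coh_comp_sub \<Theta> I A \<longleftrightarrow>
     (\<forall>m l w ws wss \<alpha>s. \<forall>f\<in>index_maps m l. \<forall>\<alpha>\<in>ThetaHom \<Theta> m w ws. ThetaHoms \<Theta> m \<alpha>s ws wss \<longrightarrow>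
        (\<forall>x\<in>Ob (pow_cat (car I) l).
         \<forall>ys\<in>Ob (XO (Xws I (XX A) (map (ksub \<Theta> l f) (concat wss))) x).
           let x' = pick x f; C = XO (Xw I (XX A) w) x'; \<alpha>s' = map (Osub \<Theta> l f) \<alpha>s in
           FA (phi A m \<alpha> x') (map2 (\<lambda>\<beta>. e_sub A l f \<beta> x) \<alpha>s (blocks (map length wss) ys))
             \<cdot>\<^bsub>C\<^esub> e_sub A l f \<alpha> x (phis A l \<alpha>s' wss x ys)
             \<cdot>\<^bsub>C\<^esub> FA (Xs I (XX A) l f w x) (e_comp A l (Osub \<Theta> l f \<alpha>) \<alpha>s' x ys)
           = e_comp A m \<alpha> \<alpha>s x' (FO (Xss I (XX A) l f (concat wss) x) ys)
             \<cdot>\<^bsub>C\<^esub> e_sub A l f (Ocomp \<Theta> m \<alpha> \<alpha>s) x ys))"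

text \<open>\<open>(\<alpha>\<^sup>\<iota>)\<^sub>f = (\<alpha>\<^sub>f)\<^sup>\<iota>\<close>.\<close>

definition coh_fun_sub :: "('t, 'h) thy2 \<Rightarrow> ('t, 'io, 'ia) palg \<Rightarrow> ('io, 'ia, 't, 'h, 'u) alg \<Rightarrow> bool" where
  "coh_fun_sub \<Theta> I A \<longleftrightarrow>
     (\<forall>m l w ws p. \<forall>f\<in>index_maps m l. \<forall>\<iota>\<in>index_maps p (length ws).
        \<forall>\<alpha>\<in>ThetaHom \<Theta> m w (pick ws \<iota>). set ws \<subseteq> kwords \<Theta> m \<longrightarrow>
        (\<forall>x\<in>Ob (pow_cat (car I) l). \<forall>ys\<in>Ob (XO (Xws I (XX A) (map (ksub \<Theta> l f) ws)) x).
           let x' = pick x f; C = XO (Xw I (XX A) w) x' in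
           e_fun A m ws \<iota> \<alpha> x' (FO (Xss I (XX A) l f ws x) ys)
             \<cdot>\<^bsub>C\<^esub> e_sub A l f (Ofun \<Theta> m ws \<iota> \<alpha>) x ys
           = e_sub A l f \<alpha> x (pick ys \<iota>)
             \<cdot>\<^bsub>C\<^esub> FA (Xs I (XX A) l f w x)
                  (e_fun A l (map (ksub \<Theta> l f) ws) \<iota> (Osub \<Theta> l f \<alpha>) x ys)))"

text \<open>\<open>us\<^sup>*(\<alpha>\<^sup>\<iota>) = (us\<^sup>* \<alpha>)\<^sup>\<iota>\<close>.\<close>

definition coh_fun_pull :: "('t, 'h) thy2 \<Rightarrow> ('t, 'io, 'ia) palg \<Rightarrow> ('io, 'ia, 't, 'h, 'u) alg \<Rightarrow> bool" where
  "coh_fun_pull \<Theta> I A \<longleftrightarrow>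
     (\<forall>m w ws p us. \<forall>\<iota>\<in>index_maps p (length ws). \<forall>\<alpha>\<in>ThetaHom \<Theta> m w (pick ws \<iota>).
        set ws \<subseteq> kwords \<Theta> m \<and> length us = m \<and> word_list (Th \<Theta>) us \<longrightarrow>
        (let N = sum_list (ars (Th \<Theta>) us) in
         \<forall>x\<in>Ob (pow_cat (car I) N). \<forall>ys\<in>Ob (XO (Xws I (XX A) (map (kgam \<Theta> us) ws)) x).
           let x' = PhiS (Th \<Theta>) I us x; C = XO (Xw I (XX A) w) x' in
           e_fun A m ws \<iota> \<alpha> x' (FO (Xcs I (XX A) us ws x) ys)
             \<cdot>\<^bsub>C\<^esub> e_pull A us (Ofun \<Theta> m ws \<iota> \<alpha>) x ys
           = e_pull A us \<alpha> x (pick ys \<iota>)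
             \<cdot>\<^bsub>C\<^esub> FA (Xc I (XX A) us w x)
                  (e_fun A N (map (kgam \<Theta> us) ws) \<iota> (Opull \<Theta> us \<alpha>) x ys)))"

text \<open>\<open>us'\<^sup>* \<alpha> = (us\<^sup>* \<alpha>)\<^sub>g\<close>. The endpoints agree by [inner substitution];
  \<open>ls ! i\<close> is the target length of \<open>f\<^sub>i = fs ! i\<close>.\<close>

definition coh_pull_by_sub :: "('t, 'h) thy2 \<Rightarrow> ('t, 'io, 'ia) palg \<Rightarrow> ('io, 'ia, 't, 'h, 'u) alg \<Rightarrow> bool" where
  "coh_pull_by_sub \<Theta> I A \<longleftrightarrow>
     (\<forall>m w ws us ls fs. \<forall>\<alpha>\<in>ThetaHom \<Theta> m w ws.
        length us = m \<and> word_list (Th \<Theta>) us \<and> length ls = m \<and> length fs = m \<and>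
        (\<forall>i<m. fs ! i \<in> index_maps (Dom (Th \<Theta>) (us ! i)) (ls ! i)) \<longrightarrow>
        (let N = sum_list ls; g = block_sum ls fs;
             us' = map (\<lambda>i. tsub (Th \<Theta>) (ls ! i) (us ! i) (fs ! i)) [0..<m] in
         \<forall>x\<in>Ob (pow_cat (car I) N). \<forall>ys\<in>Ob (XO (Xws I (XX A) (map (kgam \<Theta> us') ws)) x).
           let x' = pick x g;
               \<kappa> = map (\<lambda>i. ss I (ls ! i) (us ! i) (fs ! i) (blocks ls x ! i)) [0..<m];
               C = XO (Xw I (XX A) w) (PhiS (Th \<Theta>) I us x') in
           FA (XA (Xw I (XX A) w) \<kappa>) (e_pull A us' \<alpha> x ys)
           = e_pull A us \<alpha> x' (FO (Xss I (XX A) N g (map (kgam \<Theta> us) ws) x) ys)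
             \<cdot>\<^bsub>C\<^esub> FA (Xc I (XX A) us w x') (e_sub A N g (Opull \<Theta> us \<alpha>) x ys)))"

text \<open>\<open>us\<^sup>*(\<alpha>\<^sub>f) = (us'\<^sup>* \<alpha>)\<^bsub>fb\<^esub>\<close>. The endpoints agree by [outer substitution].\<close>

definition coh_pull_of_sub :: "('t, 'h) thy2 \<Rightarrow> ('t, 'io, 'ia) palg \<Rightarrow> ('io, 'ia, 't, 'h, 'u) alg \<Rightarrow> bool" where
  "coh_pull_of_sub \<Theta> I A \<longleftrightarrow>
     (\<forall>m l w ws us. \<forall>f\<in>index_maps m l. \<forall>\<alpha>\<in>ThetaHom \<Theta> m w ws.
        length us = l \<and> word_list (Th \<Theta>) us \<longrightarrow>
        (let ns = ars (Th \<Theta>) us; N = sum_list ns; fb = bar ns f; us' = pick us f in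
         \<forall>x\<in>Ob (pow_cat (car I) N).
         \<forall>ys\<in>Ob (XO (Xws I (XX A) (map (\<lambda>v. kgam \<Theta> us (ksub \<Theta> l f v)) ws)) x).
           let y = PhiS (Th \<Theta>) I us x; x' = pick x fb; C = XO (Xw I (XX A) w) (pick y f) in
           e_sub A l f \<alpha> y (FO (Xcs I (XX A) us (map (ksub \<Theta> l f) ws) x) ys)
             \<cdot>\<^bsub>C\<^esub> FA (Xs I (XX A) l f w y) (e_pull A us (Osub \<Theta> l f \<alpha>) x ys)
           = e_pull A us' \<alpha> x' (FO (Xss I (XX A) N fb (map (kgam \<Theta> us') ws) x) ys)
             \<cdot>\<^bsub>C\<^esub> FA (Xc I (XX A) us' w x') (e_sub A N fb (Opull \<Theta> us' \<alpha>) x ys)))"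

text \<open>\<open>us\<^sup>* \<gamma>(\<alpha>; \<alpha>s) = \<gamma>(\<beta>; \<beta>s)\<close>.\<close>

definition coh_comp_pull :: "('t, 'h) thy2 \<Rightarrow> ('t, 'io, 'ia) palg \<Rightarrow> ('io, 'ia, 't, 'h, 'u) alg \<Rightarrow> bool" where
  "coh_comp_pull \<Theta> I A \<longleftrightarrow>
     (\<forall>m w ws wss \<alpha>s us. \<forall>\<alpha>\<in>ThetaHom \<Theta> m w ws.
        ThetaHoms \<Theta> m \<alpha>s ws wss \<and> length us = m \<and> word_list (Th \<Theta>) us \<longrightarrow>
        (let N = sum_list (ars (Th \<Theta>) us) in
         \<forall>x\<in>Ob (pow_cat (car I) N).
         \<forall>ys\<in>Ob (XO (Xws I (XX A) (map (kgam \<Theta> us) (concat wss))) x).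
           let x' = PhiS (Th \<Theta>) I us x; C = XO (Xw I (XX A) w) x';
               \<beta> = Opull \<Theta> us \<alpha>; \<beta>s = map (Opull \<Theta> us) \<alpha>s in
           e_comp A m \<alpha> \<alpha>s x' (FO (Xcs I (XX A) us (concat wss) x) ys)
             \<cdot>\<^bsub>C\<^esub> e_pull A us (Ocomp \<Theta> m \<alpha> \<alpha>s) x ys
           = FA (phi A m \<alpha> x') (map2 (\<lambda>\<gamma>. e_pull A us \<gamma> x) \<alpha>s (blocks (map length wss) ys))
             \<cdot>\<^bsub>C\<^esub> e_pull A us \<alpha> x (phis A N \<beta>s wss x ys)
             \<cdot>\<^bsub>C\<^esub> FA (Xc I (XX A) us w x) (e_comp A N \<beta> \<beta>s x ys)))"

definition pseudo_algebra ::
    "'u itself \<Rightarrow> ('t, 'h) thy2 \<Rightarrow> ('t, 'io, 'ia) palg \<Rightarrow> ('io, 'ia, 't, 'h, 'u) alg \<Rightarrow> bool" where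
  "pseudo_algebra U \<Theta> I A \<longleftrightarrow>
     alg_data U \<Theta> I A \<and>
     coh_assoc \<Theta> I A \<and> coh_unit \<Theta> I A \<and> coh_fun_fun \<Theta> I A \<and> coh_fun_outer \<Theta> I A \<and> coh_fun_inner \<Theta> I A \<and>
     coh_sub_sub \<Theta> I A \<and> coh_pull_pull \<Theta> I A \<and> coh_pull_unit \<Theta> I A \<and> coh_comp_sub \<Theta> I A \<and> coh_fun_sub \<Theta> I A \<and>
     coh_fun_pull \<Theta> I A \<and> coh_pull_by_sub \<Theta> I A \<and> coh_pull_of_sub \<Theta> I A \<and> coh_comp_pull \<Theta> I A"


section \<open>The 2-category of pseudo algebras over a 2-theory\<close>

record ('io, 'h, 'u) mor =
  HH :: "'io list \<Rightarrow> ('u, 'u, 'u, 'u) func"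
  rho :: "nat \<Rightarrow> 'h \<Rightarrow> 'io list \<Rightarrow> 'u list \<Rightarrow> 'u"

text \<open>\<open>H * i\<^bsub>\<langle>\<Phi>(w)\<rangle>\<^esub>\<close> and the product over \<open>j\<close> of the \<open>H * i\<^bsub>\<langle>\<Phi>(w\<^sub>j)\<rangle>\<^esub>\<close>.\<close>

definition Hw :: "('t, 'io, 'ia) palg \<Rightarrow> ('io, 'h, 'u) mor \<Rightarrow> 't list \<Rightarrow> 'io list \<Rightarrow> ('u, 'u, 'u, 'u) func"
  where
  "Hw I H w x = HH H (map (\<lambda>v. FO (Phi I v) x) w)"

definition Hws ::
    "('t, 'io, 'ia) palg \<Rightarrow> ('io, 'h, 'u) mor \<Rightarrow> 't list list \<Rightarrow> 'io list \<Rightarrow>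
     ('u list, 'u list, 'u list, 'u list) func" where
  "Hws I H ws x = prod_func (map (\<lambda>w. Hw I H w x) ws)"

text \<open>The indices at which the components of \<open>\<rho>\<close> are meaningful; elsewhere they are \<open>undefined\<close>, so that equality of morphisms is equality in HOL.\<close>

definition rho_index ::
    "('t, 'h) thy2 \<Rightarrow> ('t, 'io, 'ia) palg \<Rightarrow> ('io, 'ia, 't, 'h, 'u) alg \<Rightarrow>
     nat \<Rightarrow> 'h \<Rightarrow> 'io list \<Rightarrow> 'u list \<Rightarrow> bool" where
  "rho_index \<Theta> I A m \<alpha> x ys \<longleftrightarrow>
     (\<exists>w ws. \<alpha> \<in> ThetaHom \<Theta> m w ws \<and> x \<in> Ob (pow_cat (car I) m) \<and>
        ys \<in> Ob (XO (Xws I (XX A) ws) x))"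

definition alg_mor ::
    "('t, 'h) thy2 \<Rightarrow> ('t, 'io, 'ia) palg \<Rightarrow> ('io, 'ia, 't, 'h, 'u) alg \<Rightarrow>
     ('io, 'ia, 't, 'h, 'u) alg \<Rightarrow> ('io, 'h, 'u) mor \<Rightarrow> bool" where
  "alg_mor \<Theta> I A B H \<longleftrightarrow> (let X = XX A; Y = XX B; P = pow_cat (car I) in
     nat_to_Cat (P (kk \<Theta>)) X Y (HH H) \<and>
     HH H \<in> extensional (Ob (P (kk \<Theta>))) \<and> (\<forall>i\<in>Ob (P (kk \<Theta>)). func_ext (XO X i) (HH H i)) \<and>
     (\<forall>m \<alpha> x ys. \<not> rho_index \<Theta> I A m \<alpha> x ys \<longrightarrow> rho H m \<alpha> x ys = undefined) \<and>
     (\<forall>m w ws. \<forall>\<alpha>\<in>ThetaHom \<Theta> m w ws.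
        inv_modif (P m) (Xws I X ws) (Xw I Y w)
          (\<lambda>x. comp_func (Hw I H w x) (phi A m \<alpha> x))
          (\<lambda>x. comp_func (phi B m \<alpha> x) (Hws I H ws x))
          (rho H m \<alpha>)) \<and>
     (\<forall>m. \<forall>w\<in>kwords \<Theta> m. \<forall>x\<in>Ob (P m). \<forall>y\<in>Ob (XO (Xw I X w) x).
        e_unit B m w x [FO (Hw I H w x) y] \<cdot>\<^bsub>XO (Xw I Y w) x\<^esub> rho H m (Ounit \<Theta> m w) x [y]
        = FA (Hw I H w x) (e_unit A m w x [y])) \<and>
     (\<forall>m w ws wss \<alpha>s. \<forall>\<alpha>\<in>ThetaHom \<Theta> m w ws. ThetaHoms \<Theta> m \<alpha>s ws wss \<longrightarrow>
        (\<forall>x\<in>Ob (P m). \<forall>ys\<in>Ob (XO (Xws I X (concat wss)) x).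
           let C = XO (Xw I Y w) x in
           e_comp B m \<alpha> \<alpha>s x (FO (Hws I H (concat wss) x) ys) \<cdot>\<^bsub>C\<^esub> rho H m (Ocomp \<Theta> m \<alpha> \<alpha>s) x ys
           = FA (phi B m \<alpha> x) (map2 (\<lambda>\<beta>. rho H m \<beta> x) \<alpha>s (blocks (map length wss) ys))
             \<cdot>\<^bsub>C\<^esub> rho H m \<alpha> x (phis A m \<alpha>s wss x ys)
             \<cdot>\<^bsub>C\<^esub> FA (Hw I H w x) (e_comp A m \<alpha> \<alpha>s x ys))) \<and>
     (\<forall>m w ws p. \<forall>\<iota>\<in>index_maps p (length ws). \<forall>\<alpha>\<in>ThetaHom \<Theta> m w (pick ws \<iota>). set ws \<subseteq> kwords \<Theta> m \<longrightarrow>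
        (\<forall>x\<in>Ob (P m). \<forall>ys\<in>Ob (XO (Xws I X ws) x).
           let C = XO (Xw I Y w) x in
           e_fun B m ws \<iota> \<alpha> x (FO (Hws I H ws x) ys) \<cdot>\<^bsub>C\<^esub> rho H m (Ofun \<Theta> m ws \<iota> \<alpha>) x ys
           = rho H m \<alpha> x (pick ys \<iota>) \<cdot>\<^bsub>C\<^esub> FA (Hw I H w x) (e_fun A m ws \<iota> \<alpha> x ys))) \<and>
     (\<forall>m l w ws. \<forall>f\<in>index_maps m l. \<forall>\<alpha>\<in>ThetaHom \<Theta> m w ws.
        \<forall>x\<in>Ob (P l). \<forall>ys\<in>Ob (XO (Xws I X (map (ksub \<Theta> l f) ws)) x).
          let x' = pick x f; C = XO (Xw I Y w) x'; vs = map (ksub \<Theta> l f) ws in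
          e_sub B l f \<alpha> x (FO (Hws I H vs x) ys)
            \<cdot>\<^bsub>C\<^esub> FA (Xs I Y l f w x) (rho H l (Osub \<Theta> l f \<alpha>) x ys)
          = rho H m \<alpha> x' (FO (Xss I X l f ws x) ys)
            \<cdot>\<^bsub>C\<^esub> FA (Hw I H w x') (e_sub A l f \<alpha> x ys)) \<and>
     (\<forall>m w ws us. \<forall>\<alpha>\<in>ThetaHom \<Theta> m w ws. length us = m \<and> word_list (Th \<Theta>) us \<longrightarrow>
        (let N = sum_list (ars (Th \<Theta>) us); vs = map (kgam \<Theta> us) ws in
         \<forall>x\<in>Ob (P N). \<forall>ys\<in>Ob (XO (Xws I X vs) x).
           let x' = PhiS (Th \<Theta>) I us x; C = XO (Xw I Y w) x' in
           e_pull B us \<alpha> x (FO (Hws I H vs x) ys)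
             \<cdot>\<^bsub>C\<^esub> FA (Xc I Y us w x) (rho H N (Opull \<Theta> us \<alpha>) x ys)
           = rho H m \<alpha> x' (FO (Xcs I X us ws x) ys)
             \<cdot>\<^bsub>C\<^esub> FA (Hw I H w x') (e_pull A us \<alpha> x ys))))"

definition alg_cell ::
    "('t, 'h) thy2 \<Rightarrow> ('t, 'io, 'ia) palg \<Rightarrow> ('io, 'ia, 't, 'h, 'u) alg \<Rightarrow>
     ('io, 'ia, 't, 'h, 'u) alg \<Rightarrow> ('io, 'h, 'u) mor \<Rightarrow> ('io, 'h, 'u) mor \<Rightarrow>
     ('io list \<Rightarrow> 'u \<Rightarrow> 'u) \<Rightarrow> bool" where
  "alg_cell \<Theta> I A B G H \<sigma> \<longleftrightarrow> (let X = XX A; Y = XX B; P = pow_cat (car I) in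
     modif (P (kk \<Theta>)) X Y (HH G) (HH H) \<sigma> \<and>
     \<sigma> \<in> extensional (Ob (P (kk \<Theta>))) \<and> (\<forall>i\<in>Ob (P (kk \<Theta>)). \<sigma> i \<in> extensional (Ob (XO X i))) \<and>
     (\<forall>m w ws. \<forall>\<alpha>\<in>ThetaHom \<Theta> m w ws. \<forall>x\<in>Ob (P m). \<forall>ys\<in>Ob (XO (Xws I X ws) x).
        let C = XO (Xw I Y w) x; \<sigma>w = (\<lambda>w. \<sigma> (map (\<lambda>v. FO (Phi I v) x) w)) in
        FA (phi B m \<alpha> x) (map2 \<sigma>w ws ys) \<cdot>\<^bsub>C\<^esub> rho G m \<alpha> x ys
        = rho H m \<alpha> x ys \<cdot>\<^bsub>C\<^esub> \<sigma>w w (FO (phi A m \<alpha> x) ys)))"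

definition id_mor ::
    "('t, 'h) thy2 \<Rightarrow> ('t, 'io, 'ia) palg \<Rightarrow> ('io, 'ia, 't, 'h, 'u) alg \<Rightarrow> ('io, 'h, 'u) mor" where
  "id_mor \<Theta> I A = \<lparr>
     HH = (\<lambda>i\<in>Ob (pow_cat (car I) (kk \<Theta>)). restrict_func (XO (XX A) i) id_func),
     rho = (\<lambda>m \<alpha> x ys. if rho_index \<Theta> I A m \<alpha> x ys
              then Ident (XO (Xw I (XX A) (out \<Theta> m \<alpha>)) x) (FO (phi A m \<alpha> x) ys) else undefined)\<rparr>"

definition comp_mor ::
    "('t, 'h) thy2 \<Rightarrow> ('t, 'io, 'ia) palg \<Rightarrow> ('io, 'ia, 't, 'h, 'u) alg \<Rightarrow>
     ('io, 'ia, 't, 'h, 'u) alg \<Rightarrow> ('io, 'ia, 't, 'h, 'u) alg \<Rightarrow>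
     ('io, 'h, 'u) mor \<Rightarrow> ('io, 'h, 'u) mor \<Rightarrow> ('io, 'h, 'u) mor" where
  "comp_mor \<Theta> I A B D K H = \<lparr>
     HH = (\<lambda>i\<in>Ob (pow_cat (car I) (kk \<Theta>)).
             restrict_func (XO (XX A) i) (comp_func (HH K i) (HH H i))),
     rho = (\<lambda>m \<alpha> x ys. if rho_index \<Theta> I A m \<alpha> x ys
              then rho K m \<alpha> x (FO (Hws I H (ins \<Theta> m \<alpha>) x) ys)
                   \<cdot>\<^bsub>XO (Xw I (XX D) (out \<Theta> m \<alpha>)) x\<^esub> FA (Hw I K (out \<Theta> m \<alpha>) x) (rho H m \<alpha> x ys)
              else undefined)\<rparr>"

text \<open>A 2-cell carries its source and target.\<close>

definition Alg2 ::
    "'u itself \<Rightarrow> ('t, 'h) thy2 \<Rightarrow> ('t, 'io, 'ia) palg \<Rightarrow>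
     (('io, 'ia, 't, 'h, 'u) alg, ('io, 'h, 'u) mor,
      ('io, 'h, 'u) mor \<times> ('io, 'h, 'u) mor \<times> ('io list \<Rightarrow> 'u \<Rightarrow> 'u)) cat2" where
  "Alg2 U \<Theta> I = (let Q = Ob (pow_cat (car I) (kk \<Theta>)) in
     \<lparr>Ob2 = {A. pseudo_algebra U \<Theta> I A},
      Mor2 = (\<lambda>A B.
        \<lparr>Ob = {H. alg_mor \<Theta> I A B H},
         Ar = {(G, H, \<sigma>). alg_mor \<Theta> I A B G \<and> alg_mor \<Theta> I A B H \<and> alg_cell \<Theta> I A B G H \<sigma>},
         Dom = (\<lambda>(G, H, \<sigma>). G),
         Cod = (\<lambda>(G, H, \<sigma>). H),
         Ident = (\<lambda>H. (H, H, \<lambda>i\<in>Q. \<lambda>y\<in>Ob (XO (XX A) i). Ident (XO (XX B) i) (FO (HH H i) y))),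
         Comp = (\<lambda>(H, L, \<tau>) (G, H', \<sigma>).
                   (G, L, \<lambda>i\<in>Q. \<lambda>y\<in>Ob (XO (XX A) i). \<tau> i y \<cdot>\<^bsub>XO (XX B) i\<^esub> \<sigma> i y))\<rparr>),
      one1 = id_mor \<Theta> I,
      cmp1 = comp_mor \<Theta> I,
      cmp2 = (\<lambda>A B D (K, K', \<tau>) (H, H', \<sigma>).
                (comp_mor \<Theta> I A B D K H, comp_mor \<Theta> I A B D K' H',
                 \<lambda>i\<in>Q. \<lambda>y\<in>Ob (XO (XX A) i).
                   \<tau> i (FO (HH H' i) y) \<cdot>\<^bsub>XO (XX D) i\<^esub> FA (HH K i) (\<sigma> i y)))\<rparr>)"

end

theory Submission
 imports Defs
begin

text \<open>
  The pseudo limit of \<open>F\<close> is the algebra \<open>W\<close> whose fibre over \<open>i\<close> consists of pseudo cones: objects \<open>a\<^sub>j\<close> of the fibres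
  of the algebras \<open>F j\<close> over \<open>i\<close>, with isomorphisms \<open>F f a\<^sub>j \<rightarrow> a\<^sub>l\<close> for \<open>f: j \<rightarrow> l\<close> that are compatible with the coherence cells
  of \<open>F\<close>. The operations of \<open>W\<close> act on the objects \<open>a\<^sub>j\<close> componentwise, and on the isomorphisms through the cells \<open>\<rho>\<close> of the
  morphisms \<open>F f\<close>; the coherence isomorphisms of \<open>W\<close> are those of the \<open>F j\<close> in each component. That these are morphisms of cones
  is the compatibility of the cells \<open>\<rho>\<close> with the coherence isomorphisms, which has one form for all five kinds once it is
  stated for composites of operations.

  The projections of \<open>W\<close> are strict and jointly faithful, and an isomorphism of \<open>W\<close> is determined by its components and its target.
  Hence every coherence diagram of \<open>W\<close> follows from those of the algebras \<open>F j\<close>. A pseudo natural transformation from the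
  constant functor at an algebra \<open>B\<close> to \<open>F\<close> is at each object of a fibre of \<open>B\<close> a cone, so that it is the same
  as a morphism \<open>B \<rightarrow> W\<close>, and likewise for modifications.
\<close>

text \<open>Every fibre must have the type \<open>'u\<close>, so cones and their morphisms are coded
  as elements of the universe, an arrow together with its source and target. Equality of arrows is
  therefore sensitive to ends, and the two sides of a coherence diagram in the limit start at values
  of two composite operations that agree only by a relation of \<open>\<Theta>\<close>. The
  comparison is moved to the target. For an isomorphism of cones, the structure arrow of the source
  followed by an invertible component equals the structure arrow of the target after the image of
  another component; so it can be solved for, and it remains to match targets, by block
  combinatorics and the axioms of \<open>I\<close>. The second obstacle is that a morphism supplies
  \<open>\<rho>\<close> for single operations, whereas a coherence isomorphism joins composites that
  may contain \<open>X(s)\<close> and \<open>X(c)\<close>. Since morphisms commute strictly with the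
  functors \<open>X(h)\<close>, only the operations of a composite contribute a component of
  \<open>\<rho>\<close>.\<close>

lemmas c1 = conjunct1 and c2 = conjunct2

abbreviation Comp_in :: "'a => ('o, 'a, 'z) cat_scheme => 'a => 'a" ("_ *[_] _" [71, 0, 70] 70) where
 "g *[C] f == Comp C g f"

section \<open>Small sets\<close>

lemma small_lepoll: "A \<lesssim> B ==> small U B ==> small U A"
 unfolding small_def by (rule lesspoll_trans1)

lemma small_subset: "A <= B ==> small U B ==> small U A"
 using small_lepoll subset_imp_lepoll by blast

lemma small_image: "small U A ==> small U (f ` A)"
 using small_lepoll image_lepoll by blast

text \<open>\<open>inaccessible\<close> speaks of subsets of \<open>'u\<close> only. Through such an
  injection its closure properties carry over to small sets of any type.\<close>

lemma small_inj:
 assumes "small TYPE('u) (A :: 'a set)"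
 obtains e :: "'a => 'u" where "inj_on e A"
 using assms unfolding small_def lesspoll_def lepoll_def by blast

lemma inaccessible_infinite:
 assumes inac: "inaccessible TYPE('u)" shows "infinite (UNIV :: 'u set)"
proof -
 have "(UNIV :: nat set) \<lesssim> (UNIV :: 'u set)"
  using inac by (auto simp: inaccessible_def lesspoll_def)
 then show ?thesis
  by (auto simp: lepoll_def infinite_iff_countable_subset)
qed

lemma small_finite: "inaccessible TYPE('u) ==> finite A ==> small TYPE('u) A"
 unfolding small_def by (rule finite_lesspoll_infinite[OF inaccessible_infinite])

lemma small_Pow:
 assumes inac: "inaccessible TYPE('u)" and A: "small TYPE('u) A" shows "small TYPE('u) (Pow A)"
proof -
 obtain e :: "_ => 'u" where e: "inj_on e A"
  using small_inj A by blast
 have "small TYPE('u) (e ` A)"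
  using A by (rule small_image)
 then have "small TYPE('u) (Pow (e ` A))"
  using inac by (simp add: inaccessible_def small_def)
 moreover have "Pow A \<lesssim> Pow (e ` A)"
  unfolding lepoll_def by (rule exI[of _ "image e"]) (use e in \<open>auto simp: inj_on_image_Pow\<close>)
 ultimately show ?thesis
  by (rule small_lepoll[rotated])
qed

text \<open>An infinite set is equipotent to its square. The pairing tags elements of the universe
  by codes that are again elements of it.\<close>

lemma pairing:
 assumes inac: "inaccessible TYPE('u)" shows "EX p :: 'u \<times> 'u => 'u. inj p"
proof -
 have "(card_of (UNIV \<times> UNIV :: ('u \<times> 'u) set), card_of (UNIV :: 'u set)) : ordLeq"
  using card_of_Times_same_infinite[OF inaccessible_infinite[OF inac]] ordIso_imp_ordLeq by blast
 then show ?thesis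
  using card_of_ordLeq[of "UNIV \<times> UNIV :: ('u \<times> 'u) set" "UNIV :: 'u set"] by auto
qed

text \<open>Inside the universe the sum becomes a small union of small sets: the copy of
  \<open>S k\<close> consists of pairs tagged by the code of \<open>k\<close>, which keeps the
  copies disjoint.\<close>

lemma small_Sigma:
 assumes inac: "inaccessible TYPE('u)" and K: "small TYPE('u) K" and S: "!!k. k : K ==> small TYPE('u) (S k)"
 shows "small TYPE('u) (Sigma K S)"
proof -
 obtain p :: "'u \<times> 'u => 'u" where p: "inj p"
  using pairing[OF inac] by blast
 obtain e :: "_ => 'u" where e: "inj_on e K"
  using small_inj K by blast
 have "ALL k:K. EX d :: _ => 'u. inj_on d (S k)"
  using small_inj S by metis
 then obtain d :: "_ => _ => 'u" where d: "!!k. k : K ==> inj_on (d k) (S k)"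
  by metis
 let ?F = "(%k. (%s. p (e k, d k s)) ` S k) ` K"
 have "small TYPE('u) ?F" "ALL A:?F. small TYPE('u) A"
  using K S small_image by auto
 then have "small TYPE('u) (\<Union>?F)"
  using inac by (simp add: inaccessible_def small_def)
 moreover have "Sigma K S \<lesssim> \<Union>?F"
  unfolding lepoll_def
 proof (intro exI conjI)
  show "inj_on (%(k, s). p (e k, d k s)) (Sigma K S)"
  proof (rule inj_onI, clarsimp)
   fix k s k' s' assume *: "k : K" "s : S k" "k' : K" "s' : S k'" "p (e k, d k s) = p (e k', d k' s')"
   then have "e k = e k'" "d k s = d k' s'"
    using injD[OF p] by blast+
   then show "k = k' & s = s'"
    using * inj_onD[OF e] inj_onD[OF d] by metis
  qed
 qed auto
 ultimately show ?thesis
  by (rule small_lepoll[rotated])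
qed

lemma small_UN:
 assumes "inaccessible TYPE('u)" and "small TYPE('u) K" and "!!k. k : K ==> small TYPE('u) (S k)"
 shows "small TYPE('u) (\<Union>k\<in>K. S k)"
proof -
 have "(\<Union>k\<in>K. S k) = snd ` Sigma K S" by force
 then show ?thesis by (simp add: small_image small_Sigma[OF assms])
qed

lemma small_Un:
 assumes "inaccessible TYPE('u)" "small TYPE('u) A" "small TYPE('u) B"
 shows "small TYPE('u) (A \<union> B)"
proof -
 have "small TYPE('u) (\<Union>b\<in>{True, False}. if b then A else B)"
  by (rule small_UN) (use assms in \<open>auto intro: small_finite\<close>)
 then show ?thesis by (simp add: Un_commute)
qed

lemma small_Times: "inaccessible TYPE('u) ==> small TYPE('u) A ==> small TYPE('u) B ==> small TYPE('u) (A \<times> B)"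
 by (rule small_Sigma)

text \<open>A function that is \<open>undefined\<close> off \<open>A\<close> is determined by its
  graph over \<open>A\<close>, a subset of the product.\<close>

lemma small_PiE:
 assumes "inaccessible TYPE('u)" "small TYPE('u) A" "small TYPE('u) B"
 shows "small TYPE('u) (A \<rightarrow>\<^sub>E B)"
proof (rule small_lepoll)
 show "(A \<rightarrow>\<^sub>E B) \<lesssim> Pow (A \<times> B)"
  unfolding lepoll_def
 proof (intro exI conjI)
  show "inj_on (%f. (%a. (a, f a)) ` A) (A \<rightarrow>\<^sub>E B)"
   by (rule inj_onI, rule PiE_ext) (auto simp: set_eq_iff image_iff)
 qed auto
 show "small TYPE('u) (Pow (A \<times> B))"
  by (intro small_Pow small_Times assms)
qed

lemma small_lists:
 assumes "inaccessible TYPE('u)" "small TYPE('u) B" shows "small TYPE('u) {xs. length xs = n & set xs <= B}"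
proof (induction n)
 case 0
 have "{xs :: 'a list. length xs = 0 & set xs <= B} = {[]}" by auto
 then show ?case by (simp add: small_finite[OF assms(1)])
next
 case (Suc n)
 have "{xs. length xs = Suc n & set xs <= B} <=
   (%(x, xs). x # xs) ` (B \<times> {xs. length xs = n & set xs <= B})"
  by (auto simp: length_Suc_conv image_iff)
 then show ?case
  by (rule small_subset) (intro small_image small_Times assms Suc)
qed

section \<open>Lists cut into blocks\<close>

lemma length_blocks [simp]: "length (blocks ns xs) = length ns"
 by (induction ns arbitrary: xs) auto

lemma blocks_concat: "map length xss = ns ==> blocks ns (concat xss) = xss"
 by (induction xss arbitrary: ns) auto

lemma map_blocks: "blocks ns (map f xs) = map (map f) (blocks ns xs)"
 by (induction ns arbitrary: xs) (auto simp: take_map drop_map)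

lemma concat_blocks: "length xs = sum_list ns ==> concat (blocks ns xs) = xs"
 by (induction ns arbitrary: xs) auto

lemma length_in_blocks: "length xs = sum_list ns ==> map length (blocks ns xs) = ns"
 by (induction ns arbitrary: xs) auto

text \<open>Once a list is written as a concatenation, its blocks are known by
  \<open>blocks_concat\<close>.\<close>

lemma split_blocks:
 assumes "length xs = sum_list ns"
 obtains xss where "xs = concat xss" "map length xss = ns"
 using concat_blocks[OF assms] length_in_blocks[OF assms] by metis

section \<open>Index functions acting on lists\<close>

lemma length_pick [simp]: "length (pick xs f) = length f"
 by (simp add: pick_def)

lemma pick_Nil [simp]: "pick xs [] = []"
 by (simp add: pick_def)

lemma nth_pick [simp]: "i < length f ==> pick xs f ! i = xs ! (f ! i)"
 by (simp add: pick_def)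

lemma map_pick: "set f <= {..<length xs} ==> map h (pick xs f) = pick (map h xs) f"
 by (auto simp: pick_def)

lemma pick_pick: "set f <= {..<length g} ==> pick (pick xs g) f = pick xs (pick g f)"
 by (auto simp: pick_def)

lemma pick_concat: "pick xs (concat fs) = concat (map (pick xs) fs)"
 by (induction fs) (simp_all add: pick_def)

lemma set_pick: "set f <= {..<length xs} ==> set (pick xs f) <= set xs"
 by (auto simp: pick_def)

lemma pick_id [simp]: "pick xs [0..<length xs] = xs"
 by (simp add: pick_def map_nth)

lemma index_mapsD: "f : index_maps p l ==> length f = p & set f <= {..<l}"
 by (simp add: index_maps_def)

lemma index_maps_nth: "f : index_maps p l ==> i < p ==> f ! i < l"
 unfolding index_maps_def by (auto dest: nth_mem)

lemma index_maps_pick: "f : index_maps p l ==> g : index_maps l r ==> pick g f : index_maps p r"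
 unfolding index_maps_def using set_pick[of f g] by auto

lemma index_maps_id: "[0..<p] : index_maps p p"
 by (auto simp: index_maps_def)

lemma sum_list_take_le: "i < length ns ==> sum_list (take i ns) + ns ! i \<le> sum_list (ns :: nat list)"
proof (induction ns arbitrary: i)
 case (Cons n ns)
 then show ?case by (cases i) auto
qed simp

lemma blk_nth: "i < length ns ==> blk ns i = map ((+) (sum_list (take i ns))) [0..<ns ! i]"
 by (simp add: blk_def take_Suc_conv_app_nth list_eq_iff_nth_eq)

lemma length_blk [simp]: "i < length ns ==> length (blk ns i) = ns ! i"
 by (simp add: blk_nth)

lemma blk_index_maps: "i < length ns ==> blk ns i : index_maps (ns ! i) (sum_list ns)"
 using sum_list_take_le[of i ns] by (auto simp: index_maps_def blk_nth)

lemma blocks_nth: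
 "i < length ns ==> blocks ns xs ! i = take (ns ! i) (drop (sum_list (take i ns)) xs)"
proof (induction ns arbitrary: xs i)
 case (Cons n ns)
 then show ?case by (cases i) (auto simp: drop_drop ac_simps)
qed simp

text \<open>A block arises by cutting or by picking along the inclusion \<open>blk\<close>; what is
  known of index functions thereby applies to blocks.\<close>

lemma pick_blk:
 assumes "i < length ns" "length xs = sum_list ns"
 shows "pick xs (blk ns i) = blocks ns xs ! i"
 using sum_list_take_le[of i ns] assms
 by (auto simp: list_eq_iff_nth_eq blocks_nth blk_nth min_def)

lemma bar_index_maps:
 assumes "f : index_maps p (length ns)"
 shows "bar ns f : index_maps (sum_list (pick ns f)) (sum_list ns)"
proof -
 have f: "i < length ns" if "i : set f" for i
  using assms that by (auto simp: index_maps_def)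
 have "map (length \<circ> blk ns) f = pick ns f"
  unfolding pick_def by (rule map_cong) (auto simp: f)
 then have "length (bar ns f) = sum_list (pick ns f)"
  by (simp add: bar_def length_concat)
 moreover have "set (blk ns i) <= {..<sum_list ns}" if "i : set f" for i
  using blk_index_maps[OF f[OF that]] by (simp add: index_maps_def)
 then have "set (bar ns f) <= {..<sum_list ns}"
  unfolding bar_def set_concat set_map image_image by (rule UN_least)
 ultimately show ?thesis by (simp add: index_maps_def)
qed

lemma pick_bar:
 assumes "set f <= {..<length ns}" "length xs = sum_list ns"
 shows "pick xs (bar ns f) = concat (pick (blocks ns xs) f)"
proof -
 have "map (pick xs \<circ> blk ns) f = pick (blocks ns xs) f"
  unfolding pick_def[of "blocks ns xs"] by (rule map_cong) (use assms in \<open>auto simp: pick_blk\<close>)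
 then show ?thesis by (simp add: bar_def pick_concat)
qed

lemma pick_bar_concat:
 "set f <= {..<length xss} ==> map length xss = ns ==>
  pick (concat xss) (bar ns f) = concat (pick xss f)"
 using pick_bar[of f ns "concat xss"] by (auto simp: blocks_concat length_concat)

text \<open>The shift by a partial sum is the block inclusion, so a block sum is made of composites
  of index functions and \<open>pick_pick\<close> applies.\<close>

lemma block_sum_eq:
 assumes "length fs = length ls" "!!i. i < length ls ==> set (fs ! i) <= {..<ls ! i}"
 shows "block_sum ls fs = concat (map (%i. pick (blk ls i) (fs ! i)) [0..<length ls])"
proof -
 have "map ((+) (sum_list (take i ls))) (fs ! i) = pick (blk ls i) (fs ! i)" if "i < length ls" for i
  unfolding pick_def by (rule map_cong) (use assms(2)[OF that] that in \<open>auto simp: blk_nth subset_iff\<close>)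
 then have "map (%i. map ((+) (sum_list (take i ls))) (fs ! i)) [0..<length fs]
   = map (%i. pick (blk ls i) (fs ! i)) [0..<length ls]"
  using assms(1) by simp
 then show ?thesis by (simp add: block_sum_def)
qed

lemma block_sum_index_maps:
 assumes "length fs = length ls" "!!i. i < length ls ==> fs ! i : index_maps (ns ! i) (ls ! i)"
  "length ns = length ls"
 shows "block_sum ls fs : index_maps (sum_list ns) (sum_list ls)"
proof -
 have f: "length (fs ! i) = ns ! i" "set (fs ! i) <= {..<ls ! i}" if "i < length ls" for i
  using index_mapsD[OF assms(2)[OF that]] by simp_all
 have "map (length \<circ> (%i. pick (blk ls i) (fs ! i))) [0..<length ls] = ns"
  by (rule nth_equalityI) (simp_all add: assms(3) f(1))
 then have "length (block_sum ls fs) = sum_list ns"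
  by (simp add: block_sum_eq[OF assms(1) f(2)] length_concat)
 moreover have "set (pick (blk ls i) (fs ! i)) <= {..<sum_list ls}" if "i < length ls" for i
  using set_pick[of "fs ! i" "blk ls i"] f(2)[OF that] index_mapsD[OF blk_index_maps[OF that]] that
  by (simp add: subset_trans)
 then have "set (block_sum ls fs) <= {..<sum_list ls}"
  by (auto simp: block_sum_eq[OF assms(1) f(2)] subset_iff)
 ultimately show ?thesis by (simp add: index_maps_def)
qed

lemma pick_block_sum:
 assumes "length fs = length ls" "!!i. i < length ls ==> set (fs ! i) <= {..<ls ! i}"
  "length xs = sum_list ls"
 shows "pick xs (block_sum ls fs) = concat (map2 pick (blocks ls xs) fs)"
proof -
 have "pick xs (pick (blk ls i) (fs ! i)) = pick (blocks ls xs ! i) (fs ! i)" if "i < length ls" for i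
  using pick_pick[of "fs ! i" "blk ls i" xs] assms that by (simp add: pick_blk)
 then have "map (pick xs) (map (%i. pick (blk ls i) (fs ! i)) [0..<length ls]) = map2 pick (blocks ls xs) fs"
  by (intro nth_equalityI) (simp_all add: assms(1))
 then show ?thesis
  by (simp add: block_sum_eq[OF assms(1,2)] pick_concat)
qed

lemma pick_block_sum_concat:
 assumes "length fs = length xss" "!!i. i < length xss ==> set (fs ! i) <= {..<length (xss ! i)}"
  "map length xss = ls"
 shows "pick (concat xss) (block_sum ls fs) = concat (map2 pick xss fs)"
proof -
 have "pick (concat xss) (block_sum ls fs) = concat (map2 pick (blocks ls (concat xss)) fs)"
  by (rule pick_block_sum) (use assms(1,2) assms(3)[symmetric] in \<open>simp_all add: length_concat\<close>)
 then show ?thesis using assms(3) by (simp add: blocks_concat)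
qed

lemma list_all2_pick:
 "list_all2 P xs ys ==> set f <= {..<length xs} ==> list_all2 P (pick xs f) (pick ys f)"
 by (auto simp: list_all2_conv_all_nth subset_iff)

section \<open>Categories\<close>

lemma homD: "f : hom C a b ==> f : Ar C & Dom C f = a & Cod C f = b"
 by (simp add: hom_def)

lemma homI: "f : Ar C ==> f : hom C (Dom C f) (Cod C f)"
 by (simp add: hom_def)

lemma hom_ob: "category C ==> f : hom C a b ==> a : Ob C & b : Ob C"
 unfolding category_def hom_def by blast

lemma ident_hom: "category C ==> a : Ob C ==> Ident C a : hom C a a"
 unfolding category_def by blast

lemma comp_hom: "category C ==> f : hom C a b ==> g : hom C b c ==> g *[C] f : hom C a c"
 unfolding category_def hom_def by auto

lemma comp_ident_right: "category C ==> f : hom C a b ==> f *[C] Ident C a = f"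
 unfolding category_def hom_def by auto

lemma comp_ident_left: "category C ==> f : hom C a b ==> Ident C b *[C] f = f"
 unfolding category_def hom_def by auto

lemma comp_assoc:
 "category C ==> f : hom C a b ==> g : hom C b c ==> h : hom C c d ==>
  (h *[C] g) *[C] f = h *[C] (g *[C] f)"
 unfolding category_def hom_def by auto

text \<open>\<open>iso_in\<close> leaves the ends of the arrow implicit. Naming them lets
  isomorphisms be composed without computing \<open>Dom\<close> and \<open>Cod\<close>.\<close>

definition isoh :: "('o, 'a, 'z) cat_scheme => 'a => 'o => 'o => bool" where
 "isoh C f a b \<longleftrightarrow> f : hom C a b & iso_in C f"

lemma isoh_hom: "isoh C f a b ==> f : hom C a b"
 by (simp add: isoh_def)

lemma isohI:
 "f : hom C a b ==> g : hom C b a ==> g *[C] f = Ident C a ==> f *[C] g = Ident C b ==> isoh C f a b"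
 unfolding isoh_def iso_in_def by (metis (lifting) homD)

lemma isohE:
 assumes "isoh C f a b"
 obtains g where "g : hom C b a" "g *[C] f = Ident C a" "f *[C] g = Ident C b" "isoh C g b a"
proof -
 have f: "f : hom C a b" using assms by (simp add: isoh_def)
 obtain g where g: "g : hom C b a" "g *[C] f = Ident C a" "f *[C] g = Ident C b"
  using assms unfolding isoh_def iso_in_def hom_def by auto
 then show ?thesis using that isohI[OF g(1) f] by blast
qed

lemma isoh_ident: "category C ==> a : Ob C ==> isoh C (Ident C a) a a"
 by (rule isohI[of _ _ _ _ "Ident C a"]) (auto intro: ident_hom comp_ident_left)

lemma isoh_comp:
 assumes C: "category C" and "isoh C f a b" "isoh C g b c"
 shows "isoh C (g *[C] f) a c"
proof -
 note f = isoh_hom[OF assms(2)] and g = isoh_hom[OF assms(3)]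
 obtain f' where f': "f' : hom C b a" "f' *[C] f = Ident C a" "f *[C] f' = Ident C b"
  using assms(2) by (rule isohE)
 obtain g' where g': "g' : hom C c b" "g' *[C] g = Ident C b" "g *[C] g' = Ident C c"
  using assms(3) by (rule isohE)
 show ?thesis
 proof (rule isohI)
  show "g *[C] f : hom C a c" "f' *[C] g' : hom C c a"
   using comp_hom[OF C] f g f' g' by blast+
  have "(f' *[C] g') *[C] (g *[C] f) = f' *[C] ((g' *[C] g) *[C] f)"
   using comp_assoc[OF C comp_hom[OF C f g] g'(1) f'(1)] comp_assoc[OF C f g g'(1)] by simp
  then show "(f' *[C] g') *[C] (g *[C] f) = Ident C a"
   using f' g' comp_ident_left[OF C f] by simp
  have "(g *[C] f) *[C] (f' *[C] g') = g *[C] ((f *[C] f') *[C] g')"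
   using comp_assoc[OF C comp_hom[OF C g'(1) f'(1)] f g] comp_assoc[OF C g'(1) f'(1) f] by simp
  then show "(g *[C] f) *[C] (f' *[C] g') = Ident C c"
   using f' g' comp_ident_left[OF C g'(1)] by simp
 qed
qed

lemma isoh_cancel_right:
 assumes C: "category C" and "isoh C f a b" "g : hom C b c" "g' : hom C b c"
  "g *[C] f = g' *[C] f"
 shows "g = g'"
proof -
 obtain f' where f': "f' : hom C b a" "f *[C] f' = Ident C b"
  using assms(2) by (rule isohE)
 have "g = (g *[C] f) *[C] f'" "g' = (g' *[C] f) *[C] f'"
  using comp_assoc[OF C f'(1) isoh_hom[OF assms(2)]] assms(3,4) f'(2)
  by (simp_all add: comp_ident_right[OF C])
 then show ?thesis using assms(5) by simp
qed

lemma isoh_cancel_left: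
 assumes C: "category C" and "isoh C f b c" "g : hom C a b" "g' : hom C a b"
  "f *[C] g = f *[C] g'"
 shows "g = g'"
proof -
 obtain f' where f': "f' : hom C c b" "f' *[C] f = Ident C b"
  using assms(2) by (rule isohE)
 have "g = f' *[C] (f *[C] g)" "g' = f' *[C] (f *[C] g')"
  using comp_assoc[OF C _ isoh_hom[OF assms(2)] f'(1)] assms(3,4) f'(2)
  by (metis comp_ident_left[OF C])+
 then show ?thesis using assms(5) by simp
qed

lemma functor_ob: "is_functor C D F ==> a : Ob C ==> FO F a : Ob D"
 by (simp add: is_functor_def)

lemma functor_hom: "is_functor C D F ==> f : hom C a b ==> FA F f : hom D (FO F a) (FO F b)"
 by (auto simp: is_functor_def hom_def)

lemma functor_ident: "is_functor C D F ==> a : Ob C ==> FA F (Ident C a) = Ident D (FO F a)"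
 by (simp add: is_functor_def)

lemma functor_comp:
 "is_functor C D F ==> f : hom C a b ==> g : hom C b c ==> FA F (g *[C] f) = FA F g *[D] FA F f"
 by (auto simp: is_functor_def hom_def)

lemma functor_isoh:
 assumes "category C" "is_functor C D F" "isoh C f a b"
 shows "isoh D (FA F f) (FO F a) (FO F b)"
proof -
 note f = isoh_hom[OF assms(3)]
 obtain g where g: "g : hom C b a" "g *[C] f = Ident C a" "f *[C] g = Ident C b"
  using assms(3) by (rule isohE)
 have ab: "a : Ob C" "b : Ob C" using hom_ob[OF assms(1) f] by auto
 show ?thesis
  using functor_hom[OF assms(2)] functor_comp[OF assms(2)] functor_ident[OF assms(2)] f g ab
  by (metis isohI)
qed

section \<open>Products and powers of categories\<close>

lemma prod_cat_simps [simp]: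
 "Ob (prod_cat Cs) = {xs. list_all2 (%C x. x : Ob C) Cs xs}"
 "Ident (prod_cat Cs) = map2 Ident Cs"
 "gs *[prod_cat Cs] fs = map (%i. gs ! i *[Cs ! i] fs ! i) [0..<length Cs]"
 by (simp_all add: prod_cat_def)

lemma hom_prod:
 "fs : hom (prod_cat Cs) as bs \<longleftrightarrow> length fs = length Cs & length as = length Cs &
  length bs = length Cs & (ALL n<length Cs. fs ! n : hom (Cs ! n) (as ! n) (bs ! n))"
proof
 assume "fs : hom (prod_cat Cs) as bs"
 then have *: "list_all2 (%C f. f : Ar C) Cs fs" "as = map2 Dom Cs fs" "bs = map2 Cod Cs fs"
  by (auto simp: hom_def prod_cat_def)
 then show "length fs = length Cs & length as = length Cs &
  length bs = length Cs & (ALL n<length Cs. fs ! n : hom (Cs ! n) (as ! n) (bs ! n))"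
  by (auto simp: list_all2_conv_all_nth hom_def)
next
 assume *: "length fs = length Cs & length as = length Cs &
  length bs = length Cs & (ALL n<length Cs. fs ! n : hom (Cs ! n) (as ! n) (bs ! n))"
 then have "map2 Dom Cs fs = as" "map2 Cod Cs fs = bs"
  by (auto simp: hom_def intro!: nth_equalityI)
 with * show "fs : hom (prod_cat Cs) as bs"
  by (auto simp: hom_def prod_cat_def list_all2_conv_all_nth)
qed

lemma category_prod:
 assumes "!!C. C : set Cs ==> category C"
 shows "category (prod_cat Cs)"
proof -
 have C: "category (Cs ! n)" if "n < length Cs" for n
  using assms that by simp
 have h: "f : Ar (prod_cat Cs) ==> f : hom (prod_cat Cs) (Dom (prod_cat Cs) f) (Cod (prod_cat Cs) f)" for f
  by (rule homI)
 show ?thesis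
  unfolding category_def
 proof (intro conjI ballI impI)
  fix f assume "f : Ar (prod_cat Cs)"
  note f = h[OF this, unfolded hom_prod]
  show "Dom (prod_cat Cs) f : Ob (prod_cat Cs)" "Cod (prod_cat Cs) f : Ob (prod_cat Cs)"
   using f hom_ob[OF C] by (auto simp: list_all2_conv_all_nth)
  show "f *[prod_cat Cs] Ident (prod_cat Cs) (Dom (prod_cat Cs) f) = f"
   "Ident (prod_cat Cs) (Cod (prod_cat Cs) f) *[prod_cat Cs] f = f"
   using f comp_ident_right[OF C] comp_ident_left[OF C] by (auto intro!: nth_equalityI)
 next
  fix x assume "x : Ob (prod_cat Cs)"
  then show "Ident (prod_cat Cs) x : hom (prod_cat Cs) x x"
   using ident_hom[OF C] by (auto simp: hom_prod list_all2_conv_all_nth)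
 next
  fix f g assume fg: "f : Ar (prod_cat Cs)" "g : Ar (prod_cat Cs)" "Cod (prod_cat Cs) f = Dom (prod_cat Cs) g"
  note f = h[OF fg(1), unfolded hom_prod] and g = h[OF fg(2), unfolded hom_prod]
  show "g *[prod_cat Cs] f : hom (prod_cat Cs) (Dom (prod_cat Cs) f) (Cod (prod_cat Cs) g)"
   unfolding hom_prod using f g fg(3) comp_hom[OF C] by auto
 next
  fix f g k assume fg: "f : Ar (prod_cat Cs)" "g : Ar (prod_cat Cs)" "k : Ar (prod_cat Cs)"
   "Cod (prod_cat Cs) f = Dom (prod_cat Cs) g & Cod (prod_cat Cs) g = Dom (prod_cat Cs) k"
  note f = h[OF fg(1), unfolded hom_prod] and g = h[OF fg(2), unfolded hom_prod]
   and k = h[OF fg(3), unfolded hom_prod]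
  have "k ! n *[Cs ! n] (g ! n *[Cs ! n] f ! n) = (k ! n *[Cs ! n] g ! n) *[Cs ! n] f ! n" if "n < length Cs" for n
   using f g k fg(4) comp_assoc[OF C[OF that]] that by (metis (no_types))
  then show "k *[prod_cat Cs] (g *[prod_cat Cs] f) = (k *[prod_cat Cs] g) *[prod_cat Cs] f"
   by simp
 qed
qed

lemma isoh_prod:
 assumes "!!C. C : set Cs ==> category C"
  and "length fs = length Cs" "length as = length Cs" "length bs = length Cs"
  and i: "!!n. n < length Cs ==> isoh (Cs ! n) (fs ! n) (as ! n) (bs ! n)"
 shows "isoh (prod_cat Cs) fs as bs"
proof -
 have "ALL n<length Cs. EX g. g : hom (Cs ! n) (bs ! n) (as ! n) &
   g *[Cs ! n] fs ! n = Ident (Cs ! n) (as ! n) & fs ! n *[Cs ! n] g = Ident (Cs ! n) (bs ! n)"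
  using isohE[OF i] by metis
 then obtain g where g: "!!n. n < length Cs ==> g n : hom (Cs ! n) (bs ! n) (as ! n) &
   g n *[Cs ! n] fs ! n = Ident (Cs ! n) (as ! n) & fs ! n *[Cs ! n] g n = Ident (Cs ! n) (bs ! n)"
  by metis
 show ?thesis
  by (rule isohI[of _ _ _ _ "map g [0..<length Cs]"])
   (use assms(2-4) g isoh_hom[OF i] in \<open>auto simp: hom_prod intro!: nth_equalityI\<close>)
qed

lemma pow_cat_Ob: "Ob (pow_cat C n) = {xs. length xs = n & set xs <= Ob C}"
 by (auto simp: pow_cat_def list_all2_conv_all_nth in_set_conv_nth subset_iff)

lemma pow_cat_hom:
 "hs : hom (pow_cat C n) xs ys \<longleftrightarrow> length hs = n & length xs = n & length ys = n &
  (ALL i<n. hs ! i : hom C (xs ! i) (ys ! i))"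
 by (auto simp: pow_cat_def hom_prod)

lemma pow_cat_comp: "gs *[pow_cat C n] fs = map (%i. gs ! i *[C] fs ! i) [0..<n]"
 by (simp add: pow_cat_def)

lemma pow_cat_ident: "length xs = n ==> Ident (pow_cat C n) xs = map (Ident C) xs"
 by (auto simp: pow_cat_def intro!: nth_equalityI)

lemma category_pow: "category C ==> category (pow_cat C n)"
 unfolding pow_cat_def by (rule category_prod) auto

lemma small_pow:
 assumes "inaccessible TYPE('u)" "small TYPE('u) (Ob C)"
 shows "small TYPE('u) (Ob (pow_cat C n))"
 unfolding pow_cat_Ob using assms by (rule small_lists)

lemma is_productD:
 assumes "is_product C P As p" "B : Ob C" "length fs = length As"
  "!!i. i < length As ==> fs ! i : hom C B (As ! i)"
 shows "EX! f. f : hom C B P & (ALL i<length As. p i *[C] f = fs ! i)"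
 using assms unfolding is_product_def by blast

section \<open>Words of a theory\<close>

locale theory_T =
 fixes T :: "'t thy"
 assumes lawvere: "lawvere_theory T"
begin

lemma category_T: "category T" and Ob_T: "Ob T = UNIV"
 and prod_T: "is_product T n (replicate n 1) (pr T n)"
 using lawvere by (auto simp: lawvere_theory_def)

lemmas T_comp = comp_hom[OF category_T] and T_assoc = comp_assoc[OF category_T]
lemmas T_ident = ident_hom[OF category_T, unfolded Ob_T, OF UNIV_I]

lemma pr_hom: "i < n ==> pr T n i : hom T n 1"
 using prod_T[of n] by (auto simp: is_product_def)

lemma tup:
 assumes "set ws <= words T m"
 shows "tup T m ws : hom T m (length ws)"
  and "i < length ws ==> pr T (length ws) i *[T] tup T m ws = ws ! i"
proof -
 have "EX! f. f : hom T m (length ws) & (ALL i<length ws. pr T (length ws) i *[T] f = ws ! i)"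
  using is_productD[OF prod_T[of "length ws"], of m ws] assms
  by (auto simp: Ob_T words_def subset_iff)
 from theI'[OF this] show "tup T m ws : hom T m (length ws)"
  "i < length ws ==> pr T (length ws) i *[T] tup T m ws = ws ! i"
  by (simp_all add: tup_def tuple_def)
qed

lemma hom_eqI:
 assumes "f : hom T m n" "g : hom T m n" "!!i. i < n ==> pr T n i *[T] f = pr T n i *[T] g"
 shows "f = g"
proof -
 have "EX! h. h : hom T m n & (ALL i<n. pr T n i *[T] h = map (%i. pr T n i *[T] g) [0..<n] ! i)"
  using is_productD[OF prod_T[of n], of m "map (%i. pr T n i *[T] g) [0..<n]"] T_comp[OF assms(2) pr_hom]
  by (simp add: Ob_T)
 with assms show ?thesis by auto
qed

lemma tup_eqI: "length ws = n ==> f : hom T m n ==> (!!i. i < n ==> pr T n i *[T] f = ws ! i) ==> set ws <= words T m ==> tup T m ws = f"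
 using tup[of ws m] by (auto intro: hom_eqI)

lemma words_comp: "w : words T m ==> u : hom T l m ==> w *[T] u : words T l"
 unfolding words_def by (rule T_comp)

lemma tup_comp:
 assumes "set ws <= words T m" "u : hom T l m"
 shows "tup T m ws *[T] u = tup T l (map (%w. w *[T] u) ws)"
proof (rule tup_eqI[symmetric])
 show "tup T m ws *[T] u : hom T l (length ws)"
  using T_comp tup assms by blast
 show "set (map (%w. w *[T] u) ws) <= words T l"
  using assms words_comp by auto
 show "pr T (length ws) i *[T] (tup T m ws *[T] u) = map (%w. w *[T] u) ws ! i" if "i < length ws" for i
  using T_assoc[OF assms(2) tup(1)[OF assms(1)] pr_hom[OF that]] tup(2)[OF assms(1) that] that by simp
qed simp

lemma ind:
 assumes "f : index_maps p l"
 shows "ind T l f : hom T l p" and "i < p ==> pr T p i *[T] ind T l f = pr T l (f ! i)"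
proof -
 have l: "length f = p" and s: "set (map (pr T l) f) <= words T l"
  using index_mapsD[OF assms] pr_hom by (auto simp: words_def)
 show "ind T l f : hom T l p" "i < p ==> pr T p i *[T] ind T l f = pr T l (f ! i)"
  using tup[OF s] l by (auto simp: ind_def)
qed

lemma ind_id: "ind T p [0..<p] = Ident T p"
 by (rule hom_eqI[OF ind(1)[OF index_maps_id] T_ident])
  (simp add: ind(2)[OF index_maps_id] comp_ident_right[OF category_T pr_hom])

lemma ind_comp:
 assumes f: "f : index_maps p l" and g: "g : index_maps l r"
 shows "ind T l f *[T] ind T r g = ind T r (pick g f)"
proof (rule hom_eqI)
 note gf = index_maps_pick[OF f g]
 show "ind T l f *[T] ind T r g : hom T r p" "ind T r (pick g f) : hom T r p"
  using ind(1)[OF f] ind(1)[OF g] ind(1)[OF gf] T_comp by auto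
 show "pr T p i *[T] (ind T l f *[T] ind T r g) = pr T p i *[T] ind T r (pick g f)" if "i < p" for i
  using T_assoc[OF ind(1)[OF g] ind(1)[OF f] pr_hom[OF that]] ind(2)[OF f that] ind(2)[OF gf that]
   ind(2)[OF g index_maps_nth[OF f that]] that index_mapsD[OF f] by simp
qed

lemma tsub_words: "w : words T p ==> f : index_maps p l ==> tsub T l w f : words T l"
 unfolding tsub_def by (rule words_comp[OF _ ind(1)])

lemma word_list_nth: "word_list T us ==> i < length us ==> us ! i : words T (Dom T (us ! i))"
 by (simp add: word_list_def)

lemma par:
 assumes "word_list T us"
 shows "par T us : hom T (sum_list (ars T us)) (length us)"
  and "i < length us ==> pr T (length us) i *[T] par T us = tsub T (sum_list (ars T us)) (us ! i) (blk (ars T us) i)"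
proof -
 let ?ws = "map (%i. tsub T (sum_list (ars T us)) (us ! i) (blk (ars T us) i)) [0..<length us]"
 have "tsub T (sum_list (ars T us)) (us ! i) (blk (ars T us) i) : words T (sum_list (ars T us))" if "i < length us" for i
  using tsub_words[OF word_list_nth[OF assms that]] blk_index_maps[of i "ars T us"] that by simp
 then have s: "set ?ws <= words T (sum_list (ars T us))" by auto
 show "par T us : hom T (sum_list (ars T us)) (length us)"
  "i < length us ==> pr T (length us) i *[T] par T us = tsub T (sum_list (ars T us)) (us ! i) (blk (ars T us) i)"
  using tup[OF s] by (simp_all add: par_def Let_def)
qed

lemma words_Dom: "w : words T n ==> Dom T w = n"
 by (simp add: words_def hom_def)

lemma word_list_iff: "word_list T us \<longleftrightarrow> (ALL i<length us. us ! i : words T (Dom T (us ! i)))"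
 by (metis word_list_def in_set_conv_nth)

lemma par_hom': "word_list T us ==> length us = m ==> sum_list (ars T us) = N ==> par T us : hom T N m"
 using par(1) by blast

lemma word_list_pick: "word_list T us ==> f : index_maps p (length us) ==> word_list T (pick us f)"
 using set_pick[of f us] index_mapsD[of f p "length us"] unfolding word_list_def by blast

text \<open>The \<open>i\<close>-th component on either side is the word \<open>us ! (f ! i)\<close>
  substituted along its own block. This is the equality of words behind the outer substitution axiom
  (4).\<close>

lemma ind_par:
 assumes us: "word_list T us" and f: "f : index_maps p (length us)"
 shows "ind T (length us) f *[T] par T us
  = par T (pick us f) *[T] ind T (sum_list (ars T us)) (bar (ars T us) f)"
proof (rule hom_eqI)
 let ?N = "sum_list (ars T us)" and ?v = "pick us f" and ?fb = "bar (ars T us) f"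
 have lf: "length f = p" "set f <= {..<length us}" using index_mapsD[OF f] by auto
 have v: "word_list T ?v" by (rule word_list_pick[OF us f])
 have av: "ars T ?v = pick (ars T us) f" using lf by (simp add: map_pick)
 have fb: "?fb : index_maps (sum_list (ars T ?v)) ?N"
  using bar_index_maps[of f p "ars T us"] f by (simp add: av)
 note pv = par[OF v]
 show "ind T (length us) f *[T] par T us : hom T ?N p"
  by (rule T_comp[OF par(1)[OF us] ind(1)[OF f]])
 show "par T ?v *[T] ind T ?N ?fb : hom T ?N p"
  using T_comp[OF ind(1)[OF fb] pv(1)] lf by simp
 fix i assume i: "i < p"
 then have fi: "f ! i < length us" using index_maps_nth[OF f] by blast
 have "pr T p i *[T] (ind T (length us) f *[T] par T us) = tsub T ?N (us ! (f ! i)) (blk (ars T us) (f ! i))"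
  using T_assoc[OF par(1)[OF us] ind(1)[OF f] pr_hom[OF i]] ind(2)[OF f i] par(2)[OF us fi] by simp
 also have "\<dots> = tsub T ?N (?v ! i) (pick ?fb (blk (ars T ?v) i))"
 proof -
  have lfb: "length ?fb = sum_list (ars T ?v)" using fb index_mapsD by blast
  have "pick ?fb (blk (ars T ?v) i) = blocks (ars T ?v) ?fb ! i"
   using i lf by (intro pick_blk lfb) simp
  \<comment> \<open>By definition \<open>bar\<close> is the concatenation of the block inclusions
    named by \<open>f\<close>, so its \<open>i\<close>-th block is the inclusion of block
    \<open>f ! i\<close>.\<close>
  also have "blocks (ars T ?v) ?fb = map (blk (ars T us)) f"
   unfolding bar_def
  proof (rule blocks_concat)
   show "map length (map (blk (ars T us)) f) = ars T ?v"
    using lf by (intro nth_equalityI) (auto simp: subset_iff)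
  qed
  finally show ?thesis using i lf by simp
 qed
 also have "\<dots> = pr T p i *[T] (par T ?v *[T] ind T ?N ?fb)"
 proof -
  have i': "i < length ?v" "i < length (ars T ?v)" using i lf by auto
  have bl: "blk (ars T ?v) i : index_maps (Dom T (?v ! i)) (sum_list (ars T ?v))"
   using blk_index_maps[OF i'(2)] i'(1) by simp
  have "pr T p i *[T] (par T ?v *[T] ind T ?N ?fb) = (?v ! i *[T] ind T (sum_list (ars T ?v)) (blk (ars T ?v) i)) *[T] ind T ?N ?fb"
   using T_assoc[OF ind(1)[OF fb] pv(1) pr_hom[of i "length ?v"]] pv(2)[OF i'(1)] i' lf
   by (simp add: tsub_def)
  also have "\<dots> = ?v ! i *[T] ind T ?N (pick ?fb (blk (ars T ?v) i))"
   using T_assoc[OF ind(1)[OF fb] ind(1)[OF bl]] word_list_nth[OF v i'(1)] ind_comp[OF bl fb]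
   by (simp add: words_def)
  finally show ?thesis by (simp add: tsub_def)
 qed
 finally show "pr T p i *[T] (ind T (length us) f *[T] par T us) = pr T p i *[T] (par T ?v *[T] ind T ?N ?fb)" .
qed

lemma tgam_words:
 "w : words T (length us) ==> word_list T us ==> tgam T w us : words T (sum_list (ars T us))"
 unfolding tgam_def by (rule words_comp[OF _ par(1)])

lemma tsub_id: "w : words T p ==> tsub T p w [0..<p] = w"
 using comp_ident_right[OF category_T] by (simp add: tsub_def ind_id words_def)

lemma tsub_tsub:
 "w : words T p ==> f : index_maps p l ==> g : index_maps l r ==>
  tsub T r (tsub T l w f) g = tsub T r w (pick g f)"
 unfolding tsub_def words_def using T_assoc[OF ind(1) ind(1)] ind_comp by metis

lemma tgam_tsub_outer:
 assumes "w : words T p" "f : index_maps p (length us)" "word_list T us"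
 shows "tgam T (tsub T (length us) w f) us
  = tsub T (sum_list (ars T us)) (tgam T w (pick us f)) (bar (ars T us) f)"
proof -
 have fb: "bar (ars T us) f : index_maps (sum_list (ars T (pick us f))) (sum_list (ars T us))"
  using bar_index_maps[of f p "ars T us"] assms(2) index_mapsD[OF assms(2)] by (simp add: map_pick)
 have pv: "par T (pick us f) : hom T (sum_list (ars T (pick us f))) p"
  using par(1)[OF word_list_pick[OF assms(3,2)]] index_mapsD[OF assms(2)] by simp
 show ?thesis
  using T_assoc[OF par(1)[OF assms(3)] ind(1)[OF assms(2)]] T_assoc[OF ind(1)[OF fb] pv] assms(1)
   ind_par[OF assms(3,2)] by (simp add: words_def tsub_def tgam_def)
qed

lemma word_list_concat: "(!!vs. vs : set wss ==> word_list T vs) ==> word_list T (concat wss)"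
 by (auto simp: word_list_def)

lemma concat_map_concat: "concat (map concat xss) = concat (concat xss)"
 by (induction xss) auto

text \<open>Strict associativity of the substitution of words, the equality behind axiom (1). On
  either side the \<open>i\<close>-th component is \<open>ws ! i\<close> composed with the product
  of \<open>wss ! i\<close>, on the indices that belong to \<open>ws ! i\<close>; the work is to see
  that two descriptions of these indices agree.\<close>

lemma par_par:
 assumes ws: "word_list T ws" and wss: "!!vs. vs : set wss ==> word_list T vs"
  and l: "map length wss = ars T ws"
 shows "par T ws *[T] par T (concat wss) = par T (map2 (tgam T) ws wss)"
  and "word_list T (map2 (tgam T) ws wss)"
  and "ars T (map2 (tgam T) ws wss) = map (%vs. sum_list (ars T vs)) wss"
proof -
 let ?us = "map2 (tgam T) ws wss" and ?N = "sum_list (ars T (concat wss))"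
 have ll: "length wss = length ws" using map_eq_imp_length_eq[OF l] by simp
 have li: "length (wss ! i) = Dom T (ws ! i)" if "i < length ws" for i
  using arg_cong[OF l, of "%z. z ! i"] that ll by simp
 have tw: "tgam T (ws ! i) (wss ! i) : words T (sum_list (ars T (wss ! i)))" if "i < length ws" for i
  using tgam_words[of "ws ! i" "wss ! i"] word_list_nth[OF ws that] li[OF that] wss[of "wss ! i"] that ll by simp
 show ar: "ars T ?us = map (%vs. sum_list (ars T vs)) wss"
  using ll words_Dom[OF tw] by (intro nth_equalityI) auto
 show wl: "word_list T ?us"
  using tw words_Dom[OF tw] ll by (auto simp: word_list_iff)
 have cw: "word_list T (concat wss)" by (rule word_list_concat[OF wss])
 have sN: "sum_list (ars T ?us) = ?N"
  unfolding ar by (induction wss) simp_all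
 have lc: "length (concat wss) = sum_list (ars T ws)" by (simp add: length_concat l)
 note pc = par_hom'[OF cw lc refl]
 show "par T ws *[T] par T (concat wss) = par T ?us"
 proof (rule hom_eqI[of _ ?N "length ws"])
  show "par T ws *[T] par T (concat wss) : hom T ?N (length ws)"
   by (rule T_comp[OF pc par(1)[OF ws]])
  show "par T ?us : hom T ?N (length ws)"
   using par(1)[OF wl] sN ll by simp
  fix i assume i: "i < length ws"
  let ?b = "blk (ars T ws) i"
  have b: "?b : index_maps (Dom T (ws ! i)) (length (concat wss))"
   using blk_index_maps[of i "ars T ws"] i lc by simp
  have pb: "pick (concat wss) ?b = wss ! i"
   using pick_blk[of i "ars T ws" "concat wss"] i lc blocks_concat[OF l] by simp
  have bb: "bar (ars T (concat wss)) ?b = blk (ars T ?us) i"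
  proof -
   have 1: "bar (ars T (concat wss)) ?b : index_maps (sum_list (ars T (wss ! i))) ?N"
    using bar_index_maps[of ?b _ "ars T (concat wss)"] b index_mapsD[OF b] pb
    by (simp add: map_pick[symmetric])
   have 2: "blk (ars T ?us) i : index_maps (sum_list (ars T (wss ! i))) ?N"
    using blk_index_maps[of i "ars T ?us"] i ll sN ar words_Dom[OF tw[OF i]] by simp
   \<comment> \<open>Applied to the list of all indices an index function returns itself, so the two
     functions can be compared by cutting that list.\<close>
   have "pick [0..<?N] (bar (ars T (concat wss)) ?b) = concat (pick (blocks (ars T (concat wss)) [0..<?N]) ?b)"
    using index_mapsD[OF b] by (intro pick_bar) auto
   also have "pick (blocks (ars T (concat wss)) [0..<?N]) ?b = blocks (ars T ws) (blocks (ars T (concat wss)) [0..<?N]) ! i"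
    using i lc by (intro pick_blk) auto
   also have "concat \<dots> = blocks (ars T ?us) [0..<?N] ! i"
   proof -
    \<comment> \<open>The list is cut by the inner words and the pieces are grouped by outer word;
      cutting it at once by the outer arities gives the same groups.\<close>
    obtain xs where xs: "[0..<?N] = concat xs" "map length xs = ars T (concat wss)"
     by (rule split_blocks[of "[0..<?N]" "ars T (concat wss)"]) auto
    obtain xss where xss: "xs = concat xss" "map length xss = map length wss"
     by (rule split_blocks[of xs "map length wss"]) (use arg_cong[OF xs(2), of length] in \<open>auto simp: length_concat\<close>)
    have q0: "map length (xss ! i) = ars T (wss ! i)"
     if "i < length wss" for i
    proof -
     have "map (map length) xss = blocks (map length wss) (concat (map (map length) xss))"
      by (rule blocks_concat[symmetric]) (simp add: o_def xss(2))
     also have "concat (map (map length) xss) = concat (map (ars T) wss)"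
      using xs(2) xss(1) by (simp add: map_concat)
     also have "blocks (map length wss) \<dots> = map (ars T) wss"
      by (rule blocks_concat) (simp add: o_def)
     finally have "map (map length) xss ! i = map (ars T) wss ! i" by simp
     moreover have "length xss = length wss" using xss(2) map_eq_imp_length_eq by blast
     ultimately show ?thesis using that by simp
    qed
    have lx: "length xss = length wss" using xss(2) map_eq_imp_length_eq by blast
    have "blocks (ars T ?us) [0..<?N] = map concat xss"
    proof -
     have "map length (map concat xss) = ars T ?us"
      unfolding ar using lx q0 by (intro nth_equalityI) (auto simp: length_concat)
     moreover have "[0..<?N] = concat (map concat xss)" using xs(1) xss(1) by (simp add: concat_map_concat)
     ultimately show ?thesis using blocks_concat by metis
    qed
    moreover have "blocks (ars T (concat wss)) [0..<?N] = concat xss"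
     using xs xss blocks_concat by metis
    moreover have "blocks (ars T ws) (concat xss) = xss"
     using xss(2) l by (intro blocks_concat) simp
    ultimately show ?thesis using i ll lx by simp
   qed
   also have "\<dots> = pick [0..<?N] (blk (ars T ?us) i)"
    using i ll sN by (intro pick_blk[symmetric]) auto
   finally have *: "pick [0..<?N] (bar (ars T (concat wss)) ?b) = pick [0..<?N] (blk (ars T ?us) i)" .
   have "pick [0..<?N] g = g" if "g : index_maps q0 ?N" for g q0
    using index_mapsD[OF that] by (intro nth_equalityI) (auto simp: subset_iff)
   then show ?thesis using * 1 2 by metis
  qed
  have "pr T (length ws) i *[T] (par T ws *[T] par T (concat wss)) = tsub T (sum_list (ars T ws)) (ws ! i) ?b *[T] par T (concat wss)"
   using T_assoc[OF pc par(1)[OF ws] pr_hom[OF i]] par(2)[OF ws i] by simp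
  also have "\<dots> = ws ! i *[T] (ind T (length (concat wss)) ?b *[T] par T (concat wss))"
   using T_assoc[OF par(1)[OF cw] ind(1)[OF b]] word_list_nth[OF ws i] by (simp add: words_def tsub_def lc)
  also have "\<dots> = ws ! i *[T] (par T (wss ! i) *[T] ind T ?N (blk (ars T ?us) i))"
   using ind_par[OF cw b] pb bb by simp
  also have "\<dots> = (ws ! i *[T] par T (wss ! i)) *[T] ind T ?N (blk (ars T ?us) i)"
  proof -
   have "ind T ?N (blk (ars T ?us) i) : hom T ?N (sum_list (ars T (wss ! i)))"
    using ind(1)[OF blk_index_maps[of i "ars T ?us"]] i ll sN ar words_Dom[OF tw[OF i]] by simp
   moreover have "par T (wss ! i) : hom T (sum_list (ars T (wss ! i))) (Dom T (ws ! i))"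
    using i ll li by (intro par_hom' wss) auto
   ultimately show ?thesis using T_assoc word_list_nth[OF ws i] unfolding words_def by metis
  qed
  also have "\<dots> = pr T (length ws) i *[T] par T ?us"
   using par(2)[OF wl, of i] i ll sN by (simp add: tsub_def tgam_def)
  finally show "pr T (length ws) i *[T] (par T ws *[T] par T (concat wss)) = pr T (length ws) i *[T] par T ?us" .
 qed
qed

text \<open>The unit of \<open>T\<close> is the chosen projection from 1 to 1, which may differ from
  the identity. The product of \<open>m\<close> copies is the identity all the same, because its
  components are the projections of \<open>m\<close>.\<close>

lemma par_unit:
 "par T (replicate m (tunit T)) = Ident T m" "word_list T (replicate m (tunit T))"
 "ars T (replicate m (tunit T)) = replicate m 1"
proof -
 have u: "tunit T : words T 1" using pr_hom[of 0 1] by (simp add: tunit_def words_def)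
 show wl: "word_list T (replicate m (tunit T))" and ar: "ars T (replicate m (tunit T)) = replicate m 1"
  using u words_Dom[OF u] by (auto simp: word_list_def)
 have s: "sum_list (replicate m 1) = m" for m :: nat by (simp add: sum_list_replicate)
 show "par T (replicate m (tunit T)) = Ident T m"
 proof (rule hom_eqI)
  show "par T (replicate m (tunit T)) : hom T m m"
   by (rule par_hom'[OF wl]) (simp_all add: ar[unfolded map_replicate] words_Dom[OF u] sum_list_replicate)
  fix i assume i: "i < m"
  have b: "blk (replicate m 1) i = [i]"
   using i by (simp add: blk_nth min_def sum_list_replicate)
  have "pr T m i *[T] par T (replicate m (tunit T)) = tunit T *[T] ind T m [i]"
   using par(2)[OF wl, of i] i b s[of m] unfolding ar by (simp add: tsub_def)
  also have "\<dots> = pr T m i"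
   using ind(2)[of "[i]" 1 m 0] i by (simp add: tunit_def index_maps_def)
  finally show "pr T m i *[T] par T (replicate m (tunit T)) = pr T m i *[T] Ident T m"
   using comp_ident_right[OF category_T pr_hom[OF i]] by simp
 qed (rule T_ident)
qed

text \<open>In each component both sides are \<open>us ! i\<close> substituted along the
  \<open>i\<close>-th function followed by the \<open>i\<close>-th block inclusion: the equality of
  words behind the inner substitution axiom (5).\<close>

lemma par_tsub:
 assumes us: "word_list T us" and l: "length ls = length us" "length fs = length us"
  and f: "!!i. i < length us ==> fs ! i : index_maps (Dom T (us ! i)) (ls ! i)"
 defines "us' == map (%i. tsub T (ls ! i) (us ! i) (fs ! i)) [0..<length us]"
 shows "par T us' = par T us *[T] ind T (sum_list ls) (block_sum ls fs)"
  and "word_list T us'" and "ars T us' = ls"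
  and "block_sum ls fs : index_maps (sum_list (ars T us)) (sum_list ls)"
proof -
 let ?N = "sum_list (ars T us)" and ?g = "block_sum ls fs"
 have w: "us' ! i : words T (ls ! i)" if "i < length us" for i
  using tsub_words[OF word_list_nth[OF us that] f[OF that]] that by (simp add: us'_def)
 have lu: "length us' = length us" by (simp add: us'_def)
 show ar: "ars T us' = ls"
  by (rule nth_equalityI) (use words_Dom[OF w] lu l in auto)
 show wl: "word_list T us'"
  using w words_Dom[OF w] lu by (auto simp: word_list_iff)
 show g: "?g : index_maps ?N (sum_list ls)"
  by (rule block_sum_index_maps) (use l f in auto)
 show "par T us' = par T us *[T] ind T (sum_list ls) ?g"
 proof (rule hom_eqI)
  show "par T us' : hom T (sum_list ls) (length us)"
   using par(1)[OF wl] ar lu by simp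
  show "par T us *[T] ind T (sum_list ls) ?g : hom T (sum_list ls) (length us)"
   by (rule T_comp[OF ind(1)[OF g] par(1)[OF us]])
  fix i assume i: "i < length us"
  have b: "blk (ars T us) i : index_maps (Dom T (us ! i)) ?N"
   using blk_index_maps[of i "ars T us"] i by simp
  have bl: "blk ls i : index_maps (ls ! i) (sum_list ls)"
   using blk_index_maps i l by metis
  have eq: "pick ?g (blk (ars T us) i) = pick (blk ls i) (fs ! i)"
  proof -
   have fs: "set (fs ! i) <= {..<ls ! i}" "length (fs ! i) = Dom T (us ! i)" if "i < length us" for i
    using index_mapsD[OF f[OF that]] by auto
   have "?g = concat (map (%i. pick (blk ls i) (fs ! i)) [0..<length ls])"
    by (rule block_sum_eq) (use l fs in auto)
   moreover have "map length (map (%i. pick (blk ls i) (fs ! i)) [0..<length ls]) = ars T us"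
    by (rule nth_equalityI) (use l fs in auto)
   ultimately have "blocks (ars T us) ?g = map (%i. pick (blk ls i) (fs ! i)) [0..<length ls]"
    using blocks_concat by metis
   moreover have "pick ?g (blk (ars T us) i) = blocks (ars T us) ?g ! i"
    using i index_mapsD[OF g] by (intro pick_blk) auto
   ultimately show ?thesis using i l by simp
  qed
  have u: "us ! i : hom T (Dom T (us ! i)) 1" using word_list_nth[OF us i] by (simp add: words_def)
  have "pr T (length us) i *[T] par T us' = (us ! i *[T] ind T (ls ! i) (fs ! i)) *[T] ind T (sum_list ls) (blk ls i)"
   using par(2)[OF wl, of i] lu i ar by (simp add: tsub_def us'_def)
  also have "\<dots> = us ! i *[T] ind T (sum_list ls) (pick (blk ls i) (fs ! i))"
   using T_assoc[OF ind(1)[OF bl] ind(1)[OF f[OF i]] u] ind_comp[OF f[OF i] bl] by simp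
  also have "\<dots> = (us ! i *[T] ind T ?N (blk (ars T us) i)) *[T] ind T (sum_list ls) ?g"
   using T_assoc[OF ind(1)[OF g] ind(1)[OF b] u] ind_comp[OF b g] eq by simp
  also have "\<dots> = pr T (length us) i *[T] (par T us *[T] ind T (sum_list ls) ?g)"
   using T_assoc[OF ind(1)[OF g] par(1)[OF us] pr_hom[OF i]] par(2)[OF us i] by (simp add: tsub_def)
  finally show "pr T (length us) i *[T] par T us' = pr T (length us) i *[T] (par T us *[T] ind T (sum_list ls) ?g)" .
 qed
qed

end

section \<open>Operations of a 2-theory\<close>

locale theory_2 =
 fixes \<Theta> :: "('t, 'h) thy2" and U :: "'u itself"
 assumes two_theory: "two_theory U \<Theta>"
begin

abbreviation "TH == ThetaHom \<Theta>"
abbreviation "THs == ThetaHoms \<Theta>"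
abbreviation "KW == kwords \<Theta>"
abbreviation "ksb == ksub \<Theta>"
abbreviation "kgm == kgam \<Theta>"
abbreviation "Osb == Osub \<Theta>"
abbreviation "Opl == Opull \<Theta>"
abbreviation "Ofn == Ofun \<Theta>"
abbreviation "Ocp == Ocomp \<Theta>"
abbreviation "Oun == Ounit \<Theta>"

sublocale theory_T "Th \<Theta>"
 using two_theory by unfold_locales (simp add: two_theory_def)

abbreviation "TT == Th \<Theta>"
abbreviation "arsum us == sum_list (map (Dom TT) us)"
abbreviation "ThC m == XO (Tht \<Theta>) m"

lemma kwords_nth: "w : KW m ==> r < kk \<Theta> ==> w ! r : words TT m"
 by (auto simp: kwords_def subset_iff)

lemma kwords_length: "w : KW m ==> length w = kk \<Theta>"
 by (simp add: kwords_def)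

lemma Tht_functor: "functor_to_Cat U (op_cat TT) (Tht \<Theta>)"
 using two_theory by (simp add: two_theory_def)

lemma category_Tht: "category (ThC m)"
 using Tht_functor Ob_T by (simp add: functor_to_Cat_def small_category_def op_cat_def)

lemma Tht_arrow: "u : hom TT l m ==> is_functor (ThC m) (ThC l) (XA (Tht \<Theta>) u)"
 using Tht_functor unfolding functor_to_Cat_def op_cat_def hom_def by auto

lemma Tht_prod: "set ws <= KW m ==> is_product (ThC m) (tobj \<Theta> m ws) (map (Pair 1) ws) (prj \<Theta> m ws)"
 using two_theory by (simp add: two_theory_def)

lemma Tht_FO: "u : hom TT l m ==> (q0, v) : Ob (ThC m) ==> FO (XA (Tht \<Theta>) u) (q0, v) = (q0, kcomp \<Theta> v u)"
 using two_theory unfolding two_theory_def by blast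

lemma tobj_ob: "set ws <= KW m ==> tobj \<Theta> m ws : Ob (ThC m)"
 using Tht_prod by (simp add: is_product_def)

lemma prj_hom: "set ws <= KW m ==> i < length ws ==> prj \<Theta> m ws i : hom (ThC m) (tobj \<Theta> m ws) (1, ws ! i)"
 using Tht_prod[of ws m] by (simp add: is_product_def)

lemma ttup_hom:
 assumes "set ws <= KW m" "P : Ob (ThC m)" "length fs = length ws"
  "!!i. i < length ws ==> fs ! i : hom (ThC m) P (1, ws ! i)"
 shows "ttup \<Theta> m P ws fs : hom (ThC m) P (tobj \<Theta> m ws)"
proof -
 have "EX! f. f : hom (ThC m) P (tobj \<Theta> m ws) & (ALL i<length (map (Pair 1) ws). prj \<Theta> m ws i *[ThC m] f = fs ! i)"
  using is_productD[OF Tht_prod[OF assms(1)] assms(2), of fs] assms(3,4) by simp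
 from theI'[OF this] show ?thesis
  by (simp add: ttup_def tuple_def assms(3))
qed

lemma ThetaHomD:
 "q : TH m w ws ==> w : KW m & set ws <= KW m & q : hom (ThC m) (tobj \<Theta> m ws) (1, w)"
 by (auto simp: ThetaHom_def split: if_splits)

lemma ThetaHomI:
 "w : KW m ==> set ws <= KW m ==> q : hom (ThC m) (tobj \<Theta> m ws) (1, w) ==> q : TH m w ws"
 by (auto simp: ThetaHom_def)

text \<open>A product object remembers its factors: their entries are the composites of its entries
  with the projections of \<open>T\<close>. Hence an operation determines its inputs, and
  \<open>ins\<close> and \<open>out\<close> are well defined.\<close>

lemma tobj_inj:
 assumes ws: "set ws <= KW m" and ws': "set ws' <= KW m" and eq: "tobj \<Theta> m ws = tobj \<Theta> m ws'"
 shows "ws = ws'"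
proof (rule nth_equalityI)
 show l: "length ws = length ws'" using eq by (simp add: tobj_def)
 fix i assume i: "i < length ws"
 show "ws ! i = ws' ! i"
 proof (rule nth_equalityI)
  have k: "ws ! i : KW m" "ws' ! i : KW m" using i l ws ws' by auto
  then show "length (ws ! i) = length (ws' ! i)" by (simp add: kwords_def)
  fix r assume "r < length (ws ! i)"
  then have r: "r < kk \<Theta>" using k by (simp add: kwords_def)
  have w: "set (map (%w. w ! r) ws) <= words TT m" "set (map (%w. w ! r) ws') <= words TT m"
   using kwords_nth r ws ws' by auto
  have "map (%r. tup TT m (map (%w. w ! r) ws)) [0..<kk \<Theta>] = map (%r. tup TT m (map (%w. w ! r) ws')) [0..<kk \<Theta>]"
   using eq by (simp add: tobj_def)
  then have "map (%r. tup TT m (map (%w. w ! r) ws)) [0..<kk \<Theta>] ! r = map (%r. tup TT m (map (%w. w ! r) ws')) [0..<kk \<Theta>] ! r"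
   by (rule arg_cong)
  then have "tup TT m (map (%w. w ! r) ws) = tup TT m (map (%w. w ! r) ws')" using r by simp
  then show "ws ! i ! r = ws' ! i ! r"
   using tup(2)[OF w(1), of i] tup(2)[OF w(2), of i] i l by simp
 qed
qed

lemma ThetaHom_unique:
 assumes "q : TH m w ws" "q : TH m w' ws'"
 shows "w = w' & ws = ws'"
 using ThetaHomD[OF assms(1)] ThetaHomD[OF assms(2)] tobj_inj[of ws m ws'] by (auto simp: hom_def)

lemma out_eq: "q : TH m w ws ==> out \<Theta> m q = w"
 unfolding out_def by (rule the_equality) (auto dest: ThetaHom_unique)

lemma ins_eq: "q : TH m w ws ==> ins \<Theta> m q = ws"
 unfolding ins_def by (rule the_equality) (auto dest: ThetaHom_unique)

lemma Ounit_hom: "w : KW m ==> Oun m w : TH m w [w]"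
 using prj_hom[of "[w]" m 0] by (auto simp: Ounit_def intro: ThetaHomI)

lemma Ofun_hom:
 assumes q: "q : TH m w (pick ws io)" and ws: "set ws <= KW m" and io: "set io <= {..<length ws}"
 shows "Ofn m ws io q : TH m w ws"
proof (rule ThetaHomI)
 note * = ThetaHomD[OF q]
 have "ttup \<Theta> m (tobj \<Theta> m ws) (pick ws io) (map (prj \<Theta> m ws) io) : hom (ThC m) (tobj \<Theta> m ws) (tobj \<Theta> m (pick ws io))"
 proof (rule ttup_hom)
  fix i assume "i < length (pick ws io)"
  then have i: "i < length io" by simp
  then have "io ! i < length ws" using io nth_mem by blast
  then show "map (prj \<Theta> m ws) io ! i : hom (ThC m) (tobj \<Theta> m ws) (1, pick ws io ! i)"
   using prj_hom[OF ws, of "io ! i"] i by simp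
 qed (use * tobj_ob[OF ws] in auto)
 then show "Ofn m ws io q : hom (ThC m) (tobj \<Theta> m ws) (1, w)"
  unfolding Ofun_def using * comp_hom[OF category_Tht] by blast
qed (use ThetaHomD[OF q] ws in auto)

lemma ThetaHoms_kwords: "THs m qs ws wss ==> set (concat wss) <= KW m"
 unfolding ThetaHoms_def by (fastforce simp: in_set_conv_nth dest: ThetaHomD)

lemma Ocomp_hom:
 assumes q: "q : TH m w ws" and qs: "THs m qs ws wss"
 shows "Ocp m q qs : TH m w (concat wss)"
proof (rule ThetaHomI)
 have l: "length qs = length ws" "length wss = length ws"
  and h: "!!i. i < length ws ==> qs ! i : TH m (ws ! i) (wss ! i)"
  using qs by (auto simp: ThetaHoms_def)
 have i: "map (ins \<Theta> m) qs = wss" "map (out \<Theta> m) qs = ws"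
  by (rule nth_equalityI; simp add: l ins_eq[OF h] out_eq[OF h])+
 note K = ThetaHoms_kwords[OF qs]
 let ?W = "concat wss"
 have "ttup \<Theta> m (tobj \<Theta> m ?W) ws (map (%i. Ofn m ?W (blk (map length wss) i) (qs ! i)) [0..<length qs])
   : hom (ThC m) (tobj \<Theta> m ?W) (tobj \<Theta> m ws)"
 proof (rule ttup_hom)
  fix i assume i: "i < length ws"
  let ?b = "blk (map length wss) i"
  have b: "set ?b <= {..<length ?W}"
   using index_mapsD[OF blk_index_maps[of i "map length wss"]] i l by (simp add: length_concat)
  have "pick ?W ?b = wss ! i"
   using pick_blk[of i "map length wss" ?W] i l by (simp add: length_concat blocks_concat)
  then have "Ofn m ?W ?b (qs ! i) : TH m (ws ! i) ?W"
   using Ofun_hom[OF _ K b] h[OF i] by simp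
  then show "map (%i. Ofn m ?W (blk (map length wss) i) (qs ! i)) [0..<length qs] ! i : hom (ThC m) (tobj \<Theta> m ?W) (1, ws ! i)"
   using ThetaHomD i l by simp
 qed (use ThetaHomD[OF q] l tobj_ob[OF K] in auto)
 then show "Ocp m q qs : hom (ThC m) (tobj \<Theta> m ?W) (1, w)"
  unfolding Ocomp_def Let_def i using ThetaHomD[OF q] comp_hom[OF category_Tht] by blast
qed (use ThetaHomD[OF q] ThetaHoms_kwords[OF qs] in auto)

lemma kcomp_kwords: "w : KW m ==> u : hom TT l m ==> kcomp \<Theta> w u : KW l"
 using words_comp by (auto simp: kwords_def kcomp_def subset_iff)

text \<open>Substitution along an index function and along words are both
  \<open>\<Theta>(u)\<close>, with \<open>u\<close> given by \<open>ind\<close> or by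
  \<open>par\<close>, so one typing serves both. The point is that \<open>\<Theta>(u)\<close>
  carries the product object of \<open>ws\<close> to that of the composed words.\<close>

lemma ThetaHom_arrow:
 assumes q: "q : TH m w ws" and u: "u : hom TT l m"
 shows "FA (XA (Tht \<Theta>) u) q : TH l (kcomp \<Theta> w u) (map (%w. kcomp \<Theta> w u) ws)"
proof (rule ThetaHomI)
 note * = ThetaHomD[OF q]
 have "FA (XA (Tht \<Theta>) u) q : hom (ThC l) (FO (XA (Tht \<Theta>) u) (tobj \<Theta> m ws)) (FO (XA (Tht \<Theta>) u) (1, w))"
  using * functor_hom[OF Tht_arrow[OF u]] by blast
 moreover have "FO (XA (Tht \<Theta>) u) (1, w) = (1, kcomp \<Theta> w u)"
  using Tht_FO[OF u] hom_ob[OF category_Tht] * by blast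
 moreover have "FO (XA (Tht \<Theta>) u) (tobj \<Theta> m ws) = tobj \<Theta> l (map (%w. kcomp \<Theta> w u) ws)"
 proof -
  have "map (%w. w ! r) (map (%w. kcomp \<Theta> w u) ws) = map (%v. v *[TT] u) (map (%w. w ! r) ws)"
   if "r < kk \<Theta>" for r
   using * that by (auto simp: kcomp_def kwords_def subset_iff)
  moreover have "set (map (%w. w ! r) ws) <= words TT m" if "r < kk \<Theta>" for r
   using * kwords_nth that by auto
  ultimately have "tup TT m (map (%w. w ! r) ws) *[TT] u = tup TT l (map (%w. w ! r) (map (%w. kcomp \<Theta> w u) ws))"
   if "r < kk \<Theta>" for r
   using tup_comp[OF _ u] that by metis
  then have "kcomp \<Theta> (map (%r. tup TT m (map (%w. w ! r) ws)) [0..<kk \<Theta>]) u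
   = map (%r. tup TT l (map (%w. w ! r) (map (%w. kcomp \<Theta> w u) ws))) [0..<kk \<Theta>]"
   by (simp add: kcomp_def)
  then show ?thesis
   using Tht_FO[OF u, of "length ws" "snd (tobj \<Theta> m ws)"] tobj_ob[of ws m] *
   by (simp add: tobj_def)
 qed
 ultimately show "FA (XA (Tht \<Theta>) u) q : hom (ThC l) (tobj \<Theta> l (map (%w. kcomp \<Theta> w u) ws)) (1, kcomp \<Theta> w u)"
  by simp
qed (use ThetaHomD[OF q] kcomp_kwords u in auto)

lemma Osub_hom:
 assumes "q : TH m w ws" "f : index_maps m l"
 shows "Osb l f q : TH l (ksb l f w) (map (ksb l f) ws)"
proof -
 have "kcomp \<Theta> w (ind TT l f) = ksb l f w" for w
  by (simp add: kcomp_def ksub_def tsub_def)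
 then show ?thesis
  using ThetaHom_arrow[OF assms(1) ind(1)[OF assms(2)]] by (simp add: Osub_def)
qed

lemma Opull_hom:
 assumes "q : TH m w ws" "length us = m" "word_list TT us"
 shows "Opl us q : TH (arsum us) (kgm us w) (map (kgm us) ws)"
proof -
 have "kcomp \<Theta> w (par TT us) = kgm us w" for w
  by (simp add: kcomp_def kgam_def tgam_def)
 then show ?thesis
  using ThetaHom_arrow[OF assms(1) par_hom'[OF assms(3,2) refl]] by (simp add: Opull_def)
qed

lemma ksub_kwords: "w : KW m ==> f : index_maps m l ==> ksb l f w : KW l"
 using tsub_words by (auto simp: kwords_def ksub_def subset_iff)

lemma kgam_kwords: "w : KW m ==> length us = m ==> word_list TT us ==> kgm us w : KW (arsum us)"
 using tgam_words by (auto simp: kwords_def kgam_def subset_iff)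

text \<open>Words index the fibres. Equalities of words such as this one show that the arguments of
  one side of a coherence diagram lie in the fibres that the other side expects.\<close>

lemma ksub_ksub:
 "w : KW p ==> f : index_maps p l ==> g : index_maps l r ==>
  ksb r g (ksb l f w) = ksb r (pick g f) w"
 by (auto simp: kwords_def ksub_def subset_iff tsub_tsub)

lemma ksub_id: "w : KW p ==> ksb p [0..<p] w = w"
 by (auto simp: kwords_def ksub_def subset_iff tsub_id intro!: map_idI)

lemma kgam_kgam:
 assumes "w : KW (length ts)" "word_list TT ts" "!!vs. vs : set sss ==> word_list TT vs"
  "map length sss = ars TT ts"
 shows "kgm (concat sss) (kgm ts w) = kgm (map2 (tgam TT) ts sss) w"
proof -
 have "par TT (concat sss) : hom TT (sum_list (ars TT (concat sss))) (sum_list (ars TT ts))"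
  using assms by (intro par_hom' word_list_concat) (auto simp: length_concat)
 then show ?thesis
  using T_assoc[OF _ par(1)[OF assms(2)]] assms(1) par_par(1)[OF assms(2-4)]
  by (auto simp: kwords_def kgam_def tgam_def words_def subset_iff)
qed

lemma kgam_unit: "w : KW m ==> kgm (replicate m (tunit TT)) w = w"
 by (auto simp: kwords_def kgam_def tgam_def par_unit words_def subset_iff
   comp_ident_right[OF category_T] intro!: map_idI)

lemma kgam_ksub:
 assumes "w : KW p" "f : index_maps p (length us)" "word_list TT us"
 shows "kgm us (ksb (length us) f w)
  = ksb (arsum us) (bar (ars TT us) f) (kgm (pick us f) w)"
 using assms tgam_tsub_outer[OF _ assms(2,3)] by (auto simp: kwords_def kgam_def ksub_def subset_iff)

lemma kgam_tsub:
 assumes "w : KW (length us)" "word_list TT us" "length ls = length us" "length fs = length us"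
  "!!i. i < length us ==> fs ! i : index_maps (Dom TT (us ! i)) (ls ! i)"
 shows "kgm (map (%i. tsub TT (ls ! i) (us ! i) (fs ! i)) [0..<length us]) w
  = ksb (sum_list ls) (block_sum ls fs) (kgm us w)"
 using T_assoc[OF ind(1)[OF par_tsub(4)[OF assms(2-5)]] par(1)[OF assms(2)]] assms(1) par_tsub(1)[OF assms(2-5)]
 by (auto simp: kwords_def kgam_def ksub_def tgam_def tsub_def words_def subset_iff)

end

section \<open>Pseudo algebras over a theory, in k-tuples\<close>

locale T_algebra = theory_2 \<Theta> U for \<Theta> :: "('t, 'h) thy2" and U :: "'u itself" +
 fixes I :: "('t, 'io, 'ia) palg"
 assumes T_alg: "pseudo_T_algebra (Th \<Theta>) I"
begin

abbreviation "cmor == comp_mor \<Theta> I"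
abbreviation "idm == id_mor \<Theta> I"
abbreviation "amor == alg_mor \<Theta> I"
abbreviation "palgebra == pseudo_algebra U \<Theta> I"

abbreviation "II == car I"
abbreviation "P m == pow_cat II m"
abbreviation "Q == P (kk \<Theta>)"

lemmas T_axioms = T_alg[unfolded pseudo_T_algebra_def Let_def]
lemmas T_cc = T_axioms[THEN c2, THEN c2, THEN c1, rule_format]
lemmas T_uu = T_axioms[THEN c2, THEN c2, THEN c2, THEN c1, rule_format]
lemmas T_ss = T_axioms[THEN c2, THEN c2, THEN c2, THEN c2, THEN c1, rule_format]
lemmas T_associativity = T_axioms[THEN c2, THEN c2, THEN c2, THEN c2, THEN c2, THEN c1, rule_format]
lemmas T_units = T_axioms[THEN c2, THEN c2, THEN c2, THEN c2, THEN c2, THEN c2, THEN c1, rule_format]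
lemmas T_outer = T_axioms[THEN c2, THEN c2, THEN c2, THEN c2, THEN c2, THEN c2, THEN c2, THEN c1, rule_format]
lemmas T_inner = T_axioms[THEN c2, THEN c2, THEN c2, THEN c2, THEN c2, THEN c2, THEN c2, THEN c2, THEN c1, rule_format]
lemmas T_composite = T_axioms[THEN c2, THEN c2, THEN c2, THEN c2, THEN c2, THEN c2, THEN c2, THEN c2, THEN c2, THEN c1, rule_format]
lemmas T_identity = T_axioms[THEN c2, THEN c2, THEN c2, THEN c2, THEN c2, THEN c2, THEN c2, THEN c2, THEN c2, THEN c2,  rule_format]

lemma category_I: "category II" and category_P: "category (P m)"
 using T_alg by (simp_all add: pseudo_T_algebra_def category_pow)

lemma Phi_functor: "w : words TT n ==> is_functor (P n) II (Phi I w)"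
 using T_alg by (simp add: pseudo_T_algebra_def)

definition PhiSA :: "'t list => 'ia list => 'ia list" where
 "PhiSA us h = map2 (%w. FA (Phi I w)) us (blocks (ars TT us) h)"

lemma gamF_Phi:
 "FO (gamF (ars TT us) (Phi I w) (map (Phi I) us)) x = FO (Phi I w) (PhiS TT I us x)"
 "FA (gamF (ars TT us) (Phi I w) (map (Phi I) us)) h = FA (Phi I w) (PhiSA us h)"
 by (simp_all add: gamF_def PhiS_def PhiSA_def zip_map1 o_def case_prod_unfold)

lemma nat_isoD:
 "nat_iso C D F G \<eta> ==> x : Ob C ==> \<eta> x : hom D (FO F x) (FO G x)"
 "nat_iso C D F G \<eta> ==> h : hom C x y ==> \<eta> y *[D] FA F h = FA G h *[D] \<eta> x"
 by (auto simp: nat_iso_def nat_trans_def hom_def)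

lemma cc_nat_iso:
 "w : words TT (length us) ==> word_list TT us ==>
  nat_iso (P (arsum us)) II (Phi I (tgam TT w us)) (gamF (ars TT us) (Phi I w) (map (Phi I) us)) (cc I w us)"
 by (rule T_cc) simp_all

lemma ss_nat_iso:
 "w : words TT p ==> f : index_maps p l ==>
  nat_iso (P l) II (Phi I (tsub TT l w f)) (subF f (Phi I w)) (ss I l w f)"
 by (rule T_ss)

lemma uu_nat_iso: "nat_iso (P 1) II (Phi I (tunit TT)) oneF (uu I)"
 by (rule T_uu)

text \<open>The functor induced by the tuple \<open>\<Phi>(w)\<close>, on objects. The value of
  \<open>X\<close> there is the fibre in which operations with output \<open>w\<close> take their
  values at \<open>x\<close>.\<close>

definition fib :: "'t list => 'io list => 'io list" where
 "fib w x = map (%v. FO (Phi I v) x) w"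

definition fibA :: "'t list => 'ia list => 'ia list" where
 "fibA w h = map (%v. FA (Phi I v) h) w"

text \<open>The tuples \<open>sQ\<close> and \<open>cQ\<close> are arrows of \<open>I^k\<close>, and
  \<open>X(s)\<close> and \<open>X(c)\<close> are \<open>X\<close> applied to them. Both therefore
  count as transports along arrows of \<open>I^k\<close>.\<close>

definition sQ :: "nat => nat list => 't list => 'io list => 'ia list" where
 "sQ l f w x = map (%v. ss I l v f x) w"

definition cQ :: "'t list => 't list => 'io list => 'ia list" where
 "cQ us w x = map (%v. cc I v us x) w"

lemma length_fib [simp]: "length (fib w x) = length w"
 by (simp add: fib_def)

lemma fib_ob: "w : KW m ==> x : Ob (P m) ==> fib w x : Ob Q"
 using functor_ob[OF Phi_functor] by (auto simp: fib_def pow_cat_Ob kwords_def subset_iff)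

lemma fibA_hom: "w : KW m ==> h : hom (P m) x y ==> fibA w h : hom Q (fib w x) (fib w y)"
 using functor_hom[OF Phi_functor[OF kwords_nth[of w m]]] kwords_length[of w m]
 by (subst pow_cat_hom) (simp add: fib_def fibA_def)

lemma pick_ob: "x : Ob (P l) ==> f : index_maps p l ==> pick x f : Ob (P p)"
 using set_pick[of f x] by (auto simp: pow_cat_Ob index_maps_def)

lemma pick_homP: "h : hom (P l) x y ==> f : index_maps p l ==> pick h f : hom (P p) (pick x f) (pick y f)"
 using index_maps_nth[of f p l] by (auto simp: pow_cat_hom index_maps_def)

lemma blocks_ob:
 assumes "x : Ob (P (sum_list ns))" "i < length ns"
 shows "blocks ns x ! i : Ob (P (ns ! i))"
proof -
 have "length x = sum_list ns" using assms(1) by (simp add: pow_cat_Ob)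
 then show ?thesis
  using pick_ob[OF assms(1) blk_index_maps[OF assms(2)]] by (simp only: pick_blk[OF assms(2)])
qed

lemma blocks_hom:
 assumes "h : hom (P (sum_list ns)) x y" "i < length ns"
 shows "blocks ns h ! i : hom (P (ns ! i)) (blocks ns x ! i) (blocks ns y ! i)"
proof -
 have "length h = sum_list ns" "length x = sum_list ns" "length y = sum_list ns"
  using assms(1) by (simp_all add: pow_cat_hom)
 then show ?thesis
  using pick_homP[OF assms(1) blk_index_maps[OF assms(2)]] by (simp only: pick_blk[OF assms(2)])
qed

lemma PhiS_nth: "i < length us ==> PhiS TT I us x ! i = FO (Phi I (us ! i)) (blocks (ars TT us) x ! i)"
 by (simp add: PhiS_def)

lemma length_PhiS [simp]: "length (PhiS TT I us x) = length us"
 by (simp add: PhiS_def)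

lemma PhiS_ob:
 assumes "word_list TT us" "x : Ob (P (arsum us))"
 shows "PhiS TT I us x : Ob (P (length us))"
proof -
 have "PhiS TT I us x ! i : Ob II" if "i < length us" for i
  using functor_ob[OF Phi_functor[OF word_list_nth[OF assms(1) that]]] blocks_ob[OF assms(2), of i] that
  by (simp add: PhiS_nth)
 then show ?thesis by (auto simp: pow_cat_Ob in_set_conv_nth)
qed

lemma PhiSA_hom:
 assumes "word_list TT us" "h : hom (P (arsum us)) x y"
 shows "PhiSA us h : hom (P (length us)) (PhiS TT I us x) (PhiS TT I us y)"
 unfolding pow_cat_hom
 using functor_hom[OF Phi_functor[OF word_list_nth[OF assms(1)]]] blocks_hom[OF assms(2)]
 by (simp add: PhiS_nth PhiSA_def)

lemma sQ_hom:
 assumes w: "w : KW p" and f: "f : index_maps p l" and x: "x : Ob (P l)"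
 shows "sQ l f w x : hom Q (fib (ksb l f w) x) (fib w (pick x f))"
 using nat_isoD(1)[OF ss_nat_iso[OF kwords_nth[OF w] f] x] kwords_length[OF w]
 by (subst pow_cat_hom) (simp add: ksub_def sQ_def fib_def subF_def)

lemma sQ_nat:
 assumes w: "w : KW p" and f: "f : index_maps p l" and h: "h : hom (P l) x y"
 shows "sQ l f w y *[Q] fibA (ksb l f w) h = fibA w (pick h f) *[Q] sQ l f w x"
 using nat_isoD(2)[OF ss_nat_iso[OF kwords_nth[OF w] f] h] kwords_length[OF w]
 by (auto simp: pow_cat_comp fibA_def ksub_def sQ_def subF_def)

lemma cQ_hom:
 assumes w: "w : KW (length us)" and us: "word_list TT us" and x: "x : Ob (P (arsum us))"
 shows "cQ us w x : hom Q (fib (kgm us w) x) (fib w (PhiS TT I us x))"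
 using nat_isoD(1)[OF cc_nat_iso[OF kwords_nth[OF w] us] x] kwords_length[OF w]
 by (subst pow_cat_hom) (simp add: kgam_def cQ_def fib_def gamF_Phi)

lemma cQ_nat:
 assumes w: "w : KW (length us)" and us: "word_list TT us"
  and h: "h : hom (P (arsum us)) x y"
 shows "cQ us w y *[Q] fibA (kgm us w) h = fibA w (PhiSA us h) *[Q] cQ us w x"
 using nat_isoD(2)[OF cc_nat_iso[OF kwords_nth[OF w] us] h] kwords_length[OF w]
 by (auto simp: pow_cat_comp fibA_def kgam_def cQ_def gamF_Phi)

text \<open>From here to \<open>cQ_inner\<close>, axioms (6), (7), (1), (2), (4), (5) of
  \<open>I\<close> become equations between arrows of \<open>I^k\<close>, one entry at a
  time.\<close>

lemma sQ_sQ: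
 assumes w: "w : KW p" and "f : index_maps p l" "g : index_maps l r" "x : Ob (P r)"
 shows "sQ l f w (pick x g) *[Q] sQ r g (ksb l f w) x = sQ r (pick g f) w x"
proof -
 have "ss I l v f (pick x g) *[II] ss I r (tsub TT l v f) g x = ss I r v (pick g f) x" if "v : words TT p" for v
  by (rule T_composite) (use assms(2-) that in auto)
 then show ?thesis
  using kwords_nth[OF w] kwords_length[OF w]
  by (intro nth_equalityI) (simp_all add: pow_cat_comp sQ_def ksub_def)
qed

lemma sQ_id:
 assumes w: "w : KW p" and x: "x : Ob (P p)"
 shows "sQ p [0..<p] w x = Ident Q (fib w x)"
proof -
 have "ss I p v [0..<p] x = Ident II (FO (Phi I v) x)" if "v : words TT p" for v
  by (rule T_identity) (use x that in auto)
 then show ?thesis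
  using kwords_nth[OF w] kwords_length[OF w]
  by (intro nth_equalityI) (simp_all add: pow_cat_ident sQ_def fib_def)
qed

lemma cQ_cQ:
 assumes w: "w : KW (length ts)" and ts: "word_list TT ts" and sss: "map length sss = ars TT ts"
  "ALL us:set sss. word_list TT us" and x: "x : Ob (P (sum_list (ars TT (concat sss))))"
 shows "cQ ts w (PhiS TT I (concat sss) x) *[Q] cQ (concat sss) (kgm ts w) x
  = fibA w (map (%i. cc I (ts ! i) (sss ! i) (blocks (map (%vs. sum_list (ars TT vs)) sss) x ! i)) [0..<length ts])
   *[Q] cQ (map2 (tgam TT) ts sss) w x"
proof -
 have "cc I v ts (PhiS TT I (concat sss) x) *[II] cc I (tgam TT v ts) (concat sss) x
  = FA (Phi I v) (map (%i. cc I (ts ! i) (sss ! i) (blocks (map (%vs. sum_list (ars TT vs)) sss) x ! i)) [0..<length ts])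
   *[II] cc I v (map2 (tgam TT) ts sss) x" if "v : words TT (length ts)" for v
  by (rule T_associativity) (use ts sss x that in auto)
 then show ?thesis
  using kwords_nth[OF w] kwords_length[OF w]
  by (intro nth_equalityI) (simp_all add: pow_cat_comp cQ_def kgam_def fibA_def)
qed

lemma cQ_unit:
 assumes w: "w : KW p" and x: "x : Ob (P p)"
 shows "fibA w (map (%y. uu I [y]) x) *[Q] cQ (replicate p (tunit TT)) w x = Ident Q (fib w x)"
proof -
 have "FA (Phi I v) (map (%y. uu I [y]) x) *[II] cc I v (replicate p (tunit TT)) x = Ident II (FO (Phi I v) x)"
  if "v : words TT p" for v
  by (rule conjunct1[OF T_units]) (use x that in auto)
 then show ?thesis
  using kwords_nth[OF w] kwords_length[OF w]
  by (intro nth_equalityI) (simp_all add: pow_cat_comp pow_cat_ident cQ_def fibA_def fib_def)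
qed

lemma cQ_outer:
 assumes w: "w : KW p" and f: "f : index_maps p (length us)" and us: "word_list TT us"
  and x: "x : Ob (P (arsum us))"
 shows "cQ (pick us f) w (pick x (bar (ars TT us) f)) *[Q] sQ (arsum us) (bar (ars TT us) f) (kgm (pick us f) w) x
  = sQ (length us) f w (PhiS TT I us x) *[Q] cQ us (ksb (length us) f w) x"
proof -
 have "cc I v (pick us f) (pick x (bar (ars TT us) f)) *[II] ss I (arsum us) (tgam TT v (pick us f)) (bar (ars TT us) f) x
  = ss I (length us) v f (PhiS TT I us x) *[II] cc I (tsub TT (length us) v f) us x" if "v : words TT p" for v
  by (rule T_outer) (use f us x that in auto)
 then show ?thesis
  using kwords_nth[OF w] kwords_length[OF w]
  by (intro nth_equalityI) (simp_all add: pow_cat_comp cQ_def sQ_def kgam_def ksub_def)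
qed

lemma cQ_inner:
 assumes w: "w : KW (length us)" and us: "word_list TT us" and l: "length ls = length us" "length gs = length us"
  "ALL i<length us. gs ! i : index_maps (Dom TT (us ! i)) (ls ! i)" and x: "x : Ob (P (sum_list ls))"
 shows "cQ us w (pick x (block_sum ls gs)) *[Q] sQ (sum_list ls) (block_sum ls gs) (kgm us w) x
  = fibA w (map (%i. ss I (ls ! i) (us ! i) (gs ! i) (blocks ls x ! i)) [0..<length us])
   *[Q] cQ (map (%i. tsub TT (ls ! i) (us ! i) (gs ! i)) [0..<length us]) w x"
proof -
 have "cc I v us (pick x (block_sum ls gs)) *[II] ss I (sum_list ls) (tgam TT v us) (block_sum ls gs) x
  = FA (Phi I v) (map (%i. ss I (ls ! i) (us ! i) (gs ! i) (blocks ls x ! i)) [0..<length us])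
   *[II] cc I v (map (%i. tsub TT (ls ! i) (us ! i) (gs ! i)) [0..<length us]) x" if "v : words TT (length us)" for v
  by (rule T_inner) (use us l x that in auto)
 then show ?thesis
  using kwords_nth[OF w] kwords_length[OF w]
  by (intro nth_equalityI) (simp_all add: pow_cat_comp cQ_def sQ_def kgam_def fibA_def)
qed

text \<open>The tuple is the arrow \<open>\<kappa>\<close> of \<open>coh_pull_pull\<close>. What has
  to be checked is that cutting \<open>x\<close> by the outer words and cutting it by all inner
  words lead to the same arguments.\<close>

lemma cc_tuple_hom:
 assumes ts: "word_list TT ts" and sss: "map length sss = ars TT ts" "ALL us:set sss. word_list TT us"
  and x: "x : Ob (P (sum_list (ars TT (concat sss))))"
 shows "map (%i. cc I (ts ! i) (sss ! i) (blocks (map (%vs. sum_list (ars TT vs)) sss) x ! i)) [0..<length ts]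
  : hom (P (length ts)) (PhiS TT I (map2 (tgam TT) ts sss) x) (PhiS TT I ts (PhiS TT I (concat sss) x))"
 unfolding pow_cat_hom
proof (intro conjI allI impI)
 let ?ns = "map (%vs. sum_list (ars TT vs)) sss"
 have ll: "length sss = length ts" using map_eq_imp_length_eq[OF sss(1)] by simp
 then show "length (PhiS TT I (map2 (tgam TT) ts sss) x) = length ts" by simp
 have sN: "sum_list ?ns = sum_list (ars TT (concat sss))" by (induction sss) simp_all
 have aS: "ars TT (map2 (tgam TT) ts sss) = ?ns" using par_par(3)[OF ts _ sss(1)] sss(2) by blast
 fix i assume i: "i < length ts"
 have li: "length (sss ! i) = Dom TT (ts ! i)"
  using arg_cong[OF sss(1), of "%z. z ! i"] i ll by simp
 have wi: "ts ! i : words TT (length (sss ! i))" using word_list_nth[OF ts i] li by simp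
 have "cc I (ts ! i) (sss ! i) (blocks ?ns x ! i) : hom II (FO (Phi I (tgam TT (ts ! i) (sss ! i))) (blocks ?ns x ! i))
   (FO (Phi I (ts ! i)) (PhiS TT I (sss ! i) (blocks ?ns x ! i)))"
  using nat_isoD(1)[OF cc_nat_iso[OF wi], of "blocks ?ns x ! i"] blocks_ob[of x ?ns i] x sN sss(2) i ll
  by (simp add: gamF_Phi)
 moreover have "PhiS TT I (map2 (tgam TT) ts sss) x ! i = FO (Phi I (tgam TT (ts ! i) (sss ! i))) (blocks ?ns x ! i)"
  using i ll by (subst PhiS_nth) (simp_all add: aS del: map_map)
 moreover have "blocks (ars TT ts) (PhiS TT I (concat sss) x) ! i = PhiS TT I (sss ! i) (blocks ?ns x ! i)"
 proof -
  obtain xss where xss: "x = concat xss" "map length xss = ?ns"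
   using split_blocks[of x ?ns] x sN by (auto simp: pow_cat_Ob)
  have lx: "length xss = length sss" using map_eq_imp_length_eq[OF xss(2)] .
  \<comment> \<open>Each block of \<open>x\<close> for an outer word is cut once more, by the
    arities of its inner words.\<close>
  have "EX yss. xss = map concat yss & map (map length) yss = map (ars TT) sss"
   using xss(2)
  proof (induction sss arbitrary: xss)
   case (Cons vs sss)
   then obtain xs xss' where 1: "xss = xs # xss'" "length xs = sum_list (ars TT vs)" "map length xss' = map (%vs. sum_list (ars TT vs)) sss"
    by (cases xss) auto
   obtain ys where ys: "xs = concat ys" "map length ys = ars TT vs" using split_blocks[OF 1(2)] by blast
   obtain yss where "xss' = map concat yss" "map (map length) yss = map (ars TT) sss" using Cons.IH[OF 1(3)] by blast
   with 1 ys show ?case by (intro exI[of _ "ys # yss"]) simp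
  qed auto
  then obtain yss where yss: "xss = map concat yss" "map (map length) yss = map (ars TT) sss" by blast
  have ly: "length yss = length sss" using lx yss by simp
  have lyi: "map length (yss ! j) = ars TT (sss ! j)" if "j < length sss" for j
   using arg_cong[OF yss(2), of "%z. z ! j"] that ly by simp
  have "map length (concat yss) = ars TT (concat sss)"
   using arg_cong[OF yss(2), of concat] by (simp add: map_concat)
  then have "PhiS TT I (concat sss) x = map2 (%w. FO (Phi I w)) (concat sss) (concat yss)"
   by (simp add: PhiS_def xss(1) yss(1) concat_map_concat blocks_concat)
  also have "\<dots> = concat (map2 (map2 (%w. FO (Phi I w))) sss yss)"
   using yss(2) ly
  proof (induction sss yss rule: list_induct2')
   case (4 vs sss ys yss)
   then show ?case by (auto simp: zip_append dest: map_eq_imp_length_eq)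
  qed auto
  finally have "blocks (ars TT ts) (PhiS TT I (concat sss) x) = map2 (map2 (%w. FO (Phi I w))) sss yss"
   using ly map_eq_imp_length_eq[OF lyi]
   by (simp only: sss(1)[symmetric]) (rule blocks_concat, rule nth_equalityI, simp_all)
  moreover have "PhiS TT I (sss ! i) (blocks ?ns x ! i) = map2 (%w. FO (Phi I w)) (sss ! i) (yss ! i)"
   using i ll lx ly lyi blocks_concat[OF xss(2)] by (simp add: PhiS_def xss(1) yss(1) blocks_concat)
  ultimately show ?thesis using i ll ly by simp
 qed
 ultimately show "map (%i. cc I (ts ! i) (sss ! i) (blocks ?ns x ! i)) [0..<length ts] ! i
   : hom II (PhiS TT I (map2 (tgam TT) ts sss) x ! i) (PhiS TT I ts (PhiS TT I (concat sss) x) ! i)"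
  using i by (simp add: PhiS_nth)
qed auto

lemma ss_tuple_hom:
 assumes us: "word_list TT us" and l: "length ls = length us" "length fs = length us"
  "ALL i<length us. fs ! i : index_maps (Dom TT (us ! i)) (ls ! i)" and x: "x : Ob (P (sum_list ls))"
 shows "map (%i. ss I (ls ! i) (us ! i) (fs ! i) (blocks ls x ! i)) [0..<length us]
  : hom (P (length us)) (PhiS TT I (map (%i. tsub TT (ls ! i) (us ! i) (fs ! i)) [0..<length us]) x)
    (PhiS TT I us (pick x (block_sum ls fs)))"
 unfolding pow_cat_hom
proof (intro conjI allI impI)
 let ?us = "map (%i. tsub TT (ls ! i) (us ! i) (fs ! i)) [0..<length us]"
 have ar: "ars TT ?us = ls" by (rule par_tsub(3)[OF us]) (use l in auto)
 have fi: "length (fs ! i) = Dom TT (us ! i)" "set (fs ! i) <= {..<ls ! i}" if "i < length us" for i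
  using index_mapsD l(3) that by blast+
 fix i assume i: "i < length us"
 have "ss I (ls ! i) (us ! i) (fs ! i) (blocks ls x ! i) : hom II (FO (Phi I (tsub TT (ls ! i) (us ! i) (fs ! i))) (blocks ls x ! i))
   (FO (Phi I (us ! i)) (pick (blocks ls x ! i) (fs ! i)))"
  using nat_isoD(1)[OF ss_nat_iso[OF word_list_nth[OF us i]]] l i blocks_ob[OF x, of i] by (auto simp: subF_def)
 moreover have "PhiS TT I ?us x ! i = FO (Phi I (tsub TT (ls ! i) (us ! i) (fs ! i))) (blocks ls x ! i)"
  using i by (subst PhiS_nth) (simp_all add: ar del: map_map)
 moreover have "blocks (ars TT us) (pick x (block_sum ls fs)) ! i = pick (blocks ls x ! i) (fs ! i)"
 proof -
  have "pick x (block_sum ls fs) = concat (map2 pick (blocks ls x) fs)"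
   by (rule pick_block_sum) (use l fi x in \<open>auto simp: pow_cat_Ob\<close>)
  moreover have "map length (map2 pick (blocks ls x) fs) = ars TT us"
   by (rule nth_equalityI) (use l fi in auto)
  ultimately have "blocks (ars TT us) (pick x (block_sum ls fs)) = map2 pick (blocks ls x) fs"
   using blocks_concat by metis
  then show ?thesis using i l by simp
 qed
 ultimately show "map (%i. ss I (ls ! i) (us ! i) (fs ! i) (blocks ls x ! i)) [0..<length us] ! i
   : hom II (PhiS TT I ?us x ! i) (PhiS TT I us (pick x (block_sum ls fs)) ! i)"
  using i by (simp add: PhiS_nth)
qed auto

lemma uu_tuple_hom:
 assumes x: "x : Ob (P m)"
 shows "map (%y. uu I [y]) x : hom (P m) (PhiS TT I (replicate m (tunit TT)) x) x"
proof -
 have lx: "length x = m" using x by (simp add: pow_cat_Ob)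
 have b: "blocks (replicate m 1) x ! i = [x ! i]" if "i < m" for i
  using that lx by (simp add: blocks_nth min_def sum_list_replicate take_Suc_conv_app_nth hd_drop_conv_nth take_Suc)
 have "uu I [x ! i] : hom II (FO (Phi I (tunit TT)) [x ! i]) (x ! i)" if "i < m" for i
 proof -
  have "x ! i : Ob II" using x that lx by (auto simp: pow_cat_Ob subset_iff)
  then show ?thesis using nat_isoD(1)[OF uu_nat_iso, of "[x ! i]"] by (simp add: oneF_def pow_cat_Ob)
 qed
 then show ?thesis
  unfolding pow_cat_hom using lx b par_unit(3)[of m] by (simp add: PhiS_nth)
qed

text \<open>In the diagram for T-substitution into \<open>\<alpha>_f\<close> the two sides end in
  fibres given by different formulas; this makes the fibres equal.\<close>

lemma pick_PhiS:
 assumes us: "word_list TT us" and f: "f : index_maps p (length us)" and x: "x : Ob (P (arsum us))"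
 shows "PhiS TT I (pick us f) (pick x (bar (ars TT us) f)) = pick (PhiS TT I us x) f"
proof -
 note ff = index_mapsD[OF f]
 have lb: "length (blocks (ars TT us) x) = length us" by simp
 have ml: "map length (blocks (ars TT us) x) = ars TT us"
  by (rule length_in_blocks) (use x in \<open>simp add: pow_cat_Ob\<close>)
 have "pick x (bar (ars TT us) f) = concat (pick (blocks (ars TT us) x) f)"
  by (rule pick_bar) (use ff x in \<open>auto simp: pow_cat_Ob\<close>)
 moreover have "map length (pick (blocks (ars TT us) x) f) = ars TT (pick us f)"
  using map_pick[of f "blocks (ars TT us) x" length] map_pick[of f us "Dom TT"] ff ml by simp
 ultimately have "blocks (ars TT (pick us f)) (pick x (bar (ars TT us) f)) = pick (blocks (ars TT us) x) f"
  using blocks_concat by metis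
 then show ?thesis
  using ff by (intro nth_equalityI) (auto simp: PhiS_nth subset_iff)
qed

end

section \<open>Terms built from the operations of an algebra\<close>

lemma functor_compose: "is_functor C D F ==> is_functor D E G ==> is_functor C E (comp_func G F)"
 by (auto simp: is_functor_def comp_func_def hom_def)

definition tupF :: "('o, 'a, 'p, 'b) func list => ('o, 'a, 'p list, 'b list) func" where
 "tupF Fs = \<lparr>FO = (%x. map (%F. FO F x) Fs), FA = (%f. map (%F. FA F f) Fs)\<rparr>"

definition projF :: "nat => ('x list, 'y list, 'x, 'y) func" where
 "projF n = \<lparr>FO = (%xs. xs ! n), FA = (%fs. fs ! n)\<rparr>"

lemma functor_tuple:
 assumes "list_all2 (%F D. is_functor C D F) Fs Ds"
 shows "is_functor C (prod_cat Ds) (tupF Fs)"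
proof -
 have l: "length Fs = length Ds" and F: "!!n. n < length Ds ==> is_functor C (Ds ! n) (Fs ! n)"
  using assms by (auto simp: list_all2_conv_all_nth)
 show ?thesis
  unfolding is_functor_def
 proof (intro conjI ballI impI)
  fix x assume "x : Ob C"
  then show "FO (tupF Fs) x : Ob (prod_cat Ds)"
   using l functor_ob[OF F] by (auto simp: tupF_def list_all2_conv_all_nth)
 next
  fix f assume "f : Ar C"
  then show "FA (tupF Fs) f : hom (prod_cat Ds) (FO (tupF Fs) (Dom C f)) (FO (tupF Fs) (Cod C f))"
   unfolding hom_prod using l functor_hom[OF F homI] by (auto simp: tupF_def)
 next
  fix x assume "x : Ob C"
  then show "FA (tupF Fs) (Ident C x) = Ident (prod_cat Ds) (FO (tupF Fs) x)"
   using l functor_ident[OF F] by (auto simp: tupF_def intro!: nth_equalityI)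
 next
  fix f g assume fg: "f : Ar C" "g : Ar C" "Cod C f = Dom C g"
  have "FA (Fs ! n) (g *[C] f) = FA (Fs ! n) g *[Ds ! n] FA (Fs ! n) f" if "n < length Ds" for n
   using F[OF that] fg by (simp add: is_functor_def)
  then show "FA (tupF Fs) (g *[C] f) = FA (tupF Fs) g *[prod_cat Ds] FA (tupF Fs) f"
   using l by (auto simp: tupF_def intro!: nth_equalityI)
 qed
qed

lemma functor_proj: "n < length Cs ==> is_functor (prod_cat Cs) (Cs ! n) (projF n)"
 unfolding is_functor_def
proof (intro conjI ballI impI)
 fix f assume n: "n < length Cs" and "f : Ar (prod_cat Cs)"
 with homI[of f "prod_cat Cs"] show "FA (projF n) f : hom (Cs ! n) (FO (projF n) (Dom (prod_cat Cs) f)) (FO (projF n) (Cod (prod_cat Cs) f))"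
  by (simp add: projF_def hom_prod)
qed (auto simp: projF_def list_all2_conv_all_nth)

lemma nat_isoI:
 assumes "!!x. x : Ob C ==> isoh D (\<eta> x) (FO F x) (FO G x)"
  and "!!f x y. f : hom C x y ==> \<eta> y *[D] FA F f = FA G f *[D] \<eta> x"
 shows "nat_iso C D F G \<eta>"
 using assms(1)[unfolded isoh_def] assms(2)[OF homI] by (simp add: nat_iso_def nat_trans_def)

lemma nat_iso_isoh: "nat_iso C D F G \<eta> ==> x : Ob C ==> isoh D (\<eta> x) (FO F x) (FO G x)"
 by (simp add: nat_iso_def nat_trans_def isoh_def)

lemma nat_iso_nat: "nat_iso C D F G \<eta> ==> f : hom C x y ==> \<eta> y *[D] FA F f = FA G f *[D] \<eta> x"
 by (auto simp: nat_iso_def nat_trans_def hom_def)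

lemma nat_iso_cong:
 "func_eq C F F' ==> func_eq C G G' ==> nat_iso C D F G \<eta> \<longleftrightarrow> nat_iso C D F' G' \<eta>"
 by (auto simp: func_eq_def nat_iso_def nat_trans_def)

lemma inv_modif_iff:
 "inv_modif C X Y \<theta> \<theta>' Z \<longleftrightarrow>
  (ALL x:Ob C. nat_iso (XO X x) (XO Y x) (\<theta> x) (\<theta>' x) (Z x)) &
  (ALL x y. ALL h:hom C x y. ALL z:Ob (XO X x). FA (XA Y h) (Z x z) = Z y (FO (XA X h) z))"
 by (auto simp: inv_modif_def modif_def nat_iso_def hom_def)

text \<open>
  \<open>V i n\<close> is the \<open>n\<close>-th variable, in the fibre over \<open>i\<close>; \<open>Op m q x ts\<close> applies \<open>\<phi>(q)\<close> at \<open>x\<close>, and \<open>Tr h t\<close> the functor \<open>X(h)\<close>.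
\<close>

datatype ('h, 'o, 'a) tm =
 V "'o list" nat
| Op nat 'h "'o list" "('h, 'o, 'a) tm list"
| Tr "'a list" "('h, 'o, 'a) tm"

lemma prod_func_simps [simp]:
 "FO (prod_func Fs) xs = map2 FO Fs xs" "FA (prod_func Fs) fs = map2 FA Fs fs"
 by (simp_all add: prod_func_def)

lemma comp_func_simps [simp]:
 "FO (comp_func G F) x = FO G (FO F x)" "FA (comp_func G F) f = FA G (FA F f)"
 by (simp_all add: comp_func_def)

lemma tupF_simps [simp]:
 "FO (tupF Fs) x = map (%F. FO F x) Fs" "FA (tupF Fs) f = map (%F. FA F f) Fs"
 by (simp_all add: tupF_def)

lemma projF_simps [simp]: "FO (projF n) xs = xs ! n" "FA (projF n) fs = fs ! n"
 by (simp_all add: projF_def)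

lemma map2_map_left: "map2 f (map g xs) ys = map2 (%x. f (g x)) xs ys"
 by (simp add: zip_map1 o_def case_prod_unfold)

context T_algebra
begin

lemma Xw_simps:
 "XO (Xw I X w) x = XO X (fib w x)" "XA (Xw I X w) h = XA X (fibA w h)"
 "XO (Xws I X ws) x = prod_cat (map (XO X) (map (%w. fib w x) ws))"
 "XA (Xws I X ws) h = prod_func (map (%w. XA X (fibA w h)) ws)"
 "Xs I X l f w x = XA X (sQ l f w x)" "Xc I X us w x = XA X (cQ us w x)"
 "Xss I X l f ws x = prod_func (map (%w. XA X (sQ l f w x)) ws)"
 "Xcs I X us ws x = prod_func (map (%w. XA X (cQ us w x)) ws)"
 by (simp_all add: Xw_def Xws_def along_def prod_catfun_def fib_def fibA_def o_def Xs_def Xss_def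
   sQ_def Xc_def Xcs_def cQ_def)

lemma along_simps:
 "XO (along X (map (%v. subF f (Phi I v)) w)) x = XO X (fib w (pick x f))"
 "XA (along X (map (%v. subF f (Phi I v)) w)) h = XA X (fibA w (pick h f))"
 "XO (along X (map (%v. gamF (ars TT us) (Phi I v) (map (Phi I) us)) w)) x = XO X (fib w (PhiS TT I us x))"
 "XA (along X (map (%v. gamF (ars TT us) (Phi I v) (map (Phi I) us)) w)) h = XA X (fibA w (PhiSA us h))"
 by (simp_all add: along_def fib_def fibA_def o_def subF_def gamF_Phi)

lemma Hw_simps:
 "Hw I H w x = HH H (fib w x)" "Hws I H ws x = prod_func (map (%w. HH H (fib w x)) ws)"
 by (simp_all add: Hw_def Hws_def fib_def)

abbreviation fibs :: "'t list list => 'io list => 'io list list" where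
 "fibs ws x == map (%w. fib w x) ws"

abbreviation Fb :: "('io, 'ia, 't, 'h, 'u) alg => 'io list => ('u, 'u) cat" where
 "Fb A == XO (XX A)"

abbreviation tr :: "('io, 'ia, 't, 'h, 'u) alg => 'ia list => ('u, 'u, 'u, 'u) func" where
 "tr A == XA (XX A)"

abbreviation E :: "('io, 'ia, 't, 'h, 'u) alg => 'io list list => ('u list, 'u list) cat" where
 "E A Z == prod_cat (map (Fb A) Z)"

abbreviation trs :: "('io, 'ia, 't, 'h, 'u) alg => 't list list => 'ia list => 'u list => 'u list" where
 "trs A ws h ys == map2 (%w. FO (tr A (fibA w h))) ws ys"

text \<open>An algebra before its coherence isomorphisms. Terms can be evaluated at this stage, so
  the limit can be studied before its coherence isomorphisms are defined.\<close>

definition prealg :: "('io, 'ia, 't, 'h, 'u) alg => bool" where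
 "prealg A \<longleftrightarrow> functor_to_Cat U Q (XX A) &
  (ALL m w ws. ALL q:TH m w ws. nat_to_Cat (P m) (Xws I (XX A) ws) (Xw I (XX A) w) (phi A m q))"

lemma E_ob: "ys : Ob (E A Z) \<longleftrightarrow> length ys = length Z & (ALL n<length Z. ys ! n : Ob (Fb A (Z ! n)))"
 by (auto simp: list_all2_conv_all_nth)

lemma E_hom: "fs : hom (E A Z) as bs \<longleftrightarrow> length fs = length Z & length as = length Z & length bs = length Z &
  (ALL n<length Z. fs ! n : hom (Fb A (Z ! n)) (as ! n) (bs ! n))"
 by (auto simp: hom_prod)

lemma E_isohI: "set Z <= Ob Q ==> prealg A ==> length fs = length Z ==> length as = length Z ==> length bs = length Z ==>
  (!!n. n < length Z ==> isoh (Fb A (Z ! n)) (fs ! n) (as ! n) (bs ! n)) ==> isoh (E A Z) fs as bs"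
 by (rule isoh_prod) (auto simp: prealg_def functor_to_Cat_def small_category_def)

lemma fibs_ob: "q : TH m w ws ==> x : Ob (P m) ==> set (fibs ws x) <= Ob Q"
 using fib_ob ThetaHomD by fastforce

context
 fixes A :: "('io, 'ia, 't, 'h, 'u) alg"
 assumes A: "prealg A"
begin

lemma category_Fb: "i : Ob Q ==> category (Fb A i)"
 using A by (simp add: prealg_def functor_to_Cat_def small_category_def)

lemma category_E: "set Z <= Ob Q ==> category (E A Z)"
 using category_Fb by (intro category_prod) auto

lemma functor_tr: "h : hom Q i i' ==> is_functor (Fb A i) (Fb A i') (tr A h)"
 using A by (auto simp: prealg_def functor_to_Cat_def hom_def)

lemma tr_comp:
 assumes "h : hom Q i i'" "g : hom Q i' i''"
 shows "a : Ob (Fb A i) ==> FO (tr A g) (FO (tr A h) a) = FO (tr A (g *[Q] h)) a"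
  and "f : hom (Fb A i) a b ==> FA (tr A g) (FA (tr A h) f) = FA (tr A (g *[Q] h)) f"
 using A assms by (auto simp: prealg_def functor_to_Cat_def hom_def func_eq_def)

lemma tr_ident:
 assumes "i : Ob Q"
 shows "a : Ob (Fb A i) ==> FO (tr A (Ident Q i)) a = a"
  and "f : hom (Fb A i) a b ==> FA (tr A (Ident Q i)) f = f"
 using A assms by (auto simp: prealg_def functor_to_Cat_def hom_def func_eq_def id_func_def)

lemma functor_phi:
 "q : TH m w ws ==> x : Ob (P m) ==> is_functor (E A (fibs ws x)) (Fb A (fib w x)) (phi A m q x)"
 using A by (auto simp: prealg_def nat_to_Cat_def Xw_simps)

lemma phi_nat:
 assumes "q : TH m w ws" "h : hom (P m) x y"
 shows "ys : Ob (E A (fibs ws x)) ==>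
   FO (phi A m q y) (trs A ws h ys) = FO (tr A (fibA w h)) (FO (phi A m q x) ys)"
  and "fs : hom (E A (fibs ws x)) as bs ==>
   FA (phi A m q y) (map2 (%w. FA (tr A (fibA w h))) ws fs) = FA (tr A (fibA w h)) (FA (phi A m q x) fs)"
proof -
 have "nat_to_Cat (P m) (Xws I (XX A) ws) (Xw I (XX A) w) (phi A m q)"
  using A assms(1) by (simp add: prealg_def)
 then have "func_eq (E A (fibs ws x)) (comp_func (phi A m q y) (prod_func (map (%w. tr A (fibA w h)) ws)))
   (comp_func (tr A (fibA w h)) (phi A m q x))"
  using assms(2) by (auto simp: nat_to_Cat_def Xw_simps hom_def)
 then show "ys : Ob (E A (fibs ws x)) ==>
   FO (phi A m q y) (trs A ws h ys) = FO (tr A (fibA w h)) (FO (phi A m q x) ys)"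
  "fs : hom (E A (fibs ws x)) as bs ==>
   FA (phi A m q y) (map2 (%w. FA (tr A (fibA w h))) ws fs) = FA (tr A (fibA w h)) (FA (phi A m q x) fs)"
  by (auto simp: func_eq_def map2_map_left dest: homD)
qed

end

text \<open>\<open>Z\<close> lists the objects of \<open>I^k\<close> over whose fibres the variables
  range; the last argument is the object over which the value lies.\<close>

inductive wt :: "'io list list => ('h, 'io, 'ia) tm => 'io list => bool" for Z where
 wt_V: "n < length Z ==> Z ! n : Ob Q ==> wt Z (V (Z ! n) n) (Z ! n)"
| wt_Op: "q : TH m w ws ==> x : Ob (P m) ==> list_all2 (wt Z) ts (fibs ws x) ==> wt Z (Op m q x ts) (fib w x)"
| wt_Tr: "wt Z t i ==> h : hom Q i i' ==> wt Z (Tr h t) i'"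

primrec evF :: "('io, 'ia, 't, 'h, 'u) alg => ('h, 'io, 'ia) tm => ('u list, 'u list, 'u, 'u) func" where
 "evF A (V i n) = projF n"
| "evF A (Op m q x ts) = comp_func (phi A m q x) (tupF (map (evF A) ts))"
| "evF A (Tr h t) = comp_func (tr A h) (evF A t)"

lemma wt_ob: "wt Z t i ==> i : Ob Q"
 by (induction rule: wt.induct) (auto intro: fib_ob dest: ThetaHomD hom_ob[OF category_P])

lemma evF_functor:
 assumes A: "prealg A" and "wt Z t i"
 shows "is_functor (E A Z) (Fb A i) (evF A t)"
 using assms(2)
proof (induction rule: wt.induct)
 case (wt_V n)
 then show ?case using functor_proj[of n "map (Fb A) Z"] by simp
next
 case (wt_Op q m w ws x ts)
 then have "list_all2 (%F D. is_functor (E A Z) D F) (map (evF A) ts) (map (Fb A) (fibs ws x))"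
  by (auto simp: list_all2_conv_all_nth)
 then show ?case
  using functor_compose[OF functor_tuple functor_phi[OF A wt_Op(1,2)]] by simp
next
 case (wt_Tr t i h i')
 then show ?case using functor_compose[OF _ functor_tr[OF A]] by simp
qed

text \<open>A morphism before compatibility with the coherence isomorphisms is imposed, the
  counterpart of \<open>prealg\<close>. \<open>rhoT\<close> is defined and typed at this
  stage.\<close>

definition premor ::
  "('io, 'ia, 't, 'h, 'u) alg => ('io, 'ia, 't, 'h, 'u) alg => ('io, 'h, 'u) mor => bool" where
 "premor A B H \<longleftrightarrow> nat_to_Cat Q (XX A) (XX B) (HH H) &
  (ALL m w ws. ALL q:TH m w ws.
    inv_modif (P m) (Xws I (XX A) ws) (Xw I (XX B) w)
     (%x. comp_func (Hw I H w x) (phi A m q x))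
     (%x. comp_func (phi B m q x) (Hws I H ws x))
     (rho H m q))"

abbreviation HO :: "('io, 'h, 'u) mor => 'io list list => 'u list => 'u list" where
 "HO H Z ys == map2 (%i. FO (HH H i)) Z ys"

lemma premor_HH:
 "premor A B H ==> i : Ob Q ==> is_functor (Fb A i) (Fb B i) (HH H i)"
 by (simp add: premor_def nat_to_Cat_def)

lemma premor_tr:
 assumes "premor A B H" "h : hom Q i i'"
 shows "a : Ob (Fb A i) ==> FO (HH H i') (FO (tr A h) a) = FO (tr B h) (FO (HH H i) a)"
  and "f : hom (Fb A i) a b ==> FA (HH H i') (FA (tr A h) f) = FA (tr B h) (FA (HH H i) f)"
 using assms by (auto simp: premor_def nat_to_Cat_def func_eq_def hom_def)

lemma premor_rho:
 assumes "premor A B H" "q : TH m w ws"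
 shows "x : Ob (P m) ==> ys : Ob (E A (fibs ws x)) ==>
   isoh (Fb B (fib w x)) (rho H m q x ys) (FO (HH H (fib w x)) (FO (phi A m q x) ys))
    (FO (phi B m q x) (HO H (fibs ws x) ys))"
  and "x : Ob (P m) ==> fs : hom (E A (fibs ws x)) as bs ==>
   rho H m q x bs *[Fb B (fib w x)] FA (HH H (fib w x)) (FA (phi A m q x) fs)
    = FA (phi B m q x) (map2 (%i. FA (HH H i)) (fibs ws x) fs) *[Fb B (fib w x)] rho H m q x as"
  and "h : hom (P m) x y ==> ys : Ob (E A (fibs ws x)) ==>
   FA (tr B (fibA w h)) (rho H m q x ys) = rho H m q y (trs A ws h ys)"
proof -
 have *: "inv_modif (P m) (Xws I (XX A) ws) (Xw I (XX B) w)
     (%x. comp_func (Hw I H w x) (phi A m q x))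
     (%x. comp_func (phi B m q x) (Hws I H ws x))
     (rho H m q)"
  using assms by (simp add: premor_def)
 show "x : Ob (P m) ==> ys : Ob (E A (fibs ws x)) ==>
   isoh (Fb B (fib w x)) (rho H m q x ys) (FO (HH H (fib w x)) (FO (phi A m q x) ys))
    (FO (phi B m q x) (HO H (fibs ws x) ys))"
  using *[unfolded inv_modif_iff, THEN c1, rule_format, THEN nat_iso_isoh, of x ys]
  by (simp add: Xw_simps Hw_simps map2_map_left)
 show "x : Ob (P m) ==> fs : hom (E A (fibs ws x)) as bs ==>
   rho H m q x bs *[Fb B (fib w x)] FA (HH H (fib w x)) (FA (phi A m q x) fs)
    = FA (phi B m q x) (map2 (%i. FA (HH H i)) (fibs ws x) fs) *[Fb B (fib w x)] rho H m q x as"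
  using *[unfolded inv_modif_iff, THEN c1, rule_format, THEN nat_iso_nat, of x fs as bs]
  by (simp add: Xw_simps Hw_simps map2_map_left)
 show "h : hom (P m) x y ==> ys : Ob (E A (fibs ws x)) ==>
   FA (tr B (fibA w h)) (rho H m q x ys) = rho H m q y (trs A ws h ys)"
  using *[unfolded inv_modif_iff, THEN c2, rule_format, of h x y ys]
  by (simp add: Xw_simps Hw_simps map2_map_left)
qed

lemma premorI:
 assumes "!!i. i : Ob Q ==> is_functor (Fb A i) (Fb B i) (HH H i)"
  and "!!h i i' a. h : hom Q i i' ==> a : Ob (Fb A i) ==> FO (HH H i') (FO (tr A h) a) = FO (tr B h) (FO (HH H i) a)"
  and "!!h i i' f a b. h : hom Q i i' ==> f : hom (Fb A i) a b ==> FA (HH H i') (FA (tr A h) f) = FA (tr B h) (FA (HH H i) f)"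
  and "!!m w ws q x ys. q : TH m w ws ==> x : Ob (P m) ==> ys : Ob (E A (fibs ws x)) ==>
   isoh (Fb B (fib w x)) (rho H m q x ys) (FO (HH H (fib w x)) (FO (phi A m q x) ys))
    (FO (phi B m q x) (HO H (fibs ws x) ys))"
  and "!!m w ws q x fs as bs. q : TH m w ws ==> x : Ob (P m) ==> fs : hom (E A (fibs ws x)) as bs ==>
   rho H m q x bs *[Fb B (fib w x)] FA (HH H (fib w x)) (FA (phi A m q x) fs)
    = FA (phi B m q x) (map2 (%i. FA (HH H i)) (fibs ws x) fs) *[Fb B (fib w x)] rho H m q x as"
  and "!!m w ws q h x y ys. q : TH m w ws ==> h : hom (P m) x y ==> ys : Ob (E A (fibs ws x)) ==>
   FA (tr B (fibA w h)) (rho H m q x ys) = rho H m q y (trs A ws h ys)"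
 shows "premor A B H"
 unfolding premor_def inv_modif_iff
proof (intro conjI allI ballI)
 show "nat_to_Cat Q (XX A) (XX B) (HH H)"
  unfolding nat_to_Cat_def func_eq_def comp_func_simps
  using assms(1) assms(2)[OF homI] assms(3)[OF homI homI] by blast
next
 fix m w ws q x assume "q : TH m w ws" "x : Ob (P m)"
 then show "nat_iso (XO (Xws I (XX A) ws) x) (XO (Xw I (XX B) w) x) (comp_func (Hw I H w x) (phi A m q x))
   (comp_func (phi B m q x) (Hws I H ws x)) (rho H m q x)"
  unfolding Xw_simps Hw_simps
  by (intro nat_isoI) (use assms(4,5) in \<open>simp_all add: map2_map_left\<close>)
next
 fix m w ws q x y h z assume "q : TH m w ws" "h : hom (P m) x y" "z : Ob (XO (Xws I (XX A) ws) x)"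
 then show "FA (XA (Xw I (XX B) w) h) (rho H m q x z) = rho H m q y (FO (XA (Xws I (XX A) ws) h) z)"
  using assms(6) by (simp add: Xw_simps map2_map_left)
qed

lemma HO_ob:
 assumes "premor A B H" "set Z <= Ob Q" "ys : Ob (E A Z)"
 shows "HO H Z ys : Ob (E B Z)"
 using assms functor_ob[OF premor_HH[OF assms(1)]] unfolding E_ob by (simp add: subset_iff)

text \<open>The composite of components of \<open>\<rho>\<close> that moves \<open>H\<close> past a term.\<close>

primrec rhoT ::
  "('io, 'ia, 't, 'h, 'u) alg => ('io, 'ia, 't, 'h, 'u) alg => ('io, 'h, 'u) mor => 'u list => ('h, 'io, 'ia) tm => 'u"
 where
 "rhoT A B H ys (V i n) = Ident (Fb B i) (FO (HH H i) (ys ! n))"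
| "rhoT A B H ys (Op m q x ts) = FA (phi B m q x) (map (rhoT A B H ys) ts)
  *[Fb B (fib (out \<Theta> m q) x)] rho H m q x (map (%t. FO (evF A t) ys) ts)"
| "rhoT A B H ys (Tr h t) = FA (tr B h) (rhoT A B H ys t)"

lemma evF_args:
 assumes "prealg A" "list_all2 (wt Z) ts \<Delta>" "ys : Ob (E A Z)"
 shows "map (%t. FO (evF A t) ys) ts : Ob (E A \<Delta>)"
 using assms functor_ob[OF evF_functor[OF assms(1)]]
 unfolding E_ob[of _ _ \<Delta>] list_all2_conv_all_nth[of "wt Z"] by fastforce

text \<open>At an operation, \<open>\<rho>\<close> moves \<open>H\<close> past it, and the operation
  of \<open>B\<close> is applied to what the arguments have contributed; at a transport, strict
  commutation with \<open>H\<close> leaves nothing to add.\<close>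

lemma rhoT_isoh:
 assumes A: "prealg A" and B: "prealg B" and H: "premor A B H" and "wt Z t i"
  and ys: "ys : Ob (E A Z)"
 shows "isoh (Fb B i) (rhoT A B H ys t) (FO (HH H i) (FO (evF A t) ys)) (FO (evF B t) (HO H Z ys))"
 using assms(4)
proof (induction rule: wt.induct)
 case (wt_V n)
 have "ys ! n : Ob (Fb A (Z ! n))" "length ys = length Z"
  using ys wt_V by (auto simp: E_ob simp del: prod_cat_simps)
 then show ?case
  using isoh_ident[OF category_Fb[OF B wt_V(2)]] functor_ob[OF premor_HH[OF H wt_V(2)]] wt_V(1) by simp
next
 case (wt_Op q m w ws x ts)
 let ?ev = "map (%t. FO (evF A t) ys) ts"
 have ts: "list_all2 (wt Z) ts (fibs ws x)" "length ts = length ws" and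
  IH: "!!n. n < length ws ==> isoh (Fb B (fib (ws ! n) x)) (rhoT A B H ys (ts ! n))
   (FO (HH H (fib (ws ! n) x)) (FO (evF A (ts ! n)) ys)) (FO (evF B (ts ! n)) (HO H Z ys))"
  using wt_Op(3) by (auto simp: list_all2_conv_all_nth)
 note Z = fibs_ob[OF wt_Op(1,2)]
 have "isoh (E B (fibs ws x)) (map (rhoT A B H ys) ts) (HO H (fibs ws x) ?ev) (map (%t. FO (evF B t) (HO H Z ys)) ts)"
  by (rule E_isohI[OF Z B]) (use ts(2) IH in auto)
 from functor_isoh[OF category_E[OF B Z] functor_phi[OF B wt_Op(1,2)] this]
 have "isoh (Fb B (fib w x)) (FA (phi B m q x) (map (rhoT A B H ys) ts))
   (FO (phi B m q x) (HO H (fibs ws x) ?ev)) (FO (evF B (Op m q x ts)) (HO H Z ys))"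
  by (simp add: o_def)
 from isoh_comp[OF category_Fb[OF B] premor_rho(1)[OF H wt_Op(1,2) evF_args[OF A ts(1) ys]] this]
 show ?case
  using fib_ob[OF _ wt_Op(2)] ThetaHomD[OF wt_Op(1)] by (simp add: out_eq[OF wt_Op(1)] o_def)
next
 case (wt_Tr t i h i')
 have i: "i : Ob Q" using hom_ob[OF category_P wt_Tr(2)] by blast
 show ?case
  using functor_isoh[OF category_Fb[OF B i] functor_tr[OF B wt_Tr(2)] wt_Tr(3)]
   premor_tr(1)[OF H wt_Tr(2) functor_ob[OF evF_functor[OF A wt_Tr(1)] ys]] by simp
qed

end

section \<open>The five kinds of coherence isomorphisms\<close>

lemma blocks_map2:
 "length xs = length ys ==> blocks ns (map2 f xs ys) = map2 (map2 f) (blocks ns xs) (blocks ns ys)"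
 by (induction ns arbitrary: xs ys) (auto simp: take_map drop_map take_zip drop_zip)

lemma list_all2_blocks:
 "list_all2 R xs (concat yss) ==> list_all2 (list_all2 R) (blocks (map length yss) xs) yss"
proof (induction yss arbitrary: xs)
 case (Cons ys yss)
 then obtain us vs where "xs = us @ vs" "length us = length ys" "list_all2 R us ys" "list_all2 R vs (concat yss)"
  by (auto simp: list_all2_append2)
 with Cons.IH[of vs] show ?case by simp
qed auto

context T_algebra
begin

text \<open>The arguments of an operation written as terms: evaluated at \<open>ys\<close> they give
  back \<open>ys\<close>.\<close>

definition vars :: "'io list list => ('h, 'io, 'ia) tm list" where
 "vars Z = map2 V Z [0..<length Z]"

lemma length_vars [simp]: "length (vars Z) = length Z"
 by (simp add: vars_def)

lemma nth_vars [simp]: "n < length Z ==> vars Z ! n = V (Z ! n) n"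
 by (simp add: vars_def)

lemma ev_vars:
 "length ys = length Z ==> map (%t. FO (evF A t) ys) (vars Z) = ys"
 "length fs = length Z ==> map (%t. FA (evF A t) fs) (vars Z) = fs"
 by (auto intro!: nth_equalityI)

lemma rhoT_vars:
 "length ys = length Z ==> map (rhoT A B H ys) (vars Z) = map2 (%i. Ident (Fb B i)) Z (HO H Z ys)"
 by (auto intro!: nth_equalityI)

lemma wt_vars: "set Z <= Ob Q ==> list_all2 (wt Z) (vars Z) Z"
 by (auto simp: list_all2_conv_all_nth subset_iff intro!: wt_V)

text \<open>
  \<open>kind Z i s t e\<close>: in an algebra \<open>A\<close>, \<open>e A\<close> is a coherence isomorphism from the term \<open>s\<close> to the term \<open>t\<close>, both
  of them functors from the product of the fibres over \<open>Z\<close> to the fibre over \<open>i\<close>.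
\<close>

inductive kind ::
  "'io list list => 'io list => ('h, 'io, 'ia) tm => ('h, 'io, 'ia) tm =>
  (('io, 'ia, 't, 'h, 'u) alg => 'u list => 'u) => bool" where
 k_unit: "w : KW m ==> x : Ob (P m) ==>
  kind [fib w x] (fib w x) (Op m (Oun m w) x (vars [fib w x])) (V (fib w x) 0) (%A. e_unit A m w x)"
| k_comp: "q : TH m w ws ==> THs m qs ws wss ==> x : Ob (P m) ==> Z = fibs (concat wss) x ==>
  kind Z (fib w x) (Op m (Ocp m q qs) x (vars Z))
   (Op m q x (map2 (%q' ts. Op m q' x ts) qs (blocks (map length wss) (vars Z)))) (%A. e_comp A m q qs x)"
| k_fun: "io : index_maps p (length ws) ==> q : TH m w (pick ws io) ==> set ws <= KW m ==>
  x : Ob (P m) ==> Z = fibs ws x ==>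
  kind Z (fib w x) (Op m (Ofn m ws io q) x (vars Z)) (Op m q x (pick (vars Z) io)) (%A. e_fun A m ws io q x)"
| k_sub: "f : index_maps m l ==> q : TH m w ws ==> x : Ob (P l) ==> Z = fibs (map (ksb l f) ws) x ==>
  kind Z (fib w (pick x f)) (Tr (sQ l f w x) (Op l (Osb l f q) x (vars Z)))
   (Op m q (pick x f) (map2 (%w. Tr (sQ l f w x)) ws (vars Z))) (%A. e_sub A l f q x)"
| k_pull: "q : TH m w ws ==> length us = m ==> word_list TT us ==> N = arsum us ==>
  x : Ob (P N) ==> Z = fibs (map (kgm us) ws) x ==>
  kind Z (fib w (PhiS TT I us x)) (Tr (cQ us w x) (Op N (Opl us q) x (vars Z)))
   (Op m q (PhiS TT I us x) (map2 (%w. Tr (cQ us w x)) ws (vars Z))) (%A. e_pull A us q x)"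

lemma wt_vars_Op: "q : TH m w ws ==> x : Ob (P m) ==> Z = fibs ws x ==> set Z <= Ob Q & wt Z (Op m q x (vars Z)) (fib w x)"
 using fibs_ob wt_vars by (auto intro!: wt_Op)

lemma wt_args_Tr:
 assumes "set Z <= Ob Q" "Z = fibs (map k ws) x" "!!w. w : set ws ==> h w : hom Q (fib (k w) x) (fib w y)"
 shows "list_all2 (wt Z) (map2 (%w. Tr (h w)) ws (vars Z)) (fibs ws y)"
proof -
 have l: "length Z = length ws" using assms(2) by simp
 then show ?thesis
  using assms(2,3) wt_vars[OF assms(1)] by (auto simp: list_all2_conv_all_nth intro!: wt_Tr)
qed

lemma sQ_homs:
 "q : TH m w ws ==> f : index_maps m l ==> x : Ob (P l) ==> v : insert w (set ws) ==>
  sQ l f v x : hom Q (fib (ksb l f v) x) (fib v (pick x f))"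
 using ThetaHomD sQ_hom by blast

lemma cQ_homs:
 "q : TH m w ws ==> length us = m ==> word_list TT us ==> x : Ob (P (arsum us)) ==> v : insert w (set ws) ==>
  cQ us v x : hom Q (fib (kgm us v) x) (fib v (PhiS TT I us x))"
 using ThetaHomD[of q m w ws] cQ_hom[of v us x] by blast

lemma kind_wt: "kind Z i s t e ==> set Z <= Ob Q & wt Z s i & wt Z t i"
proof (induction rule: kind.induct)
 case (k_unit w m x)
 then show ?case
  using wt_vars_Op[OF Ounit_hom[OF k_unit(1)] k_unit(2) refl] fib_ob[OF k_unit]
   wt_V[of 0 "[fib w x]"] by simp
next
 case (k_comp q m w ws qs wss x Z)
 note 1 = wt_vars_Op[OF Ocomp_hom[OF k_comp(1,2)] k_comp(3,4)]
 have Z: "Z = concat (map (%ws. fibs ws x) wss)" by (simp add: k_comp(4) map_concat)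
 have "list_all2 (list_all2 (wt Z)) (blocks (map length (map (%ws. fibs ws x) wss)) (vars Z)) (map (%ws. fibs ws x) wss)"
  by (rule list_all2_blocks) (use wt_vars 1 Z in simp)
 then have "list_all2 (list_all2 (wt Z)) (blocks (map length wss) (vars Z)) (map (%ws. fibs ws x) wss)"
  by (simp add: o_def)
 then have "list_all2 (wt Z) (map2 (%q' ts. Op m q' x ts) qs (blocks (map length wss) (vars Z))) (fibs ws x)"
  using k_comp(2,3) by (auto simp: list_all2_conv_all_nth[of "wt Z"] list_all2_conv_all_nth[of "list_all2 (wt Z)"] ThetaHoms_def
    intro!: wt_Op)
 then show ?case using 1 wt_Op[OF k_comp(1,3)] by blast
next
 case (k_fun io p ws q m w x Z)
 note io = index_mapsD[OF k_fun(1)]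
 note 1 = wt_vars_Op[OF Ofun_hom[OF k_fun(2,3)] k_fun(4,5)]
 have "list_all2 (wt Z) (pick (vars Z) io) (pick Z io)"
  by (rule list_all2_pick[OF wt_vars]) (use io k_fun(5) 1 in auto)
 moreover have "pick Z io = fibs (pick ws io) x" using io k_fun(5) by (simp add: map_pick)
 ultimately show ?case using 1 io wt_Op[OF k_fun(2,4)] by simp
next
 case (k_sub f m l q w ws x Z)
 note 1 = wt_vars_Op[OF Osub_hom[OF k_sub(2,1)] k_sub(3,4)]
 show ?case
  using 1 wt_Tr[OF _ sQ_homs[OF k_sub(2,1,3)], of Z _ w] wt_Op[OF k_sub(2) pick_ob[OF k_sub(3,1)]]
   wt_args_Tr[where Z = Z and k = "ksb l f" and ws = ws and x = x and h = "%w. sQ l f w x" and y = "pick x f"] sQ_homs[OF k_sub(2,1,3)] k_sub(4) by simp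
next
 case (k_pull q m w ws us N x Z)
 have x: "x : Ob (P (arsum us))" using k_pull by simp
 note 1 = wt_vars_Op[OF Opull_hom[OF k_pull(1-3)] x k_pull(6)]
 show ?case
  using 1 wt_Tr[OF _ cQ_homs[OF k_pull(1-3) x], of Z _ w] wt_Op[OF k_pull(1), of "PhiS TT I us x"] PhiS_ob[OF k_pull(3) x]
   wt_args_Tr[where Z = Z and k = "kgm us" and ws = ws and x = x and h = "%w. cQ us w x" and y = "PhiS TT I us x"] cQ_homs[OF k_pull(1-3) x] k_pull(2,4,6) by simp
qed

lemma func_eq_E:
 "(!!ys. length ys = length Z ==> FO F ys = FO G ys) ==> (!!fs. length fs = length Z ==> FA F fs = FA G fs) ==>
  func_eq (E A Z) F G"
 using homI[of _ "E A Z"] unfolding func_eq_def E_hom by (metis E_ob)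

text \<open>This and the five lemmas after it recognise the functors between which
  \<open>alg_data\<close> places its modifications as values of the terms in
  \<open>kind\<close>.\<close>

lemma evF_vars_Op: "func_eq (E A Z) (phi A m q x) (evF A (Op m q x (vars Z)))"
 by (rule func_eq_E) (simp_all add: o_def ev_vars)

lemma evF_unit: "func_eq (E A [i]) oneF (evF A (V i 0))"
 by (rule func_eq_E) (auto simp: oneF_def length_Suc_conv)

lemma evF_comp:
 "func_eq (E A Z) (gamF ns (phi A m q x) (map (%q'. phi A m q' x) qs))
  (evF A (Op m q x (map2 (%q' ts. Op m q' x ts) qs (blocks ns (vars Z)))))"
proof (rule func_eq_E)
 fix ys :: "'u list" assume "length ys = length Z"
 then have "blocks ns ys = map (map (%t. FO (evF A t) ys)) (blocks ns (vars Z))"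
  by (metis map_blocks ev_vars(1))
 then show "FO (gamF ns (phi A m q x) (map (%q'. phi A m q' x) qs)) ys
  = FO (evF A (Op m q x (map2 (%q' ts. Op m q' x ts) qs (blocks ns (vars Z))))) ys"
  by (simp add: gamF_def zip_map1 zip_map2 o_def case_prod_unfold)
next
 fix ys :: "'u list" assume "length ys = length Z"
 then have "blocks ns ys = map (map (%t. FA (evF A t) ys)) (blocks ns (vars Z))"
  by (metis map_blocks ev_vars(2))
 then show "FA (gamF ns (phi A m q x) (map (%q'. phi A m q' x) qs)) ys
  = FA (evF A (Op m q x (map2 (%q' ts. Op m q' x ts) qs (blocks ns (vars Z))))) ys"
  by (simp add: gamF_def zip_map1 zip_map2 o_def case_prod_unfold)
qed

lemma evF_fun:
 assumes "set io <= {..<length Z}"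
 shows "func_eq (E A Z) (subF io (phi A m q x)) (evF A (Op m q x (pick (vars Z) io)))"
 using assms by (intro func_eq_E) (simp_all add: subF_def o_def map_pick ev_vars)

lemma evF_Tr_vars: "func_eq (E A Z) (comp_func (tr A h) (phi A m q x)) (evF A (Tr h (Op m q x (vars Z))))"
 by (rule func_eq_E) (simp_all add: o_def ev_vars)

lemma evF_args_Tr:
 "func_eq (E A Z) (comp_func (phi A m q y) (prod_func (map (%w. tr A (h w)) ws)))
  (evF A (Op m q y (map2 (%w. Tr (h w)) ws (vars Z))))"
proof (rule func_eq_E)
 fix ys :: "'u list" assume "length ys = length Z"
 then have "FO (prod_func (map (%w. tr A (h w)) ws)) ys = map2 (%w y. FO (tr A (h w)) y) ws (map (%t. FO (evF A t) ys) (vars Z))"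
  by (simp add: ev_vars map2_map_left)
 then show "FO (comp_func (phi A m q y) (prod_func (map (%w. tr A (h w)) ws))) ys
  = FO (evF A (Op m q y (map2 (%w. Tr (h w)) ws (vars Z)))) ys"
  by (simp add: zip_map2 o_def case_prod_unfold)
next
 fix ys :: "'u list" assume "length ys = length Z"
 then have "FA (prod_func (map (%w. tr A (h w)) ws)) ys = map2 (%w y. FA (tr A (h w)) y) ws (map (%t. FA (evF A t) ys) (vars Z))"
  by (simp add: ev_vars map2_map_left)
 then show "FA (comp_func (phi A m q y) (prod_func (map (%w. tr A (h w)) ws))) ys
  = FA (evF A (Op m q y (map2 (%w. Tr (h w)) ws (vars Z)))) ys"
  by (simp add: zip_map2 o_def case_prod_unfold)
qed

text \<open>The coherence isomorphisms are modifications: this is their naturality in the object \<open>x\<close> of a power of \<open>I\<close>.\<close>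

definition xnat :: "('io, 'ia, 't, 'h, 'u) alg => bool" where
 "xnat A \<longleftrightarrow>
  (ALL m. ALL w:KW m. ALL x y. ALL h:hom (P m) x y. ALL ys:Ob (E A (fibs [w] x)).
    FA (tr A (fibA w h)) (e_unit A m w x ys) = e_unit A m w y (trs A [w] h ys)) &
  (ALL m w ws wss. ALL q:TH m w ws. ALL qs. THs m qs ws wss -->
    (ALL x y. ALL h:hom (P m) x y. ALL ys:Ob (E A (fibs (concat wss) x)).
    FA (tr A (fibA w h)) (e_comp A m q qs x ys) = e_comp A m q qs y (trs A (concat wss) h ys))) &
  (ALL m w ws p. ALL io:index_maps p (length ws). ALL q:TH m w (pick ws io). set ws <= KW m -->
    (ALL x y. ALL h:hom (P m) x y. ALL ys:Ob (E A (fibs ws x)).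
    FA (tr A (fibA w h)) (e_fun A m ws io q x ys) = e_fun A m ws io q y (trs A ws h ys))) &
  (ALL m l w ws. ALL f:index_maps m l. ALL q:TH m w ws.
    (ALL x y. ALL h:hom (P l) x y. ALL ys:Ob (E A (fibs (map (ksb l f) ws) x)).
    FA (tr A (fibA w (pick h f))) (e_sub A l f q x ys) = e_sub A l f q y (trs A (map (ksb l f) ws) h ys))) &
  (ALL m w ws us. ALL q:TH m w ws. length us = m & word_list TT us -->
    (ALL x y. ALL h:hom (P (arsum us)) x y. ALL ys:Ob (E A (fibs (map (kgm us) ws) x)).
    FA (tr A (fibA w (PhiSA us h))) (e_pull A us q x ys) = e_pull A us q y (trs A (map (kgm us) ws) h ys)))"

definition kinds_iso :: "('io, 'ia, 't, 'h, 'u) alg => bool" where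
 "kinds_iso A \<longleftrightarrow> (ALL Z i s t e. kind Z i s t e --> nat_iso (E A Z) (Fb A i) (evF A s) (evF A t) (e A))"

lemmas trs_simp = prod_func_simps map2_map_left

text \<open>An \<open>inv_modif\<close> is a natural isomorphism at each \<open>x\<close> together
  with naturality in \<open>x\<close>. The former has one form for the five kinds, as
  \<open>kind\<close> fixes \<open>x\<close>; the latter relates different terms and is kept apart
  in \<open>xnat\<close>.\<close>

lemma alg_data_iff: "alg_data U \<Theta> I A \<longleftrightarrow> prealg A & kinds_iso A & xnat A"
proof
 assume D: "alg_data U \<Theta> I A"
 note D' = D[unfolded alg_data_def Let_def inv_modif_iff Xw_simps along_simps, unfolded trs_simp]
 note D3 = D'[THEN c2, THEN c2, THEN c1, rule_format]
  and D4 = D'[THEN c2, THEN c2, THEN c2, THEN c1, rule_format]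
  and D5 = D'[THEN c2, THEN c2, THEN c2, THEN c2, THEN c1, rule_format]
  and D6 = D'[THEN c2, THEN c2, THEN c2, THEN c2, THEN c2, THEN c1, rule_format]
  and D7 = D'[THEN c2, THEN c2, THEN c2, THEN c2, THEN c2, THEN c2, rule_format]
 have P: "prealg A" using D by (simp add: alg_data_def prealg_def Let_def)
 have X: "xnat A"
  unfolding xnat_def trs_simp
  by (intro conjI allI ballI impI)
   (blast intro: D3[THEN c2, rule_format] D4[THEN c2, rule_format] D5[THEN c2, rule_format]
    D6[THEN c2, rule_format] D7[THEN c2, rule_format])+
 have K: "kinds_iso A"
  unfolding kinds_iso_def
 proof (intro allI impI)
  fix Z i s t and e :: "('io, 'ia, 't, 'h, 'u) alg => 'u list => 'u" assume "kind Z i s t e"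
  then show "nat_iso (E A Z) (Fb A i) (evF A s) (evF A t) (e A)"
  proof (induction rule: kind.induct)
   case (k_unit w m x)
   then show ?case
    unfolding nat_iso_cong[OF evF_vars_Op evF_unit, symmetric] using D3[THEN c1] k_unit by simp
  next
   case (k_comp q m w ws qs wss x Z)
   show ?case
    unfolding nat_iso_cong[OF evF_vars_Op evF_comp, symmetric] k_comp(4) by (rule D4[OF k_comp(1,2), THEN c1, rule_format, OF k_comp(3)])
  next
   case (k_fun io p ws q m w x Z)
   have "set io <= {..<length Z}" using index_mapsD[OF k_fun(1)] k_fun(5) by simp
   from nat_iso_cong[OF evF_vars_Op evF_fun[OF this], symmetric] show ?case
    using D5[OF k_fun(1-3), THEN c1, rule_format, OF k_fun(4)] unfolding k_fun(5) by blast
  next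
   case (k_sub f m l q w ws x Z)
   show ?case
    unfolding nat_iso_cong[OF evF_Tr_vars evF_args_Tr, symmetric] k_sub(4) by (rule D6[OF k_sub(1,2), THEN c1, rule_format, OF k_sub(3)])
  next
   case (k_pull q m w ws us N x Z)
   show ?case
    unfolding nat_iso_cong[OF evF_Tr_vars evF_args_Tr, symmetric] k_pull(4,6)
    by (rule D7[OF k_pull(1) conjI[OF k_pull(2,3)], THEN c1, rule_format, OF k_pull(5)[unfolded k_pull(4)]])
  qed
 qed
 from P K X show "prealg A & kinds_iso A & xnat A" by blast
next
 assume *: "prealg A & kinds_iso A & xnat A"
 then have P: "prealg A" and X: "xnat A"
  and K: "!!Z i s t e. kind Z i s t e ==> nat_iso (E A Z) (Fb A i) (evF A s) (evF A t) (e A)"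
  by (auto simp: kinds_iso_def)
 note X' = X[unfolded xnat_def trs_simp]
 note X3 = X'[THEN c1, rule_format]
  and X4 = X'[THEN c2, THEN c1, rule_format]
  and X5 = X'[THEN c2, THEN c2, THEN c1, rule_format]
  and X6 = X'[THEN c2, THEN c2, THEN c2, THEN c1, rule_format]
  and X7 = X'[THEN c2, THEN c2, THEN c2, THEN c2, rule_format]
 show "alg_data U \<Theta> I A"
  unfolding alg_data_def Let_def
 proof (intro conjI allI ballI impI; (unfold inv_modif_iff Xw_simps along_simps trs_simp)?; (intro conjI allI ballI)?)
  show "functor_to_Cat U Q (XX A)" using P by (simp add: prealg_def)
 next
  fix m w ws q assume "q : TH m w ws"
  then show "nat_to_Cat (P m) (Xws I (XX A) ws) (Xw I (XX A) w) (phi A m q)" using P by (simp add: prealg_def)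
 next
  fix m w x assume "w : KW m" "x : Ob (P m)"
  from K[OF k_unit[OF this]] show "nat_iso (E A (fibs [w] x)) (Fb A (fib w x)) (phi A m (Oun m w) x) oneF (e_unit A m w x)"
   unfolding nat_iso_cong[OF evF_vars_Op evF_unit, symmetric] by simp
 next
  fix m w ws wss q qs x assume "q : TH m w ws" "THs m qs ws wss" "x : Ob (P m)"
  from K[OF k_comp[OF this refl]] show "nat_iso (E A (fibs (concat wss) x)) (Fb A (fib w x)) (phi A m (Ocp m q qs) x)
    (gamF (map length wss) (phi A m q x) (map (%q'. phi A m q' x) qs)) (e_comp A m q qs x)"
   unfolding nat_iso_cong[OF evF_vars_Op evF_comp, symmetric] .
 next
  fix m w ws p io q x assume a: "io : index_maps p (length ws)" "q : TH m w (pick ws io)" "set ws <= KW m" "x : Ob (P m)"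
  have s: "set io <= {..<length (fibs ws x)}" using index_mapsD[OF a(1)] by simp
  show "nat_iso (E A (fibs ws x)) (Fb A (fib w x)) (phi A m (Ofn m ws io q) x) (subF io (phi A m q x)) (e_fun A m ws io q x)"
   using K[OF k_fun[OF a refl]] nat_iso_cong[OF evF_vars_Op evF_fun[OF s]] by blast
 next
  fix m l w ws f q x assume "f : index_maps m l" "q : TH m w ws" "x : Ob (P l)"
  from K[OF k_sub[OF this refl]] show "nat_iso (E A (fibs (map (ksb l f) ws) x)) (Fb A (fib w (pick x f)))
    (comp_func (tr A (sQ l f w x)) (phi A l (Osb l f q) x))
    (comp_func (phi A m q (pick x f)) (prod_func (map (%w. tr A (sQ l f w x)) ws))) (e_sub A l f q x)"
   unfolding nat_iso_cong[OF evF_Tr_vars evF_args_Tr, symmetric] .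
 next
  fix m w ws us q x assume "q : TH m w ws" "length us = m & word_list TT us" "x : Ob (P (arsum us))"
  from K[OF k_pull[OF this(1) conjunct1[OF this(2)] conjunct2[OF this(2)] refl this(3) refl]]
  show "nat_iso (E A (fibs (map (kgm us) ws) x)) (Fb A (fib w (PhiS TT I us x)))
    (comp_func (tr A (cQ us w x)) (phi A (arsum us) (Opl us q) x))
    (comp_func (phi A m q (PhiS TT I us x)) (prod_func (map (%w. tr A (cQ us w x)) ws))) (e_pull A us q x)"
   unfolding nat_iso_cong[OF evF_Tr_vars evF_args_Tr, symmetric] .
 qed (blast intro: X3 X4 X5 X6 X7)+
qed

end

section \<open>Morphisms\<close>

context T_algebra
begin

lemma kinds_isoD:
 assumes "kinds_iso A" "kind Z i s t e"
 shows "ys : Ob (E A Z) ==> isoh (Fb A i) (e A ys) (FO (evF A s) ys) (FO (evF A t) ys)"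
  and "fs : hom (E A Z) as bs ==> e A bs *[Fb A i] FA (evF A s) fs = FA (evF A t) fs *[Fb A i] e A as"
proof -
 have n: "nat_iso (E A Z) (Fb A i) (evF A s) (evF A t) (e A)"
  using assms by (simp add: kinds_iso_def)
 show "ys : Ob (E A Z) ==> isoh (Fb A i) (e A ys) (FO (evF A s) ys) (FO (evF A t) ys)"
  "fs : hom (E A Z) as bs ==> e A bs *[Fb A i] FA (evF A s) fs = FA (evF A t) fs *[Fb A i] e A as"
  using nat_iso_isoh[OF n] nat_iso_nat[OF n] by blast+
qed

text \<open>The two ways from \<open>H\<close> applied to the source in \<open>A\<close> to the
  target evaluated in \<open>B\<close>. The five compatibility conditions on a morphism are
  instances of this square.\<close>

definition mor_kind where
 "mor_kind A B H Z i s t e ys \<longleftrightarrow>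
  e B (HO H Z ys) *[Fb B i] rhoT A B H ys s = rhoT A B H ys t *[Fb B i] FA (HH H i) (e A ys)"

definition mor_kinds where
 "mor_kinds A B H \<longleftrightarrow> (ALL Z i s t e ys. kind Z i s t e --> ys : Ob (E A Z) --> mor_kind A B H Z i s t e ys)"

definition mor_ext :: "('io, 'ia, 't, 'h, 'u) alg => ('io, 'h, 'u) mor => bool" where
 "mor_ext A H \<longleftrightarrow> HH H : extensional (Ob Q) & (ALL i:Ob Q. func_ext (Fb A i) (HH H i)) &
  (ALL m q x ys. ~ rho_index \<Theta> I A m q x ys --> rho H m q x ys = undefined)"

lemma rho_index_iff:
 "q : TH m w ws ==> rho_index \<Theta> I A m q x ys \<longleftrightarrow> x : Ob (P m) & ys : Ob (E A (fibs ws x))"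
 unfolding rho_index_def Xw_simps using ThetaHom_unique by blast

lemma rho_indexE:
 assumes "rho_index \<Theta> I A m q x ys"
 obtains w ws where "q : TH m w ws" "x : Ob (P m)" "ys : Ob (E A (fibs ws x))"
 using assms unfolding rho_index_def Xw_simps by blast

context
 fixes A B :: "('io, 'ia, 't, 'h, 'u) alg" and H :: "('io, 'h, 'u) mor"
 assumes A: "prealg A" and B: "prealg B" and H: "premor A B H"
begin

text \<open>Arguments that contribute identities make the factor after \<open>\<rho>\<close> an
  identity. For this reason \<open>rhoT\<close> at most terms of \<open>kind\<close> is a single
  component of \<open>\<rho>\<close>, possibly transported.\<close>

lemma rhoT_Op:
 assumes "q : TH m w ws" "x : Ob (P m)" "zs : Ob (E A (fibs ws x))"
  and "map (%t. FO (evF A t) ys) ts = zs"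
  and "map (rhoT A B H ys) ts = map2 (%i. Ident (Fb B i)) (fibs ws x) (HO H (fibs ws x) zs)"
 shows "rhoT A B H ys (Op m q x ts) = rho H m q x zs"
proof -
 note Z = fibs_ob[OF assms(1,2)]
 have "FA (phi B m q x) (map (rhoT A B H ys) ts) = Ident (Fb B (fib w x)) (FO (phi B m q x) (HO H (fibs ws x) zs))"
  using functor_ident[OF functor_phi[OF B assms(1,2)] HO_ob[OF H Z assms(3)]]
  unfolding assms(5) prod_cat_simps(2) map2_map_left .
 then show ?thesis
  using comp_ident_left[OF category_Fb[OF B] isoh_hom[OF premor_rho(1)[OF H assms(1-3)]]]
   fib_ob[OF _ assms(2)] ThetaHomD[OF assms(1)]
  by (simp add: out_eq[OF assms(1)] assms(4))
qed

lemma rhoT_vars_Op: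
 assumes "q : TH m w ws" "x : Ob (P m)" "ys : Ob (E A (fibs ws x))"
 shows "rhoT A B H ys (Op m q x (vars (fibs ws x))) = rho H m q x ys"
proof -
 have l: "length ys = length (fibs ws x)" using assms(3) unfolding E_ob by blast
 show ?thesis by (rule rhoT_Op[OF assms ev_vars(1)[OF l] rhoT_vars[OF l]])
qed

lemma pick_E_ob:
 assumes "ys : Ob (E A (fibs ws x))" "set io <= {..<length ws}"
 shows "pick ys io : Ob (E A (fibs (pick ws io) x))"
proof -
 have "io ! n < length ws" if "n < length io" for n using assms(2) nth_mem[OF that] by blast
 then show ?thesis using assms(1) unfolding E_ob by simp
qed

lemma rhoT_pick:
 assumes "q : TH m w (pick ws io)" "x : Ob (P m)" "ys : Ob (E A (fibs ws x))" "set io <= {..<length ws}"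
 shows "rhoT A B H ys (Op m q x (pick (vars (fibs ws x)) io)) = rho H m q x (pick ys io)"
proof (rule rhoT_Op[OF assms(1,2) pick_E_ob[OF assms(3,4)]])
 have l: "length ys = length (fibs ws x)" using assms(3) unfolding E_ob by blast
 show "map (%t. FO (evF A t) ys) (pick (vars (fibs ws x)) io) = pick ys io"
  using assms(4) ev_vars(1)[OF l] by (simp add: map_pick)
 have "io ! n < length ws" if "n < length io" for n using assms(4) nth_mem[OF that] by blast
 then show "map (rhoT A B H ys) (pick (vars (fibs ws x)) io)
  = map2 (%i. Ident (Fb B i)) (fibs (pick ws io) x) (HO H (fibs (pick ws io) x) (pick ys io))"
  using l by (intro nth_equalityI) simp_all
qed

lemma tr_args_ob:
 assumes "ys : Ob (E A (fibs (map k ws) x))" "!!v. v : set ws ==> h v : hom Q (fib (k v) x) (fib v y)"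
 shows "map2 (%v. FO (tr A (h v))) ws ys : Ob (E A (fibs ws y))"
 using assms(1) functor_ob[OF functor_tr[OF A assms(2)]] unfolding E_ob by simp

lemma rhoT_args_Tr:
 assumes "q : TH m w ws" "y : Ob (P m)" "ys : Ob (E A (fibs (map k ws) x))"
  and h: "!!v. v : set ws ==> h v : hom Q (fib (k v) x) (fib v y)"
 shows "rhoT A B H ys (Op m q y (map2 (%v. Tr (h v)) ws (vars (fibs (map k ws) x))))
  = rho H m q y (map2 (%v. FO (tr A (h v))) ws ys)"
proof (rule rhoT_Op[OF assms(1,2) tr_args_ob[OF assms(3) h]])
 have l: "length ys = length ws" and y: "!!n. n < length ws ==> ys ! n : Ob (Fb A (fib (k (ws ! n)) x))"
  using assms(3) unfolding E_ob by auto
 show "map (%t. FO (evF A t) ys) (map2 (%v. Tr (h v)) ws (vars (fibs (map k ws) x))) = map2 (%v. FO (tr A (h v))) ws ys"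
  using l by (intro nth_equalityI) simp_all
 show "map (rhoT A B H ys) (map2 (%v. Tr (h v)) ws (vars (fibs (map k ws) x)))
  = map2 (%i. Ident (Fb B i)) (fibs ws y) (HO H (fibs ws y) (map2 (%v. FO (tr A (h v))) ws ys))"
 proof (rule nth_equalityI)
  fix n assume "n < length (map (rhoT A B H ys) (map2 (%v. Tr (h v)) ws (vars (fibs (map k ws) x))))"
  then have n: "n < length ws" by simp
  note hn = h[OF nth_mem[OF n]]
  have i: "fib (k (ws ! n)) x : Ob Q" using hom_ob[OF category_P hn] by blast
  have "FA (tr B (h (ws ! n))) (Ident (Fb B (fib (k (ws ! n)) x)) (FO (HH H (fib (k (ws ! n)) x)) (ys ! n)))
   = Ident (Fb B (fib (ws ! n) y)) (FO (HH H (fib (ws ! n) y)) (FO (tr A (h (ws ! n))) (ys ! n)))"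
   using functor_ident[OF functor_tr[OF B hn] functor_ob[OF premor_HH[OF H i] y[OF n]]] premor_tr(1)[OF H hn y[OF n]] by simp
  then show "map (rhoT A B H ys) (map2 (%v. Tr (h v)) ws (vars (fibs (map k ws) x))) ! n
   = map2 (%i. Ident (Fb B i)) (fibs ws y) (HO H (fibs ws y) (map2 (%v. FO (tr A (h v))) ws ys)) ! n"
   using n l by simp
 qed (use l in simp)
qed

lemma blocks_E_ob:
 assumes "ys : Ob (E A (fibs (concat wss) x))" "i < length wss"
 shows "blocks (map length wss) ys ! i : Ob (E A (fibs (wss ! i) x))"
proof -
 have "list_all2 (%y C. y : Ob C) ys (concat (map (%ws. map (Fb A) (fibs ws x)) wss))"
  using assms(1) by (simp add: list_all2_conv_all_nth map_concat o_def)
 then have "list_all2 (list_all2 (%y C. y : Ob C)) (blocks (map length wss) ys) (map (%ws. map (Fb A) (fibs ws x)) wss)"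
  using list_all2_blocks[of "%y C. y : Ob C" ys "map (%ws. map (Fb A) (fibs ws x)) wss"] by (simp add: o_def)
 then have "list_all2 (%y C. y : Ob C) (blocks (map length wss) ys ! i) (map (Fb A) (fibs (wss ! i) x))"
  using assms(2) list_all2_nthD2 by fastforce
 then show ?thesis by (auto simp: list_all2_conv_all_nth)
qed

lemma rhoT_comp_blocks:
 assumes "THs m qs ws wss" "x : Ob (P m)" "ys : Ob (E A (fibs (concat wss) x))"
 shows "map (rhoT A B H ys) (map2 (%q' ts. Op m q' x ts) qs (blocks (map length wss) (vars (fibs (concat wss) x))))
  = map2 (%q'. rho H m q' x) qs (blocks (map length wss) ys)"
proof (rule nth_equalityI)
 let ?Z = "fibs (concat wss) x" and ?b = "blocks (map length wss)"
 have l: "length qs = length ws" "length wss = length ws" using assms(1) by (auto simp: ThetaHoms_def)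
 have ly: "length ys = length ?Z" using assms(3) unfolding E_ob by blast
 have bZ: "?b ?Z = map (%ws. fibs ws x) wss"
  by (simp add: map_concat blocks_concat o_def)
 fix n assume "n < length (map (rhoT A B H ys) (map2 (%q' ts. Op m q' x ts) qs (?b (vars ?Z))))"
 then have n: "n < length ws" using l by simp
 have q: "qs ! n : TH m (ws ! n) (wss ! n)" using assms(1) n by (auto simp: ThetaHoms_def)
 have 1: "map (%t. FO (evF A t) ys) (?b (vars ?Z) ! n) = ?b ys ! n"
  using arg_cong[OF ev_vars(1)[OF ly], of "%z. ?b z ! n"] n l by (simp add: map_blocks)
 have "map (rhoT A B H ys) (?b (vars ?Z) ! n) = ?b (map2 (%i. Ident (Fb B i)) ?Z (HO H ?Z ys)) ! n"
  using arg_cong[OF rhoT_vars[OF ly], of "%z. ?b z ! n"] n l by (simp add: map_blocks)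
 also have "\<dots> = map2 (%i. Ident (Fb B i)) (fibs (wss ! n) x) (HO H (fibs (wss ! n) x) (?b ys ! n))"
  using n l ly by (simp add: blocks_map2 bZ)
 finally have 2: "map (rhoT A B H ys) (?b (vars ?Z) ! n)
  = map2 (%i. Ident (Fb B i)) (fibs (wss ! n) x) (HO H (fibs (wss ! n) x) (?b ys ! n))" .
 have "?b ys ! n : Ob (E A (fibs (wss ! n) x))" using blocks_E_ob[OF assms(3)] n l by simp
 from rhoT_Op[OF q assms(2) this 1 2]
 show "map (rhoT A B H ys) (map2 (%q' ts. Op m q' x ts) qs (?b (vars ?Z))) ! n = map2 (%q'. rho H m q' x) qs (?b ys) ! n"
  using n l by (simp del: rhoT.simps)
qed (use assms(1) in \<open>auto simp: ThetaHoms_def\<close>)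

lemma rhoT_args_hom:
 assumes "list_all2 (wt Z) ts \<Delta>" "ys : Ob (E A Z)"
 shows "map (rhoT A B H ys) ts
  : hom (E B \<Delta>) (HO H \<Delta> (map (%t. FO (evF A t) ys) ts)) (map (%t. FO (evF B t) (HO H Z ys)) ts)"
 unfolding E_hom
 using rhoT_isoh[OF A B H _ assms(2), THEN isoh_hom] assms(1) by (auto simp: list_all2_conv_all_nth)

lemma mor_kind_fun:
 assumes "io : index_maps p (length ws)" "q : TH m w (pick ws io)" "set ws <= KW m" "x : Ob (P m)"
  "ys : Ob (E A (fibs ws x))"
 shows "mor_kind A B H (fibs ws x) (fib w x) (Op m (Ofn m ws io q) x (vars (fibs ws x)))
   (Op m q x (pick (vars (fibs ws x)) io)) (%A. e_fun A m ws io q x) ys \<longleftrightarrow>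
  e_fun B m ws io q x (HO H (fibs ws x) ys) *[Fb B (fib w x)] rho H m (Ofn m ws io q) x ys
   = rho H m q x (pick ys io) *[Fb B (fib w x)] FA (HH H (fib w x)) (e_fun A m ws io q x ys)"
proof -
 have io: "set io <= {..<length ws}" using index_mapsD[OF assms(1)] by simp
 show ?thesis
  unfolding mor_kind_def rhoT_pick[OF assms(2,4,5) io] rhoT_vars_Op[OF Ofun_hom[OF assms(2,3) io] assms(4,5)] ..
qed

lemma mor_kind_sub:
 assumes "f : index_maps m l" "q : TH m w ws" "x : Ob (P l)" "ys : Ob (E A (fibs (map (ksb l f) ws) x))"
 shows "mor_kind A B H (fibs (map (ksb l f) ws) x) (fib w (pick x f))
   (Tr (sQ l f w x) (Op l (Osb l f q) x (vars (fibs (map (ksb l f) ws) x))))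
   (Op m q (pick x f) (map2 (%w. Tr (sQ l f w x)) ws (vars (fibs (map (ksb l f) ws) x)))) (%A. e_sub A l f q x) ys \<longleftrightarrow>
  e_sub B l f q x (HO H (fibs (map (ksb l f) ws) x) ys) *[Fb B (fib w (pick x f))] FA (tr B (sQ l f w x)) (rho H l (Osb l f q) x ys)
   = rho H m q (pick x f) (map2 (%w. FO (tr A (sQ l f w x))) ws ys) *[Fb B (fib w (pick x f))] FA (HH H (fib w (pick x f))) (e_sub A l f q x ys)"
proof -
 have "rhoT A B H ys (Op m q (pick x f) (map2 (%v. Tr (sQ l f v x)) ws (vars (fibs (map (ksb l f) ws) x))))
  = rho H m q (pick x f) (map2 (%v. FO (tr A (sQ l f v x))) ws ys)"
  by (rule rhoT_args_Tr[OF assms(2) pick_ob[OF assms(3,1)] assms(4)]) (rule sQ_homs[OF assms(2,1,3) insertI2])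
 then show ?thesis
  unfolding mor_kind_def rhoT.simps(3) rhoT_vars_Op[OF Osub_hom[OF assms(2,1)] assms(3,4)] by simp
qed

lemma mor_kind_pull:
 assumes "q : TH m w ws" "length us = m" "word_list TT us" "x : Ob (P (arsum us))"
  "ys : Ob (E A (fibs (map (kgm us) ws) x))"
 shows "mor_kind A B H (fibs (map (kgm us) ws) x) (fib w (PhiS TT I us x))
   (Tr (cQ us w x) (Op (arsum us) (Opl us q) x (vars (fibs (map (kgm us) ws) x))))
   (Op m q (PhiS TT I us x) (map2 (%w. Tr (cQ us w x)) ws (vars (fibs (map (kgm us) ws) x)))) (%A. e_pull A us q x) ys \<longleftrightarrow>
  e_pull B us q x (HO H (fibs (map (kgm us) ws) x) ys) *[Fb B (fib w (PhiS TT I us x))] FA (tr B (cQ us w x)) (rho H (arsum us) (Opl us q) x ys)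
   = rho H m q (PhiS TT I us x) (map2 (%w. FO (tr A (cQ us w x))) ws ys) *[Fb B (fib w (PhiS TT I us x))] FA (HH H (fib w (PhiS TT I us x))) (e_pull A us q x ys)"
proof -
 have x: "PhiS TT I us x : Ob (P m)" using PhiS_ob[OF assms(3,4)] assms(2) by simp
 have "rhoT A B H ys (Op m q (PhiS TT I us x) (map2 (%v. Tr (cQ us v x)) ws (vars (fibs (map (kgm us) ws) x))))
  = rho H m q (PhiS TT I us x) (map2 (%v. FO (tr A (cQ us v x))) ws ys)"
  by (rule rhoT_args_Tr[OF assms(1) x assms(5)]) (rule cQ_homs[OF assms(1-4) insertI2])
 then show ?thesis
  unfolding mor_kind_def rhoT.simps(3) rhoT_vars_Op[OF Opull_hom[OF assms(1-3)] assms(4,5)] by simp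
qed

text \<open>The one kind with operations nested in operations. Apart from the evaluation of
  \<open>rhoT\<close> the composite has to be reassociated to match \<open>alg_mor\<close>.\<close>

lemma mor_kind_comp:
 assumes K: "kinds_iso A" and a: "q : TH m w ws" "THs m qs ws wss" "x : Ob (P m)"
  and ys: "ys : Ob (E A (fibs (concat wss) x))"
 shows "mor_kind A B H (fibs (concat wss) x) (fib w x) (Op m (Ocp m q qs) x (vars (fibs (concat wss) x)))
   (Op m q x (map2 (%q' ts. Op m q' x ts) qs (blocks (map length wss) (vars (fibs (concat wss) x))))) (%A. e_comp A m q qs x) ys \<longleftrightarrow>
  e_comp B m q qs x (HO H (fibs (concat wss) x) ys) *[Fb B (fib w x)] rho H m (Ocp m q qs) x ys
   = FA (phi B m q x) (map2 (%q'. rho H m q' x) qs (blocks (map length wss) ys)) *[Fb B (fib w x)]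
    rho H m q x (phis A m qs wss x ys) *[Fb B (fib w x)] FA (HH H (fib w x)) (e_comp A m q qs x ys)"
proof -
 let ?Z = "fibs (concat wss) x" and ?b = "blocks (map length wss)" and ?C = "Fb B (fib w x)"
 let ?ts = "map2 (%q' ts. Op m q' x ts) qs (?b (vars ?Z))"
 note k = k_comp[OF a refl]
 have wt: "list_all2 (wt ?Z) ?ts (fibs ws x)"
  using kind_wt[OF k] a(1) by (auto elim!: wt.cases[of _ "Op m q x ?ts"] dest: ThetaHom_unique)
 have i: "fib w x : Ob Q" using fib_ob[OF _ a(3)] ThetaHomD[OF a(1)] by blast
 have ly: "length ys = length ?Z" using ys unfolding E_ob by blast
 have "?b ys = map (map (%t. FO (evF A t) ys)) (?b (vars ?Z))"
  by (metis map_blocks ev_vars(1) ly)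
 then have ev: "map (%t. FO (evF A t) ys) ?ts = phis A m qs wss x ys"
  by (simp add: phis_def zip_map2 o_def case_prod_unfold)
 have rs: "rhoT A B H ys (Op m q x ?ts) = FA (phi B m q x) (map (rhoT A B H ys) ?ts) *[?C] rho H m q x (phis A m qs wss x ys)"
  by (simp add: out_eq[OF a(1)] ev[symmetric] del: map_map)
 let ?zs = "phis A m qs wss x ys"
 have zs: "?zs : Ob (E A (fibs ws x))" using evF_args[OF A wt ys] ev by simp
 note r = isoh_hom[OF premor_rho(1)[OF H a(1,3) zs]]
 have e: "FA (HH H (fib w x)) (e_comp A m q qs x ys) : hom ?C (FO (HH H (fib w x)) (FO (evF A (Op m (Ocp m q qs) x (vars ?Z))) ys))
   (FO (HH H (fib w x)) (FO (phi A m q x) ?zs))"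
  using functor_hom[OF premor_HH[OF H i] isoh_hom[OF kinds_isoD(1)[OF K k ys]]] ev by (simp add: o_def)
 have "map (rhoT A B H ys) ?ts : hom (E B (fibs ws x)) (HO H (fibs ws x) ?zs) (map (%t. FO (evF B t) (HO H ?Z ys)) ?ts)"
  by (rule rhoT_args_hom[OF wt ys, unfolded ev])
 from functor_hom[OF functor_phi[OF B a(1,3)] this]
 have "(FA (phi B m q x) (map (rhoT A B H ys) ?ts) *[?C] rho H m q x ?zs) *[?C] FA (HH H (fib w x)) (e_comp A m q qs x ys)
  = FA (phi B m q x) (map (rhoT A B H ys) ?ts) *[?C] rho H m q x ?zs *[?C] FA (HH H (fib w x)) (e_comp A m q qs x ys)"
  by (rule comp_assoc[OF category_Fb[OF B i] e r])
 then show ?thesis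
  unfolding mor_kind_def rs rhoT_vars_Op[OF Ocomp_hom[OF a(1,2)] a(3) ys] rhoT_comp_blocks[OF a(2,3) ys] by simp
qed

text \<open>The target is a variable, where \<open>rhoT\<close> is an identity and drops
  out.\<close>

lemma mor_kind_unit:
 assumes K: "kinds_iso A" and a: "w : KW m" "x : Ob (P m)" and y: "y : Ob (Fb A (fib w x))"
 shows "mor_kind A B H [fib w x] (fib w x) (Op m (Oun m w) x (vars [fib w x])) (V (fib w x) 0) (%A. e_unit A m w x) [y] \<longleftrightarrow>
  e_unit B m w x [FO (HH H (fib w x)) y] *[Fb B (fib w x)] rho H m (Oun m w) x [y] = FA (HH H (fib w x)) (e_unit A m w x [y])"
proof -
 note i = fib_ob[OF a]
 have ys: "[y] : Ob (E A (fibs [w] x))" using y by simp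
 have "FA (HH H (fib w x)) (e_unit A m w x [y]) : hom (Fb B (fib w x)) (FO (HH H (fib w x)) (FO (evF A (Op m (Oun m w) x (vars [fib w x]))) [y])) (FO (HH H (fib w x)) y)"
  using functor_hom[OF premor_HH[OF H i] isoh_hom[OF kinds_isoD(1)[OF K k_unit[OF a], of "[y]"]]] y by simp
 from comp_ident_left[OF category_Fb[OF B i] this] show ?thesis
  unfolding mor_kind_def using rhoT_vars_Op[OF Ounit_hom[OF a(1)] a(2) ys] by (simp del: rhoT.simps(2))
qed

end

text \<open>Through this form, composites, projections and liftings of morphisms are treated for the
  five kinds at once.\<close>

lemma alg_mor_iff:
 assumes A: "prealg A" "kinds_iso A" and B: "prealg B"
 shows "amor A B H \<longleftrightarrow> premor A B H & mor_ext A H & mor_kinds A B H"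
proof
 assume M: "amor A B H"
 have H: "premor A B H" and X: "mor_ext A H"
  using M by (simp_all add: alg_mor_def premor_def mor_ext_def Let_def)
 note M' = M[unfolded alg_mor_def Let_def Xw_simps Hw_simps trs_simp, THEN c2, THEN c2, THEN c2, THEN c2, THEN c2]
 note M1 = M'[THEN c1, rule_format] and M2 = M'[THEN c2, THEN c1, rule_format]
  and M3 = M'[THEN c2, THEN c2, THEN c1, rule_format]
  and M4 = M'[THEN c2, THEN c2, THEN c2, THEN c1, rule_format]
  and M5 = M'[THEN c2, THEN c2, THEN c2, THEN c2, rule_format]
 have "mor_kind A B H Z i s t e ys" if "kind Z i s t e" "ys : Ob (E A Z)" for Z i s t e ys
  using that
 proof (induction rule: kind.induct)
  case (k_unit w m x)
  then obtain y where y: "ys = [y]" "y : Ob (Fb A (fib w x))" by (auto simp: list_all2_Cons1)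
  show ?case
   unfolding y(1) mor_kind_unit[OF A(1) B H A(2) k_unit(1,2) y(2)] by (rule M1[OF k_unit(1,2) y(2)])
 next
  case (k_comp q m w ws qs wss x Z)
  note ys = k_comp(5)[unfolded k_comp(4)]
  show ?case
   unfolding k_comp(4) mor_kind_comp[OF A(1) B H A(2) k_comp(1-3) ys] unfolding trs_simp by (rule M2[OF k_comp(1-3) ys])
 next
  case (k_fun io p ws q m w x Z)
  note ys = k_fun(6)[unfolded k_fun(5)]
  show ?case
   unfolding k_fun(5) mor_kind_fun[OF A(1) B H k_fun(1-4) ys] unfolding trs_simp by (rule M3[OF k_fun(1-4) ys])
 next
  case (k_sub f m l q w ws x Z)
  note ys = k_sub(5)[unfolded k_sub(4)]
  show ?case
   unfolding k_sub(4) mor_kind_sub[OF A(1) B H k_sub(1-3) ys] unfolding trs_simp by (rule M4[OF k_sub(1-3) ys])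
 next
  case (k_pull q m w ws us N x Z)
  note ys = k_pull(7)[unfolded k_pull(6)] and x = k_pull(5)[unfolded k_pull(4)]
  show ?case
   unfolding k_pull(4,6) mor_kind_pull[OF A(1) B H k_pull(1-3) x ys] unfolding trs_simp
   by (rule M5[OF k_pull(1) conjI[OF k_pull(2,3)] x ys])
 qed
 with H X show "premor A B H & mor_ext A H & mor_kinds A B H" by (simp add: mor_kinds_def)
next
 assume *: "premor A B H & mor_ext A H & mor_kinds A B H"
 then have H: "premor A B H" and X: "mor_ext A H"
  and K: "!!Z i s t e ys. kind Z i s t e ==> ys : Ob (E A Z) ==> mor_kind A B H Z i s t e ys"
  by (auto simp: mor_kinds_def)
 show "amor A B H"
  unfolding alg_mor_def Let_def
 proof (intro conjI allI ballI impI; (unfold Xw_simps Hw_simps trs_simp)?)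
  show "nat_to_Cat Q (XX A) (XX B) (HH H)" using H by (simp add: premor_def)
  show "HH H : extensional (Ob Q)" using X by (simp add: mor_ext_def)
  show "func_ext (Fb A i) (HH H i)" if "i : Ob Q" for i using X that by (simp add: mor_ext_def)
  show "rho H m q x ys = undefined" if "~ rho_index \<Theta> I A m q x ys" for m q x ys using X that by (simp add: mor_ext_def)
  show "inv_modif (P m) (Xws I (XX A) ws) (Xw I (XX B) w)
     (%x. comp_func (HH H (fib w x)) (phi A m q x))
     (%x. comp_func (phi B m q x) (prod_func (map (%w. HH H (fib w x)) ws)))
     (rho H m q)" if "q : TH m w ws" for m w ws q
   using H that by (simp add: premor_def Hw_simps)
 next
  fix m w x y assume a: "w : KW m" "x : Ob (P m)" and y: "y : Ob (Fb A (fib w x))"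
  show "e_unit B m w x [FO (HH H (fib w x)) y] *[Fb B (fib w x)] rho H m (Oun m w) x [y]
    = FA (HH H (fib w x)) (e_unit A m w x [y])"
   using K[OF k_unit[OF a], of "[y]"] y unfolding mor_kind_unit[OF A(1) B H A(2) a y] by simp
 next
  fix m w ws wss qs q x ys assume a: "q : TH m w ws" "THs m qs ws wss" "x : Ob (P m)"
   and ys: "ys : Ob (E A (fibs (concat wss) x))"
  show "e_comp B m q qs x (map2 (%w. FO (HH H (fib w x))) (concat wss) ys) *[Fb B (fib w x)] rho H m (Ocp m q qs) x ys
   = FA (phi B m q x) (map2 (%q'. rho H m q' x) qs (blocks (map length wss) ys)) *[Fb B (fib w x)]
    rho H m q x (phis A m qs wss x ys) *[Fb B (fib w x)] FA (HH H (fib w x)) (e_comp A m q qs x ys)"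
   using K[OF k_comp[OF a refl] ys, unfolded mor_kind_comp[OF A(1) B H A(2) a ys]] unfolding trs_simp .
 next
  fix m w ws p io q x ys assume a: "io : index_maps p (length ws)" "q : TH m w (pick ws io)" "set ws <= KW m" "x : Ob (P m)"
   and ys: "ys : Ob (E A (fibs ws x))"
  show "e_fun B m ws io q x (map2 (%w. FO (HH H (fib w x))) ws ys) *[Fb B (fib w x)] rho H m (Ofn m ws io q) x ys
   = rho H m q x (pick ys io) *[Fb B (fib w x)] FA (HH H (fib w x)) (e_fun A m ws io q x ys)"
   using K[OF k_fun[OF a refl] ys, unfolded mor_kind_fun[OF A(1) B H a ys]] unfolding trs_simp .
 next
  fix m l w ws f q x ys assume a: "f : index_maps m l" "q : TH m w ws" "x : Ob (P l)"
   and ys: "ys : Ob (E A (fibs (map (ksb l f) ws) x))"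
  show "e_sub B l f q x (map2 (%xa. FO (HH H (fib (ksb l f xa) x))) ws ys) *[Fb B (fib w (pick x f))]
    FA (tr B (sQ l f w x)) (rho H l (Osb l f q) x ys)
   = rho H m q (pick x f) (map2 (%w. FO (tr A (sQ l f w x))) ws ys) *[Fb B (fib w (pick x f))]
    FA (HH H (fib w (pick x f))) (e_sub A l f q x ys)"
   using K[OF k_sub[OF a refl] ys, unfolded mor_kind_sub[OF A(1) B H a ys]] unfolding trs_simp .
 next
  fix m w ws us q x ys assume a: "q : TH m w ws" "length us = m & word_list TT us" "x : Ob (P (arsum us))"
   and ys: "ys : Ob (E A (fibs (map (kgm us) ws) x))"
  note a' = a(1) conjunct1[OF a(2)] conjunct2[OF a(2)]
  show "e_pull B us q x (map2 (%xa. FO (HH H (fib (kgm us xa) x))) ws ys) *[Fb B (fib w (PhiS TT I us x))]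
    FA (tr B (cQ us w x)) (rho H (arsum us) (Opl us q) x ys)
   = rho H m q (PhiS TT I us x) (map2 (%w. FO (tr A (cQ us w x))) ws ys) *[Fb B (fib w (PhiS TT I us x))]
    FA (HH H (fib w (PhiS TT I us x))) (e_pull A us q x ys)"
   using K[OF k_pull[OF a' refl a(3) refl] ys, unfolded mor_kind_pull[OF A(1) B H a' a(3) ys]] unfolding trs_simp .
 qed
qed

end

section \<open>Composites and identities of morphisms\<close>

lemma is_functor_cong:
 assumes C: "category C" and "func_eq C F G" "is_functor C D F"
 shows "is_functor C D G"
proof -
 have "Ident C x : Ar C" if "x : Ob C" for x using homD[OF ident_hom[OF C that]] by blast
 moreover have "g *[C] f : Ar C" if "f : Ar C" "g : Ar C" "Cod C f = Dom C g" for f g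
  using comp_hom[OF C homI[OF that(1)], of g "Cod C g"] that homI[OF that(2)] homD by metis
 moreover have "Dom C f : Ob C & Cod C f : Ob C" if "f : Ar C" for f using hom_ob[OF C homI[OF that]] .
 ultimately show ?thesis using assms(2,3) by (simp add: func_eq_def is_functor_def)
qed

text \<open>Pasting of two commuting squares, the pattern of many diagram chases below.\<close>

lemma comp_square:
 assumes C: "category C" and h: "f : hom C x y" "g : hom C y z" "f' : hom C x' y'" "g' : hom C y' z'"
  "u : hom C x x'" "v : hom C y y'" "w : hom C z z'"
  and s: "v *[C] f = f' *[C] u" "w *[C] g = g' *[C] v"
 shows "w *[C] (g *[C] f) = (g' *[C] f') *[C] u"
 using comp_assoc[OF C h(1,2,7)] comp_assoc[OF C h(1,6,4)] comp_assoc[OF C h(5,3,4)] s by simp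

context T_algebra
begin

lemma mor_eqI:
 assumes "mor_ext A G" "mor_ext A H"
  and "!!i a. i : Ob Q ==> a : Ob (Fb A i) ==> FO (HH G i) a = FO (HH H i) a"
  and "!!i f. i : Ob Q ==> f : Ar (Fb A i) ==> FA (HH G i) f = FA (HH H i) f"
  and "!!m w ws q x ys. q : TH m w ws ==> x : Ob (P m) ==> ys : Ob (E A (fibs ws x)) ==>
   rho G m q x ys = rho H m q x ys"
 shows "G = H"
proof -
 have "HH G i = HH H i" if i: "i : Ob Q" for i
 proof (rule func.equality)
  have *: "FO (HH G i) : extensional (Ob (Fb A i))" "FO (HH H i) : extensional (Ob (Fb A i))"
   "FA (HH G i) : extensional (Ar (Fb A i))" "FA (HH H i) : extensional (Ar (Fb A i))"
   using assms(1,2) i by (auto simp: mor_ext_def func_ext_def)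
  show "FO (HH G i) = FO (HH H i)" by (rule extensionalityI[OF *(1,2)]) (use assms(3) i in blast)
  show "FA (HH G i) = FA (HH H i)" by (rule extensionalityI[OF *(3,4)]) (use assms(4) i in blast)
 qed simp
 then have "HH G = HH H"
  using assms(1,2) by (intro extensionalityI[of _ "Ob Q"]) (auto simp: mor_ext_def)
 moreover have "rho G m q x ys = rho H m q x ys" for m q x ys
 proof (cases "rho_index \<Theta> I A m q x ys")
  case True
  then show ?thesis using assms(5) by (auto elim: rho_indexE)
 qed (use assms(1,2) in \<open>simp add: mor_ext_def\<close>)
 ultimately show ?thesis by (intro mor.equality) (auto intro!: ext)
qed

context
 fixes A B D :: "('io, 'ia, 't, 'h, 'u) alg" and H K :: "('io, 'h, 'u) mor"
begin

lemma comp_mor_FO: "i : Ob Q ==> a : Ob (Fb A i) ==> FO (HH (cmor A B D K H) i) a = FO (HH K i) (FO (HH H i) a)"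
 and comp_mor_FA: "i : Ob Q ==> f : Ar (Fb A i) ==> FA (HH (cmor A B D K H) i) f = FA (HH K i) (FA (HH H i) f)"
 and comp_mor_rho: "q : TH m w ws ==> x : Ob (P m) ==> ys : Ob (E A (fibs ws x)) ==>
  rho (cmor A B D K H) m q x ys
   = rho K m q x (HO H (fibs ws x) ys) *[Fb D (fib w x)] FA (HH K (fib w x)) (rho H m q x ys)"
 by (simp_all add: comp_mor_def restrict_func_def rho_index_iff out_eq ins_eq Xw_simps Hw_simps map2_map_left del: prod_cat_simps)

lemma comp_mor_ext: "mor_ext A (cmor A B D K H)"
 by (auto simp: mor_ext_def comp_mor_def restrict_func_def func_ext_def)

lemma comp_mor_HO: "set Z <= Ob Q ==> ys : Ob (E A Z) ==> HO (cmor A B D K H) Z ys = HO K Z (HO H Z ys)"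
 unfolding E_ob by (intro nth_equalityI) (auto simp: comp_mor_FO subset_iff)

lemma comp_mor_HA: "set Z <= Ob Q ==> fs : hom (E A Z) as bs ==>
  map2 (%i. FA (HH (cmor A B D K H) i)) Z fs = map2 (%i. FA (HH K i)) Z (map2 (%i. FA (HH H i)) Z fs)"
 unfolding E_hom by (intro nth_equalityI) (auto simp: comp_mor_FA subset_iff dest!: homD)

end

lemma HA_hom: "premor A B H ==> set Z <= Ob Q ==> fs : hom (E A Z) as bs ==>
  map2 (%i. FA (HH H i)) Z fs : hom (E B Z) (HO H Z as) (HO H Z bs)"
 using functor_hom[OF premor_HH] unfolding E_hom by (simp add: subset_iff)

lemma Theta_fib: "q : TH m w ws ==> x : Ob (P m) ==> fib w x : Ob Q"
 using fib_ob ThetaHomD by blast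

context
 fixes A B D :: "('io, 'ia, 't, 'h, 'u) alg" and H K :: "('io, 'h, 'u) mor"
 assumes A: "prealg A" and B: "prealg B" and D: "prealg D" and H: "premor A B H" and K: "premor B D K"
begin

lemma premor_comp: "premor A D (cmor A B D K H)"
proof (rule premorI, goal_cases)
 case (1 i)
 note i = 1
 show ?case
  by (rule is_functor_cong[OF category_Fb[OF A i] _ functor_compose[OF premor_HH[OF H i] premor_HH[OF K i]]])
   (simp add: func_eq_def comp_mor_FO comp_mor_FA i)
next
 case (2 h i i' a)
 note h = 2(1) and a = 2(2)
 have i: "i : Ob Q" "i' : Ob Q" using hom_ob[OF category_P h] by auto
 show ?case
  using premor_tr(1)[OF H h a] premor_tr(1)[OF K h functor_ob[OF premor_HH[OF H i(1)] a]] i a functor_ob[OF functor_tr[OF A h] a]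
  by (simp add: comp_mor_FO)
next
 case (3 h i i' f a b)
 note h = 3(1) and f = 3(2)
 have i: "i : Ob Q" "i' : Ob Q" using hom_ob[OF category_P h] by auto
 show ?case
  using premor_tr(2)[OF H h f] premor_tr(2)[OF K h functor_hom[OF premor_HH[OF H i(1)] f]] i homD[OF f]
   homD[OF functor_hom[OF functor_tr[OF A h] f]] by (simp add: comp_mor_FA)
next
 case (4 m w ws q x ys)
 note a = 4(1,2) and ys = 4(3)
 note Z = fibs_ob[OF a] and i = Theta_fib[OF a]
 have p: "FO (phi A m q x) ys : Ob (Fb A (fib w x))" by (rule functor_ob[OF functor_phi[OF A a] ys])
 show ?case
  unfolding comp_mor_rho[OF a ys] comp_mor_FO[OF i p] comp_mor_HO[OF Z ys]
  by (rule isoh_comp[OF category_Fb[OF D i] functor_isoh[OF category_Fb[OF B i] premor_HH[OF K i] premor_rho(1)[OF H a ys]]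
    premor_rho(1)[OF K a HO_ob[OF H Z ys]]])
next
 case (5 m w ws q x fs as bs)
 note a = 5(1,2) and fs = 5(3)
 note Z = fibs_ob[OF a] and i = Theta_fib[OF a]
 have ab: "as : Ob (E A (fibs ws x))" "bs : Ob (E A (fibs ws x))" using hom_ob[OF category_E[OF A Z] fs] by auto
 note p = functor_hom[OF functor_phi[OF A a] fs]
 note Hf = HA_hom[OF H Z fs]
 note r = premor_rho(1)[OF H a ab(1), THEN isoh_hom] premor_rho(1)[OF H a ab(2), THEN isoh_hom]
 have s: "FA (HH K (fib w x)) (FA (phi B m q x) (map2 (%i. FA (HH H i)) (fibs ws x) fs)) *[Fb D (fib w x)] FA (HH K (fib w x)) (rho H m q x as)
  = FA (HH K (fib w x)) (rho H m q x bs) *[Fb D (fib w x)] FA (HH K (fib w x)) (FA (HH H (fib w x)) (FA (phi A m q x) fs))"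
  using premor_rho(2)[OF H a fs] functor_comp[OF premor_HH[OF K i] r(1) functor_hom[OF functor_phi[OF B a] Hf]]
   functor_comp[OF premor_HH[OF K i] functor_hom[OF premor_HH[OF H i] p] r(2)] by simp
 show ?case
  unfolding comp_mor_rho[OF a ab(1)] comp_mor_rho[OF a ab(2)] comp_mor_FA[OF i homD[OF p, THEN c1]] comp_mor_HA[OF Z fs]
  by (rule comp_square[OF category_Fb[OF D i] functor_hom[OF premor_HH[OF K i] r(1)] premor_rho(1)[OF K a HO_ob[OF H Z ab(1)], THEN isoh_hom]
    functor_hom[OF premor_HH[OF K i] r(2)] premor_rho(1)[OF K a HO_ob[OF H Z ab(2)], THEN isoh_hom]
    functor_hom[OF premor_HH[OF K i] functor_hom[OF premor_HH[OF H i] p]]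
    functor_hom[OF premor_HH[OF K i] functor_hom[OF functor_phi[OF B a] Hf]]
    functor_hom[OF functor_phi[OF D a] HA_hom[OF K Z Hf]] s premor_rho(2)[OF K a Hf, symmetric], symmetric])
next
 case (6 m w ws q h x y ys)
 note q = 6(1) and h = 6(2) and ys = 6(3)
 have x: "x : Ob (P m)" "y : Ob (P m)" using hom_ob[OF category_P h] by auto
 have w: "w : KW m" "set ws <= KW m" using ThetaHomD[OF q] by auto
 note Z = fibs_ob[OF q x(1)] and i = Theta_fib[OF q x(1)] and hw = fibA_hom[OF w(1) h]
 have hv: "fibA v h : hom Q (fib v x) (fib v y)" if "v : set ws" for v using fibA_hom[OF _ h] w that by blast
 have ys': "trs A ws h ys : Ob (E A (fibs ws y))"
  using ys functor_ob[OF functor_tr[OF A hv]] unfolding E_ob by simp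
 have e: "HO H (fibs ws y) (trs A ws h ys) = trs B ws h (HO H (fibs ws x) ys)"
  using ys premor_tr(1)[OF H hv] unfolding E_ob by (intro nth_equalityI) simp_all
 note r = premor_rho(1)[OF H q x(1) ys, THEN isoh_hom]
 show ?case
  unfolding comp_mor_rho[OF q x(1) ys] comp_mor_rho[OF q x(2) ys'] e
   functor_comp[OF functor_tr[OF D hw] functor_hom[OF premor_HH[OF K i] r] premor_rho(1)[OF K q x(1) HO_ob[OF H Z ys], THEN isoh_hom]]
   premor_rho(3)[OF K q h HO_ob[OF H Z ys], symmetric] premor_rho(3)[OF H q h ys, symmetric] premor_tr(2)[OF K hw r] ..
qed

text \<open>At an operation, what \<open>H\<close> contributes to the arguments has to be exchanged
  with \<open>\<rho>\<close> of \<open>K\<close>. This is naturality of \<open>\<rho>\<close> in the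
  arguments; the rest is reassociation.\<close>

lemma rhoT_comp:
 assumes "wt Z t i" and Z: "set Z <= Ob Q" and ys: "ys : Ob (E A Z)"
 shows "rhoT A D (cmor A B D K H) ys t
  = rhoT B D K (HO H Z ys) t *[Fb D i] FA (HH K i) (rhoT A B H ys t)"
 using assms(1)
proof (induction rule: wt.induct)
 case (wt_V n)
 have "ys ! n : Ob (Fb A (Z ! n))" "length ys = length Z" using ys wt_V(1) unfolding E_ob by auto
 moreover have o: "FO (HH H (Z ! n)) (ys ! n) : Ob (Fb B (Z ! n))"
  using functor_ob[OF premor_HH[OF H wt_V(2)]] calculation(1) .
 ultimately show ?case
  using comp_ident_left[OF category_Fb[OF D wt_V(2)] ident_hom[OF category_Fb[OF D wt_V(2)] functor_ob[OF premor_HH[OF K wt_V(2)] o]]]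
   functor_ident[OF premor_HH[OF K wt_V(2)] o] wt_V by (simp add: comp_mor_FO)
next
 case (wt_Op q m w ws x ts)
 let ?KH = "cmor A B D K H" and ?C = "Fb D (fib w x)" and ?hs = "HO H Z ys"
 let ?\<Delta> = "fibs ws x" and ?ev = "map (%t. FO (evF A t) ys) ts" and ?evB = "map (%t. FO (evF B t) (HO H Z ys)) ts"
 let ?rH = "map (rhoT A B H ys) ts" and ?rK = "map (rhoT B D K ?hs) ts"
 have ts: "list_all2 (wt Z) ts ?\<Delta>" using wt_Op(3) by (auto simp: list_all2_conv_all_nth)
 have lt: "length ts = length ws" using ts by (auto simp: list_all2_conv_all_nth)
 note a = wt_Op(1,2) and \<Delta> = fibs_ob[OF wt_Op(1,2)] and i = Theta_fib[OF wt_Op(1,2)]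
 note hs = HO_ob[OF H Z ys]
 note ev = evF_args[OF A ts ys] and evB = evF_args[OF B ts hs]
 note rH = rhoT_args_hom[OF A B H ts ys] and rK = rhoT_args_hom[OF B D K ts hs]
 note krH = HA_hom[OF K \<Delta> rH]
 have 1: "map (rhoT A D ?KH ys) ts = ?rK *[E D ?\<Delta>] map2 (%i. FA (HH K i)) ?\<Delta> ?rH"
  using wt_Op(3) lt by (auto simp: list_all2_conv_all_nth intro!: nth_equalityI)
 note p1 = functor_hom[OF functor_phi[OF D a] krH] and p2 = functor_hom[OF functor_phi[OF D a] rK]
 note r1 = premor_rho(1)[OF H a ev, THEN isoh_hom] and r2 = premor_rho(1)[OF K a HO_ob[OF H \<Delta> ev], THEN isoh_hom]
  and r3 = premor_rho(1)[OF K a evB, THEN isoh_hom]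
 note k1 = functor_hom[OF premor_HH[OF K i] r1] and k2 = functor_hom[OF premor_HH[OF K i] functor_hom[OF functor_phi[OF B a] rH]]
 note C = category_Fb[OF D i]
 have "rhoT A D ?KH ys (Op m q x ts)
  = (FA (phi D m q x) ?rK *[?C] FA (phi D m q x) (map2 (%i. FA (HH K i)) ?\<Delta> ?rH)) *[?C]
   (rho K m q x (HO H ?\<Delta> ?ev) *[?C] FA (HH K (fib w x)) (rho H m q x ?ev))"
  unfolding rhoT.simps(2) out_eq[OF a(1)] 1 comp_mor_rho[OF a ev] functor_comp[OF functor_phi[OF D a] krH rK] ..
 also have "\<dots> = FA (phi D m q x) ?rK *[?C] (FA (phi D m q x) (map2 (%i. FA (HH K i)) ?\<Delta> ?rH) *[?C]
   (rho K m q x (HO H ?\<Delta> ?ev) *[?C] FA (HH K (fib w x)) (rho H m q x ?ev)))"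
  by (rule comp_assoc[OF C comp_hom[OF C k1 r2] p1 p2])
 also have "FA (phi D m q x) (map2 (%i. FA (HH K i)) ?\<Delta> ?rH) *[?C]
   (rho K m q x (HO H ?\<Delta> ?ev) *[?C] FA (HH K (fib w x)) (rho H m q x ?ev))
  = (FA (phi D m q x) (map2 (%i. FA (HH K i)) ?\<Delta> ?rH) *[?C] rho K m q x (HO H ?\<Delta> ?ev)) *[?C] FA (HH K (fib w x)) (rho H m q x ?ev)"
  by (rule comp_assoc[OF C k1 r2 p1, symmetric])
 also have "\<dots> = (rho K m q x ?evB *[?C] FA (HH K (fib w x)) (FA (phi B m q x) ?rH)) *[?C] FA (HH K (fib w x)) (rho H m q x ?ev)"
  unfolding premor_rho(2)[OF K a rH] ..
 also have "\<dots> = rho K m q x ?evB *[?C] (FA (HH K (fib w x)) (FA (phi B m q x) ?rH) *[?C] FA (HH K (fib w x)) (rho H m q x ?ev))"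
  by (rule comp_assoc[OF C k1 k2 r3])
 also have "FA (phi D m q x) ?rK *[?C] \<dots> = (FA (phi D m q x) ?rK *[?C] rho K m q x ?evB) *[?C]
   (FA (HH K (fib w x)) (FA (phi B m q x) ?rH) *[?C] FA (HH K (fib w x)) (rho H m q x ?ev))"
  by (rule comp_assoc[OF C comp_hom[OF C k1 k2] r3 p2, symmetric])
 also have "\<dots> = rhoT B D K ?hs (Op m q x ts) *[?C] FA (HH K (fib w x)) (rhoT A B H ys (Op m q x ts))"
  unfolding rhoT.simps(2) out_eq[OF a(1)] functor_comp[OF premor_HH[OF K i] r1 functor_hom[OF functor_phi[OF B a] rH]] ..
 finally show ?case .
next
 case (wt_Tr t i h i')
 have i: "i : Ob Q" using hom_ob[OF category_P wt_Tr(2)] by blast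
 note r = rhoT_isoh[OF A B H wt_Tr(1) ys, THEN isoh_hom]
 show ?case
  using functor_comp[OF functor_tr[OF D wt_Tr(2)] functor_hom[OF premor_HH[OF K i] r]
    rhoT_isoh[OF B D K wt_Tr(1) HO_ob[OF H Z ys], THEN isoh_hom, unfolded premor_tr(1)[OF K wt_Tr(2)]]]
   premor_tr(2)[OF K wt_Tr(2) r] wt_Tr(3) by simp
qed

text \<open>By \<open>rhoT_comp\<close> the square of the composite is the image under
  \<open>K\<close> of the square of \<open>H\<close>, pasted with the square of
  \<open>K\<close>.\<close>

lemma mor_kinds_comp:
 assumes "kinds_iso A" "kinds_iso B" "kinds_iso D" "mor_kinds A B H" "mor_kinds B D K"
 shows "mor_kinds A D (cmor A B D K H)"
 unfolding mor_kinds_def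
proof (intro allI impI)
 fix Z i s t e ys assume k: "kind Z i s t e" and ys: "ys : Ob (E A Z)"
 have Z: "set Z <= Ob Q" and s: "wt Z s i" and t: "wt Z t i" using kind_wt[OF k] by auto
 note i = wt_ob[OF s] and hs = HO_ob[OF H Z ys]
 note eA = kinds_isoD(1)[OF assms(1) k ys, THEN isoh_hom] and eB = kinds_isoD(1)[OF assms(2) k hs, THEN isoh_hom]
  and eD = kinds_isoD(1)[OF assms(3) k HO_ob[OF K Z hs], THEN isoh_hom]
 note rs = rhoT_isoh[OF A B H s ys, THEN isoh_hom] and rt = rhoT_isoh[OF A B H t ys, THEN isoh_hom]
 note qs = rhoT_isoh[OF B D K s hs, THEN isoh_hom] and qt = rhoT_isoh[OF B D K t hs, THEN isoh_hom]
 have 1: "e B (HO H Z ys) *[Fb B i] rhoT A B H ys s = rhoT A B H ys t *[Fb B i] FA (HH H i) (e A ys)"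
  using assms(4) k ys unfolding mor_kinds_def mor_kind_def by blast
 have 2: "e D (HO K Z (HO H Z ys)) *[Fb D i] rhoT B D K (HO H Z ys) s = rhoT B D K (HO H Z ys) t *[Fb D i] FA (HH K i) (e B (HO H Z ys))"
  using assms(5) k hs unfolding mor_kinds_def mor_kind_def by blast
 have 3: "FA (HH K i) (e B (HO H Z ys)) *[Fb D i] FA (HH K i) (rhoT A B H ys s)
  = FA (HH K i) (rhoT A B H ys t) *[Fb D i] FA (HH K i) (FA (HH H i) (e A ys))"
  using functor_comp[OF premor_HH[OF K i] rs eB] functor_comp[OF premor_HH[OF K i] functor_hom[OF premor_HH[OF H i] eA] rt] 1 by simp
 show "mor_kind A D (cmor A B D K H) Z i s t e ys"
  unfolding mor_kind_def rhoT_comp[OF s Z ys] rhoT_comp[OF t Z ys] comp_mor_HO[OF Z ys] comp_mor_FA[OF i homD[OF eA, THEN c1]]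
  by (rule comp_square[OF category_Fb[OF D i] functor_hom[OF premor_HH[OF K i] rs] qs functor_hom[OF premor_HH[OF K i] rt] qt
    functor_hom[OF premor_HH[OF K i] functor_hom[OF premor_HH[OF H i] eA]] functor_hom[OF premor_HH[OF K i] eB] eD 3 2])
qed

end

lemma alg_prealg: "palgebra A ==> prealg A" and alg_kinds: "palgebra A ==> kinds_iso A"
 by (auto simp: pseudo_algebra_def alg_data_iff)

lemma alg_mor_premor: "palgebra A ==> palgebra B ==> amor A B H ==> premor A B H"
 using alg_mor_iff[OF alg_prealg alg_kinds alg_prealg] by blast

lemma alg_mor_comp:
 assumes "palgebra A" "palgebra B" "palgebra D" "amor A B H" "amor B D K"
 shows "amor A D (cmor A B D K H)"
 using assms(4,5) premor_comp mor_kinds_comp comp_mor_ext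
 unfolding alg_mor_iff[OF alg_prealg[OF assms(1)] alg_kinds[OF assms(1)] alg_prealg[OF assms(2)]]
  alg_mor_iff[OF alg_prealg[OF assms(2)] alg_kinds[OF assms(2)] alg_prealg[OF assms(3)]]
  alg_mor_iff[OF alg_prealg[OF assms(1)] alg_kinds[OF assms(1)] alg_prealg[OF assms(3)]]
 using assms(1-3)[THEN alg_prealg] assms(1-3)[THEN alg_kinds] by blast

lemma id_mor_FO: "i : Ob Q ==> a : Ob (Fb A i) ==> FO (HH (idm A) i) a = a"
 and id_mor_FA: "i : Ob Q ==> f : Ar (Fb A i) ==> FA (HH (idm A) i) f = f"
 and id_mor_rho: "q : TH m w ws ==> x : Ob (P m) ==> ys : Ob (E A (fibs ws x)) ==>
  rho (idm A) m q x ys = Ident (Fb A (fib w x)) (FO (phi A m q x) ys)"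
 by (simp_all add: id_mor_def restrict_func_def id_func_def rho_index_iff out_eq Xw_simps del: prod_cat_simps)

lemma id_mor_HO: "set Z <= Ob Q ==> ys : Ob (E A Z) ==> HO (idm A) Z ys = ys"
 unfolding E_ob by (intro nth_equalityI) (auto simp: id_mor_FO subset_iff)

lemma id_mor_HA: "set Z <= Ob Q ==> fs : hom (E A Z) as bs ==> map2 (%i. FA (HH (idm A) i)) Z fs = fs"
 unfolding E_hom by (intro nth_equalityI) (auto simp: id_mor_FA subset_iff dest!: homD)

lemma premor_id:
 assumes A: "prealg A"
 shows "premor A A (idm A)"
proof (rule premorI, goal_cases)
 case (1 i)
 note i = 1
 have "is_functor (Fb A i) (Fb A i) id_func"
  using category_Fb[OF A i] homI by (auto simp: is_functor_def id_func_def category_def)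
 then show ?case
  by (rule is_functor_cong[OF category_Fb[OF A i], rotated]) (simp add: func_eq_def id_mor_FO id_mor_FA id_func_def i)
next
 case (2 h i i' a)
 note h = 2(1) and a = 2(2)
 show ?case
  using hom_ob[OF category_P h] a functor_ob[OF functor_tr[OF A h] a] by (simp add: id_mor_FO)
next
 case (3 h i i' f a b)
 note h = 3(1) and f = 3(2)
 show ?case
  using hom_ob[OF category_P h] homD[OF f] homD[OF functor_hom[OF functor_tr[OF A h] f]] by (simp add: id_mor_FA)
next
 case (4 m w ws q x ys)
 note a = 4(1,2) and ys = 4(3)
 note Z = fibs_ob[OF a] and i = Theta_fib[OF a]
 have p: "FO (phi A m q x) ys : Ob (Fb A (fib w x))" by (rule functor_ob[OF functor_phi[OF A a] ys])
 show ?case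
  unfolding id_mor_rho[OF a ys] id_mor_FO[OF i p] id_mor_HO[OF Z ys] by (rule isoh_ident[OF category_Fb[OF A i] p])
next
 case (5 m w ws q x fs as bs)
 note a = 5(1,2) and fs = 5(3)
 note Z = fibs_ob[OF a] and i = Theta_fib[OF a]
 have ab: "as : Ob (E A (fibs ws x))" "bs : Ob (E A (fibs ws x))" using hom_ob[OF category_E[OF A Z] fs] by auto
 note p = functor_hom[OF functor_phi[OF A a] fs]
 show ?case
  unfolding id_mor_rho[OF a ab(1)] id_mor_rho[OF a ab(2)] id_mor_FA[OF i homD[OF p, THEN c1]] id_mor_HA[OF Z fs]
   comp_ident_left[OF category_Fb[OF A i] p] comp_ident_right[OF category_Fb[OF A i] p] ..
next
 case (6 m w ws q h x y ys)
 note q = 6(1) and h = 6(2) and ys = 6(3)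
 have x: "x : Ob (P m)" "y : Ob (P m)" using hom_ob[OF category_P h] by auto
 have w: "w : KW m" "set ws <= KW m" using ThetaHomD[OF q] by auto
 note hw = fibA_hom[OF w(1) h]
 have hv: "fibA v h : hom Q (fib v x) (fib v y)" if "v : set ws" for v using fibA_hom[OF _ h] w that by blast
 have ys': "trs A ws h ys : Ob (E A (fibs ws y))"
  using ys functor_ob[OF functor_tr[OF A hv]] unfolding E_ob by simp
 show ?case
  unfolding id_mor_rho[OF q x(1) ys] id_mor_rho[OF q x(2) ys'] phi_nat(1)[OF A q h ys]
  by (rule functor_ident[OF functor_tr[OF A hw] functor_ob[OF functor_phi[OF A q x(1)] ys]])
qed

end

section \<open>The 2-category of pseudo algebras\<close>

context T_algebra
begin

text \<open>A 2-cell regardless of its values outside the fibres. Cells given by a formula have this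
  form; \<open>pcell_restrict\<close> supplies the representative that \<open>alg_cell\<close> asks
  for.\<close>

definition pcell ::
  "('io, 'ia, 't, 'h, 'u) alg => ('io, 'ia, 't, 'h, 'u) alg => ('io, 'h, 'u) mor => ('io, 'h, 'u) mor =>
  ('io list => 'u => 'u) => bool" where
 "pcell A B G H \<sigma> \<longleftrightarrow>
  (ALL i:Ob Q. ALL y:Ob (Fb A i). \<sigma> i y : hom (Fb B i) (FO (HH G i) y) (FO (HH H i) y)) &
  (ALL i:Ob Q. ALL y z. ALL f:hom (Fb A i) y z. \<sigma> i z *[Fb B i] FA (HH G i) f = FA (HH H i) f *[Fb B i] \<sigma> i y) &
  (ALL i i'. ALL h:hom Q i i'. ALL y:Ob (Fb A i). FA (tr B h) (\<sigma> i y) = \<sigma> i' (FO (tr A h) y)) &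
  (ALL m w ws. ALL q:TH m w ws. ALL x:Ob (P m). ALL ys:Ob (E A (fibs ws x)).
    FA (phi B m q x) (map2 \<sigma> (fibs ws x) ys) *[Fb B (fib w x)] rho G m q x ys
    = rho H m q x ys *[Fb B (fib w x)] \<sigma> (fib w x) (FO (phi A m q x) ys))"

definition cell_ext :: "('io, 'ia, 't, 'h, 'u) alg => ('io list => 'u => 'u) => bool" where
 "cell_ext A \<sigma> \<longleftrightarrow> \<sigma> : extensional (Ob Q) & (ALL i:Ob Q. \<sigma> i : extensional (Ob (Fb A i)))"

lemma alg_cell_iff: "alg_cell \<Theta> I A B G H \<sigma> \<longleftrightarrow> pcell A B G H \<sigma> & cell_ext A \<sigma>"
proof -
 have 1: "modif Q (XX A) (XX B) (HH G) (HH H) \<sigma> \<longleftrightarrow>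
  (ALL i:Ob Q. ALL y:Ob (Fb A i). \<sigma> i y : hom (Fb B i) (FO (HH G i) y) (FO (HH H i) y)) &
  (ALL i:Ob Q. ALL y z. ALL f:hom (Fb A i) y z. \<sigma> i z *[Fb B i] FA (HH G i) f = FA (HH H i) f *[Fb B i] \<sigma> i y) &
  (ALL i i'. ALL h:hom Q i i'. ALL y:Ob (Fb A i). FA (tr B h) (\<sigma> i y) = \<sigma> i' (FO (tr A h) y))"
  unfolding modif_def nat_trans_def hom_def by auto
 show ?thesis
  unfolding alg_cell_def Let_def 1 pcell_def cell_ext_def Xw_simps fib_def[symmetric] map2_map_left by blast
qed

lemma pcellD:
 assumes "pcell A B G H \<sigma>"
 shows "i : Ob Q ==> y : Ob (Fb A i) ==> \<sigma> i y : hom (Fb B i) (FO (HH G i) y) (FO (HH H i) y)"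
  and "i : Ob Q ==> f : hom (Fb A i) y z ==> \<sigma> i z *[Fb B i] FA (HH G i) f = FA (HH H i) f *[Fb B i] \<sigma> i y"
  and "h : hom Q i i' ==> y : Ob (Fb A i) ==> FA (tr B h) (\<sigma> i y) = \<sigma> i' (FO (tr A h) y)"
  and "q : TH m w ws ==> x : Ob (P m) ==> ys : Ob (E A (fibs ws x)) ==>
    FA (phi B m q x) (map2 \<sigma> (fibs ws x) ys) *[Fb B (fib w x)] rho G m q x ys
    = rho H m q x ys *[Fb B (fib w x)] \<sigma> (fib w x) (FO (phi A m q x) ys)"
 using assms unfolding pcell_def by blast+

lemma pcellI:
 assumes "!!i y. i : Ob Q ==> y : Ob (Fb A i) ==> \<sigma> i y : hom (Fb B i) (FO (HH G i) y) (FO (HH H i) y)"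
  and "!!i f y z. i : Ob Q ==> f : hom (Fb A i) y z ==> \<sigma> i z *[Fb B i] FA (HH G i) f = FA (HH H i) f *[Fb B i] \<sigma> i y"
  and "!!i i' h y. h : hom Q i i' ==> y : Ob (Fb A i) ==> FA (tr B h) (\<sigma> i y) = \<sigma> i' (FO (tr A h) y)"
  and "!!m w ws q x ys. q : TH m w ws ==> x : Ob (P m) ==> ys : Ob (E A (fibs ws x)) ==>
    FA (phi B m q x) (map2 \<sigma> (fibs ws x) ys) *[Fb B (fib w x)] rho G m q x ys
    = rho H m q x ys *[Fb B (fib w x)] \<sigma> (fib w x) (FO (phi A m q x) ys)"
 shows "pcell A B G H \<sigma>"
 using assms unfolding pcell_def by blast

lemma pcells_hom:
 assumes "pcell A B G H \<sigma>" "set Z <= Ob Q" "ys : Ob (E A Z)"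
 shows "map2 \<sigma> Z ys : hom (E B Z) (HO G Z ys) (HO H Z ys)"
 using assms pcellD(1)[OF assms(1)] unfolding E_hom E_ob by (simp add: subset_iff)

lemma pcell_cong:
 assumes A: "prealg A" and \<sigma>: "pcell A B G H \<sigma>"
  and eq: "!!i y. i : Ob Q ==> y : Ob (Fb A i) ==> \<sigma> i y = \<tau> i y"
 shows "pcell A B G H \<tau>"
proof (rule pcellI, goal_cases)
 case (2 i f y z)
 note i = 2(1) and f = 2(2)
 show ?case
  using pcellD(2)[OF \<sigma> i f] eq[OF i] hom_ob[OF category_Fb[OF A i] f] by simp
next
 case (3 i i' h y)
 note h = 3(1) and y = 3(2)
 show ?case
  using pcellD(3)[OF \<sigma> h y] eq hom_ob[OF category_P h] y functor_ob[OF functor_tr[OF A h] y] by simp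
next
 case (4 m w ws q x ys)
 note a = 4(1,2) and ys = 4(3)
 have e: "map2 \<sigma> (fibs ws x) ys = map2 \<tau> (fibs ws x) ys"
  using ys fibs_ob[OF a] eq unfolding E_ob by (intro nth_equalityI) (simp_all add: subset_iff)
 show ?case
  unfolding e[symmetric] eq[OF Theta_fib[OF a] functor_ob[OF functor_phi[OF A a] ys], symmetric]
  by (rule pcellD(4)[OF \<sigma> a ys])
qed (use pcellD(1)[OF \<sigma>] eq in auto)

lemma pcell_restrict:
 assumes "prealg A" "pcell A B G H \<sigma>"
 shows "pcell A B G H (\<lambda>i\<in>Ob Q. \<lambda>y\<in>Ob (Fb A i). \<sigma> i y)" "cell_ext A (\<lambda>i\<in>Ob Q. \<lambda>y\<in>Ob (Fb A i). \<sigma> i y)"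
 by (rule pcell_cong[OF assms]) (auto simp: cell_ext_def)

lemma pcell_ident:
 assumes A: "prealg A" and B: "prealg B" and H: "premor A B H"
 shows "pcell A B H H (%i y. Ident (Fb B i) (FO (HH H i) y))"
proof (rule pcellI, goal_cases)
 case (1 i y)
 note i = 1(1) and y = 1(2)
 show ?case
  by (rule ident_hom[OF category_Fb[OF B i] functor_ob[OF premor_HH[OF H i] y]])
next
 case (2 i f y z)
 note i = 2(1) and f = 2(2)
 note Hf = functor_hom[OF premor_HH[OF H i] f]
 show ?case
  unfolding comp_ident_left[OF category_Fb[OF B i] Hf] comp_ident_right[OF category_Fb[OF B i] Hf] ..
next
 case (3 i i' h y)
 note h = 3(1) and y = 3(2)
 have i: "i : Ob Q" using hom_ob[OF category_P h] by blast
 show ?case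
  unfolding premor_tr(1)[OF H h y] by (rule functor_ident[OF functor_tr[OF B h] functor_ob[OF premor_HH[OF H i] y]])
next
 case (4 m w ws q x ys)
 note a = 4(1,2) and ys = 4(3)
 note Z = fibs_ob[OF a] and i = Theta_fib[OF a] and r = premor_rho(1)[OF H a ys, THEN isoh_hom]
 have "map2 (%i y. Ident (Fb B i) (FO (HH H i) y)) (fibs ws x) ys = Ident (E B (fibs ws x)) (HO H (fibs ws x) ys)"
  using ys unfolding E_ob by (intro nth_equalityI) simp_all
 then show ?case
  using functor_ident[OF functor_phi[OF B a] HO_ob[OF H Z ys]]
  by (simp only: comp_ident_left[OF category_Fb[OF B i] r] comp_ident_right[OF category_Fb[OF B i] r])
qed

text \<open>Each condition on the inverse becomes the corresponding condition on
  \<open>\<sigma>\<close> after composition with a component of \<open>\<sigma>\<close>, which can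
  be cancelled.\<close>

lemma pcell_inverse:
 assumes A: "prealg A" and B: "prealg B" and G: "premor A B G" and H: "premor A B H" and \<sigma>: "pcell A B G H \<sigma>"
  and inv: "!!i y. i : Ob Q ==> y : Ob (Fb A i) ==> \<tau> i y : hom (Fb B i) (FO (HH H i) y) (FO (HH G i) y) &
   \<tau> i y *[Fb B i] \<sigma> i y = Ident (Fb B i) (FO (HH G i) y) & \<sigma> i y *[Fb B i] \<tau> i y = Ident (Fb B i) (FO (HH H i) y)"
 shows "pcell A B H G \<tau>"
proof (rule pcellI)
 have iso: "isoh (Fb B i) (\<sigma> i y) (FO (HH G i) y) (FO (HH H i) y)" if "i : Ob Q" "y : Ob (Fb A i)" for i y
  by (rule isohI[OF pcellD(1)[OF \<sigma> that]]) (use inv[OF that] in auto)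
 {
  fix i f y z assume i: "i : Ob Q" and f: "f : hom (Fb A i) y z"
  have yz: "y : Ob (Fb A i)" "z : Ob (Fb A i)" using hom_ob[OF category_Fb[OF A i] f] by auto
  note C = category_Fb[OF B i] and Gf = functor_hom[OF premor_HH[OF G i] f] and Hf = functor_hom[OF premor_HH[OF H i] f]
  note t = inv[OF i yz(1), THEN c1] inv[OF i yz(2), THEN c1] and s = pcellD(1)[OF \<sigma> i yz(1)] pcellD(1)[OF \<sigma> i yz(2)]
  show "\<tau> i z *[Fb B i] FA (HH H i) f = FA (HH G i) f *[Fb B i] \<tau> i y"
  proof (rule isoh_cancel_left[OF C iso[OF i yz(2)] comp_hom[OF C Hf t(2)] comp_hom[OF C t(1) Gf]])
   show "\<sigma> i z *[Fb B i] (\<tau> i z *[Fb B i] FA (HH H i) f) = \<sigma> i z *[Fb B i] (FA (HH G i) f *[Fb B i] \<tau> i y)"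
    using comp_assoc[OF C Hf t(2) s(2)] comp_assoc[OF C t(1) Gf s(2)] comp_assoc[OF C t(1) s(1) Hf] inv[OF i yz(1)] inv[OF i yz(2)]
     pcellD(2)[OF \<sigma> i f] comp_ident_left[OF C Hf] comp_ident_right[OF C Hf] by simp
  qed
 }
 {
  fix i i' h y assume h: "h : hom Q i i'" and y: "y : Ob (Fb A i)"
  have i: "i : Ob Q" "i' : Ob Q" using hom_ob[OF category_P h] by auto
  note C = category_Fb[OF B i(2)] and y' = functor_ob[OF functor_tr[OF A h] y] and t = inv[OF i(1) y, THEN c1]
  note s = pcellD(1)[OF \<sigma> i(1) y]
  show "FA (tr B h) (\<tau> i y) = \<tau> i' (FO (tr A h) y)"
  proof (rule isoh_cancel_right[OF C iso[OF i(2) y'] _ inv[OF i(2) y', THEN c1]])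
   show "FA (tr B h) (\<tau> i y) : hom (Fb B i') (FO (HH H i') (FO (tr A h) y)) (FO (HH G i') (FO (tr A h) y))"
    using functor_hom[OF functor_tr[OF B h] t] premor_tr(1)[OF G h y] premor_tr(1)[OF H h y] by simp
   show "FA (tr B h) (\<tau> i y) *[Fb B i'] \<sigma> i' (FO (tr A h) y) = \<tau> i' (FO (tr A h) y) *[Fb B i'] \<sigma> i' (FO (tr A h) y)"
    using functor_comp[OF functor_tr[OF B h] s t] pcellD(3)[OF \<sigma> h y] inv[OF i(1) y] inv[OF i(2) y']
     functor_ident[OF functor_tr[OF B h] functor_ob[OF premor_HH[OF G i(1)] y]] premor_tr(1)[OF G h y] by simp
  qed
 }
 {
  fix m w ws q x ys assume a: "q : TH m w ws" "x : Ob (P m)" and ys: "ys : Ob (E A (fibs ws x))"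
  let ?C = "Fb B (fib w x)" and ?\<Delta> = "fibs ws x" and ?i = "fib w x"
  note Z = fibs_ob[OF a] and i = Theta_fib[OF a]
  note C = category_Fb[OF B i]
  note p = functor_ob[OF functor_phi[OF A a] ys] and Gy = HO_ob[OF G Z ys]
  note \<sigma>s = pcells_hom[OF \<sigma> Z ys]
  have \<tau>s: "map2 \<tau> ?\<Delta> ys : hom (E B ?\<Delta>) (HO H ?\<Delta> ys) (HO G ?\<Delta> ys)"
   using ys Z inv unfolding E_hom E_ob by (simp add: subset_iff)
  have c: "map2 \<tau> ?\<Delta> ys *[E B ?\<Delta>] map2 \<sigma> ?\<Delta> ys = Ident (E B ?\<Delta>) (HO G ?\<Delta> ys)"
   using ys Z inv unfolding E_ob by (intro nth_equalityI) (simp_all add: subset_iff)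
  note fB = functor_hom[OF functor_phi[OF B a]]
  note rG = premor_rho(1)[OF G a ys, THEN isoh_hom] and rH = premor_rho(1)[OF H a ys, THEN isoh_hom]
  note s = pcellD(1)[OF \<sigma> i p] and t = inv[OF i p, THEN c1]
  show "FA (phi B m q x) (map2 \<tau> ?\<Delta> ys) *[?C] rho H m q x ys = rho G m q x ys *[?C] \<tau> ?i (FO (phi A m q x) ys)"
  proof (rule isoh_cancel_right[OF C iso[OF i p] comp_hom[OF C rH fB[OF \<tau>s]] comp_hom[OF C t rG]])
   have "(FA (phi B m q x) (map2 \<tau> ?\<Delta> ys) *[?C] rho H m q x ys) *[?C] \<sigma> ?i (FO (phi A m q x) ys)
    = FA (phi B m q x) (map2 \<tau> ?\<Delta> ys) *[?C] (FA (phi B m q x) (map2 \<sigma> ?\<Delta> ys) *[?C] rho G m q x ys)"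
    unfolding comp_assoc[OF C s rH fB[OF \<tau>s]] pcellD(4)[OF \<sigma> a ys] ..
   also have "\<dots> = (FA (phi B m q x) (map2 \<tau> ?\<Delta> ys) *[?C] FA (phi B m q x) (map2 \<sigma> ?\<Delta> ys)) *[?C] rho G m q x ys"
    by (rule comp_assoc[OF C rG fB[OF \<sigma>s] fB[OF \<tau>s], symmetric])
   also have "\<dots> = rho G m q x ys"
    unfolding functor_comp[OF functor_phi[OF B a] \<sigma>s \<tau>s, symmetric] c functor_ident[OF functor_phi[OF B a] Gy]
    by (rule comp_ident_left[OF C rG])
   also have "\<dots> = (rho G m q x ys *[?C] \<tau> ?i (FO (phi A m q x) ys)) *[?C] \<sigma> ?i (FO (phi A m q x) ys)"
    using comp_assoc[OF C s t rG] inv[OF i p] comp_ident_right[OF C rG] by simp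
   finally show "(FA (phi B m q x) (map2 \<tau> ?\<Delta> ys) *[?C] rho H m q x ys) *[?C] \<sigma> ?i (FO (phi A m q x) ys)
    = (rho G m q x ys *[?C] \<tau> ?i (FO (phi A m q x) ys)) *[?C] \<sigma> ?i (FO (phi A m q x) ys)" .
  qed
 }
qed (use inv in blast)

section \<open>The hom categories of the 2-category and their isomorphisms\<close>

abbreviation "KK == Alg2 U \<Theta> I"

lemma KK_simps:
 "Ob2 KK = {A. palgebra A}" "one1 KK = idm" "cmp1 KK = cmor"
 "Ob (Mor2 KK A B) = {H. amor A B H}"
 "Ar (Mor2 KK A B) = {(G, H, \<sigma>). amor A B G & amor A B H & alg_cell \<Theta> I A B G H \<sigma>}"
 "Dom (Mor2 KK A B) (G, H, \<sigma>) = G" "Cod (Mor2 KK A B) (G, H, \<sigma>) = H"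
 "Ident (Mor2 KK A B) H = (H, H, \<lambda>i\<in>Ob Q. \<lambda>y\<in>Ob (Fb A i). Ident (Fb B i) (FO (HH H i) y))"
 "(L, L', \<tau>) *[Mor2 KK A B] (G, G', \<sigma>) = (G, L', \<lambda>i\<in>Ob Q. \<lambda>y\<in>Ob (Fb A i). \<tau> i y *[Fb B i] \<sigma> i y)"
 "cmp2 KK A B D (L, L', \<tau>) (G, G', \<sigma>) = (cmor A B D L G, cmor A B D L' G',
   \<lambda>i\<in>Ob Q. \<lambda>y\<in>Ob (Fb A i). \<tau> i (FO (HH G' i) y) *[Fb D i] FA (HH L i) (\<sigma> i y))"
 by (simp_all add: Alg2_def Let_def)

lemma KK_hom: "s : hom (Mor2 KK A B) G H \<longleftrightarrow>
  (EX \<sigma>. s = (G, H, \<sigma>) & amor A B G & amor A B H & pcell A B G H \<sigma> & cell_ext A \<sigma>)"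
 by (auto simp: hom_def KK_simps alg_cell_iff)

lemma cell_eqI:
 "cell_ext A \<sigma> ==> cell_ext A \<tau> ==> (!!i y. i : Ob Q ==> y : Ob (Fb A i) ==> \<sigma> i y = \<tau> i y) ==> \<sigma> = \<tau>"
 unfolding cell_ext_def by (intro extensionalityI[of _ "Ob Q"]) (auto intro: extensionalityI)

text \<open>Pointwise inverses form a 2-cell by \<open>pcell_inverse\<close>. So the invertibility
  demanded of the 2-cells of \<open>F\<close>, and of those in a pseudo natural transformation, can
  be read in the fibres.\<close>

lemma KK_iso:
 assumes A: "palgebra A" and B: "palgebra B" and s: "(G, H, \<sigma>) : hom (Mor2 KK A B) G H"
 shows "iso_in (Mor2 KK A B) (G, H, \<sigma>) \<longleftrightarrow>
  (ALL i:Ob Q. ALL y:Ob (Fb A i). isoh (Fb B i) (\<sigma> i y) (FO (HH G i) y) (FO (HH H i) y))"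
proof
 have \<sigma>: "pcell A B G H \<sigma>" and m: "amor A B G" "amor A B H" using s by (auto simp: KK_hom)
 {
  assume "iso_in (Mor2 KK A B) (G, H, \<sigma>)"
  then obtain g where "g : hom (Mor2 KK A B) H G"
   "g *[Mor2 KK A B] (G, H, \<sigma>) = Ident (Mor2 KK A B) G" "(G, H, \<sigma>) *[Mor2 KK A B] g = Ident (Mor2 KK A B) H"
   unfolding iso_in_def KK_simps(6,7) by blast
  then obtain \<tau> where \<tau>: "pcell A B H G \<tau>"
   and e: "(H, G, \<tau>) *[Mor2 KK A B] (G, H, \<sigma>) = Ident (Mor2 KK A B) G" "(G, H, \<sigma>) *[Mor2 KK A B] (H, G, \<tau>) = Ident (Mor2 KK A B) H"
   unfolding KK_hom by blast
  show "ALL i:Ob Q. ALL y:Ob (Fb A i). isoh (Fb B i) (\<sigma> i y) (FO (HH G i) y) (FO (HH H i) y)"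
  proof (intro ballI)
   fix i y assume i: "i : Ob Q" and y: "y : Ob (Fb A i)"
   have "\<tau> i y *[Fb B i] \<sigma> i y = Ident (Fb B i) (FO (HH G i) y)" "\<sigma> i y *[Fb B i] \<tau> i y = Ident (Fb B i) (FO (HH H i) y)"
    using e i y by (auto simp: KK_simps dest!: fun_cong[of _ _ i] fun_cong[of _ _ y])
   with pcellD(1)[OF \<sigma> i y] pcellD(1)[OF \<tau> i y] show "isoh (Fb B i) (\<sigma> i y) (FO (HH G i) y) (FO (HH H i) y)"
    by (rule isohI)
  qed
 }
 assume "ALL i:Ob Q. ALL y:Ob (Fb A i). isoh (Fb B i) (\<sigma> i y) (FO (HH G i) y) (FO (HH H i) y)"
 then have "ALL i:Ob Q. ALL y:Ob (Fb A i). EX t. t : hom (Fb B i) (FO (HH H i) y) (FO (HH G i) y) &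
   t *[Fb B i] \<sigma> i y = Ident (Fb B i) (FO (HH G i) y) & \<sigma> i y *[Fb B i] t = Ident (Fb B i) (FO (HH H i) y)"
  using isohE by metis
 then obtain \<tau> where \<tau>: "!!i y. i : Ob Q ==> y : Ob (Fb A i) ==> \<tau> i y : hom (Fb B i) (FO (HH H i) y) (FO (HH G i) y) &
   \<tau> i y *[Fb B i] \<sigma> i y = Ident (Fb B i) (FO (HH G i) y) & \<sigma> i y *[Fb B i] \<tau> i y = Ident (Fb B i) (FO (HH H i) y)"
  by metis
 note pA = alg_prealg[OF A]
 note c = pcell_restrict[OF pA pcell_inverse[OF pA alg_prealg[OF B] alg_mor_premor[OF A B m(1)] alg_mor_premor[OF A B m(2)] \<sigma> \<tau>]]
 let ?\<tau> = "\<lambda>i\<in>Ob Q. \<lambda>y\<in>Ob (Fb A i). \<tau> i y"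
 have "(H, G, ?\<tau>) : hom (Mor2 KK A B) H G" unfolding KK_hom using m c by blast
 moreover have "(H, G, ?\<tau>) *[Mor2 KK A B] (G, H, \<sigma>) = Ident (Mor2 KK A B) G" "(G, H, \<sigma>) *[Mor2 KK A B] (H, G, ?\<tau>) = Ident (Mor2 KK A B) H"
  using \<tau> by (auto simp: KK_simps intro!: restrict_ext)
 ultimately show "iso_in (Mor2 KK A B) (G, H, \<sigma>)"
  using homD[OF s] unfolding iso_in_def KK_simps(6,7) by blast
qed

end

section \<open>Algebras that embed strictly into a family of algebras\<close>

lemma blocks_append:
 "blocks (ns @ ms) xs = blocks ns (take (sum_list ns) xs) @ blocks ms (drop (sum_list ns) xs)"
 by (induction ns arbitrary: xs) (auto simp: take_drop add.commute min_def)

text \<open>For associativity of composition: applying all innermost operations and cutting the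
  result gives, for one \<open>\<alpha>_i\<close>, what is obtained by cutting the arguments and
  applying only the operations below \<open>\<alpha>_i\<close>.\<close>

lemma blocks_nested:
 assumes "map length qss = map length vsss" "i < length vsss" "length ys = sum_list (map length (concat vsss))"
 shows "blocks (map length vsss) (map2 g (concat qss) (blocks (map length (concat vsss)) ys)) ! i
  = map2 g (qss ! i) (blocks (map length (vsss ! i)) (blocks (map (%vss. length (concat vss)) vsss) ys ! i))"
 using assms
proof (induction vsss arbitrary: qss ys i)
 case (Cons vss vsss)
 then obtain a as where a: "qss = a # as" "length a = length vss" "map length as = map length vsss"
  by (cases qss) auto
 have L: "sum_list (map length vss) = length (concat vss)" by (simp add: length_concat)
 let ?L = "length (concat vss)"
 have e: "map2 g (concat qss) (blocks (map length (concat (vss # vsss))) ys)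
  = map2 g a (blocks (map length vss) (take ?L ys)) @ map2 g (concat as) (blocks (map length (concat vsss)) (drop ?L ys))"
  using a(2) by (simp add: a(1) blocks_append L)
 show ?case
 proof (cases i)
  case 0
  then show ?thesis unfolding e using a by simp
 next
  case (Suc k)
  then show ?thesis
   unfolding e using a Cons.IH[OF a(3), of k "drop ?L ys"] Cons.prems by (simp add: length_concat)
 qed
qed simp

lemma blocks_map2_concat:
 "length ys = length (concat wss) ==>
  blocks (map length wss) (map2 g (concat wss) ys) = map2 (map2 g) wss (blocks (map length wss) ys)"
 by (simp add: blocks_map2 blocks_concat)

context T_algebra
begin

lemma ThetaHoms_nth:
 "THs m qs ws wss ==> length qs = length ws & length wss = length ws"
 "THs m qs ws wss ==> i < length ws ==> qs ! i : TH m (ws ! i) (wss ! i)"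
 by (auto simp: ThetaHoms_def)

lemma ThetaHoms_concat:
 assumes "length qss = length wss" "length vsss = length wss"
  "ALL i<length wss. THs m (qss ! i) (wss ! i) (vsss ! i)"
 shows "THs m (concat qss) (concat wss) (concat vsss)"
 using assms
proof (induction wss arbitrary: qss vsss)
 case (Cons ws wss)
 then obtain as qss' vs vsss' where e: "qss = as # qss'" "vsss = vs # vsss'"
  by (metis length_0_conv list.distinct(1) list.exhaust)
 have 1: "THs m as ws vs" using Cons.prems(3)[rule_format, of 0] by (simp add: e)
 have "ALL i<length wss. THs m (qss' ! i) (wss ! i) (vsss' ! i)"
  using Cons.prems(3) by (auto simp: e dest: spec[of _ "Suc _"])
 then have 2: "THs m (concat qss') (concat wss) (concat vsss')"
  using Cons.IH[of qss' vsss'] Cons.prems by (simp add: e)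
 show ?case using 1 2 by (auto simp: e ThetaHoms_def nth_append)
qed (simp add: ThetaHoms_def)

text \<open>Brings the ends of the isomorphisms in \<open>kind\<close> into the shape in which the
  coherence diagrams mention them.\<close>

lemma ev_forms:
 assumes "prealg A"
 shows "length ys = length Z ==> FO (evF A (Op m q x (vars Z))) ys = FO (phi A m q x) ys"
  and "length ys = length Z ==> FO (evF A (Tr h (Op m q x (vars Z)))) ys = FO (tr A h) (FO (phi A m q x) ys)"
  and "length ys = length Z ==> map length wss = ns ==> FO (evF A (Op m q x (map2 (%q' ts. Op m q' x ts) qs (blocks ns (vars Z))))) ys
   = FO (phi A m q x) (phis A m qs wss x ys)"
  and "length ys = length Z ==> set io <= {..<length Z} ==> FO (evF A (Op m q x (pick (vars Z) io))) ys = FO (phi A m q x) (pick ys io)"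
  and "length ys = length Z ==> FO (evF A (Op m q y (map2 (%v. Tr (k v)) ws (vars Z)))) ys
   = FO (phi A m q y) (map2 (%v. FO (tr A (k v))) ws ys)"
proof -
 assume l: "length ys = length Z"
 show "FO (evF A (Op m q x (vars Z))) ys = FO (phi A m q x) ys"
  "FO (evF A (Tr h (Op m q x (vars Z)))) ys = FO (tr A h) (FO (phi A m q x) ys)"
  using ev_vars(1)[OF l] by (simp_all add: o_def)
 {
  assume ns: "map length wss = ns"
  have "blocks ns ys = map (map (%t. FO (evF A t) ys)) (blocks ns (vars Z))"
   by (metis map_blocks ev_vars(1) l)
  then show "FO (evF A (Op m q x (map2 (%q' ts. Op m q' x ts) qs (blocks ns (vars Z))))) ys
   = FO (phi A m q x) (phis A m qs wss x ys)"
   by (simp add: phis_def ns zip_map2 o_def case_prod_unfold)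
 }
 show "set io <= {..<length Z} ==> FO (evF A (Op m q x (pick (vars Z) io))) ys = FO (phi A m q x) (pick ys io)"
  using ev_vars(1)[OF l] by (simp add: map_pick o_def)
 have "map2 (%v. FO (tr A (k v))) ws ys = map2 (%v y. FO (tr A (k v)) y) ws (map (%t. FO (evF A t) ys) (vars Z))"
  using ev_vars(1)[OF l] by simp
 then show "FO (evF A (Op m q y (map2 (%v. Tr (k v)) ws (vars Z)))) ys
   = FO (phi A m q y) (map2 (%v. FO (tr A (k v))) ws ys)"
  by (simp add: zip_map2 o_def case_prod_unfold)
qed

end

text \<open>What the coherence diagrams ask of the limit, without reference to cones. The coherence
  isomorphisms of \<open>W\<close> enter by their ends, invertibility and components; their
  naturality is derived from \<open>joint\<close>, a naturality square being an equation of parallel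
  arrows.\<close>

locale strict_family = T_algebra \<Theta> U I
 for \<Theta> :: "('t, 'h) thy2" and U :: "'u itself" and I :: "('t, 'io, 'ia) palg" +
 fixes W :: "('io, 'ia, 't, 'h, 'u) alg" and JJ :: "'jo set" and A :: "'jo => ('io, 'ia, 't, 'h, 'u) alg"
  and prO prA :: "'jo => 'u => 'u"
 assumes W: "prealg W" and Aj: "j : JJ ==> palgebra (A j)"
  and pr_functor: "j : JJ ==> i : Ob Q ==> is_functor (Fb W i) (Fb (A j) i) \<lparr>FO = prO j, FA = prA j\<rparr>"
  and pr_tr: "j : JJ ==> h : hom Q i i' ==> a : Ob (Fb W i) ==> prO j (FO (tr W h) a) = FO (tr (A j) h) (prO j a)"
   "j : JJ ==> h : hom Q i i' ==> f : hom (Fb W i) a b ==> prA j (FA (tr W h) f) = FA (tr (A j) h) (prA j f)"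
  and pr_phi: "j : JJ ==> q : TH m w ws ==> x : Ob (P m) ==> ys : Ob (E W (fibs ws x)) ==>
    prO j (FO (phi W m q x) ys) = FO (phi (A j) m q x) (map (prO j) ys)"
   "j : JJ ==> q : TH m w ws ==> x : Ob (P m) ==> fs : hom (E W (fibs ws x)) as bs ==>
    prA j (FA (phi W m q x) fs) = FA (phi (A j) m q x) (map (prA j) fs)"
  and W_kind: "kind Z i s t e ==> ys : Ob (E W Z) ==> isoh (Fb W i) (e W ys) (FO (evF W s) ys) (FO (evF W t) ys)"
  and pr_kind: "j : JJ ==> kind Z i s t e ==> ys : Ob (E W Z) ==> prA j (e W ys) = e (A j) (map (prO j) ys)"
  and joint: "i : Ob Q ==> f : hom (Fb W i) a b ==> g : hom (Fb W i) a b ==> (!!j. j : JJ ==> prA j f = prA j g) ==> f = g"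
  and joint_iso: "i : Ob Q ==> isoh (Fb W i) f a b ==> isoh (Fb W i) g a' b ==> (!!j. j : JJ ==> prA j f = prA j g) ==> f = g"
begin

lemmas pA = alg_prealg[OF Aj] and kA = alg_kinds[OF Aj]

lemma prO_ob: "j : JJ ==> i : Ob Q ==> a : Ob (Fb W i) ==> prO j a : Ob (Fb (A j) i)"
 using functor_ob[OF pr_functor] by simp

lemma prA_hom: "j : JJ ==> i : Ob Q ==> f : hom (Fb W i) a b ==> prA j f : hom (Fb (A j) i) (prO j a) (prO j b)"
 using functor_hom[OF pr_functor] by fastforce

lemma prA_comp: "j : JJ ==> i : Ob Q ==> f : hom (Fb W i) a b ==> g : hom (Fb W i) b c ==>
  prA j (g *[Fb W i] f) = prA j g *[Fb (A j) i] prA j f"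
 using functor_comp[OF pr_functor] by fastforce

lemma prA_ident: "j : JJ ==> i : Ob Q ==> a : Ob (Fb W i) ==> prA j (Ident (Fb W i) a) = Ident (Fb (A j) i) (prO j a)"
 using functor_ident[OF pr_functor] by fastforce

lemma pr_env: "j : JJ ==> set Z <= Ob Q ==> ys : Ob (E W Z) ==> map (prO j) ys : Ob (E (A j) Z)"
 unfolding E_ob using prO_ob by (simp add: subset_iff)

lemma pr_envA: "j : JJ ==> set Z <= Ob Q ==> fs : hom (E W Z) as bs ==>
  map (prA j) fs : hom (E (A j) Z) (map (prO j) as) (map (prO j) bs)"
 unfolding E_hom using prA_hom by (simp add: subset_iff)

lemma pr_evF:
 assumes "j : JJ" "wt Z t i" "set Z <= Ob Q" "fs : hom (E W Z) as bs"
 shows "prA j (FA (evF W t) fs) = FA (evF (A j) t) (map (prA j) fs)"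
 using assms(2)
proof (induction rule: wt.induct)
 case (wt_V n)
 then show ?case using assms(4) unfolding E_hom by simp
next
 case (wt_Op q m w ws x ts)
 have ts: "list_all2 (wt Z) ts (fibs ws x)" and l: "length ts = length ws" using wt_Op(3) by (auto simp: list_all2_conv_all_nth)
 have "map (%t. FA (evF W t) fs) ts : hom (E W (fibs ws x)) (map (%t. FO (evF W t) as) ts) (map (%t. FO (evF W t) bs) ts)"
  unfolding E_hom using functor_hom[OF evF_functor[OF W] assms(4)] ts l by (auto simp: list_all2_conv_all_nth)
 note p = pr_phi(2)[OF assms(1) wt_Op(1,2) this]
 have e: "map (prA j) (map (%t. FA (evF W t) fs) ts) = map (%t. FA (evF (A j) t) (map (prA j) fs)) ts"
  using wt_Op(3) by (auto simp: list_all2_conv_all_nth in_set_conv_nth)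
 have "FA (evF W (Op m q x ts)) fs = FA (phi W m q x) (map (%t. FA (evF W t) fs) ts)" by (simp add: o_def)
 then show ?case unfolding p[unfolded e, symmetric] by (simp add: p[unfolded e] o_def)
next
 case (wt_Tr t i h i')
 show ?case
  using pr_tr(2)[OF assms(1) wt_Tr(2) functor_hom[OF evF_functor[OF W wt_Tr(1)] assms(4)]] wt_Tr(3) by simp
qed

lemma kinds_iso_W: "kinds_iso W"
 unfolding kinds_iso_def
proof (intro allI impI nat_isoI)
 fix Z i s t and e :: "('io, 'ia, 't, 'h, 'u) alg => 'u list => 'u"
 assume k: "kind Z i s t e"
 then show "isoh (Fb W i) (e W ys) (FO (evF W s) ys) (FO (evF W t) ys)" if "ys : Ob (E W Z)" for ys
  using W_kind that by blast
 fix fs as bs assume fs: "fs : hom (E W Z) as bs"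
 have Z: "set Z <= Ob Q" and s: "wt Z s i" and t: "wt Z t i" using kind_wt[OF k] by auto
 note i = wt_ob[OF s]
 have ab: "as : Ob (E W Z)" "bs : Ob (E W Z)" using hom_ob[OF category_E[OF W Z] fs] by auto
 note C = category_Fb[OF W i] and Fs = functor_hom[OF evF_functor[OF W s] fs] and Ft = functor_hom[OF evF_functor[OF W t] fs]
 note ea = W_kind[OF k ab(1), THEN isoh_hom] and eb = W_kind[OF k ab(2), THEN isoh_hom]
 show "e W bs *[Fb W i] FA (evF W s) fs = FA (evF W t) fs *[Fb W i] e W as"
 proof (rule joint[OF i comp_hom[OF C Fs eb] comp_hom[OF C ea Ft]])
  fix j assume j: "j : JJ"
  show "prA j (e W bs *[Fb W i] FA (evF W s) fs) = prA j (FA (evF W t) fs *[Fb W i] e W as)"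
   unfolding prA_comp[OF j i Fs eb] prA_comp[OF j i ea Ft] pr_evF[OF j s Z fs] pr_evF[OF j t Z fs] pr_kind[OF j k ab(1)] pr_kind[OF j k ab(2)]
   by (rule kinds_isoD(2)[OF kA[OF j] k pr_envA[OF j Z fs]])
 qed
qed

text \<open>
  \<open>R i f a b \<phi>\<close>: the arrow \<open>f: a \<rightarrow> b\<close> is an isomorphism with components \<open>\<phi>\<close>. By \<open>joint_iso\<close> two such arrows with the same
  components and the same target agree. So the sources of the two sides of a coherence diagram need not be compared,
  and no relation between operations of \<open>\<Theta>\<close> has to be proved.
\<close>

definition R :: "'io list => 'u => 'u => 'u => ('jo => 'u) => bool" where
 "R i f a b \<phi> \<longleftrightarrow> i : Ob Q & isoh (Fb W i) f a b & (ALL j:JJ. prA j f = \<phi> j)"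

lemma R_eq: "R i f a b \<phi> ==> R i g a' b' \<psi> ==> b = b' ==> (!!j. j : JJ ==> \<phi> j = \<psi> j) ==> f = g"
 unfolding R_def using joint_iso by metis

lemma R_comp: "R i g b c \<psi> ==> R i f a b \<phi> ==> R i (g *[Fb W i] f) a c (%j. \<psi> j *[Fb (A j) i] \<phi> j)"
 unfolding R_def using isoh_comp[OF category_Fb[OF W]] prA_comp isoh_hom by metis

lemma R_ident: "i : Ob Q ==> a : Ob (Fb W i) ==> R i (Ident (Fb W i) a) a a (%j. Ident (Fb (A j) i) (prO j a))"
 unfolding R_def using isoh_ident[OF category_Fb[OF W]] prA_ident by blast

lemma R_tr: "h : hom Q i i' ==> R i f a b \<phi> ==> R i' (FA (tr W h) f) (FO (tr W h) a) (FO (tr W h) b) (%j. FA (tr (A j) h) (\<phi> j))"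
 unfolding R_def using functor_isoh[OF category_Fb[OF W] functor_tr[OF W]] pr_tr(2) isoh_hom hom_ob[OF category_P] by metis

lemma R_phi:
 assumes "q : TH m w ws" "x : Ob (P m)" "length fs = length ws" "length as = length ws" "length bs = length ws"
  and r: "!!n. n < length ws ==> R (fib (ws ! n) x) (fs ! n) (as ! n) (bs ! n) (%j. \<phi> j ! n)"
  and l: "!!j. j : JJ ==> length (\<phi> j) = length ws"
 shows "R (fib w x) (FA (phi W m q x) fs) (FO (phi W m q x) as) (FO (phi W m q x) bs) (%j. FA (phi (A j) m q x) (\<phi> j))"
proof -
 note Z = fibs_ob[OF assms(1,2)]
 have i: "isoh (E W (fibs ws x)) fs as bs"
  by (rule E_isohI[OF Z W]) (use assms(3-5) r in \<open>auto simp: R_def\<close>)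
 have "map (prA j) fs = \<phi> j" if "j : JJ" for j
  using r l[OF that] assms(3) that by (intro nth_equalityI) (auto simp: R_def)
 then show ?thesis
  using functor_isoh[OF category_E[OF W Z] functor_phi[OF W assms(1,2)] i] pr_phi(2)[OF _ assms(1,2) isoh_hom[OF i]] Theta_fib[OF assms(1,2)]
  by (simp add: R_def)
qed

lemma R_kind:
 assumes "kind Z i s t e" "ys : Ob (E W Z)"
 shows "R i (e W ys) (FO (evF W s) ys) (FO (evF W t) ys) (%j. e (A j) (map (prO j) ys))"
 unfolding R_def using W_kind[OF assms] pr_kind[OF _ assms] kind_wt[OF assms(1)] wt_ob by blast

section \<open>The five kinds of coherence isomorphisms in the form \<open>R\<close>\<close>

lemma R_unit:
 "w : KW m ==> x : Ob (P m) ==> y : Ob (Fb W (fib w x)) ==>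
  R (fib w x) (e_unit W m w x [y]) (FO (phi W m (Oun m w) x) [y]) y (%j. e_unit (A j) m w x [prO j y])"
 using R_kind[OF k_unit, of w m x "[y]"] ev_forms(1)[OF W, of "[y]" "[fib w x]"] by (simp del: evF.simps(2))

lemma R_ecomp:
 assumes "q : TH m w ws" "THs m qs ws wss" "x : Ob (P m)" "ys : Ob (E W (fibs (concat wss) x))"
 shows "R (fib w x) (e_comp W m q qs x ys) (FO (phi W m (Ocp m q qs) x) ys) (FO (phi W m q x) (phis W m qs wss x ys))
  (%j. e_comp (A j) m q qs x (map (prO j) ys))"
proof -
 have l: "length ys = length (fibs (concat wss) x)" using assms(4) unfolding E_ob by blast
 show ?thesis using R_kind[OF k_comp[OF assms(1-3) refl] assms(4)] unfolding ev_forms(1)[OF W l] ev_forms(3)[OF W l refl] .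
qed

lemma R_efun:
 assumes "io : index_maps p (length ws)" "q : TH m w (pick ws io)" "set ws <= KW m" "x : Ob (P m)"
  "ys : Ob (E W (fibs ws x))"
 shows "R (fib w x) (e_fun W m ws io q x ys) (FO (phi W m (Ofn m ws io q) x) ys) (FO (phi W m q x) (pick ys io))
  (%j. e_fun (A j) m ws io q x (map (prO j) ys))"
proof -
 have l: "length ys = length (fibs ws x)" using assms(5) unfolding E_ob by blast
 have "set io <= {..<length (fibs ws x)}" using index_mapsD[OF assms(1)] by simp
 from ev_forms(4)[OF W l this] show ?thesis
  using R_kind[OF k_fun[OF assms(1-4) refl] assms(5)] unfolding ev_forms(1)[OF W l] by simp
qed

lemma R_esub:
 assumes "f : index_maps m l" "q : TH m w ws" "x : Ob (P l)" "ys : Ob (E W (fibs (map (ksb l f) ws) x))"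
 shows "R (fib w (pick x f)) (e_sub W l f q x ys) (FO (tr W (sQ l f w x)) (FO (phi W l (Osb l f q) x) ys))
  (FO (phi W m q (pick x f)) (map2 (%v. FO (tr W (sQ l f v x))) ws ys)) (%j. e_sub (A j) l f q x (map (prO j) ys))"
proof -
 have l: "length ys = length (fibs (map (ksb l f) ws) x)" using assms(4) unfolding E_ob by blast
 show ?thesis using R_kind[OF k_sub[OF assms(1-3) refl] assms(4)] unfolding ev_forms(2)[OF W l] ev_forms(5)[OF W l] .
qed

lemma R_epull:
 assumes "q : TH m w ws" "length us = m" "word_list TT us" "x : Ob (P (arsum us))"
  "ys : Ob (E W (fibs (map (kgm us) ws) x))"
 shows "R (fib w (PhiS TT I us x)) (e_pull W us q x ys) (FO (tr W (cQ us w x)) (FO (phi W (arsum us) (Opl us q) x) ys))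
  (FO (phi W m q (PhiS TT I us x)) (map2 (%v. FO (tr W (cQ us v x))) ws ys)) (%j. e_pull (A j) us q x (map (prO j) ys))"
proof -
 have l: "length ys = length (fibs (map (kgm us) ws) x)" using assms(5) unfolding E_ob by blast
 show ?thesis using R_kind[OF k_pull[OF assms(1-3) refl assms(4) refl] assms(5)] unfolding ev_forms(2)[OF W l] ev_forms(5)[OF W l] .
qed

lemma pr_trs:
 assumes "j : JJ" "ys : Ob (E W (fibs (map k ws) x))" "!!v. v : set ws ==> h v : hom Q (fib (k v) x) (fib v y)"
 shows "map (prO j) (map2 (%v. FO (tr W (h v))) ws ys) = map2 (%v. FO (tr (A j) (h v))) ws (map (prO j) ys)"
 using assms(2) pr_tr(1)[OF assms(1) assms(3)] unfolding E_ob by (intro nth_equalityI) simp_all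

lemma phis_ob:
 assumes A: "prealg A'" and qs: "THs m qs ws wss" and x: "x : Ob (P m)" and ys: "ys : Ob (E A' (fibs (concat wss) x))"
 shows "phis A' m qs wss x ys : Ob (E A' (fibs ws x))"
 using functor_ob[OF functor_phi[OF A ThetaHoms_nth(2)[OF qs] x] blocks_E_ob[OF _ _ _ ys]] ThetaHoms_nth(1)[OF qs] A premor_id[OF A]
 unfolding E_ob by (simp add: phis_def)

lemma pr_phis:
 assumes j: "j : JJ" and qs: "THs m qs ws wss" and x: "x : Ob (P m)" and ys: "ys : Ob (E W (fibs (concat wss) x))"
 shows "map (prO j) (phis W m qs wss x ys) = phis (A j) m qs wss x (map (prO j) ys)"
proof (rule nth_equalityI)
 fix n assume "n < length (map (prO j) (phis W m qs wss x ys))"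
 then have n: "n < length ws" using ThetaHoms_nth(1)[OF qs] by (simp add: phis_def)
 have "blocks (map length wss) ys ! n : Ob (E W (fibs (wss ! n) x))"
  using blocks_E_ob[OF W W premor_id[OF W] ys] n ThetaHoms_nth(1)[OF qs] by simp
 from pr_phi(1)[OF j ThetaHoms_nth(2)[OF qs n] x this]
 show "map (prO j) (phis W m qs wss x ys) ! n = phis (A j) m qs wss x (map (prO j) ys) ! n"
  using n ThetaHoms_nth(1)[OF qs] by (simp add: phis_def map_blocks)
qed (simp add: phis_def)

end

section \<open>Transporting, picking and cutting of arguments\<close>

context T_algebra
begin

lemmas xnatD = xnat_def[THEN iffD1, THEN c1, rule_format]
 xnat_def[THEN iffD1, THEN c2, THEN c1, rule_format]
 xnat_def[THEN iffD1, THEN c2, THEN c2, THEN c1, rule_format]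
 xnat_def[THEN iffD1, THEN c2, THEN c2, THEN c2, THEN c1, rule_format]
 xnat_def[THEN iffD1, THEN c2, THEN c2, THEN c2, THEN c2, rule_format]

lemma map2_tr_comp:
 assumes A: "prealg A" and ys: "ys : Ob (E A (fibs (map k ws) x))"
  and h: "!!v. v : set ws ==> h1 v : hom Q (fib (k v) x) (i1 v) & h2 v : hom Q (i1 v) (i2 v)"
 shows "map2 (%v. FO (tr A (h2 v))) ws (map2 (%v. FO (tr A (h1 v))) ws ys) = map2 (%v. FO (tr A (h2 v *[Q] h1 v))) ws ys"
proof (rule nth_equalityI)
 fix n assume "n < length (map2 (%v. FO (tr A (h2 v))) ws (map2 (%v. FO (tr A (h1 v))) ws ys))"
 then have n: "n < length ws" "n < length ys" by simp_all
 have "ys ! n : Ob (Fb A (fib (k (ws ! n)) x))" using ys n unfolding E_ob by auto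
 with tr_comp(1)[OF A h[OF nth_mem[OF n(1)], THEN c1] h[OF nth_mem[OF n(1)], THEN c2]]
 show "map2 (%v. FO (tr A (h2 v))) ws (map2 (%v. FO (tr A (h1 v))) ws ys) ! n = map2 (%v. FO (tr A (h2 v *[Q] h1 v))) ws ys ! n"
  using n by simp
qed simp

lemma map2_tr_ident:
 assumes A: "prealg A" and ys: "ys : Ob (E A (fibs ws x))" and h: "!!v. v : set ws ==> h v = Ident Q (fib v x) & fib v x : Ob Q"
 shows "map2 (%v. FO (tr A (h v))) ws ys = ys"
 using ys h tr_ident(1)[OF A] unfolding E_ob by (intro nth_equalityI) simp_all

lemma tr_args:
 "prealg A ==> ys : Ob (E A (fibs (map k ws) x)) ==> (!!v. v : set ws ==> h v : hom Q (fib (k v) x) (fib v y)) ==>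
  map2 (%v. FO (tr A (h v))) ws ys : Ob (E A (fibs ws y))"
 by (rule tr_args_ob[OF _ _ premor_id])

lemma blocks_env:
 "prealg A ==> ys : Ob (E A (fibs (concat wss) x)) ==> i < length wss ==> blocks (map length wss) ys ! i : Ob (E A (fibs (wss ! i) x))"
 by (rule blocks_E_ob[OF _ _ premor_id])

lemma pick_env:
 "prealg A ==> ys : Ob (E A (fibs ws x)) ==> set io <= {..<length ws} ==> pick ys io : Ob (E A (fibs (pick ws io) x))"
 by (rule pick_E_ob[OF _ _ premor_id])

lemma trs_env:
 assumes "prealg A" "set ws <= KW m" "h : hom (P m) x y" "ys : Ob (E A (fibs ws x))"
 shows "trs A ws h ys : Ob (E A (fibs ws y))"
 using assms functor_ob[OF functor_tr[OF assms(1) fibA_hom[OF _ assms(3)]]] unfolding E_ob by (simp add: subset_iff)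

lemma phis_trs:
 assumes A: "prealg A" and qs: "THs m qs ws wss" and h: "h : hom (P m) x y" and ys: "ys : Ob (E A (fibs (concat wss) x))"
 shows "phis A m qs wss y (trs A (concat wss) h ys) = trs A ws h (phis A m qs wss x ys)"
proof (rule nth_equalityI)
 have l: "length qs = length ws" "length wss = length ws" using ThetaHoms_nth(1)[OF qs] by auto
 have ly: "length ys = length (concat wss)" using ys unfolding E_ob by simp
 show "length (phis A m qs wss y (trs A (concat wss) h ys)) = length (trs A ws h (phis A m qs wss x ys))"
  using l by (simp add: phis_def)
 fix n assume "n < length (phis A m qs wss y (trs A (concat wss) h ys))"
 then have n: "n < length ws" using l by (simp add: phis_def)
 have "blocks (map length wss) ys ! n : Ob (E A (fibs (wss ! n) x))" using blocks_env[OF A ys] n l by simp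
 from phi_nat(1)[OF A ThetaHoms_nth(2)[OF qs n] h this]
 show "phis A m qs wss y (trs A (concat wss) h ys) ! n = trs A ws h (phis A m qs wss x ys) ! n"
  using n l by (simp add: phis_def blocks_map2_concat[OF ly])
qed

end

context strict_family
begin

lemma pr_trs':
 assumes "j : JJ" "set ws <= KW m" "h : hom (P m) x y" "ys : Ob (E W (fibs ws x))"
 shows "map (prO j) (trs W ws h ys) = trs (A j) ws h (map (prO j) ys)"
 using assms(2,4) pr_tr(1)[OF assms(1) fibA_hom[OF _ assms(3)]] unfolding E_ob
 by (intro nth_equalityI) (simp_all add: subset_iff)

lemma xnat_Aj: "j : JJ ==> xnat (A j)"
 using Aj by (simp add: pseudo_algebra_def alg_data_iff)

text \<open>\<open>R\<close> serves here as well: a transported isomorphism is an isomorphism with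
  known components, so it remains to compare the targets.\<close>

lemma xnat_W: "xnat W"
 unfolding xnat_def
proof (intro conjI allI ballI impI)
 fix m w x y h ys assume w: "w : KW m" and h: "h : hom (P m) x y" and ys: "ys : Ob (E W (fibs [w] x))"
 have x: "x : Ob (P m)" "y : Ob (P m)" using hom_ob[OF category_P h] by auto
 obtain z where z: "ys = [z]" "z : Ob (Fb W (fib w x))" using ys by (auto simp: list_all2_Cons1)
 note hw = fibA_hom[OF w h]
 have "FA (tr W (fibA w h)) (e_unit W m w x [z]) = e_unit W m w y [FO (tr W (fibA w h)) z]"
 proof (rule R_eq[OF R_tr[OF hw R_unit[OF w x(1) z(2)]] R_unit[OF w x(2) functor_ob[OF functor_tr[OF W hw] z(2)]] refl])
  fix j assume j: "j : JJ"
  show "FA (tr (A j) (fibA w h)) (e_unit (A j) m w x [prO j z]) = e_unit (A j) m w y [prO j (FO (tr W (fibA w h)) z)]"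
   using xnatD(1)[OF xnat_Aj[OF j] w h, of "[prO j z]"] prO_ob[OF j fib_ob[OF w x(1)] z(2)] by (simp add: pr_tr(1)[OF j hw z(2)])
 qed
 then show "FA (tr W (fibA w h)) (e_unit W m w x ys) = e_unit W m w y (trs W [w] h ys)" by (simp add: z)
next
 fix m w ws wss q qs x y h ys assume q: "q : TH m w ws" and qs: "THs m qs ws wss" and h: "h : hom (P m) x y"
  and ys: "ys : Ob (E W (fibs (concat wss) x))"
 have x: "x : Ob (P m)" "y : Ob (P m)" using hom_ob[OF category_P h] by auto
 note hw = fibA_hom[OF ThetaHomD[OF q, THEN c1] h] and k = ThetaHoms_kwords[OF qs]
 show "FA (tr W (fibA w h)) (e_comp W m q qs x ys) = e_comp W m q qs y (trs W (concat wss) h ys)"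
 proof (rule R_eq[OF R_tr[OF hw R_ecomp[OF q qs x(1) ys]] R_ecomp[OF q qs x(2) trs_env[OF W k h ys]]])
  show "FO (tr W (fibA w h)) (FO (phi W m q x) (phis W m qs wss x ys)) = FO (phi W m q y) (phis W m qs wss y (trs W (concat wss) h ys))"
   unfolding phis_trs[OF W qs h ys] by (rule phi_nat(1)[OF W q h phis_ob[OF W qs x(1) ys], symmetric])
  fix j assume j: "j : JJ"
  show "FA (tr (A j) (fibA w h)) (e_comp (A j) m q qs x (map (prO j) ys)) = e_comp (A j) m q qs y (map (prO j) (trs W (concat wss) h ys))"
   unfolding pr_trs'[OF j k h ys]
   by (rule xnatD(2)[OF xnat_Aj[OF j] q qs h pr_env[OF j fibs_ob[OF Ocomp_hom[OF q qs] x(1)] ys]])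
 qed
next
 fix m w ws p io q x y h ys assume io: "io : index_maps p (length ws)" and q: "q : TH m w (pick ws io)" and k: "set ws <= KW m"
  and h: "h : hom (P m) x y" and ys: "ys : Ob (E W (fibs ws x))"
 have x: "x : Ob (P m)" "y : Ob (P m)" using hom_ob[OF category_P h] by auto
 note hw = fibA_hom[OF ThetaHomD[OF q, THEN c1] h] and ii = index_mapsD[OF io, THEN c2]
 have "io ! n < length ws" if "n < length io" for n using ii nth_mem[OF that] by blast
 then have e: "trs W (pick ws io) h (pick ys io) = pick (trs W ws h ys) io"
  using ys unfolding E_ob by (intro nth_equalityI) simp_all
 show "FA (tr W (fibA w h)) (e_fun W m ws io q x ys) = e_fun W m ws io q y (trs W ws h ys)"
 proof (rule R_eq[OF R_tr[OF hw R_efun[OF io q k x(1) ys]] R_efun[OF io q k x(2) trs_env[OF W k h ys]]])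
  show "FO (tr W (fibA w h)) (FO (phi W m q x) (pick ys io)) = FO (phi W m q y) (pick (trs W ws h ys) io)"
   unfolding e[symmetric] by (rule phi_nat(1)[OF W q h pick_env[OF W ys ii], symmetric])
  fix j assume j: "j : JJ"
  show "FA (tr (A j) (fibA w h)) (e_fun (A j) m ws io q x (map (prO j) ys)) = e_fun (A j) m ws io q y (map (prO j) (trs W ws h ys))"
   unfolding pr_trs'[OF j k h ys]
   by (rule xnatD(3)[OF xnat_Aj[OF j] io q k h pr_env[OF j fibs_ob[OF Ofun_hom[OF q k ii] x(1)] ys]])
 qed
next
 fix m l w ws f q x y h ys assume f: "f : index_maps m l" and q: "q : TH m w ws" and h: "h : hom (P l) x y"
  and ys: "ys : Ob (E W (fibs (map (ksb l f) ws) x))"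
 have x: "x : Ob (P l)" "y : Ob (P l)" using hom_ob[OF category_P h] by auto
 note hf = pick_homP[OF h f] and kw = ThetaHomD[OF q, THEN c1] and kws = ThetaHomD[OF q, THEN c2, THEN c1]
 note hw = fibA_hom[OF kw hf] and O = Osub_hom[OF q f]
 note k = ThetaHomD[OF O, THEN c2, THEN c1]
 note ys' = trs_env[OF W k h ys]
 show "FA (tr W (fibA w (pick h f))) (e_sub W l f q x ys) = e_sub W l f q y (trs W (map (ksb l f) ws) h ys)"
 proof (rule R_eq[OF R_tr[OF hw R_esub[OF f q x(1) ys]] R_esub[OF f q x(2) ys']])
  let ?z = "map2 (%v. FO (tr W (sQ l f v x))) ws ys"
  have z: "?z : Ob (E W (fibs ws (pick x f)))"
   by (rule tr_args[OF W ys]) (rule sQ_homs[OF q f x(1) insertI2])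
  \<comment> \<open>In each argument this is the naturality square of \<open>s\<close> in
    \<open>I^k\<close>, carried over by \<open>X\<close>.\<close>
  have "trs W ws (pick h f) ?z = map2 (%v. FO (tr W (sQ l f v y))) ws (trs W (map (ksb l f) ws) h ys)"
  proof -
   have "trs W ws (pick h f) ?z = map2 (%v. FO (tr W (fibA v (pick h f) *[Q] sQ l f v x))) ws ys"
    by (rule map2_tr_comp[OF W ys]) (use sQ_homs[OF q f x(1) insertI2] fibA_hom[OF _ hf] kws in blast)
   also have "\<dots> = map2 (%v. FO (tr W (sQ l f v y *[Q] fibA (ksb l f v) h))) ws ys"
    using sQ_nat[OF _ f h] kws by (intro map_cong refl) (auto dest!: set_zip_leftD)
   also have "\<dots> = map2 (%v. FO (tr W (sQ l f v y))) ws (map2 (%v. FO (tr W (fibA (ksb l f v) h))) ws ys)"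
    by (rule map2_tr_comp[OF W ys, symmetric]) (use sQ_homs[OF q f x(2) insertI2] fibA_hom[OF ksub_kwords[OF _ f] h] kws in blast)
   finally show ?thesis by (simp add: map2_map_left)
  qed
  then show "FO (tr W (fibA w (pick h f))) (FO (phi W m q (pick x f)) ?z)
   = FO (phi W m q (pick y f)) (map2 (%v. FO (tr W (sQ l f v y))) ws (trs W (map (ksb l f) ws) h ys))"
   using phi_nat(1)[OF W q hf z] by simp
  fix j assume j: "j : JJ"
  show "FA (tr (A j) (fibA w (pick h f))) (e_sub (A j) l f q x (map (prO j) ys)) = e_sub (A j) l f q y (map (prO j) (trs W (map (ksb l f) ws) h ys))"
   unfolding pr_trs'[OF j k h ys] by (rule xnatD(4)[OF xnat_Aj[OF j] f q h pr_env[OF j fibs_ob[OF O x(1)] ys]])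
 qed
next
 fix m w ws us q x y h ys assume q: "q : TH m w ws" and us: "length us = m & word_list TT us"
  and h: "h : hom (P (arsum us)) x y" and ys: "ys : Ob (E W (fibs (map (kgm us) ws) x))"
 note u = us[THEN c1] us[THEN c2]
 have x: "x : Ob (P (arsum us))" "y : Ob (P (arsum us))" using hom_ob[OF category_P h] by auto
 have hf: "PhiSA us h : hom (P m) (PhiS TT I us x) (PhiS TT I us y)" using PhiSA_hom[OF u(2) h] u(1) by simp
 note kw = ThetaHomD[OF q, THEN c1] and kws = ThetaHomD[OF q, THEN c2, THEN c1]
 note hw = fibA_hom[OF kw hf] and O = Opull_hom[OF q u]
 note k = ThetaHomD[OF O, THEN c2, THEN c1]
 note ys' = trs_env[OF W k h ys]
 show "FA (tr W (fibA w (PhiSA us h))) (e_pull W us q x ys) = e_pull W us q y (trs W (map (kgm us) ws) h ys)"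
 proof (rule R_eq[OF R_tr[OF hw R_epull[OF q u x(1) ys]] R_epull[OF q u x(2) ys']])
  let ?z = "map2 (%v. FO (tr W (cQ us v x))) ws ys"
  have z: "?z : Ob (E W (fibs ws (PhiS TT I us x)))"
   by (rule tr_args[OF W ys]) (rule cQ_homs[OF q u x(1) insertI2])
  have "trs W ws (PhiSA us h) ?z = map2 (%v. FO (tr W (cQ us v y))) ws (trs W (map (kgm us) ws) h ys)"
  proof -
   have "trs W ws (PhiSA us h) ?z = map2 (%v. FO (tr W (fibA v (PhiSA us h) *[Q] cQ us v x))) ws ys"
    by (rule map2_tr_comp[OF W ys]) (use cQ_homs[OF q u x(1) insertI2] fibA_hom[OF _ hf] kws in blast)
   also have "\<dots> = map2 (%v. FO (tr W (cQ us v y *[Q] fibA (kgm us v) h))) ws ys"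
    using cQ_nat[OF _ u(2) h] kws u(1) by (intro map_cong refl) (auto dest!: set_zip_leftD)
   also have "\<dots> = map2 (%v. FO (tr W (cQ us v y))) ws (map2 (%v. FO (tr W (fibA (kgm us v) h))) ws ys)"
    by (rule map2_tr_comp[OF W ys, symmetric]) (use cQ_homs[OF q u x(2) insertI2] fibA_hom[OF kgam_kwords[OF _ u] h] kws in blast)
   finally show ?thesis by (simp add: map2_map_left)
  qed
  then show "FO (tr W (fibA w (PhiSA us h))) (FO (phi W m q (PhiS TT I us x)) ?z)
   = FO (phi W m q (PhiS TT I us y)) (map2 (%v. FO (tr W (cQ us v y))) ws (trs W (map (kgm us) ws) h ys))"
   using phi_nat(1)[OF W q hf z] by simp
  fix j assume j: "j : JJ"
  show "FA (tr (A j) (fibA w (PhiSA us h))) (e_pull (A j) us q x (map (prO j) ys)) = e_pull (A j) us q y (map (prO j) (trs W (map (kgm us) ws) h ys))"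
   unfolding pr_trs'[OF j k h ys] by (rule xnatD(5)[OF xnat_Aj[OF j] q us h pr_env[OF j fibs_ob[OF O x(1)] ys]])
 qed
qed

lemma alg_data_W: "alg_data U \<Theta> I W"
 unfolding alg_data_iff using W kinds_iso_W xnat_W by blast

section \<open>The fourteen coherence diagrams\<close>

lemma coh_Aj:
 assumes "j : JJ"
 shows "coh_assoc \<Theta> I (A j)" "coh_unit \<Theta> I (A j)" "coh_fun_fun \<Theta> I (A j)" "coh_fun_outer \<Theta> I (A j)" "coh_fun_inner \<Theta> I (A j)"
  "coh_sub_sub \<Theta> I (A j)" "coh_pull_pull \<Theta> I (A j)" "coh_pull_unit \<Theta> I (A j)" "coh_comp_sub \<Theta> I (A j)" "coh_fun_sub \<Theta> I (A j)"
  "coh_fun_pull \<Theta> I (A j)" "coh_pull_by_sub \<Theta> I (A j)" "coh_pull_of_sub \<Theta> I (A j)" "coh_comp_pull \<Theta> I (A j)"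
 using Aj[OF assms] unfolding pseudo_algebra_def by blast+

text \<open>The pattern of all fourteen diagrams: \<open>R\<close> is derived for both sides, the
  targets are matched, and equality of the components is the diagram for \<open>A j\<close>. Here
  the targets coincide literally.\<close>

lemma coh_assoc_W: "coh_assoc \<Theta> I W"
 unfolding coh_assoc_def Let_def Xw_simps
proof (intro allI ballI impI, goal_cases)
 case (1 m w ws wss vsss qs qss q x ys)
 note q = 1(1) and x = 1(3) and ys = 1(4)
 have qs: "THs m qs ws wss" and l: "length qss = length ws" "length vsss = length ws"
  and qss: "ALL i<length ws. THs m (qss ! i) (wss ! i) (vsss ! i)" using 1(2) by auto
 have lw: "length qs = length ws" "length wss = length ws" using ThetaHoms_nth(1)[OF qs] by auto
 have li: "length (qss ! i) = length (wss ! i)" "length (vsss ! i) = length (wss ! i)" if "i < length ws" for i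
  using ThetaHoms_nth(1)[OF qss[rule_format, OF that]] by auto
 have ca: "THs m (concat qss) (concat wss) (concat vsss)"
  by (rule ThetaHoms_concat) (use l lw qss in auto)
 have cb: "THs m (map2 (Ocp m) qs qss) ws (map concat vsss)"
  unfolding ThetaHoms_def using Ocomp_hom[OF ThetaHoms_nth(2)[OF qs] qss[rule_format]] l lw by simp
 let ?zs = "phis W m (concat qss) (concat vsss) x ys" and ?bl = "blocks (map (%vss. length (concat vss)) vsss)"
 note zs = phis_ob[OF W ca x ys] and O = Ocomp_hom[OF q qs]
 have ys': "ys : Ob (E W (fibs (concat (map concat vsss)) x))" using ys by (simp only: concat_map_concat)
 \<comment> \<open>An operation applied to a family of isomorphisms needs their ends one by one;
   \<open>blocks_nested\<close> brings the \<open>n\<close>-th target into the required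
   form.\<close>
 have R2: "R (fib w x) (FA (phi W m q x) (map (%i. e_comp W m (qs ! i) (qss ! i) x (?bl ys ! i)) [0..<length ws]))
  (FO (phi W m q x) (phis W m (map2 (Ocp m) qs qss) (map concat vsss) x ys)) (FO (phi W m q x) (phis W m qs wss x ?zs))
  (%j. FA (phi (A j) m q x) (map (%i. e_comp (A j) m (qs ! i) (qss ! i) x (?bl (map (prO j) ys) ! i)) [0..<length ws]))"
 proof (rule R_phi[OF q x])
  fix n assume n: "n < length ws"
  have bo: "?bl ys ! n : Ob (E W (fibs (concat (vsss ! n)) x))" using blocks_env[OF W ys', of n] n l by (simp add: o_def)
  have e1: "phis W m (map2 (Ocp m) qs qss) (map concat vsss) x ys ! n = FO (phi W m (Ocp m (qs ! n) (qss ! n)) x) (?bl ys ! n)"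
   using n l lw by (simp add: phis_def o_def)
  have wl: "map length wss = map length vsss" "map length qss = map length vsss"
   using li l lw by (auto intro!: nth_equalityI)
  have ly: "length ys = sum_list (map length (concat vsss))" using ys unfolding E_ob by (simp add: length_concat)
  have e2: "phis W m qs wss x ?zs ! n = FO (phi W m (qs ! n) x) (phis W m (qss ! n) (vsss ! n) x (?bl ys ! n))"
   using n l lw blocks_nested[OF wl(2) _ ly, where i = n and g = "%q'. FO (phi W m q' x)"] by (simp add: phis_def wl(1))
  show "R (fib (ws ! n) x) (map (%i. e_comp W m (qs ! i) (qss ! i) x (?bl ys ! i)) [0..<length ws] ! n)
   (phis W m (map2 (Ocp m) qs qss) (map concat vsss) x ys ! n) (phis W m qs wss x ?zs ! n)
   (%j. map (%i. e_comp (A j) m (qs ! i) (qss ! i) x (?bl (map (prO j) ys) ! i)) [0..<length ws] ! n)"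
   using R_ecomp[OF ThetaHoms_nth(2)[OF qs n] qss[rule_format, OF n] x bo] n by (simp add: e1 e2 map_blocks l)
 qed (use l lw in \<open>simp_all add: phis_def\<close>)
 show ?case
  by (rule R_eq[OF R_comp[OF R_ecomp[OF q qs x zs] R_ecomp[OF O ca x ys]] R_comp[OF R2 R_ecomp[OF q cb x ys']] refl])
   (simp only: pr_phis[OF _ ca x ys], rule coh_Aj(1)[unfolded coh_assoc_def Let_def Xw_simps, rule_format, OF _ q 1(2) x
    pr_env[OF _ fibs_ob[OF Ocomp_hom[OF O ca] x] ys]])
qed

lemma coh_unit_W: "coh_unit \<Theta> I W"
 unfolding coh_unit_def Let_def Xw_simps
proof (intro allI ballI impI, goal_cases)
 case (1 m w ws q x ys)
 note q = 1(1) and x = 1(2) and ys = 1(3)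
 note i = Theta_fib[OF q x] and p = functor_ob[OF functor_phi[OF W q x] ys] and k = ThetaHomD[OF q]
 have ly: "length ys = length ws" using ys unfolding E_ob by simp
 let ?wss = "map (%w. [w]) ws"
 have cw: "concat ?wss = ws" by (induction ws) auto
 have \<theta>: "THs m (map (Oun m) ws) ws ?wss"
  unfolding ThetaHoms_def using k nth_mem by (auto intro!: Ounit_hom)
 have ys': "ys : Ob (E W (fibs (concat ?wss) x))" using ys unfolding cw .
 have bl: "blocks (map length ?wss) ys = map (%y. [y]) ys"
 proof -
  have "blocks (map length ?wss) (concat (map (%y. [y]) ys)) = map (%y. [y]) ys"
   by (rule blocks_concat) (use ly in \<open>auto intro!: nth_equalityI\<close>)
  then show ?thesis by (simp add: concat_map_singleton)
 qed
 have R2: "R (fib w x) (FA (phi W m q x) (map2 (%v y. e_unit W m v x [y]) ws ys))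
  (FO (phi W m q x) (phis W m (map (Oun m) ws) ?wss x ys)) (FO (phi W m q x) ys)
  (%j. FA (phi (A j) m q x) (map2 (%v y. e_unit (A j) m v x [y]) ws (map (prO j) ys)))"
 proof (rule R_phi[OF q x])
  fix n assume n: "n < length ws"
  have "ws ! n : KW m" "ys ! n : Ob (Fb W (fib (ws ! n) x))" using n k nth_mem ys unfolding E_ob by auto
  from R_unit[OF this(1) x this(2)]
  show "R (fib (ws ! n) x) (map2 (%v y. e_unit W m v x [y]) ws ys ! n) (phis W m (map (Oun m) ws) ?wss x ys ! n) (ys ! n)
   (%j. map2 (%v y. e_unit (A j) m v x [y]) ws (map (prO j) ys) ! n)"
   using n ly bl by (simp add: phis_def)
 qed (use ly bl in \<open>simp_all add: phis_def\<close>)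
 have "FA (phi W m q x) (map2 (%v y. e_unit W m v x [y]) ws ys) *[Fb W (fib w x)] e_comp W m q (map (Oun m) ws) x ys
  = Ident (Fb W (fib w x)) (FO (phi W m q x) ys)"
  by (rule R_eq[OF R_comp[OF R2 R_ecomp[OF q \<theta> x ys']] R_ident[OF i p] refl])
   (simp only: pr_phi(1)[OF _ q x ys], rule coh_Aj(2)[unfolded coh_unit_def Let_def Xw_simps, rule_format, OF _ q x
    pr_env[OF _ fibs_ob[OF q x] ys], THEN c1])
 moreover have "e_unit W m w x [FO (phi W m q x) ys] *[Fb W (fib w x)] e_comp W m (Oun m w) [q] x ys
  = Ident (Fb W (fib w x)) (FO (phi W m q x) ys)"
 proof -
  have \<theta>: "THs m [q] [w] [ws]" using q by (simp add: ThetaHoms_def)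
  have ys': "ys : Ob (E W (fibs (concat [ws]) x))" using ys by simp
  have e: "phis W m [q] [ws] x ys = [FO (phi W m q x) ys]" using ly by (simp add: phis_def)
  show ?thesis
   by (rule R_eq[OF R_comp[OF R_unit[OF k[THEN c1] x p] R_ecomp[OF Ounit_hom[OF k[THEN c1]] \<theta> x ys', unfolded e]] R_ident[OF i p] refl])
    (simp only: pr_phi(1)[OF _ q x ys], rule coh_Aj(2)[unfolded coh_unit_def Let_def Xw_simps, rule_format, OF _ q x
     pr_env[OF _ fibs_ob[OF q x] ys], THEN c2])
 qed
 ultimately show ?case ..
qed

lemma coh_fun_fun_W: "coh_fun_fun \<Theta> I W"
 unfolding coh_fun_fun_def Let_def Xw_simps
proof (intro conjI allI ballI impI, goal_cases)
 case (1 m w ws p q0 io \<theta> q x ys)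
 note io = 1(1) and \<theta> = 1(2) and q = 1(3) and k = 1(4) and x = 1(5) and ys = 1(6)
 note l\<theta> = index_mapsD[OF \<theta>] and lio = index_mapsD[OF io]
 have pp: "pick (pick z \<theta>) io = pick z (pick \<theta> io)" for z :: "'x list" using l\<theta> lio by (intro pick_pick) simp
 have q': "q : TH m w (pick (pick ws \<theta>) io)" using q unfolding pp .
 have k': "set (pick ws \<theta>) <= KW m" using set_pick[of \<theta> ws] l\<theta> k by auto
 have io': "io : index_maps p (length (pick ws \<theta>))" using io l\<theta> by simp
 note O = Ofun_hom[OF q' k' index_mapsD[OF io', THEN c2]]
 note ys' = pick_env[OF W ys l\<theta>[THEN c2]]
 have mp: "map (prO j) (pick ys \<theta>) = pick (map (prO j) ys) \<theta>" for j
  using l\<theta> ys unfolding E_ob by (intro map_pick) simp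
 show ?case
  by (rule R_eq[OF R_comp[OF R_efun[OF io' q' k' x ys'] R_efun[OF \<theta> O k x ys]] R_efun[OF index_maps_pick[OF io \<theta>] q k x ys]])
   (simp only: pp, simp only: mp, rule coh_Aj(3)[unfolded coh_fun_fun_def Let_def Xw_simps, THEN c1, rule_format, OF _ io \<theta> q k x
    pr_env[OF _ fibs_ob[OF Ofun_hom[OF O k l\<theta>[THEN c2]] x] ys]])
next
 case (2 m w ws q x ys)
 note q = 2(1) and x = 2(2) and ys = 2(3)
 note i = Theta_fib[OF q x] and p = functor_ob[OF functor_phi[OF W q x] ys] and k = ThetaHomD[OF q, THEN c2, THEN c1]
 have ly: "length ys = length ws" using ys unfolding E_ob by simp
 have q': "q : TH m w (pick ws [0..<length ws])" using q by simp
 have py: "pick ys [0..<length ws] = ys" by (simp flip: ly)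
 show ?case
  by (rule R_eq[OF R_efun[OF index_maps_id q' k x ys] R_ident[OF i p]])
   (simp only: py, simp only: pr_phi(1)[OF _ q x ys], rule coh_Aj(3)[unfolded coh_fun_fun_def Let_def Xw_simps, THEN c2, rule_format, OF _ q x
    pr_env[OF _ fibs_ob[OF q x] ys]])
qed

lemma coh_fun_outer_W: "coh_fun_outer \<Theta> I W"
 unfolding coh_fun_outer_def Let_def Xw_simps
proof (intro allI ballI impI, goal_cases)
 case (1 m w ws wss p qs io q x ys)
 note io = 1(1) and q = 1(2) and x = 1(4) and ys = 1(5)
 have k: "set ws <= KW m" and qs: "THs m qs ws wss" using 1(3) by auto
 note lio = index_mapsD[OF io] and l = ThetaHoms_nth(1)[OF qs] and O = Ofun_hom[OF q k index_mapsD[OF io, THEN c2]]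
 have in_: "io ! n < length ws" if "n < length io" for n using lio nth_mem[OF that] by auto
 let ?b = "bar (map length wss) io" and ?zs = "phis W m qs wss x ys"
 note zs = phis_ob[OF W qs x ys]
 have \<theta>: "THs m (pick qs io) (pick ws io) (pick wss io)"
  using ThetaHoms_nth(2)[OF qs in_] by (simp add: ThetaHoms_def)
 have b: "?b : index_maps (sum_list (pick (map length wss) io)) (length (concat wss))"
  using bar_index_maps[of io p "map length wss"] io l by (simp add: length_concat)
 note lb = index_mapsD[OF b, THEN c2]
 have pc: "pick (concat wss) ?b = concat (pick wss io)" by (rule pick_bar_concat) (use lio l in auto)
 note O2 = Ocomp_hom[OF q \<theta>] and ck = ThetaHoms_kwords[OF qs]
 note O2' = O2[folded pc]
 note ys' = pick_env[OF W ys lb, unfolded pc]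
 have ly: "length ys = length (concat wss)" using ys unfolding E_ob by simp
 \<comment> \<open>For the targets: picking values amounts to picking the operations together with
   the blocks of their arguments.\<close>
 have e: "pick ?zs io = phis W m (pick qs io) (pick wss io) x (pick ys ?b)"
 proof -
  have 1: "pick ys ?b = concat (pick (blocks (map length wss) ys) io)"
   by (rule pick_bar) (use lio l ly in \<open>auto simp: length_concat\<close>)
  have 2: "map length (pick (blocks (map length wss) ys) io) = map length (pick wss io)"
   using lio l ly length_in_blocks[of ys "map length wss"] map_pick[of io "blocks (map length wss) ys" length] map_pick[of io wss length]
   by (simp add: length_concat)
  show ?thesis
   unfolding phis_def 1 blocks_concat[OF 2] using in_ l by (intro nth_equalityI) simp_all
 qed
 have mp: "map (prO j) (pick ys ?b) = pick (map (prO j) ys) ?b" for j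
  using lb ly by (intro map_pick) simp
 show ?case
  by (rule R_eq[OF R_comp[OF R_efun[OF io q k x zs] R_ecomp[OF O qs x ys]] R_comp[OF R_ecomp[OF q \<theta> x ys'] R_efun[OF b O2' ck x ys]]])
   (simp only: e, simp only: mp pr_phis[OF _ qs x ys], rule coh_Aj(4)[unfolded coh_fun_outer_def Let_def Xw_simps, rule_format, OF _ io q 1(3) x
    pr_env[OF _ fibs_ob[OF Ocomp_hom[OF O qs] x] ys]])
qed

lemma coh_fun_inner_W: "coh_fun_inner \<Theta> I W"
 unfolding coh_fun_inner_def Let_def Xw_simps
proof (intro allI ballI impI, goal_cases)
 case (1 m w ws wss ios qs q x ys)
 note q = 1(1) and x = 1(3) and ys = 1(4)
 have l: "length wss = length ws" "length ios = length ws"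
  and k: "!!i. i < length ws ==> set (wss ! i) <= KW m"
  and io: "!!i. i < length ws ==> ios ! i : index_maps (length (ios ! i)) (length (wss ! i))"
  and qs: "THs m qs ws (map2 pick wss ios)" using 1(2) by auto
 note li = index_mapsD[OF io, THEN c2] and la = ThetaHoms_nth(1)[OF qs, THEN c1]
 have qi: "qs ! i : TH m (ws ! i) (pick (wss ! i) (ios ! i))" if "i < length ws" for i
  using ThetaHoms_nth(2)[OF qs that] that l by simp
 let ?as = "map (%i. Ofn m (wss ! i) (ios ! i) (qs ! i)) [0..<length ws]" and ?b = "blocks (map length wss)"
  and ?\<kappa> = "block_sum (map length wss) ios"
 have \<theta>: "THs m ?as ws wss"
  using Ofun_hom[OF qi k li] l by (simp add: ThetaHoms_def)
 have ly: "length ys = length (concat wss)" using ys unfolding E_ob by simp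
 have pc: "pick (concat wss) ?\<kappa> = concat (map2 pick wss ios)"
  by (rule pick_block_sum_concat) (use l li in auto)
 have py: "pick ys ?\<kappa> = concat (map2 pick (?b ys) ios)"
  by (rule pick_block_sum) (use l li ly in \<open>auto simp: length_concat\<close>)
 have \<kappa>: "?\<kappa> : index_maps (sum_list (map length ios)) (length (concat wss))"
  using block_sum_index_maps[of ios "map length wss" "map length ios"] l io by (simp add: length_concat)
 note O = Ocomp_hom[OF q qs, folded pc] and l\<kappa> = index_mapsD[OF \<kappa>, THEN c2] and ck = ThetaHoms_kwords[OF \<theta>]
 note ys' = pick_env[OF W ys l\<kappa>, unfolded pc]
 \<comment> \<open>Picking along the block sum and cutting is picking inside each block; this
   identifies the arguments of each \<open>\<alpha>_i\<close>.\<close>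
 have bl: "blocks (map length (map2 pick wss ios)) (pick ys ?\<kappa>) = map2 pick (?b ys) ios"
  unfolding py by (rule blocks_concat) (use l in \<open>auto intro!: nth_equalityI\<close>)
 have R2: "R (fib w x) (FA (phi W m q x) (map (%i. e_fun W m (wss ! i) (ios ! i) (qs ! i) x (?b ys ! i)) [0..<length ws]))
  (FO (phi W m q x) (phis W m ?as wss x ys)) (FO (phi W m q x) (phis W m qs (map2 pick wss ios) x (pick ys ?\<kappa>)))
  (%j. FA (phi (A j) m q x) (map (%i. e_fun (A j) m (wss ! i) (ios ! i) (qs ! i) x (?b (map (prO j) ys) ! i)) [0..<length ws]))"
 proof (rule R_phi[OF q x])
  fix n assume n: "n < length ws"
  have bo: "?b ys ! n : Ob (E W (fibs (wss ! n) x))" using blocks_env[OF W ys, of n] n l by simp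
  show "R (fib (ws ! n) x) (map (%i. e_fun W m (wss ! i) (ios ! i) (qs ! i) x (?b ys ! i)) [0..<length ws] ! n)
   (phis W m ?as wss x ys ! n) (phis W m qs (map2 pick wss ios) x (pick ys ?\<kappa>) ! n)
   (%j. map (%i. e_fun (A j) m (wss ! i) (ios ! i) (qs ! i) x (?b (map (prO j) ys) ! i)) [0..<length ws] ! n)"
   using R_efun[OF io[OF n] qi[OF n] k[OF n] x bo] n l la by (simp add: phis_def bl[simplified] bl map_blocks)
 qed (use l la bl in \<open>simp_all add: phis_def\<close>)
 have mp: "map (prO j) (pick ys ?\<kappa>) = pick (map (prO j) ys) ?\<kappa>" for j
  using l\<kappa> ly by (intro map_pick) simp
 show ?case
  by (rule R_eq[OF R_comp[OF R2 R_ecomp[OF q \<theta> x ys]] R_comp[OF R_ecomp[OF q qs x ys'] R_efun[OF \<kappa> O ck x ys]] refl])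
   (simp only: mp, rule coh_Aj(5)[unfolded coh_fun_inner_def Let_def Xw_simps, rule_format, OF _ q 1(2) x
    pr_env[OF _ fibs_ob[OF Ocomp_hom[OF q \<theta>] x] ys]])
qed

lemma coh_sub_sub_W: "coh_sub_sub \<Theta> I W"
 unfolding coh_sub_sub_def Let_def Xw_simps trs_simp
proof (intro conjI allI ballI impI, goal_cases)
 case (1 m l r w ws f g q x ys)
 note f = 1(1) and g = 1(2) and q = 1(3) and x = 1(4) and ys = 1(5)
 note kw = ThetaHomD[OF q, THEN c1] and kws = ThetaHomD[OF q, THEN c2, THEN c1]
 note O = Osub_hom[OF q f] and x' = pick_ob[OF x g]
 have pp: "pick (pick x g) f = pick x (pick g f)" using index_mapsD[OF f] index_mapsD[OF g] by (intro pick_pick) simp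
 have kk: "map (ksb r g) (map (ksb l f) ws) = map (ksb r (pick g f)) ws"
  using ksub_ksub[OF _ f g] kws by auto
 have ys': "ys : Ob (E W (fibs (map (ksb r g) (map (ksb l f) ws)) x))" using ys unfolding kk .
 have ys2: "ys : Ob (E W (fibs (map (%v. ksb r g (ksb l f v)) ws) x))" using ys' by (simp add: o_def)
 note r1 = R_tr[OF sQ_hom[OF kw f x'] R_esub[OF g O x ys', unfolded map2_map_left]]
 have s1: "sQ r g v x : hom Q (fib (ksb r g v) x) (fib v (pick x g))" if "v : set (map (ksb l f) ws)" for v
  using sQ_homs[OF O g x insertI2[OF that]] .
 have "map2 (%v. FO (tr W (sQ r g v x))) (map (ksb l f) ws) ys : Ob (E W (fibs (map (ksb l f) ws) (pick x g)))"
  by (rule tr_args[OF W ys']) (rule s1)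
 note zs = this[unfolded map2_map_left]
 \<comment> \<open>The targets agree by axiom (6) of \<open>I\<close>, in the form
   \<open>sQ_sQ\<close>.\<close>
 have e: "map2 (%v. FO (tr W (sQ l f v (pick x g)))) ws (map2 (%v. FO (tr W (sQ r g (ksb l f v) x))) ws ys)
  = map2 (%v. FO (tr W (sQ r (pick g f) v x))) ws ys" (is "?l = _")
 proof -
  have "?l = map2 (%v. FO (tr W (sQ l f v (pick x g) *[Q] sQ r g (ksb l f v) x))) ws ys"
   by (rule map2_tr_comp[OF W ys2]) (use s1 sQ_homs[OF q f x' insertI2] in auto)
  also have "\<dots> = map2 (%v. FO (tr W (sQ r (pick g f) v x))) ws ys"
   using sQ_sQ[OF _ f g x] kws by (intro map_cong refl) (auto dest!: set_zip_leftD)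
  finally show ?thesis .
 qed
 have mp: "map (prO j) (map2 (%v. FO (tr W (sQ r g (ksb l f v) x))) ws ys)
  = map2 (%v. FO (tr (A j) (sQ r g (ksb l f v) x))) ws (map (prO j) ys)" if "j : JJ" for j
  using pr_trs[OF that ys' s1] by (simp add: map2_map_left)
 show ?case
  by (rule R_eq[OF R_comp[OF R_esub[OF f q x' zs] r1] R_esub[OF index_maps_pick[OF f g] q x ys, folded pp]])
   (simp only: e, simp only: mp, rule coh_Aj(6)[unfolded coh_sub_sub_def Let_def Xw_simps trs_simp, THEN c1, rule_format, OF _ f g q x
    pr_env[OF _ fibs_ob[OF Osub_hom[OF q index_maps_pick[OF f g]] x] ys]])
next
 case (2 m w ws q x ys)
 note q = 2(1) and x = 2(2) and ys = 2(3)
 note i = Theta_fib[OF q x] and p = functor_ob[OF functor_phi[OF W q x] ys]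
  and kws = ThetaHomD[OF q, THEN c2, THEN c1]
 have kk: "map (ksb m [0..<m]) ws = ws" using ksub_id kws by (auto intro!: map_idI)
 have ys': "ys : Ob (E W (fibs (map (ksb m [0..<m]) ws) x))" using ys unfolding kk .
 have px: "pick x [0..<m] = x" using x pick_id[of x] by (simp add: pow_cat_Ob del: pick_id)
 have e: "map2 (%v. FO (tr W (sQ m [0..<m] v x))) ws ys = ys"
  by (rule map2_tr_ident[OF W ys]) (use sQ_id[OF _ x] fib_ob[OF _ x] kws in blast)
 show ?case
  by (rule R_eq[OF R_esub[OF index_maps_id q x ys', unfolded px] R_ident[OF i p]])
   (simp only: e, simp only: pr_phi(1)[OF _ q x ys], rule coh_Aj(6)[unfolded coh_sub_sub_def Let_def Xw_simps trs_simp, THEN c2, rule_format, OF _ q x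
    pr_env[OF _ fibs_ob[OF q x] ys]])
qed

lemma coh_comp_sub_W: "coh_comp_sub \<Theta> I W"
 unfolding coh_comp_sub_def Let_def Xw_simps trs_simp
proof (intro allI ballI impI, goal_cases)
 case (1 m l w ws wss qs f q x ys)
 note f = 1(1) and q = 1(2) and qs = 1(3) and x = 1(4) and ys = 1(5)
 note kw = ThetaHomD[OF q, THEN c1] and la = ThetaHoms_nth(1)[OF qs] and x' = pick_ob[OF x f]
 note O = Osub_hom[OF q f]
 let ?as = "map (Osb l f) qs" and ?b = "blocks (map length wss)" and ?wss = "map (map (ksb l f)) wss"
 have \<theta>: "THs l ?as (map (ksb l f) ws) ?wss"
  using la Osub_hom[OF ThetaHoms_nth(2)[OF qs] f] by (simp add: ThetaHoms_def)
 have ys': "ys : Ob (E W (fibs (concat ?wss) x))" using ys by (simp only: map_concat)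
 have ly: "length ys = length (concat wss)" using ys unfolding E_ob by simp
 \<comment> \<open>\<open>phis\<close> depends on the lists of words through their lengths alone,
   and these are unchanged by substitution.\<close>
 have p: "phis B l ?as ?wss x zs = phis B l ?as wss x zs" for B :: "('io, 'ia, 't, 'h, 'u) alg" and zs
  by (simp add: phis_def o_def)
 let ?zs = "phis W l ?as wss x ys" and ?ts = "map2 (%v. FO (tr W (sQ l f v x))) (concat wss) ys"
 note zs = phis_ob[OF W \<theta> x ys', unfolded p]
 note h = sQ_homs[OF q f x insertI2] and hc = sQ_homs[OF Ocomp_hom[OF q qs] f x insertI2]
 have ts: "?ts : Ob (E W (fibs (concat wss) (pick x f)))" by (rule tr_args[OF W ys]) (rule hc)
 have R2: "R (fib w (pick x f)) (FA (phi W m q (pick x f)) (map2 (%q'. e_sub W l f q' x) qs (?b ys)))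
  (FO (phi W m q (pick x f)) (map2 (%v. FO (tr W (sQ l f v x))) ws ?zs)) (FO (phi W m q (pick x f)) (phis W m qs wss (pick x f) ?ts))
  (%j. FA (phi (A j) m q (pick x f)) (map2 (%q'. e_sub (A j) l f q' x) qs (?b (map (prO j) ys))))"
 proof (rule R_phi[OF q x'])
  fix n assume n: "n < length ws"
  have bo: "?b ys ! n : Ob (E W (fibs (map (ksb l f) (wss ! n)) x))"
   using blocks_env[OF W ys', of n] n la by (simp add: o_def)
  have e1: "map2 (%v. FO (tr W (sQ l f v x))) ws ?zs ! n
   = FO (tr W (sQ l f (ws ! n) x)) (FO (phi W l (Osb l f (qs ! n)) x) (?b ys ! n))"
   using n la by (simp add: phis_def)
  have e2: "phis W m qs wss (pick x f) ?ts ! n = FO (phi W m (qs ! n) (pick x f)) (map2 (%v. FO (tr W (sQ l f v x))) (wss ! n) (?b ys ! n))"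
   unfolding phis_def blocks_map2_concat[OF ly] using n la by simp
  show "R (fib (ws ! n) (pick x f)) (map2 (%q'. e_sub W l f q' x) qs (?b ys) ! n) (map2 (%v. FO (tr W (sQ l f v x))) ws ?zs ! n)
   (phis W m qs wss (pick x f) ?ts ! n) (%j. map2 (%q'. e_sub (A j) l f q' x) qs (?b (map (prO j) ys)) ! n)"
   using R_esub[OF f ThetaHoms_nth(2)[OF qs n] x bo] n la
   unfolding e1 e2 by (simp add: map_blocks)
 qed (use la in \<open>simp_all add: phis_def\<close>)
 have mp: "map (prO j) ?ts = map2 (%v. FO (tr (A j) (sQ l f v x))) (concat wss) (map (prO j) ys)" if "j : JJ" for j
  by (rule pr_trs[OF that ys]) (rule hc)
 show ?case
  by (rule R_eq[OF R_comp[OF R2 R_comp[OF R_esub[OF f q x zs] R_tr[OF sQ_hom[OF kw f x] R_ecomp[OF O \<theta> x ys', unfolded p]]]]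
    R_comp[OF R_ecomp[OF q qs x' ts] R_esub[OF f Ocomp_hom[OF q qs] x ys]] refl])
   (simp only: mp pr_phis[OF _ \<theta> x ys', unfolded p], rule coh_Aj(9)[unfolded coh_comp_sub_def Let_def Xw_simps trs_simp, rule_format, OF _ f q qs x
    pr_env[OF _ fibs_ob[OF Osub_hom[OF Ocomp_hom[OF q qs] f] x] ys]])
qed

lemma coh_fun_sub_W: "coh_fun_sub \<Theta> I W"
 unfolding coh_fun_sub_def Let_def Xw_simps trs_simp
proof (intro allI ballI impI, goal_cases)
 case (1 m l w ws p f io q x ys)
 note f = 1(1) and io = 1(2) and q = 1(3) and k = 1(4) and x = 1(5) and ys = 1(6)
 note kw = ThetaHomD[OF q, THEN c1] and lio = index_mapsD[OF io] and x' = pick_ob[OF x f]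
 note O = Ofun_hom[OF q k lio[THEN c2]] and O2 = Osub_hom[OF q f]
 have in_: "io ! n < length ws" if "n < length io" for n using lio nth_mem[OF that] by auto
 let ?zs = "map2 (%v. FO (tr W (sQ l f v x))) ws ys"
 have zs: "?zs : Ob (E W (fibs ws (pick x f)))" by (rule tr_args[OF W ys]) (rule sQ_homs[OF O f x insertI2])
 have ly: "length ys = length ws" using ys unfolding E_ob by simp
 have mpk: "map (ksb l f) (pick ws io) = pick (map (ksb l f) ws) io" using lio by (intro map_pick) simp
 note O2' = O2[unfolded mpk]
 have io': "io : index_maps p (length (map (ksb l f) ws))" using io by simp
 have k': "set (map (ksb l f) ws) <= KW l" using ThetaHomD[OF Osub_hom[OF O f]] by blast
 have py: "pick ys io : Ob (E W (fibs (map (ksb l f) (pick ws io)) x))"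
  unfolding mpk by (rule pick_env[OF W ys]) (use lio in simp)
 have e: "map2 (%v. FO (tr W (sQ l f v x))) (pick ws io) (pick ys io) = pick ?zs io"
  using in_ ly by (intro nth_equalityI) simp_all
 have mp: "map (prO j) (pick ys io) = pick (map (prO j) ys) io" for j using lio ly by (intro map_pick) simp
 have mz: "map (prO j) ?zs = map2 (%v. FO (tr (A j) (sQ l f v x))) ws (map (prO j) ys)" if "j : JJ" for j
  by (rule pr_trs[OF that ys]) (rule sQ_homs[OF O f x insertI2])
 show ?case
  by (rule R_eq[OF R_comp[OF R_efun[OF io q k x' zs] R_esub[OF f O x ys]]
    R_comp[OF R_esub[OF f q x py] R_tr[OF sQ_hom[OF kw f x] R_efun[OF io' O2' k' x ys]]]])
   (simp only: e, simp only: mp mz, rule coh_Aj(10)[unfolded coh_fun_sub_def Let_def Xw_simps trs_simp, rule_format, OF _ f io q k x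
    pr_env[OF _ fibs_ob[OF Osub_hom[OF O f] x] ys]])
qed

lemma coh_comp_pull_W: "coh_comp_pull \<Theta> I W"
 unfolding coh_comp_pull_def Let_def Xw_simps trs_simp
proof (intro allI ballI impI, goal_cases)
 case (1 m w ws wss qs us q x ys)
 have qs: "THs m qs ws wss" and u: "length us = m" "word_list TT us" using 1(2) by auto
 note q = 1(1) and x = 1(3) and ys = 1(4)
 note kw = ThetaHomD[OF q, THEN c1] and la = ThetaHoms_nth(1)[OF qs] and x' = PhiS_ob[OF u(2) x, unfolded u(1)]
 note O = Opull_hom[OF q u]
 let ?as = "map (Opl us) qs" and ?b = "blocks (map length wss)" and ?wss = "map (map (kgm us)) wss"
 have \<theta>: "THs (arsum us) ?as (map (kgm us) ws) ?wss"
  using la Opull_hom[OF ThetaHoms_nth(2)[OF qs] u] by (simp add: ThetaHoms_def)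
 have ys': "ys : Ob (E W (fibs (concat ?wss) x))" using ys by (simp only: map_concat)
 have ly: "length ys = length (concat wss)" using ys unfolding E_ob by simp
 have p: "phis B (arsum us) ?as ?wss x zs = phis B (arsum us) ?as wss x zs" for B :: "('io, 'ia, 't, 'h, 'u) alg" and zs
  by (simp add: phis_def o_def)
 let ?zs = "phis W (arsum us) ?as wss x ys" and ?ts = "map2 (%v. FO (tr W (cQ us v x))) (concat wss) ys"
 note zs = phis_ob[OF W \<theta> x ys', unfolded p]
 note h = cQ_homs[OF q u x insertI2] and hc = cQ_homs[OF Ocomp_hom[OF q qs] u x insertI2]
 have ts: "?ts : Ob (E W (fibs (concat wss) (PhiS TT I us x)))" by (rule tr_args[OF W ys]) (rule hc)
 have R2: "R (fib w (PhiS TT I us x)) (FA (phi W m q (PhiS TT I us x)) (map2 (%q'. e_pull W us q' x) qs (?b ys)))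
  (FO (phi W m q (PhiS TT I us x)) (map2 (%v. FO (tr W (cQ us v x))) ws ?zs)) (FO (phi W m q (PhiS TT I us x)) (phis W m qs wss (PhiS TT I us x) ?ts))
  (%j. FA (phi (A j) m q (PhiS TT I us x)) (map2 (%q'. e_pull (A j) us q' x) qs (?b (map (prO j) ys))))"
 proof (rule R_phi[OF q x'])
  fix n assume n: "n < length ws"
  have bo: "?b ys ! n : Ob (E W (fibs (map (kgm us) (wss ! n)) x))"
   using blocks_env[OF W ys', of n] n la by (simp add: o_def)
  have e1: "map2 (%v. FO (tr W (cQ us v x))) ws ?zs ! n
   = FO (tr W (cQ us (ws ! n) x)) (FO (phi W (arsum us) (Opl us (qs ! n)) x) (?b ys ! n))"
   using n la by (simp add: phis_def)
  have e2: "phis W m qs wss (PhiS TT I us x) ?ts ! n = FO (phi W m (qs ! n) (PhiS TT I us x)) (map2 (%v. FO (tr W (cQ us v x))) (wss ! n) (?b ys ! n))"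
   unfolding phis_def blocks_map2_concat[OF ly] using n la by simp
  show "R (fib (ws ! n) (PhiS TT I us x)) (map2 (%q'. e_pull W us q' x) qs (?b ys) ! n) (map2 (%v. FO (tr W (cQ us v x))) ws ?zs ! n)
   (phis W m qs wss (PhiS TT I us x) ?ts ! n) (%j. map2 (%q'. e_pull (A j) us q' x) qs (?b (map (prO j) ys)) ! n)"
   using R_epull[OF ThetaHoms_nth(2)[OF qs n] u x bo] n la
   unfolding e1 e2 by (simp add: map_blocks)
 qed (use la in \<open>simp_all add: phis_def\<close>)
 have mp: "map (prO j) ?ts = map2 (%v. FO (tr (A j) (cQ us v x))) (concat wss) (map (prO j) ys)" if "j : JJ" for j
  by (rule pr_trs[OF that ys]) (rule hc)
 show ?case
  by (rule R_eq[OF R_comp[OF R_ecomp[OF q qs x' ts] R_epull[OF Ocomp_hom[OF q qs] u x ys]]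
    R_comp[OF R2 R_comp[OF R_epull[OF q u x zs] R_tr[OF cQ_homs[OF q u x insertI1] R_ecomp[OF O \<theta> x ys', unfolded p]]]] refl])
   (simp only: mp pr_phis[OF _ \<theta> x ys', unfolded p], rule coh_Aj(14)[unfolded coh_comp_pull_def Let_def Xw_simps trs_simp, rule_format, OF _ q 1(2) x
    pr_env[OF _ fibs_ob[OF Opull_hom[OF Ocomp_hom[OF q qs] u] x] ys]])
qed

lemma coh_fun_pull_W: "coh_fun_pull \<Theta> I W"
 unfolding coh_fun_pull_def Let_def Xw_simps trs_simp
proof (intro allI ballI impI, goal_cases)
 case (1 m w ws p us io q x ys)
 have k: "set ws <= KW m" and u: "length us = m" "word_list TT us" using 1(3) by auto
 note io = 1(1) and q = 1(2) and x = 1(4) and ys = 1(5)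
 note kw = ThetaHomD[OF q, THEN c1] and lio = index_mapsD[OF io] and x' = PhiS_ob[OF u(2) x, unfolded u(1)]
 note O = Ofun_hom[OF q k lio[THEN c2]] and O2 = Opull_hom[OF q u]
 have in_: "io ! n < length ws" if "n < length io" for n using lio nth_mem[OF that] by auto
 let ?zs = "map2 (%v. FO (tr W (cQ us v x))) ws ys"
 have zs: "?zs : Ob (E W (fibs ws (PhiS TT I us x)))" by (rule tr_args[OF W ys]) (rule cQ_homs[OF O u x insertI2])
 have ly: "length ys = length ws" using ys unfolding E_ob by simp
 have mpk: "map (kgm us) (pick ws io) = pick (map (kgm us) ws) io" using lio by (intro map_pick) simp
 note O2' = O2[unfolded mpk]
 have io': "io : index_maps p (length (map (kgm us) ws))" using io by simp
 have k': "set (map (kgm us) ws) <= KW (arsum us)" using ThetaHomD[OF Opull_hom[OF O u]] by blast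
 have py: "pick ys io : Ob (E W (fibs (map (kgm us) (pick ws io)) x))"
  unfolding mpk by (rule pick_env[OF W ys]) (use lio in simp)
 have e: "map2 (%v. FO (tr W (cQ us v x))) (pick ws io) (pick ys io) = pick ?zs io"
  using in_ ly by (intro nth_equalityI) simp_all
 have mp: "map (prO j) (pick ys io) = pick (map (prO j) ys) io" for j using lio ly by (intro map_pick) simp
 have mz: "map (prO j) ?zs = map2 (%v. FO (tr (A j) (cQ us v x))) ws (map (prO j) ys)" if "j : JJ" for j
  by (rule pr_trs[OF that ys]) (rule cQ_homs[OF O u x insertI2])
 show ?case
  by (rule R_eq[OF R_comp[OF R_efun[OF io q k x' zs] R_epull[OF O u x ys]]
    R_comp[OF R_epull[OF q u x py] R_tr[OF cQ_homs[OF q u x insertI1] R_efun[OF io' O2' k' x ys]]]])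
   (simp only: e, simp only: mp mz, rule coh_Aj(11)[unfolded coh_fun_pull_def Let_def Xw_simps trs_simp, rule_format, OF _ io q 1(3) x
    pr_env[OF _ fibs_ob[OF Opull_hom[OF O u] x] ys]])
qed

lemma coh_pull_pull_W: "coh_pull_pull \<Theta> I W"
 unfolding coh_pull_pull_def Let_def Xw_simps trs_simp
proof (intro allI ballI impI, goal_cases)
 case (1 m w ws ts sss q x ys)
 have t: "length ts = m" "word_list TT ts" and s: "map length sss = ars TT ts" "ALL us:set sss. word_list TT us" using 1(2) by auto
 note q = 1(1) and ys = 1(4)
 note kw = ThetaHomD[OF q, THEN c1] and kws = ThetaHomD[OF q, THEN c2, THEN c1]
 let ?S = "concat sss" and ?rs = "map2 (tgam TT) ts sss" and ?ns = "map (%us. arsum us) sss"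
 let ?\<kappa> = "map (%i. cc I (ts ! i) (sss ! i) (blocks ?ns x ! i)) [0..<m]"
 have wS: "word_list TT ?S" by (rule word_list_concat) (use s in blast)
 have lS: "length ?S = sum_list (ars TT ts)" by (simp add: length_concat s(1))
 have N: "sum_list ?ns = sum_list (ars TT ?S)" by (induction sss) simp_all
 have wr: "word_list TT ?rs" and ar: "ars TT ?rs = ?ns" using par_par(2,3)[OF t(2) _ s(1)] s(2) by blast+
 have lr: "length ?rs = m" using map_eq_imp_length_eq[OF s(1)] t by simp
 have xr: "x : Ob (P (sum_list (ars TT ?rs)))" unfolding ar by (rule 1(3))
 have xS: "x : Ob (P (sum_list (ars TT ?S)))" using 1(3) unfolding N .
 have x': "PhiS TT I ?S x : Ob (P (sum_list (ars TT ts)))" using PhiS_ob[OF wS xS] lS by simp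
 note O = Opull_hom[OF q t]
 have kk: "kgm ?S (kgm ts v) = kgm ?rs v" if "v : insert w (set ws)" for v
  by (rule kgam_kgam) (use that kw kws t s in auto)
 have km: "map (kgm ?S) (map (kgm ts) ws) = map (kgm ?rs) ws" using kk by simp
 have ys': "ys : Ob (E W (fibs (map (kgm ?S) (map (kgm ts) ws)) x))" using ys unfolding km .
 have ys2: "ys : Ob (E W (fibs (map (%v. kgm ?S (kgm ts v)) ws) x))" using ys' by (simp add: o_def)
 have h1: "cQ ?S v x : hom Q (fib (kgm ?S v) x) (fib v (PhiS TT I ?S x))" if "v : set (map (kgm ts) ws)" for v
  using cQ_homs[OF O lS wS xS insertI2[OF that]] .
 have "map2 (%v. FO (tr W (cQ ?S v x))) (map (kgm ts) ws) ys : Ob (E W (fibs (map (kgm ts) ws) (PhiS TT I ?S x)))"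
  by (rule tr_args[OF W ys']) (rule h1)
 note zs = this[unfolded map2_map_left]
 have \<kappa>: "?\<kappa> : hom (P m) (PhiS TT I ?rs x) (PhiS TT I ts (PhiS TT I ?S x))"
  using cc_tuple_hom[OF t(2) s xS] unfolding t(1) .
 note r1 = R_tr[OF cQ_homs[OF q t x' insertI1] R_epull[OF O lS wS xS ys', unfolded map2_map_left]]
 let ?z = "map2 (%v. FO (tr W (cQ ?rs v x))) ws ys"
 have z: "?z : Ob (E W (fibs ws (PhiS TT I ?rs x)))" by (rule tr_args[OF W ys]) (rule cQ_homs[OF q lr wr xr insertI2])
 \<comment> \<open>Axiom (1) of \<open>I\<close>, in the form \<open>cQ_cQ\<close>. The transport
   along \<open>\<kappa>\<close> acts on the value of the other side and is moved to its arguments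
   by \<open>phi_nat\<close>.\<close>
 have e: "map2 (%v. FO (tr W (cQ ts v (PhiS TT I ?S x)))) ws (map2 (%v. FO (tr W (cQ ?S (kgm ts v) x))) ws ys)
  = map2 (%v. FO (tr W (fibA v ?\<kappa>))) ws ?z" (is "?l = ?r")
 proof -
  have "?l = map2 (%v. FO (tr W (cQ ts v (PhiS TT I ?S x) *[Q] cQ ?S (kgm ts v) x))) ws ys"
   by (rule map2_tr_comp[OF W ys2]) (use h1 cQ_homs[OF q t x' insertI2] in auto)
  also have "\<dots> = map2 (%v. FO (tr W (fibA v ?\<kappa> *[Q] cQ ?rs v x))) ws ys"
   using cQ_cQ[OF _ t(2) s xS, unfolded t(1)] kws by (intro map_cong refl) (auto dest!: set_zip_leftD)
  also have "\<dots> = ?r"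
   by (rule map2_tr_comp[OF W ys, symmetric]) (use cQ_homs[OF q lr wr xr insertI2] fibA_hom[OF _ \<kappa>] kws in blast)
  finally show ?thesis .
 qed
 have mp: "map (prO j) (map2 (%v. FO (tr W (cQ ?S (kgm ts v) x))) ws ys)
  = map2 (%v. FO (tr (A j) (cQ ?S (kgm ts v) x))) ws (map (prO j) ys)" if "j : JJ" for j
  using pr_trs[OF that ys' h1] by (simp add: map2_map_left)
 show ?case
  by (rule R_eq[OF R_comp[OF R_epull[OF q t x' zs] r1] R_tr[OF fibA_hom[OF kw \<kappa>] R_epull[OF q lr wr xr ys]]])
   (simp only: e phi_nat(1)[OF W q \<kappa> z], simp only: mp, rule coh_Aj(7)[unfolded coh_pull_pull_def Let_def Xw_simps trs_simp, rule_format, OF _ q 1(2,3)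
    pr_env[OF _ fibs_ob[OF Opull_hom[OF q lr wr] xr] ys]])
qed

lemma coh_pull_unit_W: "coh_pull_unit \<Theta> I W"
 unfolding coh_pull_unit_def Let_def Xw_simps trs_simp
proof (intro allI ballI impI, goal_cases)
 case (1 m w ws q x ys)
 note q = 1(1) and x = 1(2) and ys = 1(3)
 note kw = ThetaHomD[OF q, THEN c1] and kws = ThetaHomD[OF q, THEN c2, THEN c1]
 note i = Theta_fib[OF q x] and p = functor_ob[OF functor_phi[OF W q x] ys]
 let ?u = "replicate m (tunit TT)" and ?h = "map (%y. uu I [y]) x"
 have u: "length ?u = m" "word_list TT ?u" using par_unit(2) by auto
 have ar: "sum_list (ars TT ?u) = m" unfolding par_unit(3) by (simp add: sum_list_replicate)
 have xr: "x : Ob (P (sum_list (ars TT ?u)))" unfolding ar by (rule x)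
 have kk: "map (kgm ?u) ws = ws" using kgam_unit kws by (auto intro!: map_idI)
 have ys': "ys : Ob (E W (fibs (map (kgm ?u) ws) x))" using ys unfolding kk .
 note h = uu_tuple_hom[OF x]
 let ?z = "map2 (%v. FO (tr W (cQ ?u v x))) ws ys"
 have z: "?z : Ob (E W (fibs ws (PhiS TT I ?u x)))" by (rule tr_args[OF W ys']) (rule cQ_homs[OF q u xr insertI2])
 \<comment> \<open>By axiom (2) of \<open>I\<close> the transport along the units takes the
   arguments, after their transport along \<open>cQ\<close>, back to \<open>ys\<close>.\<close>
 have "map2 (%v. FO (tr W (fibA v ?h))) ws ?z = map2 (%v. FO (tr W (fibA v ?h *[Q] cQ ?u v x))) ws ys"
  by (rule map2_tr_comp[OF W ys']) (use cQ_homs[OF q u xr insertI2] fibA_hom[OF _ h] kws in blast)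
 also have "\<dots> = ys"
  by (rule map2_tr_ident[OF W ys]) (use cQ_unit[OF _ x] fib_ob[OF _ x] kws in blast)
 finally have e: "map2 (%v. FO (tr W (fibA v ?h))) ws ?z = ys" .
 show ?case
  by (rule R_eq[OF R_tr[OF fibA_hom[OF kw h] R_epull[OF q u xr ys']] R_ident[OF i p]])
   (simp only: phi_nat(1)[OF W q h z, symmetric] e, simp only: pr_phi(1)[OF _ q x ys], rule coh_Aj(8)[unfolded coh_pull_unit_def Let_def Xw_simps trs_simp, rule_format, OF _ q x
    pr_env[OF _ fibs_ob[OF q x] ys]])
qed

lemma coh_pull_by_sub_W: "coh_pull_by_sub \<Theta> I W"
 unfolding coh_pull_by_sub_def Let_def Xw_simps trs_simp
proof (intro allI ballI impI, goal_cases)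
 case (1 m w ws us ls fs q x ys)
 have u: "length us = m" "word_list TT us" and l: "length ls = length us" "length fs = length us"
  and fs: "ALL i<length us. fs ! i : index_maps (Dom TT (us ! i)) (ls ! i)" using 1(2) by auto
 note q = 1(1) and x = 1(3) and ys = 1(4)
 note kw = ThetaHomD[OF q, THEN c1] and kws = ThetaHomD[OF q, THEN c2, THEN c1]
 let ?us = "map (%i. tsub TT (ls ! i) (us ! i) (fs ! i)) [0..<m]" and ?g = "block_sum ls fs" and ?N = "sum_list ls"
 let ?\<kappa> = "map (%i. ss I (ls ! i) (us ! i) (fs ! i) (blocks ls x ! i)) [0..<m]"
 note par_tsub = par_tsub[OF u(2) l fs[rule_format], unfolded u(1)]
 have wr: "word_list TT ?us" and ar: "ars TT ?us = ls" and g: "?g : index_maps (arsum us) ?N"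
  using par_tsub(2-4) u(1) by blast+
 have lr: "length ?us = m" by simp
 have xr: "x : Ob (P (sum_list (ars TT ?us)))" unfolding ar by (rule x)
 note x' = pick_ob[OF x g] and O = Opull_hom[OF q u]
 have kk: "kgm ?us v = ksb ?N ?g (kgm us v)" if "v : KW m" for v
  using kgam_tsub[OF _ u(2) l fs[rule_format], of v] that u(1) by simp
 have km: "map (ksb ?N ?g) (map (kgm us) ws) = map (kgm ?us) ws" using kk kws by auto
 have ys': "ys : Ob (E W (fibs (map (ksb ?N ?g) (map (kgm us) ws)) x))" using ys unfolding km .
 have ys2: "ys : Ob (E W (fibs (map (%v. ksb ?N ?g (kgm us v)) ws) x))" using ys' by (simp add: o_def)
 have h1: "sQ ?N ?g v x : hom Q (fib (ksb ?N ?g v) x) (fib v (pick x ?g))" if "v : set (map (kgm us) ws)" for v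
  using sQ_homs[OF O g x insertI2[OF that]] .
 have "map2 (%v. FO (tr W (sQ ?N ?g v x))) (map (kgm us) ws) ys : Ob (E W (fibs (map (kgm us) ws) (pick x ?g)))"
  by (rule tr_args[OF W ys']) (rule h1)
 note zs = this[unfolded map2_map_left]
 have \<kappa>: "?\<kappa> : hom (P m) (PhiS TT I ?us x) (PhiS TT I us (pick x ?g))"
  using ss_tuple_hom[OF u(2) l fs x] unfolding u(1) .
 note r1 = R_tr[OF cQ_homs[OF q u x' insertI1] R_esub[OF g O x ys', unfolded map2_map_left]]
 let ?z = "map2 (%v. FO (tr W (cQ ?us v x))) ws ys"
 have z: "?z : Ob (E W (fibs ws (PhiS TT I ?us x)))" by (rule tr_args[OF W ys]) (rule cQ_homs[OF q lr wr xr insertI2])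
 \<comment> \<open>The targets agree by axiom (5) of \<open>I\<close>, in the form
   \<open>cQ_inner\<close>.\<close>
 have e: "map2 (%v. FO (tr W (cQ us v (pick x ?g)))) ws (map2 (%v. FO (tr W (sQ ?N ?g (kgm us v) x))) ws ys)
  = map2 (%v. FO (tr W (fibA v ?\<kappa>))) ws ?z" (is "?l = ?r")
 proof -
  have "?l = map2 (%v. FO (tr W (cQ us v (pick x ?g) *[Q] sQ ?N ?g (kgm us v) x))) ws ys"
   by (rule map2_tr_comp[OF W ys2]) (use h1 cQ_homs[OF q u x' insertI2] in auto)
  also have "\<dots> = map2 (%v. FO (tr W (fibA v ?\<kappa> *[Q] cQ ?us v x))) ws ys"
   using cQ_inner[OF _ u(2) l fs x, unfolded u(1)] kws by (intro map_cong refl) (auto dest!: set_zip_leftD)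
  also have "\<dots> = ?r"
   by (rule map2_tr_comp[OF W ys, symmetric]) (use cQ_homs[OF q lr wr xr insertI2] fibA_hom[OF _ \<kappa>] kws in blast)
  finally show ?thesis .
 qed
 have mp: "map (prO j) (map2 (%v. FO (tr W (sQ ?N ?g (kgm us v) x))) ws ys)
  = map2 (%v. FO (tr (A j) (sQ ?N ?g (kgm us v) x))) ws (map (prO j) ys)" if "j : JJ" for j
  using pr_trs[OF that ys' h1] by (simp add: map2_map_left)
 show ?case
  by (rule R_eq[OF R_tr[OF fibA_hom[OF kw \<kappa>] R_epull[OF q lr wr xr ys]] R_comp[OF R_epull[OF q u x' zs] r1]])
   (simp only: e phi_nat(1)[OF W q \<kappa> z], simp only: mp, rule coh_Aj(12)[unfolded coh_pull_by_sub_def Let_def Xw_simps trs_simp, rule_format, OF _ q 1(2) x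
    pr_env[OF _ fibs_ob[OF Opull_hom[OF q lr wr] xr] ys]])
qed

lemma coh_pull_of_sub_W: "coh_pull_of_sub \<Theta> I W"
 unfolding coh_pull_of_sub_def Let_def Xw_simps trs_simp
proof (intro allI ballI impI, goal_cases)
 case (1 m l w ws us f q x ys)
 have u: "length us = l" "word_list TT us" using 1(3) by auto
 note f = 1(1) and q = 1(2) and x = 1(4) and ys = 1(5)
 note kw = ThetaHomD[OF q, THEN c1] and kws = ThetaHomD[OF q, THEN c2, THEN c1]
 let ?N = "arsum us" and ?fb = "bar (ars TT us) f" and ?us = "pick us f"
 have fu: "f : index_maps m (length us)" using f u(1) by simp
 have wr: "word_list TT ?us" by (rule word_list_pick[OF u(2) fu])
 have lr: "length ?us = m" using index_mapsD[OF f] by simp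
 have g: "?fb : index_maps (sum_list (ars TT ?us)) ?N"
  using bar_index_maps[of f m "ars TT us"] fu index_mapsD[OF fu] by (simp add: map_pick)
 note x' = pick_ob[OF x g] and O = Osub_hom[OF q f] and O' = Opull_hom[OF q lr wr]
 have y: "PhiS TT I us x : Ob (P l)" using PhiS_ob[OF u(2) x] u(1) by simp
 note pp = pick_PhiS[OF u(2) fu x]
 have kk: "kgm us (ksb l f v) = ksb ?N ?fb (kgm ?us v)" if "v : KW m" for v
  using kgam_ksub[OF that fu u(2)] u(1) by simp
 have km: "map (kgm us) (map (ksb l f) ws) = map (ksb ?N ?fb) (map (kgm ?us) ws)" using kk kws by auto
 have ys1: "ys : Ob (E W (fibs (map (kgm us) (map (ksb l f) ws)) x))" using ys by (simp add: o_def)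
 have ys2: "ys : Ob (E W (fibs (map (ksb ?N ?fb) (map (kgm ?us) ws)) x))" using ys1 unfolding km .
 have ys3: "ys : Ob (E W (fibs (map (%v. ksb ?N ?fb (kgm ?us v)) ws) x))" using ys2 by (simp add: o_def)
 have h1: "cQ us v x : hom Q (fib (kgm us v) x) (fib v (PhiS TT I us x))" if "v : set (map (ksb l f) ws)" for v
  using cQ_homs[OF O u x insertI2[OF that]] .
 have h2: "sQ ?N ?fb v x : hom Q (fib (ksb ?N ?fb v) x) (fib v (pick x ?fb))" if "v : set (map (kgm ?us) ws)" for v
  using sQ_homs[OF O' g x insertI2[OF that]] .
 have "map2 (%v. FO (tr W (cQ us v x))) (map (ksb l f) ws) ys : Ob (E W (fibs (map (ksb l f) ws) (PhiS TT I us x)))"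
  by (rule tr_args[OF W ys1]) (rule h1)
 note z1 = this[unfolded map2_map_left]
 have "map2 (%v. FO (tr W (sQ ?N ?fb v x))) (map (kgm ?us) ws) ys : Ob (E W (fibs (map (kgm ?us) ws) (pick x ?fb)))"
  by (rule tr_args[OF W ys2]) (rule h2)
 note z2 = this[unfolded map2_map_left]
 note r1 = R_tr[OF sQ_hom[OF kw f y] R_epull[OF O u x ys1, unfolded map2_map_left]]
 note r2 = R_tr[OF cQ_homs[OF q lr wr x' insertI1] R_esub[OF g O' x ys2, unfolded map2_map_left]]
 \<comment> \<open>The targets agree by axiom (4) of \<open>I\<close>, in the form
   \<open>cQ_outer\<close>.\<close>
 have e: "map2 (%v. FO (tr W (sQ l f v (PhiS TT I us x)))) ws (map2 (%v. FO (tr W (cQ us (ksb l f v) x))) ws ys)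
  = map2 (%v. FO (tr W (cQ ?us v (pick x ?fb)))) ws (map2 (%v. FO (tr W (sQ ?N ?fb (kgm ?us v) x))) ws ys)" (is "?l = ?r")
 proof -
  have "?l = map2 (%v. FO (tr W (sQ l f v (PhiS TT I us x) *[Q] cQ us (ksb l f v) x))) ws ys"
   by (rule map2_tr_comp[OF W ys]) (use h1 sQ_homs[OF q f y insertI2] in auto)
  also have "\<dots> = map2 (%v. FO (tr W (cQ ?us v (pick x ?fb) *[Q] sQ ?N ?fb (kgm ?us v) x))) ws ys"
   using cQ_outer[OF _ fu u(2) x, unfolded u(1)] kws by (intro map_cong refl) (auto dest!: set_zip_leftD)
  also have "\<dots> = ?r"
   by (rule map2_tr_comp[OF W ys3, symmetric]) (use h2 cQ_homs[OF q lr wr x' insertI2] in auto)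
  finally show ?thesis .
 qed
 have Z: "set (fibs (map (%v. kgm us (ksb l f v)) ws) x) <= Ob Q"
  using fibs_ob[OF Opull_hom[OF O u] x] by simp
 have m1: "map (prO j) (map2 (%v. FO (tr W (cQ us (ksb l f v) x))) ws ys)
  = map2 (%v. FO (tr (A j) (cQ us (ksb l f v) x))) ws (map (prO j) ys)" if "j : JJ" for j
  using pr_trs[OF that ys1 h1] by (simp add: map2_map_left)
 have m2: "map (prO j) (map2 (%v. FO (tr W (sQ ?N ?fb (kgm ?us v) x))) ws ys)
  = map2 (%v. FO (tr (A j) (sQ ?N ?fb (kgm ?us v) x))) ws (map (prO j) ys)" if "j : JJ" for j
  using pr_trs[OF that ys2 h2] by (simp add: map2_map_left)
 show ?case
  by (rule R_eq[OF R_comp[OF R_esub[OF f q y z1] r1] R_comp[OF R_epull[OF q lr wr x' z2] r2, unfolded pp]])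
   (simp only: e, simp only: m1 m2, rule coh_Aj(13)[unfolded coh_pull_of_sub_def Let_def Xw_simps trs_simp, rule_format, OF _ f q 1(3) x
    pr_env[OF _ Z ys]])
qed

lemma pseudo_algebra_W: "palgebra W"
 unfolding pseudo_algebra_def
 using alg_data_W coh_assoc_W coh_unit_W coh_fun_fun_W coh_fun_outer_W coh_fun_inner_W coh_sub_sub_W coh_pull_pull_W
  coh_pull_unit_W coh_comp_sub_W coh_fun_sub_W coh_fun_pull_W coh_pull_by_sub_W coh_pull_of_sub_W coh_comp_pull_W
 by blast

end

section \<open>The algebra of pseudo cones\<close>

text \<open>A pseudo functor into the 2-category of algebras, its 2-cells replaced by their
  components: \<open>pu\<close> for units and \<open>pc\<close> for composition.\<close>

locale diagram = T_algebra \<Theta> U I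
 for \<Theta> :: "('t, 'h) thy2" and U :: "'u itself" and I :: "('t, 'io, 'ia) palg" +
 fixes J :: "('jo, 'ja) cat" and A :: "'jo => ('io, 'ia, 't, 'h, 'u) alg" and H :: "'ja => ('io, 'h, 'u) mor"
  and pu :: "'jo => 'io list => 'u => 'u" and pc :: "'ja => 'ja => 'io list => 'u => 'u"
 assumes inaccessible: "inaccessible TYPE('u)"
  and small_I: "small TYPE('u) (Ob II)" and J: "category J" and small_J: "small TYPE('u) (Ob J)" "small TYPE('u) (Ar J)"
  and alg_A: "j : Ob J ==> palgebra (A j)"
  and mor_H: "f : Ar J ==> amor (A (Dom J f)) (A (Cod J f)) (H f)"
  and pu: "j : Ob J ==> pcell (A j) (A j) (idm (A j)) (H (Ident J j)) (pu j)"
  and pu_iso: "j : Ob J ==> i : Ob Q ==> y : Ob (Fb (A j) i) ==> isoh (Fb (A j) i) (pu j i y) y (FO (HH (H (Ident J j)) i) y)"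
  and pc: "f : Ar J ==> g : Ar J ==> Cod J f = Dom J g ==>
   pcell (A (Dom J f)) (A (Cod J g)) (cmor (A (Dom J f)) (A (Cod J f)) (A (Cod J g)) (H g) (H f)) (H (g *[J] f)) (pc g f)"
  and pc_iso: "f : Ar J ==> g : Ar J ==> Cod J f = Dom J g ==> i : Ob Q ==> y : Ob (Fb (A (Dom J f)) i) ==>
   isoh (Fb (A (Cod J g)) i) (pc g f i y) (FO (HH (H g) i) (FO (HH (H f) i) y)) (FO (HH (H (g *[J] f)) i) y)"
begin

abbreviation "dJ == Dom J"
abbreviation "cJ == Cod J"

lemmas preA = alg_prealg[OF alg_A] and kindsA = alg_kinds[OF alg_A]

lemma J_ob: "f : Ar J ==> dJ f : Ob J" "f : Ar J ==> cJ f : Ob J"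
 using J by (auto simp: category_def)

lemma J_ident: "j : Ob J ==> Ident J j : Ar J & dJ (Ident J j) = j & cJ (Ident J j) = j"
 using ident_hom[OF J] homD by metis

lemma J_comp: "f : Ar J ==> g : Ar J ==> cJ f = dJ g ==> g *[J] f : Ar J & dJ (g *[J] f) = dJ f & cJ (g *[J] f) = cJ g"
 using J unfolding category_def hom_def by blast

lemma preH: "f : Ar J ==> premor (A (dJ f)) (A (cJ f)) (H f)"
 using alg_mor_premor[OF alg_A alg_A mor_H] J_ob by blast

lemmas catA = category_Fb[OF preA] and trA = functor_tr[OF preA]

text \<open>An object of the pseudo limit of the fibres over \<open>i\<close>: the last two clauses
  are the unit and composition axioms of a pseudo natural transformation from a constant functor,
  read at one object.\<close>

definition cone :: "'io list => ('jo => 'u) => ('ja => 'u) => bool" where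
 "cone i a \<epsilon> \<longleftrightarrow> (ALL j:Ob J. a j : Ob (Fb (A j) i)) &
  (ALL f:Ar J. isoh (Fb (A (cJ f)) i) (\<epsilon> f) (FO (HH (H f) i) (a (dJ f))) (a (cJ f))) &
  (ALL j:Ob J. \<epsilon> (Ident J j) *[Fb (A j) i] pu j i (a j) = Ident (Fb (A j) i) (a j)) &
  (ALL f:Ar J. ALL g:Ar J. cJ f = dJ g -->
    \<epsilon> (g *[J] f) *[Fb (A (cJ g)) i] pc g f i (a (dJ f)) = \<epsilon> g *[Fb (A (cJ g)) i] FA (HH (H g) i) (\<epsilon> f))"

text \<open>Decoding recovers a cone only on objects and arrows of \<open>J\<close>, which is where
  the conditions look.\<close>

lemma cone_cong:
 assumes "!!j. j : Ob J ==> a j = a' j" "!!f. f : Ar J ==> \<epsilon> f = \<epsilon>' f"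
 shows "cone i a \<epsilon> \<longleftrightarrow> cone i a' \<epsilon>'"
 unfolding cone_def using assms J_ob J_ident J_comp by auto

text \<open>Cones are coded by elements of the universe through one injection, so that the decoding does not depend on the fibre.\<close>

definition U0 :: "'u set" where
 "U0 = (\<Union>i\<in>Ob Q. \<Union>j\<in>Ob J. Ob (Fb (A j) i) \<union> Ar (Fb (A j) i))"

text \<open>A small product that contains the cones over all \<open>i\<close> at once.\<close>

definition SO :: "(('jo => 'u) \<times> ('ja => 'u)) set" where
 "SO = (Ob J \<rightarrow>\<^sub>E U0) \<times> (Ar J \<rightarrow>\<^sub>E U0)"

definition eO :: "('jo => 'u) \<times> ('ja => 'u) => 'u" where
 "eO = (SOME e. inj_on e SO)"

definition mkO :: "('jo => 'u) => ('ja => 'u) => 'u" where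
 "mkO a \<epsilon> = eO (restrict a (Ob J), restrict \<epsilon> (Ar J))"

definition prO :: "'jo => 'u => 'u" where "prO j y = fst (inv_into SO eO y) j"
definition prE :: "'ja => 'u => 'u" where "prE f y = snd (inv_into SO eO y) f"

text \<open>Components do not determine the ends of an arrow, since the structure arrows of a cone
  are invisible in them; so both ends are part of the code.\<close>

definition SA :: "('u \<times> 'u \<times> ('jo => 'u)) set" where
 "SA = (eO ` SO) \<times> (eO ` SO) \<times> (Ob J \<rightarrow>\<^sub>E U0)"

definition eA :: "'u \<times> 'u \<times> ('jo => 'u) => 'u" where
 "eA = (SOME e. inj_on e SA)"

definition mkA :: "'u => 'u => ('jo => 'u) => 'u" where
 "mkA y z h = eA (y, z, restrict h (Ob J))"

definition dm :: "'u => 'u" where "dm t = fst (inv_into SA eA t)"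
definition cd :: "'u => 'u" where "cd t = fst (snd (inv_into SA eA t))"
definition prA :: "'jo => 'u => 'u" where "prA j t = snd (snd (inv_into SA eA t)) j"

text \<open>Here the smallness of \<open>I\<close> enters: the union runs over all objects of a
  power of \<open>I\<close>.\<close>

lemma small_U0: "small TYPE('u) U0"
proof -
 have "small TYPE('u) (Ob (Fb (A j) i) \<union> Ar (Fb (A j) i))" if "j : Ob J" "i : Ob Q" for i j
  using preA[OF that(1)] that(2) by (intro small_Un inaccessible) (auto simp: prealg_def functor_to_Cat_def small_category_def small_def)
 then show ?thesis
  unfolding U0_def by (intro small_UN inaccessible small_J small_pow small_I) auto
qed

lemma small_SO: "small TYPE('u) SO" and small_SA: "small TYPE('u) SA"
 unfolding SA_def SO_def by (intro small_Times small_PiE small_image inaccessible small_J small_U0)+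

lemma eO_inj: "inj_on eO SO" and eA_inj: "inj_on eA SA"
 unfolding eO_def eA_def using small_inj[OF small_SO] small_inj[OF small_SA] by (metis someI_ex)+

lemma cone_SO:
 assumes i: "i : Ob Q" and c: "cone i a \<epsilon>"
 shows "(restrict a (Ob J), restrict \<epsilon> (Ar J)) : SO"
proof -
 have "a j : U0" if "j : Ob J" for j using c i that unfolding cone_def U0_def by blast
 moreover have "\<epsilon> f : U0" if "f : Ar J" for f
 proof -
  have "isoh (Fb (A (cJ f)) i) (\<epsilon> f) (FO (HH (H f) i) (a (dJ f))) (a (cJ f))" using c that unfolding cone_def by blast
  from homD[OF isoh_hom[OF this]] show ?thesis using i J_ob(2)[OF that] unfolding U0_def by blast
 qed
 ultimately show ?thesis by (auto simp: SO_def)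
qed

lemma pr_mkO:
 assumes "i : Ob Q" "cone i a \<epsilon>"
 shows "j : Ob J ==> prO j (mkO a \<epsilon>) = a j" "f : Ar J ==> prE f (mkO a \<epsilon>) = \<epsilon> f"
 unfolding prO_def prE_def mkO_def inv_into_f_f[OF eO_inj cone_SO[OF assms]] by simp_all

definition WO :: "'io list => 'u set" where
 "WO i = {mkO a \<epsilon> |a \<epsilon>. cone i a \<epsilon>}"

lemma WO_cone:
 assumes i: "i : Ob Q" and y: "y : WO i"
 shows "cone i (%j. prO j y) (%f. prE f y)" "mkO (%j. prO j y) (%f. prE f y) = y"
proof -
 obtain a \<epsilon> where y: "y = mkO a \<epsilon>" and c: "cone i a \<epsilon>" using assms unfolding WO_def by blast
 note p = pr_mkO[OF i c]
 show "cone i (%j. prO j y) (%f. prE f y)"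
  using c cone_cong[of "%j. prO j y" a "%f. prE f y" \<epsilon>] by (simp add: y p)
 have "restrict (%j. prO j y) (Ob J) = restrict a (Ob J)" "restrict (%f. prE f y) (Ar J) = restrict \<epsilon> (Ar J)"
  unfolding y by (auto intro!: restrict_ext p)
 then show "mkO (%j. prO j y) (%f. prE f y) = y"
  by (simp only: mkO_def) (simp add: y mkO_def)
qed

lemma mkO_WO: "cone i a \<epsilon> ==> mkO a \<epsilon> : WO i"
 unfolding WO_def by blast

lemma WO_eqI:
 assumes i: "i : Ob Q" and "y : WO i" "z : WO i" "!!j. j : Ob J ==> prO j y = prO j z" "!!f. f : Ar J ==> prE f y = prE f z"
 shows "y = z"
proof -
 have "restrict (%j. prO j y) (Ob J) = restrict (%j. prO j z) (Ob J)" "restrict (%f. prE f y) (Ar J) = restrict (%f. prE f z) (Ar J)"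
  by (auto intro!: restrict_ext assms(4,5))
 then have "mkO (%j. prO j y) (%f. prE f y) = mkO (%j. prO j z) (%f. prE f z)"
  by (simp only: mkO_def)
 then show ?thesis using WO_cone(2)[OF i assms(2)] WO_cone(2)[OF i assms(3)] by simp
qed

lemma WO_D:
 assumes "i : Ob Q" "y : WO i"
 shows "j : Ob J ==> prO j y : Ob (Fb (A j) i)"
  and "f : Ar J ==> isoh (Fb (A (cJ f)) i) (prE f y) (FO (HH (H f) i) (prO (dJ f) y)) (prO (cJ f) y)"
  and "j : Ob J ==> prE (Ident J j) y *[Fb (A j) i] pu j i (prO j y) = Ident (Fb (A j) i) (prO j y)"
  and "f : Ar J ==> g : Ar J ==> cJ f = dJ g ==>
   prE (g *[J] f) y *[Fb (A (cJ g)) i] pc g f i (prO (dJ f) y) = prE g y *[Fb (A (cJ g)) i] FA (HH (H g) i) (prE f y)"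
 using WO_cone(1)[OF assms] unfolding cone_def by blast+

lemma WO_eO: "i : Ob Q ==> WO i <= eO ` SO"
 unfolding WO_def mkO_def using cone_SO by auto

definition arr :: "'io list => 'u => 'u => ('jo => 'u) => bool" where
 "arr i y z h \<longleftrightarrow> y : WO i & z : WO i & (ALL j:Ob J. h j : hom (Fb (A j) i) (prO j y) (prO j z)) &
  (ALL f:Ar J. prE f z *[Fb (A (cJ f)) i] FA (HH (H f) i) (h (dJ f)) = h (cJ f) *[Fb (A (cJ f)) i] prE f y)"

lemma arrD:
 assumes "arr i y z h"
 shows "y : WO i" "z : WO i" "j : Ob J ==> h j : hom (Fb (A j) i) (prO j y) (prO j z)"
  and "f : Ar J ==> prE f z *[Fb (A (cJ f)) i] FA (HH (H f) i) (h (dJ f)) = h (cJ f) *[Fb (A (cJ f)) i] prE f y"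
 using assms unfolding arr_def by blast+

lemma arr_cong: "(!!j. j : Ob J ==> h j = h' j) ==> arr i y z h \<longleftrightarrow> arr i y z h'"
 unfolding arr_def using J_ob by auto

definition WF :: "'io list => ('u, 'u) cat" where
 "WF i = \<lparr>Ob = WO i, Ar = {mkA y z h |y z h. arr i y z h}, Dom = dm, Cod = cd,
  Ident = (%y. mkA y y (%j. Ident (Fb (A j) i) (prO j y))),
  Comp = (%g f. mkA (dm f) (cd g) (%j. prA j g *[Fb (A j) i] prA j f))\<rparr>"

lemma WF_simps [simp]:
 "Ob (WF i) = WO i" "Ar (WF i) = {mkA y z h |y z h. arr i y z h}" "Dom (WF i) = dm" "Cod (WF i) = cd"
 "Ident (WF i) y = mkA y y (%j. Ident (Fb (A j) i) (prO j y))"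
 "g *[WF i] f = mkA (dm f) (cd g) (%j. prA j g *[Fb (A j) i] prA j f)"
 by (simp_all add: WF_def)

lemma arr_SA:
 assumes i: "i : Ob Q" and a: "arr i y z h"
 shows "(y, z, restrict h (Ob J)) : SA"
proof -
 have "h j : U0" if "j : Ob J" for j using homD[OF arrD(3)[OF a that]] i that unfolding U0_def by blast
 then show ?thesis using arrD(1,2)[OF a] WO_eO[OF i] by (auto simp: SA_def)
qed

lemma pr_mkA:
 assumes "i : Ob Q" "arr i y z h"
 shows "dm (mkA y z h) = y" "cd (mkA y z h) = z" "j : Ob J ==> prA j (mkA y z h) = h j"
 unfolding dm_def cd_def prA_def mkA_def inv_into_f_f[OF eA_inj arr_SA[OF assms]] by simp_all

lemma mkA_hom: "i : Ob Q ==> arr i y z h ==> mkA y z h : hom (WF i) y z"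
 by (auto simp: hom_def pr_mkA)

lemma WF_hom:
 assumes i: "i : Ob Q" and t: "t : hom (WF i) y z"
 shows "arr i y z (%j. prA j t)" "mkA y z (%j. prA j t) = t" "dm t = y" "cd t = z"
proof -
 obtain h where h: "t = mkA y z h" "arr i y z h" using t pr_mkA(1,2)[OF i] by (auto simp: hom_def)
 show "dm t = y" "cd t = z" using pr_mkA(1,2)[OF i h(2)] h(1) by auto
 note p = pr_mkA(3)[OF i h(2)]
 show "arr i y z (%j. prA j t)" using h(2) arr_cong[of "%j. prA j t" h] by (simp add: h(1) p)
 have "restrict (%j. prA j t) (Ob J) = restrict h (Ob J)" unfolding h(1) by (auto intro!: restrict_ext p)
 then show "mkA y z (%j. prA j t) = t" by (simp only: mkA_def) (simp add: h(1) mkA_def)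
qed

lemma mkA_cong: "(!!j. j : Ob J ==> h j = h' j) ==> mkA y z h = mkA y z h'"
 unfolding mkA_def by (simp cong: restrict_cong)

lemma WF_eqI:
 assumes "i : Ob Q" "s : hom (WF i) y z" "t : hom (WF i) y z" "!!j. j : Ob J ==> prA j s = prA j t"
 shows "s = t"
proof -
 have "mkA y z (%j. prA j s) = mkA y z (%j. prA j t)" by (rule mkA_cong) (rule assms(4))
 then show ?thesis by (simp only: WF_hom(2)[OF assms(1,2)] WF_hom(2)[OF assms(1,3)])
qed

lemma arr_ident: "i : Ob Q ==> y : WO i ==> arr i y y (%j. Ident (Fb (A j) i) (prO j y))"
 unfolding arr_def
proof (intro conjI ballI)
 assume i: "i : Ob Q" and y: "y : WO i"
 fix f assume f: "f : Ar J"
 note e = isoh_hom[OF WO_D(2)[OF i y f]] and C = catA[OF J_ob(2)[OF f] i]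
 show "prE f y *[Fb (A (cJ f)) i] FA (HH (H f) i) (Ident (Fb (A (dJ f)) i) (prO (dJ f) y)) = Ident (Fb (A (cJ f)) i) (prO (cJ f) y) *[Fb (A (cJ f)) i] prE f y"
  unfolding functor_ident[OF premor_HH[OF preH[OF f] i] WO_D(1)[OF i y J_ob(1)[OF f]]] comp_ident_left[OF C e] comp_ident_right[OF C e] ..
qed (auto intro!: ident_hom catA WO_D(1))

lemma arr_comp:
 assumes i: "i : Ob Q" and h: "arr i x y h" and k: "arr i y z k"
 shows "arr i x z (%j. k j *[Fb (A j) i] h j)"
 unfolding arr_def
proof (intro conjI ballI)
 show "x : WO i" "z : WO i" using arrD[OF h] arrD[OF k] by auto
 fix j assume j: "j : Ob J"
 show "k j *[Fb (A j) i] h j : hom (Fb (A j) i) (prO j x) (prO j z)"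
  by (rule comp_hom[OF catA[OF j i] arrD(3)[OF h j] arrD(3)[OF k j]])
next
 fix f assume f: "f : Ar J"
 note C = catA[OF J_ob(2)[OF f] i] and F = premor_HH[OF preH[OF f] i] and d = J_ob(1)[OF f] and c = J_ob(2)[OF f]
 note ex = isoh_hom[OF WO_D(2)[OF i arrD(1)[OF h] f]] and ey = isoh_hom[OF WO_D(2)[OF i arrD(2)[OF h] f]] and ez = isoh_hom[OF WO_D(2)[OF i arrD(2)[OF k] f]]
 show "prE f z *[Fb (A (cJ f)) i] FA (HH (H f) i) (k (dJ f) *[Fb (A (dJ f)) i] h (dJ f)) = (k (cJ f) *[Fb (A (cJ f)) i] h (cJ f)) *[Fb (A (cJ f)) i] prE f x"
  unfolding functor_comp[OF F arrD(3)[OF h d] arrD(3)[OF k d]]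
  by (rule comp_square[OF C functor_hom[OF F arrD(3)[OF h d]] functor_hom[OF F arrD(3)[OF k d]] arrD(3)[OF h c] arrD(3)[OF k c]
     ex ey ez arrD(4)[OF h f] arrD(4)[OF k f]])
qed

text \<open>The square of the inverse follows by cancelling the component of \<open>h\<close> at the
  codomain of \<open>f\<close>.\<close>

lemma arr_inverse:
 assumes i: "i : Ob Q" and h: "arr i y z h"
  and k: "!!j. j : Ob J ==> k j : hom (Fb (A j) i) (prO j z) (prO j y) & k j *[Fb (A j) i] h j = Ident (Fb (A j) i) (prO j y) &
   h j *[Fb (A j) i] k j = Ident (Fb (A j) i) (prO j z)"
 shows "arr i z y k"
 unfolding arr_def
proof (intro conjI ballI)
 show "z : WO i" "y : WO i" using arrD[OF h] by auto
 show "k j : hom (Fb (A j) i) (prO j z) (prO j y)" if "j : Ob J" for j using k[OF that] by blast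
 fix f assume f: "f : Ar J"
 note C = catA[OF J_ob(2)[OF f] i] and F = premor_HH[OF preH[OF f] i] and d = J_ob(1)[OF f] and c = J_ob(2)[OF f]
 note ey = isoh_hom[OF WO_D(2)[OF i arrD(1)[OF h] f]] and ez = isoh_hom[OF WO_D(2)[OF i arrD(2)[OF h] f]]
 note hc = arrD(3)[OF h c] and hd = functor_hom[OF F arrD(3)[OF h d]] and kc = k[OF c, THEN c1] and kd = functor_hom[OF F k[OF d, THEN c1]]
 let ?C = "Fb (A (cJ f)) i" and ?F = "FA (HH (H f) i)"
 have iso: "isoh ?C (h (cJ f)) (prO (cJ f) y) (prO (cJ f) z)" using isohI[OF hc kc] k[OF c] by blast
 show "prE f y *[?C] ?F (k (dJ f)) = k (cJ f) *[?C] prE f z"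
 proof (rule isoh_cancel_left[OF C iso comp_hom[OF C kd ey] comp_hom[OF C ez kc]])
  have "h (cJ f) *[?C] (prE f y *[?C] ?F (k (dJ f))) = (prE f z *[?C] ?F (h (dJ f))) *[?C] ?F (k (dJ f))"
   unfolding arrD(4)[OF h f] by (rule comp_assoc[OF C kd ey hc, symmetric])
  also have "\<dots> = prE f z"
   unfolding comp_assoc[OF C kd hd ez] functor_comp[OF F k[OF d, THEN c1] arrD(3)[OF h d], symmetric]
   using k[OF d] functor_ident[OF F WO_D(1)[OF i arrD(2)[OF h] d]] comp_ident_right[OF C ez] by simp
  also have "\<dots> = h (cJ f) *[?C] (k (cJ f) *[?C] prE f z)"
   unfolding comp_assoc[OF C ez kc hc, symmetric] using k[OF c] comp_ident_left[OF C ez] by simp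
  finally show "h (cJ f) *[?C] (prE f y *[?C] ?F (k (dJ f))) = h (cJ f) *[?C] (k (cJ f) *[?C] prE f z)" .
 qed
qed

lemma category_WF:
 assumes i: "i : Ob Q" shows "category (WF i)"
proof -
 have h: "f : Ar (WF i) ==> f : hom (WF i) (dm f) (cd f)" for f using homI[of f "WF i"] by simp
 have id: "Ident (WF i) x : hom (WF i) x x" if "x : WO i" for x
  using mkA_hom[OF i arr_ident[OF i that]] by simp
 have co: "g *[WF i] f : hom (WF i) x z" and pco: "!!j. j : Ob J ==> prA j (g *[WF i] f) = prA j g *[Fb (A j) i] prA j f"
  if "f : hom (WF i) x y" "g : hom (WF i) y z" for f g x y z
 proof -
  note a = arr_comp[OF i WF_hom(1)[OF i that(1)] WF_hom(1)[OF i that(2)]]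
  show "g *[WF i] f : hom (WF i) x z" "!!j. j : Ob J ==> prA j (g *[WF i] f) = prA j g *[Fb (A j) i] prA j f"
   using mkA_hom[OF i a] pr_mkA(3)[OF i a] WF_hom(3)[OF i that(1)] WF_hom(4)[OF i that(2)] by simp_all
 qed
 have ob: "x : WO i & y : WO i" if "f : hom (WF i) x y" for f x y using arrD(1,2)[OF WF_hom(1)[OF i that]] by blast
 have pid: "prA j (Ident (WF i) x) = Ident (Fb (A j) i) (prO j x)" if "x : WO i" "j : Ob J" for x j
  using pr_mkA(3)[OF i arr_ident[OF i that(1)] that(2)] by simp
 show ?thesis
  unfolding category_def
 proof (intro conjI ballI impI)
  fix f assume "f : Ar (WF i)"
  note f = h[OF this] and o = ob[OF h[OF this], THEN c1] ob[OF h[OF this], THEN c2]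
  note p = arrD(3)[OF WF_hom(1)[OF i f]]
  show "Dom (WF i) f : Ob (WF i)" "Cod (WF i) f : Ob (WF i)" using o by auto
  have "f *[WF i] Ident (WF i) (dm f) = f"
   by (rule WF_eqI[OF i co[OF id[OF o(1)] f] f]) (simp only: pco[OF id[OF o(1)] f] pid[OF o(1)] comp_ident_right[OF catA[OF _ i] p])
  moreover have "Ident (WF i) (cd f) *[WF i] f = f"
   by (rule WF_eqI[OF i co[OF f id[OF o(2)]] f]) (simp only: pco[OF f id[OF o(2)]] pid[OF o(2)] comp_ident_left[OF catA[OF _ i] p])
  ultimately show "f *[WF i] Ident (WF i) (Dom (WF i) f) = f" "Ident (WF i) (Cod (WF i) f) *[WF i] f = f"
   by (simp_all only: WF_simps(3,4))
 next
  fix x assume "x : Ob (WF i)"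
  then show "Ident (WF i) x : hom (WF i) x x" using id by simp
 next
  fix f g assume fg: "f : Ar (WF i)" "g : Ar (WF i)" "Cod (WF i) f = Dom (WF i) g"
  then show "g *[WF i] f : hom (WF i) (Dom (WF i) f) (Cod (WF i) g)"
   using co[OF h[OF fg(1)], of g "cd g"] h[OF fg(2)] by (simp only: WF_simps(3,4))
 next
  fix f g k assume fg: "f : Ar (WF i)" "g : Ar (WF i)" "k : Ar (WF i)" "Cod (WF i) f = Dom (WF i) g & Cod (WF i) g = Dom (WF i) k"
  have f: "f : hom (WF i) (dm f) (cd f)" and g: "g : hom (WF i) (cd f) (cd g)" and k: "k : hom (WF i) (cd g) (cd k)"
   using h[OF fg(1)] h[OF fg(2)] h[OF fg(3)] fg(4) by (simp_all only: WF_simps(3,4))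
  note p = arrD(3)[OF WF_hom(1)[OF i f]] arrD(3)[OF WF_hom(1)[OF i g]] arrD(3)[OF WF_hom(1)[OF i k]]
  show "k *[WF i] (g *[WF i] f) = (k *[WF i] g) *[WF i] f"
   by (rule WF_eqI[OF i co[OF co[OF f g] k] co[OF f co[OF g k]]])
    (simp only: pco[OF f g] pco[OF g k] pco[OF co[OF f g] k] pco[OF f co[OF g k]] comp_assoc[OF catA[OF _ i] p])
 qed
qed

lemma prA_ident: "i : Ob Q ==> y : WO i ==> j : Ob J ==> prA j (Ident (WF i) y) = Ident (Fb (A j) i) (prO j y)"
 using pr_mkA(3)[OF _ arr_ident] by simp

lemma prA_comp:
 assumes i: "i : Ob Q" and "f : hom (WF i) x y" "g : hom (WF i) y z" "j : Ob J"
 shows "prA j (g *[WF i] f) = prA j g *[Fb (A j) i] prA j f"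
 using pr_mkA(3)[OF i arr_comp[OF i WF_hom(1)[OF i assms(2)] WF_hom(1)[OF i assms(3)]] assms(4)]
  WF_hom(3)[OF i assms(2)] WF_hom(4)[OF i assms(3)] by simp

lemma pr_functor: "j : Ob J ==> i : Ob Q ==> is_functor (WF i) (Fb (A j) i) \<lparr>FO = prO j, FA = prA j\<rparr>"
 unfolding is_functor_def func.simps
proof (intro conjI ballI impI)
 assume j: "j : Ob J" and i: "i : Ob Q"
 show "prO j x : Ob (Fb (A j) i)" if "x : Ob (WF i)" for x using that WO_D(1)[OF i _ j] by simp
 show "prA j f : hom (Fb (A j) i) (prO j (Dom (WF i) f)) (prO j (Cod (WF i) f))" if "f : Ar (WF i)" for f
  by (rule arrD(3)[OF WF_hom(1)[OF i homI[OF that]] j])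
 show "prA j (Ident (WF i) x) = Ident (Fb (A j) i) (prO j x)" if "x : Ob (WF i)" for x
  by (rule prA_ident[OF i _ j]) (use that in simp)
 show "prA j (g *[WF i] f) = prA j g *[Fb (A j) i] prA j f" if "f : Ar (WF i)" "g : Ar (WF i)" "Cod (WF i) f = Dom (WF i) g" for f g
  by (rule prA_comp[OF i homI[OF that(1), unfolded that(3)] homI[OF that(2)] j])
qed

lemma isoh_WF:
 assumes i: "i : Ob Q" and a: "arr i y z h" and h: "!!j. j : Ob J ==> isoh (Fb (A j) i) (h j) (prO j y) (prO j z)"
 shows "isoh (WF i) (mkA y z h) y z"
proof -
 have "ALL j:Ob J. EX k. k : hom (Fb (A j) i) (prO j z) (prO j y) & k *[Fb (A j) i] h j = Ident (Fb (A j) i) (prO j y) &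
   h j *[Fb (A j) i] k = Ident (Fb (A j) i) (prO j z)"
  using isohE[OF h] by metis
 then obtain k where k: "!!j. j : Ob J ==> k j : hom (Fb (A j) i) (prO j z) (prO j y) & k j *[Fb (A j) i] h j = Ident (Fb (A j) i) (prO j y) &
   h j *[Fb (A j) i] k j = Ident (Fb (A j) i) (prO j z)"
  by metis
 note b = arr_inverse[OF i a k]
 note p = mkA_hom[OF i a] mkA_hom[OF i b]
 note C = category_WF[OF i]
 note y = arrD(1)[OF a] and z = arrD(2)[OF a]
 show ?thesis
 proof (rule isohI[OF p])
  show "mkA z y k *[WF i] mkA y z h = Ident (WF i) y"
   by (rule WF_eqI[OF i comp_hom[OF C p] ident_hom[OF C]])
    (use y k in \<open>simp_all add: prA_comp[OF i p] prA_ident[OF i y] pr_mkA(3)[OF i a] pr_mkA(3)[OF i b] del: WF_simps(5,6)\<close>)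
  show "mkA y z h *[WF i] mkA z y k = Ident (WF i) z"
   by (rule WF_eqI[OF i comp_hom[OF C p(2,1)] ident_hom[OF C]])
    (use z k in \<open>simp_all add: prA_comp[OF i p(2,1)] prA_ident[OF i z] pr_mkA(3)[OF i a] pr_mkA(3)[OF i b] del: WF_simps(5,6)\<close>)
 qed
qed

lemma isoh_pr: "j : Ob J ==> i : Ob Q ==> isoh (WF i) f a b ==> isoh (Fb (A j) i) (prA j f) (prO j a) (prO j b)"
 using functor_isoh[OF category_WF pr_functor] by simp

text \<open>With equal components and the same target, the squares for \<open>a\<close> and
  \<open>a'\<close> share one of their two composites; cancelling the component at the codomain of
  \<open>u\<close> in the other gives equal structure arrows.\<close>

lemma joint_iso_WF:
 assumes i: "i : Ob Q" and f: "isoh (WF i) f a b" and g: "isoh (WF i) g a' b" and e: "!!j. j : Ob J ==> prA j f = prA j g"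
 shows "f = g"
proof -
 note fa = WF_hom(1)[OF i isoh_hom[OF f]] and ga = WF_hom(1)[OF i isoh_hom[OF g]]
 have o: "prO j a = prO j a'" if "j : Ob J" for j
  using homD[OF arrD(3)[OF fa that]] homD[OF arrD(3)[OF ga that]] e[OF that] by simp
 have "a = a'"
 proof (rule WO_eqI[OF i arrD(1)[OF fa] arrD(1)[OF ga] o])
  fix u assume u: "u : Ar J"
  note eu = isoh_hom[OF WO_D(2)[OF i arrD(1)[OF fa] u]] and eu' = isoh_hom[OF WO_D(2)[OF i arrD(1)[OF ga] u]]
  note c = J_ob(2)[OF u] and d = J_ob(1)[OF u]
  show "prE u a = prE u a'"
  proof (rule isoh_cancel_left[OF catA[OF c i] isoh_pr[OF c i f] eu])
   show "prE u a' : hom (Fb (A (cJ u)) i) (FO (HH (H u) i) (prO (dJ u) a)) (prO (cJ u) a)"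
    using eu' o[OF c] o[OF d] by simp
   show "prA (cJ u) f *[Fb (A (cJ u)) i] prE u a = prA (cJ u) f *[Fb (A (cJ u)) i] prE u a'"
    using arrD(4)[OF fa u] arrD(4)[OF ga u] e[OF c] e[OF d] by simp
  qed
 qed
 then show ?thesis using WF_eqI[OF i isoh_hom[OF f]] isoh_hom[OF g] e by blast
qed

lemma small_WF: "i : Ob Q ==> small_category U (WF i)"
proof -
 assume i: "i : Ob Q"
 have "small TYPE('u) (WO i)"
  by (rule small_subset[OF WO_eO[OF i] small_image[OF small_SO]])
 moreover have "{mkA y z h |y z h. arr i y z h} <= eA ` SA"
  unfolding mkA_def using arr_SA[OF i] by blast
 then have "small TYPE('u) (Ar (WF i))"
  using small_subset[OF _ small_image[OF small_SA]] by simp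
 ultimately show ?thesis
  using category_WF[OF i] by (simp add: small_category_def small_def)
qed

section \<open>Transport and operations on cones\<close>

definition trO :: "'ia list => 'u => 'u" where
 "trO h y = mkO (%j. FO (tr (A j) h) (prO j y)) (%f. FA (tr (A (cJ f)) h) (prE f y))"

definition trW :: "'ia list => ('u, 'u, 'u, 'u) func" where
 "trW h = \<lparr>FO = trO h, FA = (%t. mkA (trO h (dm t)) (trO h (cd t)) (%j. FA (tr (A j) h) (prA j t)))\<rparr>"

text \<open>The structure arrow has to start at \<open>H f\<close> of the value in
  \<open>A (dJ f)\<close>. From there \<open>\<rho>\<close> leads to the operation on the images of
  the arguments, to which their structure arrows apply.\<close>

definition phiO :: "nat => 'h => 'io list => 'u list => 'u" where
 "phiO m q x ys = mkO (%j. FO (phi (A j) m q x) (map (prO j) ys))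
  (%f. FA (phi (A (cJ f)) m q x) (map (prE f) ys) *[Fb (A (cJ f)) (fib (out \<Theta> m q) x)] rho (H f) m q x (map (prO (dJ f)) ys))"

definition phiW :: "nat => 'h => 'io list => ('u list, 'u list, 'u, 'u) func" where
 "phiW m q x = \<lparr>FO = phiO m q x, FA = (%ts. mkA (phiO m q x (map dm ts)) (phiO m q x (map cd ts))
  (%j. FA (phi (A j) m q x) (map (prA j) ts)))\<rparr>"

text \<open>Morphisms commute strictly with transport, and the components of a 2-cell are compatible
  with it, so applying the transport to all data preserves the conditions.\<close>

lemma trO_cone:
 assumes h: "h : hom Q i i'" and y: "y : WO i"
 shows "cone i' (%j. FO (tr (A j) h) (prO j y)) (%f. FA (tr (A (cJ f)) h) (prE f y))"
proof -
 have i: "i : Ob Q" using hom_ob[OF category_P h] by blast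
 note D = WO_D[OF i y]
 show ?thesis
  unfolding cone_def
 proof (intro conjI ballI impI)
  show "FO (tr (A j) h) (prO j y) : Ob (Fb (A j) i')" if "j : Ob J" for j
   by (rule functor_ob[OF trA[OF that h] D(1)[OF that]])
  show "isoh (Fb (A (cJ f)) i') (FA (tr (A (cJ f)) h) (prE f y)) (FO (HH (H f) i') (FO (tr (A (dJ f)) h) (prO (dJ f) y))) (FO (tr (A (cJ f)) h) (prO (cJ f) y))"
   if "f : Ar J" for f
   using functor_isoh[OF catA[OF J_ob(2)[OF that] i] trA[OF J_ob(2)[OF that] h] D(2)[OF that]] premor_tr(1)[OF preH[OF that] h D(1)[OF J_ob(1)[OF that]]] by simp
  show "FA (tr (A (cJ (Ident J j))) h) (prE (Ident J j) y) *[Fb (A j) i'] pu j i' (FO (tr (A j) h) (prO j y)) = Ident (Fb (A j) i') (FO (tr (A j) h) (prO j y))"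
   if j: "j : Ob J" for j
   using functor_comp[OF trA[OF j h] isoh_hom[OF pu_iso[OF j i D(1)[OF j]]], of "prE (Ident J j) y"] isoh_hom[OF D(2)[of "Ident J j"]] J_ident[OF j]
    pcellD(3)[OF pu[OF j] h D(1)[OF j]] D(3)[OF j] functor_ident[OF trA[OF j h] D(1)[OF j]] by simp
  fix f g assume f: "f : Ar J" and g: "g : Ar J" and c: "cJ f = dJ g"
  note gf = J_comp[OF f g c] and o = J_ob(1)[OF f] J_ob(2)[OF g]
  note ef = isoh_hom[OF D(2)[OF f]] and eg = isoh_hom[OF D(2)[OF g], folded c]
  have egf: "prE (g *[J] f) y : hom (Fb (A (cJ g)) i) (FO (HH (H (g *[J] f)) i) (prO (dJ f) y)) (prO (cJ g) y)"
   using isoh_hom[OF D(2)[of "g *[J] f"]] gf by simp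
  note Hg = preH[OF g, folded c]
  note He = functor_hom[OF premor_HH[OF Hg i] ef]
  show "FA (tr (A (cJ (g *[J] f))) h) (prE (g *[J] f) y) *[Fb (A (cJ g)) i'] pc g f i' (FO (tr (A (dJ f)) h) (prO (dJ f) y))
   = FA (tr (A (cJ g)) h) (prE g y) *[Fb (A (cJ g)) i'] FA (HH (H g) i') (FA (tr (A (cJ f)) h) (prE f y))"
   unfolding gf[THEN c2, THEN c2] premor_tr(2)[OF Hg h ef]
    pcellD(3)[OF pc[OF f g c] h D(1)[OF o(1)], symmetric]
    functor_comp[OF trA[OF o(2) h] He eg, symmetric]
    functor_comp[OF trA[OF o(2) h] isoh_hom[OF pc_iso[OF f g c i D(1)[OF o(1)]]] egf, symmetric] D(4)[OF f g c] ..
 qed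
qed

lemma trO:
 assumes h: "h : hom Q i i'" and y: "y : WO i"
 shows "trO h y : WO i'" "j : Ob J ==> prO j (trO h y) = FO (tr (A j) h) (prO j y)"
  "f : Ar J ==> prE f (trO h y) = FA (tr (A (cJ f)) h) (prE f y)"
proof -
 have i': "i' : Ob Q" using hom_ob[OF category_P h] by blast
 show "trO h y : WO i'" "j : Ob J ==> prO j (trO h y) = FO (tr (A j) h) (prO j y)"
  "f : Ar J ==> prE f (trO h y) = FA (tr (A (cJ f)) h) (prE f y)"
  using mkO_WO[OF trO_cone[OF assms]] pr_mkO[OF i' trO_cone[OF assms]] by (simp_all add: trO_def)
qed

lemma trO_arr:
 assumes h: "h : hom Q i i'" and k: "arr i y z k"
 shows "arr i' (trO h y) (trO h z) (%j. FA (tr (A j) h) (k j))"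
proof -
 have i: "i : Ob Q" using hom_ob[OF category_P h] by blast
 note y = arrD(1)[OF k] and z = arrD(2)[OF k]
 show ?thesis
  unfolding arr_def
 proof (intro conjI ballI)
  show "trO h y : WO i'" "trO h z : WO i'" using trO(1)[OF h] y z by auto
  show "FA (tr (A j) h) (k j) : hom (Fb (A j) i') (prO j (trO h y)) (prO j (trO h z))" if "j : Ob J" for j
   unfolding trO(2)[OF h y that] trO(2)[OF h z that] by (rule functor_hom[OF trA[OF that h] arrD(3)[OF k that]])
  fix f assume f: "f : Ar J"
  note c = J_ob(2)[OF f] and d = J_ob(1)[OF f]
  show "prE f (trO h z) *[Fb (A (cJ f)) i'] FA (HH (H f) i') (FA (tr (A (dJ f)) h) (k (dJ f))) = FA (tr (A (cJ f)) h) (k (cJ f)) *[Fb (A (cJ f)) i'] prE f (trO h y)"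
   unfolding trO(3)[OF h y f] trO(3)[OF h z f] premor_tr(2)[OF preH[OF f] h arrD(3)[OF k d]]
    functor_comp[OF trA[OF c h] functor_hom[OF premor_HH[OF preH[OF f] i] arrD(3)[OF k d]] isoh_hom[OF WO_D(2)[OF i z f]], symmetric]
    functor_comp[OF trA[OF c h] isoh_hom[OF WO_D(2)[OF i y f]] arrD(3)[OF k c], symmetric] arrD(4)[OF k f] ..
 qed
qed

lemma trW:
 assumes h: "h : hom Q i i'" and t: "t : hom (WF i) y z"
 shows "FA (trW h) t : hom (WF i') (trO h y) (trO h z)" "j : Ob J ==> prA j (FA (trW h) t) = FA (tr (A j) h) (prA j t)"
proof -
 have i: "i : Ob Q" "i' : Ob Q" using hom_ob[OF category_P h] by auto
 note a = trO_arr[OF h WF_hom(1)[OF i(1) t]]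
 show "FA (trW h) t : hom (WF i') (trO h y) (trO h z)" "j : Ob J ==> prA j (FA (trW h) t) = FA (tr (A j) h) (prA j t)"
  using mkA_hom[OF i(2) a] pr_mkA(3)[OF i(2) a] WF_hom(3,4)[OF i(1) t] by (simp_all add: trW_def)
qed

lemma trW_FO [simp]: "FO (trW h) = trO h"
 by (simp add: trW_def)

lemma WF_ob: "i : Ob Q ==> t : hom (WF i) y z ==> y : WO i & z : WO i"
 using arrD(1,2)[OF WF_hom(1)] by blast

text \<open>Parallel arrows of the limit with equal components are equal, so the functor laws reduce
  to those of the \<open>G j\<close>.\<close>

lemma functor_to_WF:
 assumes C: "category C" and i: "i : Ob Q"
  and F: "!!t y z. t : hom C y z ==> FA F t : hom (WF i) (FO F y) (FO F z)"
  and G: "!!j. j : Ob J ==> is_functor C (Fb (A j) i) (G j)"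
  and p: "!!j t y z. j : Ob J ==> t : hom C y z ==> prA j (FA F t) = FA (G j) t"
  and o: "!!j y. j : Ob J ==> y : Ob C ==> prO j (FO F y) = FO (G j) y"
 shows "is_functor C (WF i) F"
proof -
 have ob: "FO F y : WO i" if "y : Ob C" for y using WF_ob[OF i F[OF ident_hom[OF C that]]] by blast
 note CW = category_WF[OF i]
 show ?thesis
  unfolding is_functor_def
 proof (intro conjI ballI impI)
  show "FO F x : Ob (WF i)" if "x : Ob C" for x using ob[OF that] by simp
  show "FA F f : hom (WF i) (FO F (Dom C f)) (FO F (Cod C f))" if "f : Ar C" for f by (rule F[OF homI[OF that]])
  show "FA F (Ident C x) = Ident (WF i) (FO F x)" if x: "x : Ob C" for x
  proof (rule WF_eqI[OF i F[OF ident_hom[OF C x]] ident_hom[OF CW]])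
   show "FO F x : Ob (WF i)" using ob[OF x] by simp
   show "prA j (FA F (Ident C x)) = prA j (Ident (WF i) (FO F x))" if j: "j : Ob J" for j
    unfolding p[OF j ident_hom[OF C x]] prA_ident[OF i ob[OF x] j] functor_ident[OF G[OF j] x] o[OF j x] ..
  qed
  fix f g assume "f : Ar C" "g : Ar C" "Cod C f = Dom C g"
  then have f: "f : hom C (Dom C f) (Cod C f)" and g: "g : hom C (Cod C f) (Cod C g)" by (auto simp: hom_def)
  note gf = comp_hom[OF C f g]
  show "FA F (g *[C] f) = FA F g *[WF i] FA F f"
  proof (rule WF_eqI[OF i F[OF gf] comp_hom[OF CW F[OF f] F[OF g]]])
   show "prA j (FA F (g *[C] f)) = prA j (FA F g *[WF i] FA F f)" if j: "j : Ob J" for j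
    unfolding p[OF j gf] prA_comp[OF i F[OF f] F[OF g] j] p[OF j f] p[OF j g] by (rule functor_comp[OF G[OF j] f g])
  qed
 qed
qed

lemma functor_trW: "h : hom Q i i' ==> is_functor (WF i) (WF i') (trW h)"
proof -
 assume h: "h : hom Q i i'"
 have i: "i : Ob Q" "i' : Ob Q" using hom_ob[OF category_P h] by auto
 show ?thesis
  by (rule functor_to_WF[OF category_WF[OF i(1)] i(2), where G = "%j. comp_func (tr (A j) h) \<lparr>FO = prO j, FA = prA j\<rparr>"])
   (use trW[OF h] trO(2)[OF h] functor_compose[OF pr_functor[OF _ i(1)] trA[OF _ h]] in auto)
qed

lemma functor_to_Cat_W: "functor_to_Cat U Q \<lparr>XO = WF, XA = trW\<rparr>"
 unfolding functor_to_Cat_def catfun.simps func_eq_def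
proof (intro conjI ballI impI)
 show "small_category U (WF x)" if "x : Ob Q" for x by (rule small_WF[OF that])
 show "is_functor (WF (Dom Q f)) (WF (Cod Q f)) (trW f)" if "f : Ar Q" for f by (rule functor_trW[OF homI[OF that]])
next
 fix i assume i: "i : Ob Q"
 note h = ident_hom[OF category_P i]
 have o: "trO (Ident Q i) y = y" if y: "y : WO i" for y
  by (rule WO_eqI[OF i trO(1)[OF h y] y])
   (simp_all only: trO(2,3)[OF h y] tr_ident(1)[OF preA i WO_D(1)[OF i y]] tr_ident(2)[OF preA[OF J_ob(2)] i isoh_hom[OF WO_D(2)[OF i y]]])
 then show "FO (trW (Ident Q i)) y = FO id_func y" if "y : Ob (WF i)" for y using that by (simp add: id_func_def)
 show "FA (trW (Ident Q i)) t = FA id_func t" if "t : Ar (WF i)" for t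
 proof -
  note t = homI[OF that] and a = WF_hom(1)[OF i homI[OF that]]
  have "FA (trW (Ident Q i)) t = t"
  proof (rule WF_eqI[OF i _ t])
   show "FA (trW (Ident Q i)) t : hom (WF i) (Dom (WF i) t) (Cod (WF i) t)"
    using trW(1)[OF h t] o[OF arrD(1)[OF a]] o[OF arrD(2)[OF a]] by simp
   show "prA j (FA (trW (Ident Q i)) t) = prA j t" if j: "j : Ob J" for j
    unfolding trW(2)[OF h t j] by (rule tr_ident(2)[OF preA[OF j] i arrD(3)[OF a j]])
  qed
  then show ?thesis by (simp add: id_func_def)
 qed
next
 fix k l assume "k : Ar Q" "l : Ar Q" "Cod Q k = Dom Q l"
 then have k: "k : hom Q (Dom Q k) (Cod Q k)" and l: "l : hom Q (Cod Q k) (Cod Q l)" by (auto simp: hom_def)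
 let ?i = "Dom Q k" and ?i'' = "Cod Q l"
 note kl = comp_hom[OF category_P k l]
 have i: "?i : Ob Q" "?i'' : Ob Q" using hom_ob[OF category_P kl] by auto
 have o: "trO (l *[Q] k) y = trO l (trO k y)" if y: "y : WO ?i" for y
  by (rule WO_eqI[OF i(2) trO(1)[OF kl y] trO(1)[OF l trO(1)[OF k y]]])
   (simp_all only: trO(2,3)[OF kl y] trO(2,3)[OF l trO(1)[OF k y]] trO(2,3)[OF k y] tr_comp(1)[OF preA k l WO_D(1)[OF i(1) y]]
    tr_comp(2)[OF preA[OF J_ob(2)] k l isoh_hom[OF WO_D(2)[OF i(1) y]]])
 then show "FO (trW (l *[Q] k)) y = FO (comp_func (trW l) (trW k)) y" if "y : Ob (WF ?i)" for y using that by simp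
 show "FA (trW (l *[Q] k)) t = FA (comp_func (trW l) (trW k)) t" if "t : Ar (WF ?i)" for t
 proof -
  note t = homI[OF that] and a = WF_hom(1)[OF i(1) homI[OF that]]
  show ?thesis
   unfolding comp_func_simps
  proof (rule WF_eqI[OF i(2) _ trW(1)[OF l trW(1)[OF k t]]])
   show "FA (trW (l *[Q] k)) t : hom (WF ?i'') (trO l (trO k (Dom (WF ?i) t))) (trO l (trO k (Cod (WF ?i) t)))"
    using trW(1)[OF kl t] o[OF arrD(1)[OF a]] o[OF arrD(2)[OF a]] by simp
   show "prA j (FA (trW (l *[Q] k)) t) = prA j (FA (trW l) (FA (trW k) t))" if j: "j : Ob J" for j
    unfolding trW(2)[OF kl t j] trW(2)[OF l trW(1)[OF k t] j] trW(2)[OF k t j]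
    by (rule tr_comp(2)[OF preA[OF j] k l arrD(3)[OF a j], symmetric])
  qed
 qed
qed

abbreviation EW :: "'io list list => ('u list, 'u list) cat" where "EW Z == prod_cat (map WF Z)"

lemma EW_ob: "ys : Ob (EW Z) \<longleftrightarrow> length ys = length Z & (ALL n<length Z. ys ! n : WO (Z ! n))"
 by (auto simp: list_all2_conv_all_nth)

lemma EW_hom: "fs : hom (EW Z) as bs \<longleftrightarrow> length fs = length Z & length as = length Z & length bs = length Z &
  (ALL n<length Z. fs ! n : hom (WF (Z ! n)) (as ! n) (bs ! n))"
 by (auto simp: hom_prod)

lemma envO: "set Z <= Ob Q ==> ys : Ob (EW Z) ==> j : Ob J ==> map (prO j) ys : Ob (E (A j) Z)"
 unfolding EW_ob E_ob using WO_D(1) by (simp add: subset_iff)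

lemma envE: "set Z <= Ob Q ==> ys : Ob (EW Z) ==> f : Ar J ==>
  isoh (E (A (cJ f)) Z) (map (prE f) ys) (HO (H f) Z (map (prO (dJ f)) ys)) (map (prO (cJ f)) ys)"
 by (rule E_isohI[OF _ preA[OF J_ob(2)]]) (auto simp: EW_ob WO_D(2) subset_iff simp del: prod_cat_simps)

lemma envA: "set Z <= Ob Q ==> fs : hom (EW Z) as bs ==> j : Ob J ==>
  map (prA j) fs : hom (E (A j) Z) (map (prO j) as) (map (prO j) bs)"
 unfolding EW_hom E_hom using arrD(3)[OF WF_hom(1)] by (simp add: subset_iff)

lemma EW_hom_ob:
 assumes Z: "set Z <= Ob Q" and fs: "fs : hom (EW Z) as bs"
 shows "as : Ob (EW Z) & bs : Ob (EW Z) & map dm fs = as & map cd fs = bs"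
proof -
 have n: "as ! n : WO (Z ! n) & bs ! n : WO (Z ! n) & dm (fs ! n) = as ! n & cd (fs ! n) = bs ! n" if "n < length Z" for n
 proof -
  have i: "Z ! n : Ob Q" using Z nth_mem[OF that] by blast
  have f: "fs ! n : hom (WF (Z ! n)) (as ! n) (bs ! n)" using fs that unfolding EW_hom by blast
  show ?thesis using WF_ob[OF i f] WF_hom(3,4)[OF i f] by blast
 qed
 then show ?thesis using fs unfolding EW_hom EW_ob by (auto intro!: nth_equalityI)
qed

text \<open>The unit and composition conditions for the arguments are combined with the axiom that
  relates a 2-cell to \<open>\<rho>\<close> of its source and target, applied to \<open>pu\<close>
  and \<open>pc\<close>.\<close>

lemma phiO_cone:
 assumes a: "q : TH m w ws" "x : Ob (P m)" and ys: "ys : Ob (EW (fibs ws x))"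
 shows "cone (fib w x) (%j. FO (phi (A j) m q x) (map (prO j) ys))
  (%f. FA (phi (A (cJ f)) m q x) (map (prE f) ys) *[Fb (A (cJ f)) (fib w x)] rho (H f) m q x (map (prO (dJ f)) ys))"
proof -
 note Z = fibs_ob[OF a] and i = Theta_fib[OF a]
 note oj = envO[OF Z ys] and ef = envE[OF Z ys] and F = functor_phi[OF preA a]
 let ?i = "fib w x" and ?\<Delta> = "fibs ws x"
 show ?thesis
  unfolding cone_def
 proof (intro conjI ballI impI)
  show "FO (phi (A j) m q x) (map (prO j) ys) : Ob (Fb (A j) ?i)" if j: "j : Ob J" for j
   by (rule functor_ob[OF F[OF j] oj[OF j]])
 next
  fix f assume f: "f : Ar J"
  note c = J_ob(2)[OF f] and d = J_ob(1)[OF f]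
  show "isoh (Fb (A (cJ f)) ?i) (FA (phi (A (cJ f)) m q x) (map (prE f) ys) *[Fb (A (cJ f)) ?i] rho (H f) m q x (map (prO (dJ f)) ys))
   (FO (HH (H f) ?i) (FO (phi (A (dJ f)) m q x) (map (prO (dJ f)) ys))) (FO (phi (A (cJ f)) m q x) (map (prO (cJ f)) ys))"
   by (rule isoh_comp[OF catA[OF c i] premor_rho(1)[OF preH[OF f] a oj[OF d]] functor_isoh[OF category_E[OF preA[OF c] Z] F[OF c] ef[OF f]]])
 next
  fix j assume j: "j : Ob J"
  let ?f = "Ident J j" and ?C = "Fb (A j) ?i" and ?a = "map (prO j) ys"
  note I = J_ident[OF j] and o = oj[OF j] and C = catA[OF j i]
  have e: "map (prE ?f) ys : hom (E (A j) ?\<Delta>) (HO (H ?f) ?\<Delta> ?a) ?a" using isoh_hom[OF ef[of ?f]] I by simp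
  have r: "rho (H ?f) m q x ?a : hom ?C (FO (HH (H ?f) ?i) (FO (phi (A j) m q x) ?a)) (FO (phi (A j) m q x) (HO (H ?f) ?\<Delta> ?a))"
   using premor_rho(1)[OF preH[of ?f] a] I o isoh_hom by fastforce
  have p: "map2 (pu j) ?\<Delta> ?a : hom (E (A j) ?\<Delta>) ?a (HO (H ?f) ?\<Delta> ?a)"
   using pcells_hom[OF pu[OF j] Z o] unfolding id_mor_HO[OF Z o] .
  have u: "pu j ?i (FO (phi (A j) m q x) ?a) : hom ?C (FO (phi (A j) m q x) ?a) (FO (HH (H ?f) ?i) (FO (phi (A j) m q x) ?a))"
   by (rule isoh_hom[OF pu_iso[OF j i functor_ob[OF F[OF j] o]]])
  have ep: "map (prE ?f) ys *[E (A j) ?\<Delta>] map2 (pu j) ?\<Delta> ?a = Ident (E (A j) ?\<Delta>) ?a"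
   using ys WO_D(3)[OF _ _ j] Z unfolding EW_ob by (intro nth_equalityI) (simp_all add: subset_iff)
  \<comment> \<open>The 2-cell \<open>pu j\<close> trades \<open>\<rho>\<close> of
    \<open>H (Ident J j)\<close> for that of the identity morphism, which is an identity.\<close>
  have "(FA (phi (A j) m q x) (map (prE ?f) ys) *[?C] rho (H ?f) m q x ?a) *[?C] pu j ?i (FO (phi (A j) m q x) ?a)
   = FA (phi (A j) m q x) (map (prE ?f) ys) *[?C] (FA (phi (A j) m q x) (map2 (pu j) ?\<Delta> ?a) *[?C] rho (idm (A j)) m q x ?a)"
   unfolding comp_assoc[OF C u r functor_hom[OF F[OF j] e]] pcellD(4)[OF pu[OF j] a o] ..
  also have "\<dots> = Ident ?C (FO (phi (A j) m q x) ?a)"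
   unfolding id_mor_rho[OF a o] comp_ident_right[OF C functor_hom[OF F[OF j] p]] functor_comp[OF F[OF j] p e, symmetric] ep
    functor_ident[OF F[OF j] o] ..
  finally show "(FA (phi (A (cJ ?f)) m q x) (map (prE ?f) ys) *[Fb (A (cJ ?f)) ?i] rho (H ?f) m q x (map (prO (dJ ?f)) ys)) *[?C] pu j ?i (FO (phi (A j) m q x) ?a)
   = Ident ?C (FO (phi (A j) m q x) ?a)" using I by simp
 next
  fix f g assume f: "f : Ar J" and g: "g : Ar J" and c: "cJ f = dJ g"
  let ?k = "g *[J] f" and ?B = "A (cJ g)" and ?C = "Fb (A (cJ g)) ?i" and ?a = "map (prO (dJ f)) ys" and ?b = "map (prO (cJ f)) ys"
  note K = J_comp[OF f g c] and d = J_ob(1)[OF f] and m' = J_ob(2)[OF f] and e' = J_ob(2)[OF g]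
  note o = oj[OF d] and ob = oj[OF m'] and C = catA[OF e' i]
  have k: "?k : Ar J" and Hk: "premor (A (dJ f)) ?B (H ?k)" using preH[of ?k] K by auto
  note Hf = preH[OF f] and Hg = preH[OF g, folded c]
  have ek: "map (prE ?k) ys : hom (E ?B ?\<Delta>) (HO (H ?k) ?\<Delta> ?a) (map (prO (cJ g)) ys)" using isoh_hom[OF ef[OF k]] K by simp
  note ff = isoh_hom[OF ef[OF f]] and eg = isoh_hom[OF ef[OF g], folded c]
  note rk = isoh_hom[OF premor_rho(1)[OF Hk a o]]
  have p: "map2 (pc g f) ?\<Delta> ?a : hom (E ?B ?\<Delta>) (HO (H g) ?\<Delta> (HO (H f) ?\<Delta> ?a)) (HO (H ?k) ?\<Delta> ?a)"
   using pcells_hom[OF pc[OF f g c] Z o] unfolding comp_mor_HO[OF Z o] .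
  note u = isoh_hom[OF pc_iso[OF f g c i functor_ob[OF F[OF d] o]]]
  note Hgf = HA_hom[OF Hg Z ff]
  have ep: "map (prE ?k) ys *[E ?B ?\<Delta>] map2 (pc g f) ?\<Delta> ?a = map (prE g) ys *[E ?B ?\<Delta>] map2 (%i. FA (HH (H g) i)) ?\<Delta> (map (prE f) ys)"
   using ys WO_D(4)[OF _ _ f g c] Z unfolding EW_ob by (intro nth_equalityI) (simp_all add: subset_iff)
  note rf = isoh_hom[OF premor_rho(1)[OF Hf a o]] and rg = isoh_hom[OF premor_rho(1)[OF Hg a ob]]
   and rg1 = isoh_hom[OF premor_rho(1)[OF Hg a HO_ob[OF Hf Z o]]]
  note Gr = functor_hom[OF premor_HH[OF Hg i] rf] and Ge = functor_hom[OF premor_HH[OF Hg i] functor_hom[OF F[OF m'] ff]]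
  note PE = functor_hom[OF F[OF e']]
  \<comment> \<open>The 2-cell \<open>pc g f\<close> trades \<open>\<rho>\<close> of
    \<open>H ?k\<close> for that of the composite morphism, made of \<open>\<rho>\<close> of
    \<open>H g\<close> and the image of \<open>\<rho>\<close> of \<open>H f\<close>.\<close>
  have "(FA (phi ?B m q x) (map (prE ?k) ys) *[?C] rho (H ?k) m q x ?a) *[?C] pc g f ?i (FO (phi (A (dJ f)) m q x) ?a)
   = FA (phi ?B m q x) (map (prE ?k) ys) *[?C] (FA (phi ?B m q x) (map2 (pc g f) ?\<Delta> ?a) *[?C]
     (rho (H g) m q x (HO (H f) ?\<Delta> ?a) *[?C] FA (HH (H g) ?i) (rho (H f) m q x ?a)))"
   unfolding comp_assoc[OF C u rk PE[OF ek]] pcellD(4)[OF pc[OF f g c] a o, symmetric] comp_mor_rho[OF a o] ..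
  also have "\<dots> = (FA (phi ?B m q x) (map (prE g) ys) *[?C] FA (phi ?B m q x) (map2 (%i. FA (HH (H g) i)) ?\<Delta> (map (prE f) ys))) *[?C]
     (rho (H g) m q x (HO (H f) ?\<Delta> ?a) *[?C] FA (HH (H g) ?i) (rho (H f) m q x ?a))"
   unfolding comp_assoc[OF C comp_hom[OF C Gr rg1] PE[OF p] PE[OF ek], symmetric] functor_comp[OF F[OF e'] p ek, symmetric] ep
    functor_comp[OF F[OF e'] Hgf eg] ..
  \<comment> \<open>Naturality of \<open>\<rho>\<close> of \<open>H g\<close> at the structure
    arrows \<open>map (prE f) ys\<close>.\<close>
  also have "\<dots> = FA (phi ?B m q x) (map (prE g) ys) *[?C] ((rho (H g) m q x ?b *[?C] FA (HH (H g) ?i) (FA (phi (A (cJ f)) m q x) (map (prE f) ys))) *[?C]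
     FA (HH (H g) ?i) (rho (H f) m q x ?a))"
   unfolding comp_assoc[OF C comp_hom[OF C Gr rg1] PE[OF Hgf] PE[OF eg]] comp_assoc[OF C Gr rg1 PE[OF Hgf], symmetric] premor_rho(2)[OF Hg a ff] ..
  also have "\<dots> = (FA (phi ?B m q x) (map (prE g) ys) *[?C] rho (H g) m q x ?b) *[?C]
     FA (HH (H g) ?i) (FA (phi (A (cJ f)) m q x) (map (prE f) ys) *[Fb (A (cJ f)) ?i] rho (H f) m q x ?a)"
   unfolding comp_assoc[OF C Gr Ge rg] functor_comp[OF premor_HH[OF Hg i] rf functor_hom[OF F[OF m'] ff]]
    comp_assoc[OF C comp_hom[OF C Gr Ge] rg PE[OF eg]] ..
  finally show "(FA (phi (A (cJ ?k)) m q x) (map (prE ?k) ys) *[Fb (A (cJ ?k)) ?i] rho (H ?k) m q x (map (prO (dJ ?k)) ys)) *[?C]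
    pc g f ?i (FO (phi (A (dJ f)) m q x) ?a)
   = (FA (phi ?B m q x) (map (prE g) ys) *[?C] rho (H g) m q x (map (prO (dJ g)) ys)) *[?C]
     FA (HH (H g) ?i) (FA (phi (A (cJ f)) m q x) (map (prE f) ys) *[Fb (A (cJ f)) ?i] rho (H f) m q x ?a)"
   using K c by simp
 qed
qed

lemma phiO:
 assumes "q : TH m w ws" "x : Ob (P m)" "ys : Ob (EW (fibs ws x))"
 shows "phiO m q x ys : WO (fib w x)" "j : Ob J ==> prO j (phiO m q x ys) = FO (phi (A j) m q x) (map (prO j) ys)"
  "f : Ar J ==> prE f (phiO m q x ys) =
   FA (phi (A (cJ f)) m q x) (map (prE f) ys) *[Fb (A (cJ f)) (fib w x)] rho (H f) m q x (map (prO (dJ f)) ys)"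
 using mkO_WO[OF phiO_cone[OF assms]] pr_mkO[OF Theta_fib[OF assms(1,2)] phiO_cone[OF assms]] by (simp_all add: phiO_def out_eq[OF assms(1)])

text \<open>Naturality of \<open>\<rho>\<close> at the components, pasted with the operation applied
  to the squares of the arguments.\<close>

lemma phiO_arr:
 assumes a: "q : TH m w ws" "x : Ob (P m)" and fs: "fs : hom (EW (fibs ws x)) as bs"
 shows "arr (fib w x) (phiO m q x as) (phiO m q x bs) (%j. FA (phi (A j) m q x) (map (prA j) fs))"
proof -
 note Z = fibs_ob[OF a] and i = Theta_fib[OF a]
 have ab: "as : Ob (EW (fibs ws x))" "bs : Ob (EW (fibs ws x))" using EW_hom_ob[OF Z fs] by auto
 note F = functor_phi[OF preA a] and h = envA[OF Z fs]
 let ?i = "fib w x" and ?\<Delta> = "fibs ws x"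
 show ?thesis
  unfolding arr_def
 proof (intro conjI ballI)
  show "phiO m q x as : WO ?i" "phiO m q x bs : WO ?i" using phiO(1)[OF a] ab by auto
  show "FA (phi (A j) m q x) (map (prA j) fs) : hom (Fb (A j) ?i) (prO j (phiO m q x as)) (prO j (phiO m q x bs))" if j: "j : Ob J" for j
   unfolding phiO(2)[OF a ab(1) j] phiO(2)[OF a ab(2) j] by (rule functor_hom[OF F[OF j] h[OF j]])
  fix f assume f: "f : Ar J"
  note c = J_ob(2)[OF f] and d = J_ob(1)[OF f]
  note C = catA[OF c i] and ea = isoh_hom[OF envE[OF Z ab(1) f]] and eb = isoh_hom[OF envE[OF Z ab(2) f]]
  note ra = isoh_hom[OF premor_rho(1)[OF preH[OF f] a envO[OF Z ab(1) d]]] and rb = isoh_hom[OF premor_rho(1)[OF preH[OF f] a envO[OF Z ab(2) d]]]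
  note Hh = HA_hom[OF preH[OF f] Z h[OF d]] and P' = functor_hom[OF F[OF c]]
  have s: "map (prE f) bs *[E (A (cJ f)) ?\<Delta>] map2 (%i. FA (HH (H f) i)) ?\<Delta> (map (prA (dJ f)) fs) = map (prA (cJ f)) fs *[E (A (cJ f)) ?\<Delta>] map (prE f) as"
   using fs arrD(4)[OF WF_hom(1) f] Z unfolding EW_hom by (intro nth_equalityI) (simp_all add: subset_iff)
  show "prE f (phiO m q x bs) *[Fb (A (cJ f)) ?i] FA (HH (H f) ?i) (FA (phi (A (dJ f)) m q x) (map (prA (dJ f)) fs))
   = FA (phi (A (cJ f)) m q x) (map (prA (cJ f)) fs) *[Fb (A (cJ f)) ?i] prE f (phiO m q x as)"
   unfolding phiO(3)[OF a ab(1) f] phiO(3)[OF a ab(2) f]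
   by (rule comp_square[OF C ra P'[OF ea] rb P'[OF eb] functor_hom[OF premor_HH[OF preH[OF f] i] functor_hom[OF F[OF d] h[OF d]]] P'[OF Hh] P'[OF h[OF c]]
     premor_rho(2)[OF preH[OF f] a h[OF d], symmetric] functor_comp[OF F[OF c] ea h[OF c], folded s, unfolded functor_comp[OF F[OF c] Hh eb], symmetric], symmetric])
 qed
qed

lemma phiW_FO [simp]: "FO (phiW m q x) = phiO m q x"
 by (simp add: phiW_def)

lemma phiW:
 assumes a: "q : TH m w ws" "x : Ob (P m)" and fs: "fs : hom (EW (fibs ws x)) as bs"
 shows "FA (phiW m q x) fs : hom (WF (fib w x)) (phiO m q x as) (phiO m q x bs)"
  "j : Ob J ==> prA j (FA (phiW m q x) fs) = FA (phi (A j) m q x) (map (prA j) fs)"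
 using mkA_hom[OF Theta_fib[OF a] phiO_arr[OF a fs]] pr_mkA(3)[OF Theta_fib[OF a] phiO_arr[OF a fs]] EW_hom_ob[OF fibs_ob[OF a] fs]
 by (simp_all add: phiW_def)

lemma functor_phiW:
 assumes a: "q : TH m w ws" "x : Ob (P m)"
 shows "is_functor (EW (fibs ws x)) (WF (fib w x)) (phiW m q x)"
proof (rule functor_to_WF[OF _ Theta_fib[OF a], where G = "%j. comp_func (phi (A j) m q x) \<lparr>FO = map (prO j), FA = map (prA j)\<rparr>"])
 note Z = fibs_ob[OF a]
 show "category (EW (fibs ws x))" by (rule category_prod) (use Z category_WF in auto)
 fix j assume j: "j : Ob J"
 have "is_functor (EW (fibs ws x)) (E (A j) (fibs ws x)) \<lparr>FO = map (prO j), FA = map (prA j)\<rparr>"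
  unfolding is_functor_def func.simps
 proof (intro conjI ballI impI)
  show "map (prO j) y : Ob (E (A j) (fibs ws x))" if "y : Ob (EW (fibs ws x))" for y by (rule envO[OF Z that j])
  show "map (prA j) f : hom (E (A j) (fibs ws x)) (map (prO j) (Dom (EW (fibs ws x)) f)) (map (prO j) (Cod (EW (fibs ws x)) f))"
   if "f : Ar (EW (fibs ws x))" for f by (rule envA[OF Z homI[OF that] j])
  show "map (prA j) (Ident (EW (fibs ws x)) y) = Ident (E (A j) (fibs ws x)) (map (prO j) y)" if "y : Ob (EW (fibs ws x))" for y
   using that Z prA_ident[OF _ _ j] unfolding EW_ob by (intro nth_equalityI) (simp_all add: subset_iff del: WF_simps(5))
  fix f g assume fg: "f : Ar (EW (fibs ws x))" "g : Ar (EW (fibs ws x))" "Cod (EW (fibs ws x)) f = Dom (EW (fibs ws x)) g"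
  obtain as bs cs where f: "f : hom (EW (fibs ws x)) as bs" and g: "g : hom (EW (fibs ws x)) bs cs"
   using homI[OF fg(1)] homI[OF fg(2), folded fg(3)] by blast
  show "map (prA j) (g *[EW (fibs ws x)] f) = map (prA j) g *[E (A j) (fibs ws x)] map (prA j) f"
  proof (rule nth_equalityI)
   fix n assume "n < length (map (prA j) (g *[EW (fibs ws x)] f))"
   then have n: "n < length (fibs ws x)" by simp
   have i: "fibs ws x ! n : Ob Q" using Z nth_mem[OF n] by blast
   have "f ! n : hom (WF (fibs ws x ! n)) (as ! n) (bs ! n)" "g ! n : hom (WF (fibs ws x ! n)) (bs ! n) (cs ! n)"
    "length f = length ws" "length g = length ws" using f g n unfolding EW_hom by simp_all
   then show "map (prA j) (g *[EW (fibs ws x)] f) ! n = (map (prA j) g *[E (A j) (fibs ws x)] map (prA j) f) ! n"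
    using prA_comp[OF i _ _ j] n by (simp del: WF_simps(6))
  qed simp
 qed
 from functor_compose[OF this functor_phi[OF preA[OF j] a]]
 show "is_functor (EW (fibs ws x)) (Fb (A j) (fib w x)) (comp_func (phi (A j) m q x) \<lparr>FO = map (prO j), FA = map (prA j)\<rparr>)" .
qed (use phiW[OF a] phiO(2)[OF a] in auto)

end

context T_algebra
begin

text \<open>Evaluation reads the fibres, transports and operations only; hence the ends of the
  coherence isomorphisms of the limit can be computed before these exist.\<close>

lemma evF_cong: "XX A = XX B ==> phi A = phi B ==> evF A t = evF B t"
proof (induction t)
 case (Op m q x ts)
 then have "map (evF A) ts = map (evF B) ts" by simp
 with Op show ?case by (simp only: evF.simps)
qed simp_all

lemma ThetaHoms_ins: "THs m qs ws wss ==> map (ins \<Theta> m) qs = wss"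
 by (rule nth_equalityI) (auto simp: ThetaHoms_def ins_eq)

end

section \<open>The coherence isomorphisms of the limit\<close>

context diagram
begin

definition W0 :: "('io, 'ia, 't, 'h, 'u) alg" where
 "W0 = \<lparr>XX = \<lparr>XO = WF, XA = trW\<rparr>, phi = phiW, e_unit = undefined, e_comp = undefined, e_fun = undefined,
  e_sub = undefined, e_pull = undefined\<rparr>"

text \<open>
  \<open>W0\<close> has the functors and the operations of the limit. Since arrows are coded together with their source and target,
  the coherence isomorphisms are defined afterwards, with the terms of \<open>kind\<close> for source and target.
\<close>

definition eW :: "('h, 'io, 'ia) tm => ('h, 'io, 'ia) tm => (('io, 'ia, 't, 'h, 'u) alg => 'u list => 'u) => 'u list => 'u" where
 "eW s t e ys = mkA (FO (evF W0 s) ys) (FO (evF W0 t) ys) (%j. e (A j) (map (prO j) ys))"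

text \<open>The fields of an algebra receive the operation \<open>q\<close> without its inputs, its
  output or its arity; these are recovered by \<open>ins\<close>, \<open>out\<close> and
  \<open>length\<close>.\<close>

definition Wa :: "('io, 'ia, 't, 'h, 'u) alg" where
 "Wa = W0\<lparr>
  e_unit := %m w x. eW (Op m (Oun m w) x (vars [fib w x])) (V (fib w x) 0) (%A. e_unit A m w x),
  e_comp := %m q qs x. let wss = map (ins \<Theta> m) qs; vs = vars (fibs (concat wss) x) in
   eW (Op m (Ocp m q qs) x vs) (Op m q x (map2 (%q' ts. Op m q' x ts) qs (blocks (map length wss) vs))) (%A. e_comp A m q qs x),
  e_fun := %m ws io q x. let vs = vars (fibs ws x) in
   eW (Op m (Ofn m ws io q) x vs) (Op m q x (pick vs io)) (%A. e_fun A m ws io q x),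
  e_sub := %l f q x. let m = length f; w = out \<Theta> m q; ws = ins \<Theta> m q; vs = vars (fibs (map (ksb l f) ws) x) in
   eW (Tr (sQ l f w x) (Op l (Osb l f q) x vs)) (Op m q (pick x f) (map2 (%w. Tr (sQ l f w x)) ws vs)) (%A. e_sub A l f q x),
  e_pull := %us q x. let m = length us; w = out \<Theta> m q; ws = ins \<Theta> m q; vs = vars (fibs (map (kgm us) ws) x) in
   eW (Tr (cQ us w x) (Op (arsum us) (Opl us q) x vs))
    (Op m q (PhiS TT I us x) (map2 (%w. Tr (cQ us w x)) ws vs)) (%A. e_pull A us q x)\<rparr>"

lemma Wa_simps [simp]: "XX Wa = \<lparr>XO = WF, XA = trW\<rparr>" "phi Wa = phiW"
 by (simp_all add: Wa_def W0_def)

lemma Wa_kind: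
 assumes "kind Z i s t e"
 shows "e Wa ys = mkA (FO (evF Wa s) ys) (FO (evF Wa t) ys) (%j. e (A j) (map (prO j) ys))"
proof -
 have 0: "evF W0 t = evF Wa t" for t by (rule evF_cong) (simp_all add: W0_def)
 have "e Wa ys = eW s t e ys"
  using assms
 proof (induction rule: kind.induct)
  case (k_comp q m w ws qs wss x Z)
  then show ?case by (simp add: Wa_def ThetaHoms_ins[OF k_comp(2)] Let_def del: map_map)
 next
  case (k_sub f m l q w ws x Z)
  then show ?case using index_mapsD[OF k_sub(1)] by (simp add: Wa_def out_eq[OF k_sub(2)] ins_eq[OF k_sub(2)] Let_def)
 next
  case (k_pull q m w ws us N x Z)
  then show ?case by (simp add: Wa_def out_eq[OF k_pull(1)] ins_eq[OF k_pull(1)] Let_def)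
 qed (simp_all add: Wa_def Let_def)
 then show ?thesis by (simp only: eW_def 0)
qed

lemma trs_WO:
 assumes q: "q : TH m w ws" and h: "h : hom (P m) x y" and ys: "ys : Ob (EW (fibs ws x))"
 shows "map2 (%w. trO (fibA w h)) ws ys : Ob (EW (fibs ws y))"
  and "j : Ob J ==> map (prO j) (map2 (%w. trO (fibA w h)) ws ys) = trs (A j) ws h (map (prO j) ys)"
  and "f : Ar J ==> map (prE f) (map2 (%w. trO (fibA w h)) ws ys) = map2 (%w. FA (tr (A (cJ f)) (fibA w h))) ws (map (prE f) ys)"
proof -
 have hv: "fibA v h : hom Q (fib v x) (fib v y)" if "v : set ws" for v using fibA_hom[OF _ h] ThetaHomD[OF q] that by blast
 show "map2 (%w. trO (fibA w h)) ws ys : Ob (EW (fibs ws y))"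
  "j : Ob J ==> map (prO j) (map2 (%w. trO (fibA w h)) ws ys) = trs (A j) ws h (map (prO j) ys)"
  "f : Ar J ==> map (prE f) (map2 (%w. trO (fibA w h)) ws ys) = map2 (%w. FA (tr (A (cJ f)) (fibA w h))) ws (map (prE f) ys)"
  using ys trO[OF hv] unfolding EW_ob by (auto intro!: nth_equalityI)
qed

text \<open>On structure arrows this combines naturality in \<open>x\<close> of the operation with
  that of \<open>\<rho>\<close>.\<close>

lemma phiO_nat:
 assumes q: "q : TH m w ws" and h: "h : hom (P m) x y" and ys: "ys : Ob (EW (fibs ws x))"
 shows "phiO m q y (map2 (%w. trO (fibA w h)) ws ys) = trO (fibA w h) (phiO m q x ys)"
proof -
 have x: "x : Ob (P m)" "y : Ob (P m)" using hom_ob[OF category_P h] by auto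
 note a = q x(1) and b = q x(2)
 have hw: "fibA w h : hom Q (fib w x) (fib w y)" using fibA_hom[OF _ h] ThetaHomD[OF q] by blast
 note t = trs_WO[OF q h ys] and p = phiO[OF a ys] and q0 = phiO[OF b trs_WO(1)[OF q h ys]] and Z = fibs_ob[OF a]
 show ?thesis
 proof (rule WO_eqI[OF Theta_fib[OF b] q0(1) trO(1)[OF hw p(1)]])
  show "prO j (phiO m q y (map2 (%w. trO (fibA w h)) ws ys)) = prO j (trO (fibA w h) (phiO m q x ys))" if j: "j : Ob J" for j
   unfolding q0(2)[OF j] trO(2)[OF hw p(1) j] p(2)[OF j] t(2)[OF j] by (rule phi_nat(1)[OF preA[OF j] q h envO[OF Z ys j]])
  fix f assume f: "f : Ar J"
  note c = J_ob(2)[OF f] and d = J_ob(1)[OF f]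
  note e = isoh_hom[OF envE[OF Z ys f]] and o = envO[OF Z ys d]
  show "prE f (phiO m q y (map2 (%w. trO (fibA w h)) ws ys)) = prE f (trO (fibA w h) (phiO m q x ys))"
   unfolding q0(3)[OF f] trO(3)[OF hw p(1) f] p(3)[OF f] t(2)[OF d] t(3)[OF f] phi_nat(2)[OF preA[OF c] q h e]
    premor_rho(3)[OF preH[OF f] q h o, symmetric]
   by (rule functor_comp[OF trA[OF c hw] isoh_hom[OF premor_rho(1)[OF preH[OF f] a o]] functor_hom[OF functor_phi[OF preA[OF c] a] e], symmetric])
 qed
qed

lemma phiW_nat:
 assumes q: "q : TH m w ws" and h: "h : hom (P m) x y" and fs: "fs : hom (EW (fibs ws x)) as bs"
 shows "FA (phiW m q y) (map2 (%w. FA (trW (fibA w h))) ws fs) = FA (trW (fibA w h)) (FA (phiW m q x) fs)"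
proof -
 have x: "x : Ob (P m)" "y : Ob (P m)" using hom_ob[OF category_P h] by auto
 note a = q x(1) and b = q x(2)
 have hw: "fibA w h : hom Q (fib w x) (fib w y)" using fibA_hom[OF _ h] ThetaHomD[OF q] by blast
 have hv: "fibA v h : hom Q (fib v x) (fib v y)" if "v : set ws" for v using fibA_hom[OF _ h] ThetaHomD[OF q] that by blast
 have o: "as : Ob (EW (fibs ws x))" "bs : Ob (EW (fibs ws x))" using EW_hom_ob[OF fibs_ob[OF a] fs] by auto
 have f: "map2 (%w. FA (trW (fibA w h))) ws fs : hom (EW (fibs ws y)) (map2 (%w. trO (fibA w h)) ws as) (map2 (%w. trO (fibA w h)) ws bs)"
  using fs trW(1)[OF hv] unfolding EW_hom by simp
 have e: "map (prA j) (map2 (%w. FA (trW (fibA w h))) ws fs) = map2 (%w. FA (tr (A j) (fibA w h))) ws (map (prA j) fs)" if "j : Ob J" for j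
  using fs trW(2)[OF hv _ that] unfolding EW_hom by (auto intro!: nth_equalityI)
 show ?thesis
 proof (rule WF_eqI[OF Theta_fib[OF b] phiW(1)[OF b f]])
  show "FA (trW (fibA w h)) (FA (phiW m q x) fs) : hom (WF (fib w y)) (phiO m q y (map2 (%w. trO (fibA w h)) ws as)) (phiO m q y (map2 (%w. trO (fibA w h)) ws bs))"
   unfolding phiO_nat[OF q h o(1)] phiO_nat[OF q h o(2)] by (rule trW(1)[OF hw phiW(1)[OF a fs]])
  show "prA j (FA (phiW m q y) (map2 (%w. FA (trW (fibA w h))) ws fs)) = prA j (FA (trW (fibA w h)) (FA (phiW m q x) fs))" if j: "j : Ob J" for j
   unfolding phiW(2)[OF b f j] trW(2)[OF hw phiW(1)[OF a fs] j] phiW(2)[OF a fs j] e[OF j]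
   by (rule phi_nat(2)[OF preA[OF j] q h envA[OF fibs_ob[OF a] fs j]])
 qed
qed

lemma prealg_Wa: "prealg Wa"
 unfolding prealg_def nat_to_Cat_def
proof (intro conjI allI ballI)
 show "functor_to_Cat U Q (XX Wa)" using functor_to_Cat_W by simp
next
 fix m w ws q x assume "q : TH m w ws" "x : Ob (P m)"
 then show "is_functor (XO (Xws I (XX Wa) ws) x) (XO (Xw I (XX Wa) w) x) (phi Wa m q x)"
  unfolding Xw_simps Wa_simps catfun.simps by (rule functor_phiW)
next
 fix m w ws q h assume q: "q : TH m w ws" and "h : Ar (P m)"
 then have h: "h : hom (P m) (Dom (P m) h) (Cod (P m) h)" by (intro homI)
 show "func_eq (XO (Xws I (XX Wa) ws) (Dom (P m) h)) (comp_func (phi Wa m q (Cod (P m) h)) (XA (Xws I (XX Wa) ws) h))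
   (comp_func (XA (Xw I (XX Wa) w) h) (phi Wa m q (Dom (P m) h)))"
  unfolding Xw_simps Wa_simps catfun.simps func_eq_def comp_func_simps prod_func_simps map2_map_left trW_FO phiW_FO
  using phiO_nat[OF q h] phiW_nat[OF q h homI] by blast
qed

lemma E_Wa: "E Wa Z = EW Z"
 by simp

text \<open>The formula for the structure arrows of \<open>phiO\<close>, propagated from operations
  to terms; \<open>rhoT\<close> is the form that \<open>\<rho>\<close> takes there. At a transport
  there is only functoriality to use.\<close>

lemma evW:
 assumes "wt Z t i" and Z: "set Z <= Ob Q" and ys: "ys : Ob (E Wa Z)"
 shows "(ALL j:Ob J. prO j (FO (evF Wa t) ys) = FO (evF (A j) t) (map (prO j) ys)) &
  (ALL f:Ar J. prE f (FO (evF Wa t) ys) = FA (evF (A (cJ f)) t) (map (prE f) ys) *[Fb (A (cJ f)) i]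
   rhoT (A (dJ f)) (A (cJ f)) (H f) (map (prO (dJ f)) ys) t)"
 using assms(1)
proof (induction rule: wt.induct)
 case (wt_V n)
 note ys' = ys[unfolded E_Wa EW_ob]
 have y: "ys ! n : WO (Z ! n)" "length ys = length Z" using ys' wt_V by auto
 have "prE f (ys ! n) *[Fb (A (cJ f)) (Z ! n)] Ident (Fb (A (cJ f)) (Z ! n)) (FO (HH (H f) (Z ! n)) (prO (dJ f) (ys ! n))) = prE f (ys ! n)"
  if "f : Ar J" for f
  by (rule comp_ident_right[OF catA[OF J_ob(2)[OF that] wt_V(2)] isoh_hom[OF WO_D(2)[OF wt_V(2) y(1) that]]])
 then show ?case using y wt_V(1) by simp
next
 case (wt_Op q m w ws x ts)
 note a = wt_Op(1,2)
 have ts: "list_all2 (wt Z) ts (fibs ws x)" and l: "length ts = length ws" using wt_Op(3) by (auto simp: list_all2_conv_all_nth)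
 let ?zs = "map (%t. FO (evF Wa t) ys) ts" and ?\<Delta> = "fibs ws x"
 have zs: "?zs : Ob (EW ?\<Delta>)" using evF_args[OF prealg_Wa ts ys] unfolding E_Wa .
 note ys' = ys[unfolded E_Wa]
 have IH: "n < length ts ==> j : Ob J ==> prO j (FO (evF Wa (ts ! n)) ys) = FO (evF (A j) (ts ! n)) (map (prO j) ys)"
  "n < length ts ==> f : Ar J ==> prE f (FO (evF Wa (ts ! n)) ys) = FA (evF (A (cJ f)) (ts ! n)) (map (prE f) ys) *[Fb (A (cJ f)) (?\<Delta> ! n)]
   rhoT (A (dJ f)) (A (cJ f)) (H f) (map (prO (dJ f)) ys) (ts ! n)" for n j f
  using wt_Op(3) by (auto simp: list_all2_conv_all_nth)
 have o: "map (prO j) ?zs = map (%t. FO (evF (A j) t) (map (prO j) ys)) ts" if "j : Ob J" for j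
  using IH(1)[OF _ that] by (intro nth_equalityI) simp_all
 have ev: "FO (evF Wa (Op m q x ts)) ys = phiO m q x ?zs" by (simp add: o_def)
 have "prE f (phiO m q x ?zs) = FA (evF (A (cJ f)) (Op m q x ts)) (map (prE f) ys) *[Fb (A (cJ f)) (fib w x)]
   rhoT (A (dJ f)) (A (cJ f)) (H f) (map (prO (dJ f)) ys) (Op m q x ts)" if f: "f : Ar J" for f
 proof -
  note c = J_ob(2)[OF f] and d = J_ob(1)[OF f]
  note C = catA[OF c Theta_fib[OF a]] and F = functor_phi[OF preA[OF c] a]
  note es = isoh_hom[OF envE[OF Z ys' f]] and od = envO[OF Z ys' d]
  note r = rhoT_args_hom[OF preA[OF d] preA[OF c] preH[OF f] ts od]
  have e: "map (%t. FA (evF (A (cJ f)) t) (map (prE f) ys)) ts : hom (E (A (cJ f)) ?\<Delta>)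
    (map (%t. FO (evF (A (cJ f)) t) (HO (H f) Z (map (prO (dJ f)) ys))) ts) (map (%t. FO (evF (A (cJ f)) t) (map (prO (cJ f)) ys)) ts)"
   unfolding E_hom using functor_hom[OF evF_functor[OF preA[OF c]] es] ts l by (auto simp: list_all2_conv_all_nth)
  \<comment> \<open>The induction hypotheses for all arguments form one equation in the product of
    the fibres, to which the operation applies as a functor.\<close>
  have E: "map (prE f) ?zs = map (%t. FA (evF (A (cJ f)) t) (map (prE f) ys)) ts *[E (A (cJ f)) ?\<Delta>]
    map (rhoT (A (dJ f)) (A (cJ f)) (H f) (map (prO (dJ f)) ys)) ts"
   using IH(2)[OF _ f] l by (intro nth_equalityI) simp_all
  have R: "rho (H f) m q x (map (%t. FO (evF (A (dJ f)) t) (map (prO (dJ f)) ys)) ts) : hom (Fb (A (cJ f)) (fib w x))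
   (FO (HH (H f) (fib w x)) (FO (phi (A (dJ f)) m q x) (map (%t. FO (evF (A (dJ f)) t) (map (prO (dJ f)) ys)) ts)))
   (FO (phi (A (cJ f)) m q x) (HO (H f) ?\<Delta> (map (%t. FO (evF (A (dJ f)) t) (map (prO (dJ f)) ys)) ts)))"
   by (rule isoh_hom[OF premor_rho(1)[OF preH[OF f] a evF_args[OF preA[OF d] ts od]]])
  show ?thesis
   unfolding phiO(3)[OF a zs f] o[OF d] E functor_comp[OF F r e] comp_assoc[OF C R functor_hom[OF F r] functor_hom[OF F e]]
   by (simp add: out_eq[OF a(1)] o_def)
 qed
 moreover have "prO j (phiO m q x ?zs) = FO (evF (A j) (Op m q x ts)) (map (prO j) ys)" if "j : Ob J" for j
  unfolding phiO(2)[OF a zs that] o[OF that] by (simp add: o_def)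
 ultimately show ?case unfolding ev by blast
next
 case (wt_Tr t i h i')
 note ys' = ys[unfolded E_Wa]
 have y: "FO (evF Wa t) ys : WO i" using functor_ob[OF evF_functor[OF prealg_Wa wt_Tr(1)] ys] by simp
 have "prE f (trO h (FO (evF Wa t) ys)) = FA (tr (A (cJ f)) h) (FA (evF (A (cJ f)) t) (map (prE f) ys)) *[Fb (A (cJ f)) i']
   FA (tr (A (cJ f)) h) (rhoT (A (dJ f)) (A (cJ f)) (H f) (map (prO (dJ f)) ys) t)" if f: "f : Ar J" for f
 proof -
  note c = J_ob(2)[OF f] and d = J_ob(1)[OF f]
  show ?thesis
   using wt_Tr(3) f functor_comp[OF trA[OF c wt_Tr(2)] isoh_hom[OF rhoT_isoh[OF preA[OF d] preA[OF c] preH[OF f] wt_Tr(1) envO[OF Z ys' d]]]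
    functor_hom[OF evF_functor[OF preA[OF c] wt_Tr(1)] isoh_hom[OF envE[OF Z ys' f]]]] trO(3)[OF wt_Tr(2) y f] by simp
 qed
 then show ?case using wt_Tr(3) trO(2)[OF wt_Tr(2) y] by simp
qed

lemma kindsH: "f : Ar J ==> mor_kinds (A (dJ f)) (A (cJ f)) (H f)"
 using mor_H alg_mor_iff[OF preA kindsA preA] J_ob by blast

text \<open>By \<open>evW\<close> the square of a morphism of cones splits into two: compatibility
  of \<open>H f\<close> with \<open>e\<close>, and naturality of \<open>e\<close> in
  \<open>A (cJ f)\<close> at the structure arrows of the arguments.\<close>

lemma Wa_kind_arr:
 assumes k: "kind Z i s t e" and ys: "ys : Ob (E Wa Z)"
 shows "arr i (FO (evF Wa s) ys) (FO (evF Wa t) ys) (%j. e (A j) (map (prO j) ys))"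
  and "j : Ob J ==> isoh (Fb (A j) i) (e (A j) (map (prO j) ys)) (prO j (FO (evF Wa s) ys)) (prO j (FO (evF Wa t) ys))"
proof -
 have Z: "set Z <= Ob Q" and s: "wt Z s i" and t: "wt Z t i" using kind_wt[OF k] by auto
 note i = wt_ob[OF s] and ys' = ys[unfolded E_Wa]
 note S = evW[OF s Z ys, THEN c1, rule_format] evW[OF s Z ys, THEN c2, rule_format]
  and T = evW[OF t Z ys, THEN c1, rule_format] evW[OF t Z ys, THEN c2, rule_format]
 show I: "isoh (Fb (A j) i) (e (A j) (map (prO j) ys)) (prO j (FO (evF Wa s) ys)) (prO j (FO (evF Wa t) ys))" if j: "j : Ob J" for j
  unfolding S(1)[OF j] T(1)[OF j] by (rule kinds_isoD(1)[OF kindsA[OF j] k envO[OF Z ys' j]])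
 show "arr i (FO (evF Wa s) ys) (FO (evF Wa t) ys) (%j. e (A j) (map (prO j) ys))"
  unfolding arr_def
 proof (intro conjI ballI)
  show "FO (evF Wa s) ys : WO i" "FO (evF Wa t) ys : WO i"
   using functor_ob[OF evF_functor[OF prealg_Wa s] ys] functor_ob[OF evF_functor[OF prealg_Wa t] ys] by simp_all
  show "e (A j) (map (prO j) ys) : hom (Fb (A j) i) (prO j (FO (evF Wa s) ys)) (prO j (FO (evF Wa t) ys))" if "j : Ob J" for j
   by (rule isoh_hom[OF I[OF that]])
  fix f assume f: "f : Ar J"
  note c = J_ob(2)[OF f] and d = J_ob(1)[OF f]
  note od = envO[OF Z ys' d] and oc = envO[OF Z ys' c] and ef = isoh_hom[OF envE[OF Z ys' f]]
  note rs = isoh_hom[OF rhoT_isoh[OF preA[OF d] preA[OF c] preH[OF f] s od]] and rt = isoh_hom[OF rhoT_isoh[OF preA[OF d] preA[OF c] preH[OF f] t od]]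
  have 1: "e (A (cJ f)) (HO (H f) Z (map (prO (dJ f)) ys)) *[Fb (A (cJ f)) i] rhoT (A (dJ f)) (A (cJ f)) (H f) (map (prO (dJ f)) ys) s
   = rhoT (A (dJ f)) (A (cJ f)) (H f) (map (prO (dJ f)) ys) t *[Fb (A (cJ f)) i] FA (HH (H f) i) (e (A (dJ f)) (map (prO (dJ f)) ys))"
   using kindsH[OF f] k od unfolding mor_kinds_def mor_kind_def by blast
  show "prE f (FO (evF Wa t) ys) *[Fb (A (cJ f)) i] FA (HH (H f) i) (e (A (dJ f)) (map (prO (dJ f)) ys))
   = e (A (cJ f)) (map (prO (cJ f)) ys) *[Fb (A (cJ f)) i] prE f (FO (evF Wa s) ys)"
   unfolding S(2)[OF f] T(2)[OF f]
   by (rule comp_square[OF catA[OF c i] rs functor_hom[OF evF_functor[OF preA[OF c] s] ef] rt functor_hom[OF evF_functor[OF preA[OF c] t] ef]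
     functor_hom[OF premor_HH[OF preH[OF f] i] isoh_hom[OF kinds_isoD(1)[OF kindsA[OF d] k od]]]
     isoh_hom[OF kinds_isoD(1)[OF kindsA[OF c] k HO_ob[OF preH[OF f] Z od]]] isoh_hom[OF kinds_isoD(1)[OF kindsA[OF c] k oc]]
     1 kinds_isoD(2)[OF kindsA[OF c] k ef], symmetric])
 qed
qed

lemma pseudo_algebra_Wa: "palgebra Wa"
proof -
 interpret W: strict_family \<Theta> U I Wa "Ob J" A prO prA
 proof
  show "prealg Wa" by (rule prealg_Wa)
 next
  fix j assume "j : Ob J" then show "palgebra (A j)" by (rule alg_A)
 next
  fix j i assume "j : Ob J" "i : Ob Q"
  then show "is_functor (Fb Wa i) (Fb (A j) i) \<lparr>FO = prO j, FA = prA j\<rparr>" using pr_functor by simp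
 next
  fix j h i i' a assume "j : Ob J" "h : hom Q i i'" "a : Ob (Fb Wa i)"
  then show "prO j (FO (tr Wa h) a) = FO (tr (A j) h) (prO j a)" using trO(2)[of h i i' a j] by simp
 next
  fix j h i i' f a b assume "j : Ob J" "h : hom Q i i'" "f : hom (Fb Wa i) a b"
  then show "prA j (FA (tr Wa h) f) = FA (tr (A j) h) (prA j f)" using trW(2)[of h i i' f a b j] by simp
 next
  fix j q m w ws x ys assume "j : Ob J" "q : TH m w ws" "x : Ob (P m)" "ys : Ob (E Wa (fibs ws x))"
  then show "prO j (FO (phi Wa m q x) ys) = FO (phi (A j) m q x) (map (prO j) ys)" unfolding E_Wa using phiO(2) by simp
 next
  fix j q m w ws x fs as bs assume "j : Ob J" "q : TH m w ws" "x : Ob (P m)" "fs : hom (E Wa (fibs ws x)) as bs"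
  then show "prA j (FA (phi Wa m q x) fs) = FA (phi (A j) m q x) (map (prA j) fs)" unfolding E_Wa Wa_simps catfun.simps by (intro phiW(2))
 next
  fix Z i s t ys and e :: "('io, 'ia, 't, 'h, 'u) alg => 'u list => 'u"
  assume k: "kind Z i s t e" and ys: "ys : Ob (E Wa Z)"
  have i: "i : Ob Q" using kind_wt[OF k] wt_ob by blast
  show "isoh (Fb Wa i) (e Wa ys) (FO (evF Wa s) ys) (FO (evF Wa t) ys)"
   unfolding Wa_kind[OF k] Wa_simps catfun.simps by (rule isoh_WF[OF i Wa_kind_arr[OF k ys]])
  fix j assume j: "j : Ob J"
  show "prA j (e Wa ys) = e (A j) (map (prO j) ys)"
   unfolding Wa_kind[OF k] by (rule pr_mkA(3)[OF i Wa_kind_arr(1)[OF k ys] j])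
 next
  fix i f a b g assume "i : Ob Q" "f : hom (Fb Wa i) a b" "g : hom (Fb Wa i) a b" "!!j. j : Ob J ==> prA j f = prA j g"
  then show "f = g" unfolding Wa_simps catfun.simps by (rule WF_eqI)
 next
  fix i f a b g a' assume "i : Ob Q" "isoh (Fb Wa i) f a b" "isoh (Fb Wa i) g a' b" "!!j. j : Ob J ==> prA j f = prA j g"
  then show "f = g" unfolding Wa_simps catfun.simps by (rule joint_iso_WF)
 qed
 show ?thesis by (rule W.pseudo_algebra_W)
qed

end

section \<open>The pseudo limit\<close>

context T_algebra
begin

lemma alg_mor_ext: "palgebra A ==> palgebra B ==> amor A B H ==> mor_ext A H"
proof -
 assume "palgebra A" "palgebra B" "amor A B H"
 then show "mor_ext A H" by (simp add: alg_mor_iff[OF alg_prealg alg_kinds alg_prealg])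
qed

text \<open>The laws of composition hold as equalities. They make the sources and targets of the
  composite 2-cells match in the axioms of a pseudo natural transformation.\<close>

lemma comp_mor_id_right:
 assumes B: "prealg B" and D: "prealg D" and K: "premor B D K" "mor_ext B K"
 shows "cmor B B D K (idm B) = K"
proof (rule mor_eqI[OF comp_mor_ext K(2)])
 fix m w ws q x ys assume a: "q : TH m w ws" "x : Ob (P m)" and ys: "ys : Ob (E B (fibs ws x))"
 note i = Theta_fib[OF a] and p = functor_ob[OF functor_phi[OF B a] ys]
 show "rho (cmor B B D K (idm B)) m q x ys = rho K m q x ys"
  unfolding comp_mor_rho[OF a ys] id_mor_HO[OF fibs_ob[OF a] ys] id_mor_rho[OF a ys] functor_ident[OF premor_HH[OF K(1) i] p]
  by (rule comp_ident_right[OF category_Fb[OF D i] isoh_hom[OF premor_rho(1)[OF K(1) a ys]]])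
qed (simp_all add: comp_mor_FO comp_mor_FA id_mor_FO id_mor_FA)

lemma comp_mor_id_left:
 assumes B: "prealg B" and D: "prealg D" and K: "premor B D K" "mor_ext B K"
 shows "cmor B D D (idm D) K = K"
proof (rule mor_eqI[OF comp_mor_ext K(2)])
 fix i assume i: "i : Ob Q"
 show "FO (HH (cmor B D D (idm D) K) i) a = FO (HH K i) a" if "a : Ob (Fb B i)" for a
  using functor_ob[OF premor_HH[OF K(1) i] that] i that by (simp add: comp_mor_FO id_mor_FO)
 show "FA (HH (cmor B D D (idm D) K) i) f = FA (HH K i) f" if "f : Ar (Fb B i)" for f
  using homD[OF functor_hom[OF premor_HH[OF K(1) i] homI[OF that]]] i that by (simp add: comp_mor_FA id_mor_FA)
next
 fix m w ws q x ys assume a: "q : TH m w ws" "x : Ob (P m)" and ys: "ys : Ob (E B (fibs ws x))"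
 note i = Theta_fib[OF a] and r = isoh_hom[OF premor_rho(1)[OF K(1) a ys]]
 show "rho (cmor B D D (idm D) K) m q x ys = rho K m q x ys"
  unfolding comp_mor_rho[OF a ys] id_mor_FA[OF i homD[OF r, THEN c1]] id_mor_rho[OF a HO_ob[OF K(1) fibs_ob[OF a] ys]]
  by (rule comp_ident_left[OF category_Fb[OF D i] r])
qed

lemma comp_mor_assoc:
 assumes A: "prealg A" and B: "prealg B" and D: "prealg D" and G: "prealg G"
  and H: "premor A B H" and K: "premor B D K" and L: "premor D G L"
 shows "cmor A B G (cmor B D G L K) H = cmor A D G L (cmor A B D K H)"
proof (rule mor_eqI[OF comp_mor_ext comp_mor_ext])
 fix i assume i: "i : Ob Q"
 show "FO (HH (cmor A B G (cmor B D G L K) H) i) a = FO (HH (cmor A D G L (cmor A B D K H)) i) a"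
  if "a : Ob (Fb A i)" for a
  using functor_ob[OF premor_HH[OF H i] that] i that by (simp add: comp_mor_FO)
 show "FA (HH (cmor A B G (cmor B D G L K) H) i) f = FA (HH (cmor A D G L (cmor A B D K H)) i) f"
  if "f : Ar (Fb A i)" for f
  using homD[OF functor_hom[OF premor_HH[OF H i] homI[OF that]]] i that by (simp add: comp_mor_FA)
next
 fix m w ws q x ys assume a: "q : TH m w ws" "x : Ob (P m)" and ys: "ys : Ob (E A (fibs ws x))"
 note i = Theta_fib[OF a] and Z = fibs_ob[OF a]
 note Hy = HO_ob[OF H Z ys] and rH = isoh_hom[OF premor_rho(1)[OF H a ys]]
 note KHy = HO_ob[OF K Z Hy] and rK = isoh_hom[OF premor_rho(1)[OF K a Hy]]
 note KrH = functor_hom[OF premor_HH[OF K i] rH]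
 show "rho (cmor A B G (cmor B D G L K) H) m q x ys = rho (cmor A D G L (cmor A B D K H)) m q x ys"
  unfolding comp_mor_rho[OF a ys] comp_mor_rho[OF a Hy] comp_mor_HO[OF Z ys] comp_mor_FA[OF i homD[OF rH, THEN c1]]
   functor_comp[OF premor_HH[OF L i] KrH rK]
  by (rule comp_assoc[OF category_Fb[OF G i] functor_hom[OF premor_HH[OF L i] KrH] functor_hom[OF premor_HH[OF L i] rK]
    isoh_hom[OF premor_rho(1)[OF L a KHy]]])
qed

lemma whisk_r_KK:
 assumes D: "prealg D" and H: "premor A B H" and K: "premor B D K" and \<tau>: "pcell B D K K' \<tau>"
 shows "whisk_r KK A B D (K, K', \<tau>) H
  = (cmor A B D K H, cmor A B D K' H, \<lambda>i\<in>Ob Q. \<lambda>y\<in>Ob (Fb A i). \<tau> i (FO (HH H i) y))"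
proof -
 have "\<tau> i (FO (HH H i) y) *[Fb D i] FA (HH K i) (Ident (Fb B i) (FO (HH H i) y)) = \<tau> i (FO (HH H i) y)"
  if i: "i : Ob Q" and y: "y : Ob (Fb A i)" for i y
  using functor_ident[OF premor_HH[OF K i] functor_ob[OF premor_HH[OF H i] y]]
   comp_ident_right[OF category_Fb[OF D i] pcellD(1)[OF \<tau> i functor_ob[OF premor_HH[OF H i] y]]] by simp
 then show ?thesis by (auto simp: whisk_r_def KK_simps intro!: restrict_ext)
qed

lemma whisk_l_KK:
 assumes D: "prealg D" and K: "premor B D K" and H: "premor A B H'" and \<sigma>: "pcell A B H H' \<sigma>"
 shows "whisk_l KK A B D K (H, H', \<sigma>)
  = (cmor A B D K H, cmor A B D K H', \<lambda>i\<in>Ob Q. \<lambda>y\<in>Ob (Fb A i). FA (HH K i) (\<sigma> i y))"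
proof -
 have "Ident (Fb D i) (FO (HH K i) (FO (HH H' i) y)) *[Fb D i] FA (HH K i) (\<sigma> i y) = FA (HH K i) (\<sigma> i y)"
  if i: "i : Ob Q" and y: "y : Ob (Fb A i)" for i y
  by (rule comp_ident_left[OF category_Fb[OF D i] functor_hom[OF premor_HH[OF K i] pcellD(1)[OF \<sigma> i y]]])
 then show ?thesis using functor_ob[OF premor_HH[OF H]] by (auto simp: whisk_l_def KK_simps intro!: restrict_ext)
qed

lemma triple_eq_iff:
 "(G, L, \<lambda>i\<in>Ob Q. \<lambda>y\<in>Ob (Fb A i). s i y) = (G', L', \<lambda>i\<in>Ob Q. \<lambda>y\<in>Ob (Fb A i). t i y) \<longleftrightarrow>
  G = G' & L = L' & (ALL i:Ob Q. ALL y:Ob (Fb A i). s i y = t i y)"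
proof -
 have "s i y = t i y" if "(\<lambda>i\<in>Ob Q. \<lambda>y\<in>Ob (Fb A i). s i y) = (\<lambda>i\<in>Ob Q. \<lambda>y\<in>Ob (Fb A i). t i y)" "i : Ob Q" "y : Ob (Fb A i)" for i y
  using fun_cong[OF fun_cong[OF that(1), of i], of y] that(2,3) by simp
 then show ?thesis by (auto intro!: restrict_ext)
qed

text \<open>For the projections of the limit. In the induction the arguments contribute an identity,
  whose ends are equal; hence \<open>H\<close> commutes with the evaluation of the arguments, and
  two identities at the same object are composed.\<close>

lemma rhoT_strict:
 assumes A: "prealg A" and D: "prealg D" and H: "premor A D H" and "wt Z t i" and Z: "set Z <= Ob Q" and ys: "ys : Ob (E A Z)"
  and r: "!!m w ws q x ys. q : TH m w ws ==> x : Ob (P m) ==> ys : Ob (E A (fibs ws x)) ==>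
   rho H m q x ys = Ident (Fb D (fib w x)) (FO (phi D m q x) (HO H (fibs ws x) ys))"
 shows "rhoT A D H ys t = Ident (Fb D i) (FO (evF D t) (HO H Z ys))"
 using assms(4)
proof (induction rule: wt.induct)
 case (wt_V n)
 then show ?case using ys unfolding E_ob by simp
next
 case (wt_Op q m w ws x ts)
 let ?ev = "map (%t. FO (evF A t) ys) ts" and ?evD = "map (%t. FO (evF D t) (HO H Z ys)) ts"
 have ts: "list_all2 (wt Z) ts (fibs ws x)" and l: "length ts = length ws" using wt_Op(3) by (auto simp: list_all2_conv_all_nth)
 note a = wt_Op(1,2)
 note ev = evF_args[OF A ts ys] and i = Theta_fib[OF a] and evD = evF_args[OF D ts HO_ob[OF H Z ys]]
 have R: "map (rhoT A D H ys) ts = Ident (E D (fibs ws x)) ?evD"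
  using wt_Op(3) l by (auto simp: list_all2_conv_all_nth intro!: nth_equalityI)
 have "map (rhoT A D H ys) ts : hom (E D (fibs ws x)) ?evD ?evD"
  unfolding R by (rule ident_hom[OF category_E[OF D fibs_ob[OF a]] evD])
 then have "HO H (fibs ws x) ?ev = ?evD"
  using rhoT_args_hom[OF A D H ts ys] homD by metis
 then have "rhoT A D H ys (Op m q x ts) = Ident (Fb D (fib w x)) (FO (phi D m q x) ?evD) *[Fb D (fib w x)] Ident (Fb D (fib w x)) (FO (phi D m q x) ?evD)"
  unfolding rhoT.simps R r[OF a ev] out_eq[OF a(1)] functor_ident[OF functor_phi[OF D a] evD] by simp
 then show ?case
  using comp_ident_left[OF category_Fb[OF D i] ident_hom[OF category_Fb[OF D i] functor_ob[OF functor_phi[OF D a] evD]]] by (simp add: o_def)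
next
 case (wt_Tr t i h i')
 show ?case
  using functor_ident[OF functor_tr[OF D wt_Tr(2)] functor_ob[OF evF_functor[OF D wt_Tr(1)] HO_ob[OF H Z ys]]] wt_Tr(3) by simp
qed

end

section \<open>The projections and the universal cone\<close>

context diagram
begin

definition pi :: "'jo => ('io, 'h, 'u) mor" where
 "pi j = \<lparr>HH = (\<lambda>i\<in>Ob Q. restrict_func (WF i) \<lparr>FO = prO j, FA = prA j\<rparr>),
  rho = (%m q x ys. if rho_index \<Theta> I Wa m q x ys
   then Ident (Fb (A j) (fib (out \<Theta> m q) x)) (FO (phi (A j) m q x) (map (prO j) ys)) else undefined)\<rparr>"

lemma pi_FO: "i : Ob Q ==> y : WO i ==> FO (HH (pi j) i) y = prO j y"
 and pi_FA: "i : Ob Q ==> f : hom (WF i) y z ==> FA (HH (pi j) i) f = prA j f"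
 by (auto simp: pi_def restrict_func_def hom_def)

lemma pi_rho: "q : TH m w ws ==> x : Ob (P m) ==> ys : Ob (EW (fibs ws x)) ==>
  rho (pi j) m q x ys = Ident (Fb (A j) (fib w x)) (FO (phi (A j) m q x) (map (prO j) ys))"
 by (simp add: pi_def rho_index_iff out_eq E_Wa del: prod_cat_simps)

lemma pi_ext: "mor_ext Wa (pi j)"
 by (auto simp: mor_ext_def pi_def restrict_func_def func_ext_def)

lemma pi_HO: "set Z <= Ob Q ==> ys : Ob (EW Z) ==> HO (pi j) Z ys = map (prO j) ys"
 unfolding EW_ob by (intro nth_equalityI) (auto simp: pi_FO subset_iff)

lemma premor_pi:
 assumes j: "j : Ob J"
 shows "premor Wa (A j) (pi j)"
proof (rule premorI, unfold Wa_simps catfun.simps, goal_cases)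
 case (1 i)
 note i = 1
 show ?case
  by (rule is_functor_cong[OF category_WF[OF i] _ pr_functor[OF j i]]) (auto simp: func_eq_def pi_def restrict_func_def i)
next
 case (2 h i i' a)
 note h = 2(1)
 from 2 have a: "a : WO i" by simp
 have i: "i : Ob Q" "i' : Ob Q" using hom_ob[OF category_P h] by auto
 show ?case
  by (simp add: pi_FO[OF i(1) a] pi_FO[OF i(2) trO(1)[OF h a]] trO(2)[OF h a j])
next
 case (3 h i i' f a b)
 note h = 3(1) and f = 3(2)
 have i: "i : Ob Q" "i' : Ob Q" using hom_ob[OF category_P h] by auto
 show ?case
  by (simp only: pi_FA[OF i(1) f] pi_FA[OF i(2) trW(1)[OF h f]] trW(2)[OF h f j])
next
 case (4 m w ws q x ys)
 note a = 4(1,2) and ys = 4(3)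
 note Z = fibs_ob[OF a] and i = Theta_fib[OF a]
 show ?case
  unfolding pi_rho[OF a ys] pi_HO[OF Z ys] phiW_FO pi_FO[OF i phiO(1)[OF a ys]] phiO(2)[OF a ys j]
  by (rule isoh_ident[OF catA[OF j i] functor_ob[OF functor_phi[OF preA[OF j] a] envO[OF Z ys j]]])
next
 case (5 m w ws q x fs as bs)
 note a = 5(1,2) and fs = 5(3)
 note Z = fibs_ob[OF a] and i = Theta_fib[OF a]
 have ab: "as : Ob (EW (fibs ws x))" "bs : Ob (EW (fibs ws x))" using EW_hom_ob[OF Z fs] by auto
 have e: "map2 (%i. FA (HH (pi j) i)) (fibs ws x) fs = map (prA j) fs"
  using fs pi_FA Z unfolding EW_hom by (intro nth_equalityI) (auto simp: subset_iff)
 note p = functor_hom[OF functor_phi[OF preA[OF j] a] envA[OF Z fs j]]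
 show ?case
  unfolding e pi_rho[OF a ab(1)] pi_rho[OF a ab(2)] pi_FA[OF i phiW(1)[OF a fs]] phiW(2)[OF a fs j]
   comp_ident_left[OF catA[OF j i] p] comp_ident_right[OF catA[OF j i] p] ..
next
 case (6 m w ws q h x y ys)
 note q = 6(1) and h = 6(2) and ys = 6(3)
 have x: "x : Ob (P m)" "y : Ob (P m)" using hom_ob[OF category_P h] by auto
 have hw: "fibA w h : hom Q (fib w x) (fib w y)" using fibA_hom[OF _ h] ThetaHomD[OF q] by blast
 note Z = fibs_ob[OF q x(1)]
 have "rho (pi j) m q y (map2 (%w. trO (fibA w h)) ws ys) = FA (tr (A j) (fibA w h)) (rho (pi j) m q x ys)"
  unfolding pi_rho[OF q x(1) ys] pi_rho[OF q x(2) trs_WO(1)[OF q h ys]] trs_WO(2)[OF q h ys j] phi_nat(1)[OF preA[OF j] q h envO[OF Z ys j]]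
  by (rule functor_ident[OF trA[OF j hw] functor_ob[OF functor_phi[OF preA[OF j] q x(1)] envO[OF Z ys j]], symmetric])
 then show ?case
  by simp
qed

lemma rhoT_pi:
 assumes j: "j : Ob J" and t: "wt Z t i" and Z: "set Z <= Ob Q" and ys: "ys : Ob (EW Z)"
 shows "rhoT Wa (A j) (pi j) ys t = Ident (Fb (A j) i) (FO (evF (A j) t) (map (prO j) ys))"
proof -
 have ys': "ys : Ob (E Wa Z)" using ys unfolding E_Wa .
 show ?thesis
  unfolding pi_HO[OF Z ys, symmetric]
 proof (rule rhoT_strict[OF prealg_Wa preA[OF j] premor_pi[OF j] t Z ys'])
  fix m w ws q x ys assume a: "q : TH m w ws" "x : Ob (P m)" and "ys : Ob (E Wa (fibs ws x))"
  then have ys: "ys : Ob (EW (fibs ws x))" unfolding E_Wa by blast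
  show "rho (pi j) m q x ys = Ident (Fb (A j) (fib w x)) (FO (phi (A j) m q x) (HO (pi j) (fibs ws x) ys))"
   unfolding pi_HO[OF fibs_ob[OF a] ys] by (rule pi_rho[OF a ys])
 qed
qed

lemma Wa_kind_hom:
 assumes k: "kind Z i s t e" and ys: "ys : Ob (EW Z)"
 shows "e Wa ys : hom (WF i) (FO (evF Wa s) ys) (FO (evF Wa t) ys)" "j : Ob J ==> prA j (e Wa ys) = e (A j) (map (prO j) ys)"
proof -
 have i: "i : Ob Q" using kind_wt[OF k] wt_ob by blast
 note a = Wa_kind_arr(1)[OF k ys[folded E_Wa]]
 show "e Wa ys : hom (WF i) (FO (evF Wa s) ys) (FO (evF Wa t) ys)" "j : Ob J ==> prA j (e Wa ys) = e (A j) (map (prO j) ys)"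
  unfolding Wa_kind[OF k] using mkA_hom[OF i a] pr_mkA(3)[OF i a] by auto
qed

text \<open>Both occurrences of \<open>rhoT\<close> are identities, and the component at
  \<open>j\<close> of a coherence isomorphism of the limit is by construction that of
  \<open>A j\<close>.\<close>

lemma alg_mor_pi:
 assumes j: "j : Ob J"
 shows "amor Wa (A j) (pi j)"
 unfolding alg_mor_iff[OF prealg_Wa alg_kinds[OF pseudo_algebra_Wa] preA[OF j]] mor_kinds_def mor_kind_def
proof (intro conjI allI impI premor_pi[OF j] pi_ext)
 fix Z i s t ys and e :: "('io, 'ia, 't, 'h, 'u) alg => 'u list => 'u"
 assume k: "kind Z i s t e" and "ys : Ob (E Wa Z)"
 then have ys: "ys : Ob (EW Z)" unfolding E_Wa by blast
 have Z: "set Z <= Ob Q" and s: "wt Z s i" and t: "wt Z t i" using kind_wt[OF k] by auto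
 note i = wt_ob[OF s] and eh = isoh_hom[OF kinds_isoD(1)[OF kindsA[OF j] k envO[OF Z ys j]]]
 show "e (A j) (HO (pi j) Z ys) *[Fb (A j) i] rhoT Wa (A j) (pi j) ys s = rhoT Wa (A j) (pi j) ys t *[Fb (A j) i] FA (HH (pi j) i) (e Wa ys)"
  unfolding rhoT_pi[OF j s Z ys] rhoT_pi[OF j t Z ys] pi_HO[OF Z ys] pi_FA[OF i Wa_kind_hom(1)[OF k ys]] Wa_kind_hom(2)[OF k ys j]
   comp_ident_left[OF catA[OF j i] eh] comp_ident_right[OF catA[OF j i] eh] ..
qed

text \<open>The structure arrows at \<open>f\<close> form a 2-cell: naturality is the square of a
  morphism of cones, compatibility with the operations is the formula for the structure arrows of
  \<open>phiO\<close>.\<close>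

lemma pcell_prE:
 assumes f: "f : Ar J"
 shows "pcell Wa (A (cJ f)) (cmor Wa (A (dJ f)) (A (cJ f)) (H f) (pi (dJ f))) (pi (cJ f)) (%i. prE f)"
proof -
 note c = J_ob(2)[OF f] and d = J_ob(1)[OF f]
 let ?c = "cmor Wa (A (dJ f)) (A (cJ f)) (H f) (pi (dJ f))"
 have FO: "FO (HH ?c i) y = FO (HH (H f) i) (prO (dJ f) y)" if "i : Ob Q" "y : WO i" for i y
  using that by (simp add: comp_mor_FO pi_FO)
 show ?thesis
 proof (rule pcellI, goal_cases)
  case (1 i y)
  note i = 1(1)
  from 1 have y: "y : WO i" by simp
  show ?case
   unfolding FO[OF i y] pi_FO[OF i y] by (rule isoh_hom[OF WO_D(2)[OF i y f]])
 next
  case (2 i t y z)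
  note i = 2(1) and t' = 2(2)
  from 2 have t: "t : hom (WF i) y z" by simp
  have t2: "t : Ar (Fb Wa i)" using t' by (simp add: hom_def)
  show ?case
   unfolding comp_mor_FA[OF i t2] pi_FA[OF i t] by (rule arrD(4)[OF WF_hom(1)[OF i t] f])
 next
  case (3 i i' h y)
  note h = 3(1)
  from 3 show ?case using trO(3)[OF h _ f, of y] by simp
 next
  case (4 m w ws q x ys)
  note a = 4(1,2) and ys' = 4(3)
  from 4 have ys: "ys : Ob (EW (fibs ws x))" unfolding E_Wa by blast
  note Z = fibs_ob[OF a] and i = Theta_fib[OF a]
  note C = catA[OF c i] and o = envO[OF Z ys d]
  note r = isoh_hom[OF premor_rho(1)[OF preH[OF f] a o]]
  have e: "map2 (%i. prE f) (fibs ws x) ys = map (prE f) ys" using ys unfolding EW_ob by (intro nth_equalityI) simp_all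
  have p: "prE f (phiO m q x ys) : hom (Fb (A (cJ f)) (fib w x)) (FO (HH (H f) (fib w x)) (prO (dJ f) (phiO m q x ys))) (FO (phi (A (cJ f)) m q x) (map (prO (cJ f)) ys))"
   using isoh_hom[OF WO_D(2)[OF i phiO(1)[OF a ys] f]] unfolding phiO(2)[OF a ys c] .
  have R: "rho ?c m q x ys = rho (H f) m q x (map (prO (dJ f)) ys)"
   unfolding comp_mor_rho[OF a ys'] pi_HO[OF Z ys] pi_rho[OF a ys]
    functor_ident[OF premor_HH[OF preH[OF f] i] functor_ob[OF functor_phi[OF preA[OF d] a] o]]
   by (rule comp_ident_right[OF C r])
  show ?case
   unfolding e R pi_rho[OF a ys] Wa_simps phiW_FO comp_ident_left[OF C p] unfolding phiO(3)[OF a ys f] ..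
 qed
qed

definition cone_pnt :: "('jo, 'ja, ('io, 'h, 'u) mor, ('io, 'h, 'u) mor \<times> ('io, 'h, 'u) mor \<times> ('io list => 'u => 'u)) pnt" where
 "cone_pnt = \<lparr>N1 = restrict pi (Ob J), N2 = (\<lambda>f\<in>Ar J.
  (cmor Wa (A (dJ f)) (A (cJ f)) (H f) (pi (dJ f)), pi (cJ f), \<lambda>i\<in>Ob Q. \<lambda>y\<in>Ob (Fb Wa i). prE f y))\<rparr>"

abbreviation "cel q f == snd (snd (N2 q f))"

text \<open>A pseudo natural transformation from the constant functor at \<open>B\<close>, with
  invertibility and the axioms read at each object of a fibre of \<open>B\<close>.\<close>

definition nat_cone where
 "nat_cone B q \<longleftrightarrow> N1 q : extensional (Ob J) & N2 q : extensional (Ar J) &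
  (ALL j:Ob J. amor B (A j) (N1 q j)) &
  (ALL f:Ar J. N2 q f = (cmor B (A (dJ f)) (A (cJ f)) (H f) (N1 q (dJ f)), N1 q (cJ f), cel q f) &
    pcell B (A (cJ f)) (cmor B (A (dJ f)) (A (cJ f)) (H f) (N1 q (dJ f))) (N1 q (cJ f)) (cel q f) & cell_ext B (cel q f)) &
  (ALL i:Ob Q. ALL y:Ob (Fb B i). cone i (%j. FO (HH (N1 q j) i) y) (%f. cel q f i y))"

lemma nat_coneD:
 assumes "nat_cone B q"
 shows "N1 q : extensional (Ob J)" "N2 q : extensional (Ar J)" "j : Ob J ==> amor B (A j) (N1 q j)"
  "f : Ar J ==> N2 q f = (cmor B (A (dJ f)) (A (cJ f)) (H f) (N1 q (dJ f)), N1 q (cJ f), cel q f)"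
  "f : Ar J ==> pcell B (A (cJ f)) (cmor B (A (dJ f)) (A (cJ f)) (H f) (N1 q (dJ f))) (N1 q (cJ f)) (cel q f)"
  "f : Ar J ==> cell_ext B (cel q f)"
  "i : Ob Q ==> y : Ob (Fb B i) ==> cone i (%j. FO (HH (N1 q j) i) y) (%f. cel q f i y)"
 using assms unfolding nat_cone_def by blast+

lemma nat_cone_pi: "nat_cone Wa cone_pnt"
 unfolding nat_cone_def
proof (intro conjI ballI)
 fix f assume f: "f : Ar J"
 note r = pcell_restrict[OF prealg_Wa pcell_prE[OF f]]
 show "N2 cone_pnt f = (cmor Wa (A (dJ f)) (A (cJ f)) (H f) (N1 cone_pnt (dJ f)), N1 cone_pnt (cJ f), cel cone_pnt f)"
  "pcell Wa (A (cJ f)) (cmor Wa (A (dJ f)) (A (cJ f)) (H f) (N1 cone_pnt (dJ f))) (N1 cone_pnt (cJ f)) (cel cone_pnt f)" "cell_ext Wa (cel cone_pnt f)"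
  using f J_ob[OF f] r by (simp_all add: cone_pnt_def)
next
 fix i y assume i: "i : Ob Q" and y: "y : Ob (Fb Wa i)"
 then show "cone i (%j. FO (HH (N1 cone_pnt j) i) y) (%f. cel cone_pnt f i y)"
  using WO_cone(1)[OF i, of y] cone_cong[of "%j. FO (HH (N1 cone_pnt j) i) y" "%j. prO j y" "%f. cel cone_pnt f i y" "%f. prE f y"]
  by (simp add: cone_pnt_def pi_FO)
qed (simp_all add: cone_pnt_def alg_mor_pi)

section \<open>Pseudo natural transformations and modifications read in the fibres\<close>

context
 fixes F :: "('jo, 'ja, ('io, 'ia, 't, 'h, 'u) alg, ('io, 'h, 'u) mor, ('io, 'h, 'u) mor \<times> ('io, 'h, 'u) mor \<times> ('io list => 'u => 'u)) pseudo"
 assumes F: "P0 F = A" "P1 F = H" "!!j. j : Ob J ==> Pu F j = (idm (A j), H (Ident J j), pu j)"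
  "!!f g. f : Ar J ==> g : Ar J ==> cJ f = dJ g ==>
   Pc F g f = (cmor (A (dJ f)) (A (cJ f)) (A (cJ g)) (H g) (H f), H (g *[J] f), pc g f)"
begin

context
 fixes B :: "('io, 'ia, 't, 'h, 'u) alg"
 assumes B: "palgebra B"
begin

lemmas pB = alg_prealg[OF B]

lemma N1_mor:
 assumes "amor B (A j) K" "j : Ob J"
 shows "premor B (A j) K" "mor_ext B K" "cmor B B (A j) K (idm B) = K" "cmor B (A j) (A j) (idm (A j)) K = K"
proof -
 show p: "premor B (A j) K" and e: "mor_ext B K"
  using alg_mor_premor[OF B alg_A[OF assms(2)] assms(1)] alg_mor_ext[OF B alg_A[OF assms(2)] assms(1)] .
 show "cmor B B (A j) K (idm B) = K" "cmor B (A j) (A j) (idm (A j)) K = K"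
  using comp_mor_id_right[OF pB preA[OF assms(2)] p e] comp_mor_id_left[OF pB preA[OF assms(2)] p e] .
qed

lemma whisk_id:
 assumes "amor B (A j) K" "j : Ob J"
 shows "whisk_l KK B B (A j) K (Ident (Mor2 KK B B) (idm B))
  = (K, K, \<lambda>i\<in>Ob Q. \<lambda>y\<in>Ob (Fb B i). Ident (Fb (A j) i) (FO (HH K i) y))"
proof -
 note K = N1_mor[OF assms] and c = pcell_restrict(1)[OF pB pcell_ident[OF pB pB premor_id[OF pB]]]
 show ?thesis
  unfolding KK_simps(8) whisk_l_KK[OF preA[OF assms(2)] K(1) premor_id[OF pB] c] K(3)
  using functor_ident[OF premor_HH[OF K(1)]] by (auto simp: id_mor_FO intro!: restrict_ext)
qed

context
 fixes q :: "('jo, 'ja, ('io, 'h, 'u) mor, ('io, 'h, 'u) mor \<times> ('io, 'h, 'u) mor \<times> ('io list => 'u => 'u)) pnt" and \<sigma> :: "'ja => 'io list => 'u => 'u"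
 assumes n1: "!!j. j : Ob J ==> amor B (A j) (N1 q j)"
  and n2: "!!f. f : Ar J ==> N2 q f = (cmor B (A (dJ f)) (A (cJ f)) (H f) (N1 q (dJ f)), N1 q (cJ f), \<sigma> f)"
  and n3: "!!f. f : Ar J ==> pcell B (A (cJ f)) (cmor B (A (dJ f)) (A (cJ f)) (H f) (N1 q (dJ f))) (N1 q (cJ f)) (\<sigma> f)"
begin

lemmas N = N1_mor[OF n1]

text \<open>The identity 1-cells disappear by the strict unit laws. Source and target of the two
  sides then agree, so the axiom can be tested at each object.\<close>

lemma pu_eq:
 assumes j: "j : Ob J"
 shows "N2 q (Ident J j) *[Mor2 KK B (A j)] whisk_r KK B (A j) (A j) (Pu F j) (N1 q j)
   = whisk_l KK B B (A j) (N1 q j) (Ident (Mor2 KK B B) (idm B)) \<longleftrightarrow>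
  (ALL i:Ob Q. ALL y:Ob (Fb B i). \<sigma> (Ident J j) i y *[Fb (A j) i] pu j i (FO (HH (N1 q j) i) y) = Ident (Fb (A j) i) (FO (HH (N1 q j) i) y))"
proof -
 have "(\<lambda>i\<in>Ob Q. \<lambda>y\<in>Ob (Fb B i). \<sigma> (Ident J j) i y *[Fb (A j) i] (\<lambda>i\<in>Ob Q. \<lambda>y\<in>Ob (Fb B i). pu j i (FO (HH (N1 q j) i) y)) i y)
  = (\<lambda>i\<in>Ob Q. \<lambda>y\<in>Ob (Fb B i). \<sigma> (Ident J j) i y *[Fb (A j) i] pu j i (FO (HH (N1 q j) i) y))"
  by (auto intro!: restrict_ext)
 then show ?thesis
  using J_ident[OF j] N(4)[OF j j]
  unfolding whisk_id[OF n1[OF j] j] F(3)[OF j] whisk_r_KK[OF preA[OF j] N(1)[OF j j] premor_id[OF preA[OF j]] pu[OF j]]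
   n2[OF J_ident[OF j, THEN c1]] KK_simps(9) by (simp only: triple_eq_iff simp_thms)
qed

lemma pc_eq:
 assumes f: "f : Ar J" and g: "g : Ar J" and c: "cJ f = dJ g"
 shows "N2 q (g *[J] f) *[Mor2 KK B (A (cJ g))] whisk_r KK B (A (dJ f)) (A (cJ g)) (Pc F g f) (N1 q (dJ f))
   = whisk_l KK B B (A (cJ g)) (N1 q (cJ g)) (Ident (Mor2 KK B B) (idm B)) *[Mor2 KK B (A (cJ g))]
    whisk_r KK B B (A (cJ g)) (N2 q g) (idm B) *[Mor2 KK B (A (cJ g))]
    whisk_l KK B (A (cJ f)) (A (cJ g)) (H g) (N2 q f) \<longleftrightarrow>
  (ALL i:Ob Q. ALL y:Ob (Fb B i). \<sigma> (g *[J] f) i y *[Fb (A (cJ g)) i] pc g f i (FO (HH (N1 q (dJ f)) i) y)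
   = \<sigma> g i y *[Fb (A (cJ g)) i] FA (HH (H g) i) (\<sigma> f i y))"
proof -
 note d = J_ob(1)[OF f] and m = J_ob(2)[OF f] and e = J_ob(2)[OF g] and gf = J_comp[OF f g c]
 note Hf = preH[OF f] and Hg = preH[OF g, folded c]
 note nd = N(1)[OF d d] and nm = N(1)[OF m m] and ne = N(1)[OF e e]
 let ?s = "%i y. \<sigma> (g *[J] f) i y *[Fb (A (cJ g)) i] pc g f i (FO (HH (N1 q (dJ f)) i) y)"
 let ?t = "%i y. \<sigma> g i y *[Fb (A (cJ g)) i] FA (HH (H g) i) (\<sigma> f i y)"
 let ?l = "cmor B (A (cJ f)) (A (cJ g)) (H g) (cmor B (A (dJ f)) (A (cJ f)) (H f) (N1 q (dJ f)))"
 note w = whisk_r_KK[OF preA[OF e] nd premor_comp[OF preA[OF d] preA[OF m] preA[OF e] Hf Hg] pc[OF f g c]]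
 note v = whisk_l_KK[OF preA[OF e] Hg nm n3[OF f]]
 note p = premor_comp[OF pB preA[OF m] preA[OF e] nm Hg]
 note u = whisk_r_KK[OF preA[OF e] premor_id[OF pB] p n3[OF g, folded c]]
 \<comment> \<open>Strict associativity gives both sides of the composition axiom the same
   source.\<close>
 have as: "cmor B (A (dJ f)) (A (cJ g)) (cmor (A (dJ f)) (A (cJ f)) (A (cJ g)) (H g) (H f)) (N1 q (dJ f)) = ?l"
  by (rule comp_mor_assoc[OF pB preA[OF d] preA[OF m] preA[OF e] nd Hf Hg])
 have L: "N2 q (g *[J] f) *[Mor2 KK B (A (cJ g))] whisk_r KK B (A (dJ f)) (A (cJ g)) (Pc F g f) (N1 q (dJ f))
  = (?l, N1 q (cJ g), \<lambda>i\<in>Ob Q. \<lambda>y\<in>Ob (Fb B i). ?s i y)"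
  using gf unfolding F(4)[OF f g c] w n2[OF gf[THEN c1]] KK_simps(9) as by (auto intro!: restrict_ext)
 \<comment> \<open>The composition 2-cell of the constant functor is an identity and contributes
   this factor.\<close>
 have t: "Ident (Fb (A (cJ g)) i) (FO (HH (N1 q (cJ g)) i) y) *[Fb (A (cJ g)) i] ?t i y = ?t i y" if i: "i : Ob Q" and y: "y : Ob (Fb B i)" for i y
 proof -
  note C = catA[OF e i]
  have 1: "FA (HH (H g) i) (\<sigma> f i y) : hom (Fb (A (cJ g)) i) (FO (HH (H g) i) (FO (HH (cmor B (A (dJ f)) (A (cJ f)) (H f) (N1 q (dJ f))) i) y))
    (FO (HH (H g) i) (FO (HH (N1 q (cJ f)) i) y))"
   by (rule functor_hom[OF premor_HH[OF Hg i] pcellD(1)[OF n3[OF f] i y]])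
  have 2: "\<sigma> g i y : hom (Fb (A (cJ g)) i) (FO (HH (H g) i) (FO (HH (N1 q (cJ f)) i) y)) (FO (HH (N1 q (cJ g)) i) y)"
   using pcellD(1)[OF n3[OF g] i y] by (simp add: comp_mor_FO[OF i y] c)
  show ?thesis by (rule comp_ident_left[OF C comp_hom[OF C 1 2]])
 qed
 have R: "whisk_l KK B B (A (cJ g)) (N1 q (cJ g)) (Ident (Mor2 KK B B) (idm B)) *[Mor2 KK B (A (cJ g))]
    whisk_r KK B B (A (cJ g)) (N2 q g) (idm B) *[Mor2 KK B (A (cJ g))]
    whisk_l KK B (A (cJ f)) (A (cJ g)) (H g) (N2 q f) = (?l, N1 q (cJ g), \<lambda>i\<in>Ob Q. \<lambda>y\<in>Ob (Fb B i). ?t i y)"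
  unfolding whisk_id[OF n1[OF e] e] n2[OF f] n2[OF g, folded c] v u KK_simps(9) using t by (auto simp: id_mor_FO intro!: restrict_ext)
 show ?thesis unfolding L R triple_eq_iff by simp
qed

end

text \<open>Invertibility passes to the fibres by \<open>KK_iso\<close>, the two axioms by
  \<open>pu_eq\<close> and \<open>pc_eq\<close>.\<close>

lemma pseudo_nat_iff: "pseudo_nat J KK (const_pseudo KK B) F q \<longleftrightarrow> nat_cone B q"
proof -
 let ?S = "%f. cmor B (A (dJ f)) (A (cJ f)) (H f) (N1 q (dJ f))"
 have D: "P0 (const_pseudo KK B) j = B" "P1 (const_pseudo KK B) f = idm B"
  "Pc (const_pseudo KK B) f g = Ident (Mor2 KK B B) (idm B)" "Pu (const_pseudo KK B) j = Ident (Mor2 KK B B) (idm B)" for j f g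
  by (simp_all add: const_pseudo_def KK_simps(2))
 note P = pseudo_nat_def[of J KK "const_pseudo KK B" F q, unfolded Let_def D F(1,2) KK_simps(2,3)]
 show ?thesis
 proof
  assume "pseudo_nat J KK (const_pseudo KK B) F q"
  note P' = this[unfolded P]
  have n1: "amor B (A j) (N1 q j)" if "j : Ob J" for j using P' that by (simp add: KK_simps)
  note p3 = P'[THEN c2, THEN c2, THEN c2, THEN c1, rule_format]
   and p4 = P'[THEN c2, THEN c2, THEN c2, THEN c2, THEN c1, rule_format]
   and p5 = P'[THEN c2, THEN c2, THEN c2, THEN c2, THEN c2, rule_format]
  have h: "N2 q f : hom (Mor2 KK B (A (cJ f))) (?S f) (N1 q (cJ f)) & iso_in (Mor2 KK B (A (cJ f))) (N2 q f)" if "f : Ar J" for f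
   using p3[OF that] N1_mor(3)[OF n1[OF J_ob(2)[OF that]] J_ob(2)[OF that]] by simp
  then have n: "N2 q f = (?S f, N1 q (cJ f), cel q f) & pcell B (A (cJ f)) (?S f) (N1 q (cJ f)) (cel q f) & cell_ext B (cel q f)" if "f : Ar J" for f
   using that unfolding KK_hom by fastforce
  note n2 = n[THEN c1] and n3 = n[THEN c2, THEN c1]
  have "isoh (Fb (A (cJ f)) i) (cel q f i y) (FO (HH (H f) i) (FO (HH (N1 q (dJ f)) i) y)) (FO (HH (N1 q (cJ f)) i) y)"
   if f: "f : Ar J" and i: "i : Ob Q" and y: "y : Ob (Fb B i)" for f i y
  proof -
   obtain \<sigma> where s: "N2 q f = (?S f, N1 q (cJ f), \<sigma>)" using n2[OF f] by blast
   from KK_iso[OF B alg_A[OF J_ob(2)[OF f]] h[OF f, unfolded s, THEN c1]] h[OF f, unfolded s, THEN c2] i y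
   have "isoh (Fb (A (cJ f)) i) (\<sigma> i y) (FO (HH (?S f) i) y) (FO (HH (N1 q (cJ f)) i) y)" by blast
   then show ?thesis unfolding comp_mor_FO[OF i y] by (simp add: s)
  qed
  moreover have "FO (HH (N1 q j) i) y : Ob (Fb (A j) i)" if "j : Ob J" "i : Ob Q" "y : Ob (Fb B i)" for j i y
   by (rule functor_ob[OF premor_HH[OF N1_mor(1)[OF n1[OF that(1)] that(1)] that(2)] that(3)])
  moreover have "cel q (Ident J j) i y *[Fb (A j) i] pu j i (FO (HH (N1 q j) i) y) = Ident (Fb (A j) i) (FO (HH (N1 q j) i) y)"
   if "j : Ob J" "i : Ob Q" "y : Ob (Fb B i)" for j i y
   using pu_eq[OF n1 n2 n3 that(1)] p4[OF that(1)] that(2,3) by blast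
  moreover have "cel q (g *[J] f) i y *[Fb (A (cJ g)) i] pc g f i (FO (HH (N1 q (dJ f)) i) y)
   = cel q g i y *[Fb (A (cJ g)) i] FA (HH (H g) i) (cel q f i y)"
   if "f : Ar J" "g : Ar J" "cJ f = dJ g" "i : Ob Q" "y : Ob (Fb B i)" for f g i y
   using pc_eq[OF n1 n2 n3 that(1-3)] p5[OF that(1-3), folded that(3)] that(4,5) by blast
  ultimately have "cone i (%j. FO (HH (N1 q j) i) y) (%f. cel q f i y)" if "i : Ob Q" "y : Ob (Fb B i)" for i y
   using that by (auto simp: cone_def)
  with n n1 P'[THEN c1] P'[THEN c2, THEN c1] show "nat_cone B q" by (simp add: nat_cone_def)
 next
  assume a: "nat_cone B q"
  note D = nat_coneD[OF a]
  have S: "N2 q f : hom (Mor2 KK B (A (cJ f))) (?S f) (N1 q (cJ f))" if f: "f : Ar J" for f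
   unfolding KK_hom using D(3-6) J_ob[OF f] f alg_mor_comp[OF B alg_A alg_A D(3) mor_H] by blast
  show "pseudo_nat J KK (const_pseudo KK B) F q"
   unfolding P
  proof (intro conjI ballI impI)
   show "N1 q : extensional (Ob J)" "N2 q : extensional (Ar J)" using D(1,2) .
   show "N1 q j : Ob (Mor2 KK B (A j))" if "j : Ob J" for j using D(3)[OF that] by (simp add: KK_simps)
  next
   fix f assume f: "f : Ar J"
   note c = J_ob(2)[OF f]
   show "N2 q f : hom (Mor2 KK B (A (cJ f))) (?S f) (cmor B B (A (cJ f)) (N1 q (cJ f)) (idm B))"
    using S[OF f] N1_mor(3)[OF D(3)[OF c] c] by simp
   show "iso_in (Mor2 KK B (A (cJ f))) (N2 q f)"
   proof -
    obtain \<sigma> where s: "N2 q f = (?S f, N1 q (cJ f), \<sigma>)" using D(4)[OF f] by blast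
    show ?thesis
     unfolding s KK_iso[OF B alg_A[OF c] S[OF f, unfolded s]] using D(7) f s unfolding cone_def by (fastforce simp: comp_mor_FO)
   qed
  next
   fix j assume j: "j : Ob J"
   have "cel q (Ident J j) i y *[Fb (A j) i] pu j i (FO (HH (N1 q j) i) y) = Ident (Fb (A j) i) (FO (HH (N1 q j) i) y)"
    if "i : Ob Q" "y : Ob (Fb B i)" for i y
    using D(7)[OF that] j unfolding cone_def by blast
   then show "N2 q (Ident J j) *[Mor2 KK B (A j)] whisk_r KK B (A j) (A j) (Pu F j) (N1 q j)
    = whisk_l KK B B (A j) (N1 q j) (Ident (Mor2 KK B B) (idm B))"
    using pu_eq[OF D(3,4,5) j] by blast
  next
   fix f g assume fg: "f : Ar J" "g : Ar J" "cJ f = dJ g"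
   have "cel q (g *[J] f) i y *[Fb (A (cJ g)) i] pc g f i (FO (HH (N1 q (dJ f)) i) y)
     = cel q g i y *[Fb (A (cJ g)) i] FA (HH (H g) i) (cel q f i y)"
    if "i : Ob Q" "y : Ob (Fb B i)" for i y
    using D(7)[OF that] fg unfolding cone_def by blast
   then show "N2 q (g *[J] f) *[Mor2 KK B (A (cJ g))] whisk_r KK B (A (dJ f)) (A (cJ g)) (Pc F g f) (N1 q (dJ f))
    = whisk_l KK B B (A (cJ g)) (N1 q (cJ g)) (Ident (Mor2 KK B B) (idm B)) *[Mor2 KK B (A (cJ g))]
     whisk_r KK B B (A (cJ g)) (N2 q g) (idm B) *[Mor2 KK B (A (cJ g))] whisk_l KK B (A (cJ f)) (A (cJ g)) (H g) (N2 q f)"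
    using pc_eq[OF D(3,4,5) fg] by blast
  qed
 qed
qed

text \<open>At an object \<open>y\<close> of a fibre the modification axiom is the square of a
  morphism between the cones that \<open>q\<close> and \<open>q'\<close> give at
  \<open>y\<close>.\<close>

lemma modification_iff:
 assumes a: "nat_cone B q" and b: "nat_cone B q'"
 shows "modification J KK (const_pseudo KK B) F q q' \<Lambda> \<longleftrightarrow> \<Lambda> : extensional (Ob J) &
  (ALL j:Ob J. \<Lambda> j = (N1 q j, N1 q' j, snd (snd (\<Lambda> j))) & pcell B (A j) (N1 q j) (N1 q' j) (snd (snd (\<Lambda> j))) & cell_ext B (snd (snd (\<Lambda> j)))) &
  (ALL f:Ar J. ALL i:Ob Q. ALL y:Ob (Fb B i). cel q' f i y *[Fb (A (cJ f)) i] FA (HH (H f) i) (snd (snd (\<Lambda> (dJ f))) i y)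
   = snd (snd (\<Lambda> (cJ f))) i y *[Fb (A (cJ f)) i] cel q f i y)"
proof -
 have C: "P0 (const_pseudo KK B) j = B" "P1 (const_pseudo KK B) f = idm B" for j f
  by (simp_all add: const_pseudo_def KK_simps(2))
 note Da = nat_coneD[OF a] and Db = nat_coneD[OF b]
 have h: "\<Lambda> j : hom (Mor2 KK B (A j)) (N1 q j) (N1 q' j) \<longleftrightarrow>
  \<Lambda> j = (N1 q j, N1 q' j, snd (snd (\<Lambda> j))) & pcell B (A j) (N1 q j) (N1 q' j) (snd (snd (\<Lambda> j))) & cell_ext B (snd (snd (\<Lambda> j)))" if "j : Ob J" for j
  unfolding KK_hom using Da(3)[OF that] Db(3)[OF that] by (metis snd_conv)
 have e: "N2 q' f *[Mor2 KK B (A (cJ f))] whisk_l KK B (A (dJ f)) (A (cJ f)) (H f) (\<Lambda> (dJ f))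
    = whisk_r KK B B (A (cJ f)) (\<Lambda> (cJ f)) (idm B) *[Mor2 KK B (A (cJ f))] N2 q f \<longleftrightarrow>
   (ALL i:Ob Q. ALL y:Ob (Fb B i). cel q' f i y *[Fb (A (cJ f)) i] FA (HH (H f) i) (snd (snd (\<Lambda> (dJ f))) i y)
   = snd (snd (\<Lambda> (cJ f))) i y *[Fb (A (cJ f)) i] cel q f i y)"
  if f: "f : Ar J" and L: "!!j. j : Ob J ==> \<Lambda> j = (N1 q j, N1 q' j, snd (snd (\<Lambda> j))) & pcell B (A j) (N1 q j) (N1 q' j) (snd (snd (\<Lambda> j)))" for f
 proof -
  note c = J_ob(2)[OF f] and d = J_ob(1)[OF f]
  note Ld = L[OF d, THEN c1] and Lc = L[OF c, THEN c1]
  let ?d = "snd (snd (\<Lambda> (dJ f)))" and ?c = "snd (snd (\<Lambda> (cJ f)))"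
  let ?S = "cmor B (A (dJ f)) (A (cJ f)) (H f) (N1 q (dJ f))"
  have 1: "N2 q' f *[Mor2 KK B (A (cJ f))] whisk_l KK B (A (dJ f)) (A (cJ f)) (H f) (\<Lambda> (dJ f))
   = (?S, N1 q' (cJ f), \<lambda>i\<in>Ob Q. \<lambda>y\<in>Ob (Fb B i). cel q' f i y *[Fb (A (cJ f)) i] FA (HH (H f) i) (?d i y))"
   by (subst Ld, subst whisk_l_KK[OF preA[OF c] preH[OF f] N1_mor(1)[OF Db(3)[OF d] d] L[OF d, THEN c2]], subst Db(4)[OF f])
    (auto simp: KK_simps(9) intro!: restrict_ext)
  have 2: "whisk_r KK B B (A (cJ f)) (\<Lambda> (cJ f)) (idm B) *[Mor2 KK B (A (cJ f))] N2 q f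
   = (?S, N1 q' (cJ f), \<lambda>i\<in>Ob Q. \<lambda>y\<in>Ob (Fb B i). ?c i y *[Fb (A (cJ f)) i] cel q f i y)"
   by (subst Lc, subst whisk_r_KK[OF preA[OF c] premor_id[OF pB] N1_mor(1)[OF Da(3)[OF c] c] L[OF c, THEN c2]], subst Da(4)[OF f])
    (auto simp: KK_simps(9) id_mor_FO N1_mor(3)[OF Db(3)[OF c] c] intro!: restrict_ext)
  show ?thesis unfolding 1 2 triple_eq_iff by blast
 qed
 show ?thesis
  unfolding modification_def Let_def C F(1,2)
 proof (intro conj_cong refl)
  show "(ALL j:Ob J. \<Lambda> j : hom (Mor2 KK B (A j)) (N1 q j) (N1 q' j)) \<longleftrightarrow> (ALL j:Ob J. \<Lambda> j = (N1 q j, N1 q' j, snd (snd (\<Lambda> j))) &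
   pcell B (A j) (N1 q j) (N1 q' j) (snd (snd (\<Lambda> j))) & cell_ext B (snd (snd (\<Lambda> j))))" by (rule ball_cong[OF refl h])
  assume "ALL j:Ob J. \<Lambda> j = (N1 q j, N1 q' j, snd (snd (\<Lambda> j))) & pcell B (A j) (N1 q j) (N1 q' j) (snd (snd (\<Lambda> j))) & cell_ext B (snd (snd (\<Lambda> j)))"
  then show "(ALL f:Ar J. N2 q' f *[Mor2 KK B (A (cJ f))] whisk_l KK B (A (dJ f)) (A (cJ f)) (H f) (\<Lambda> (dJ f))
    = whisk_r KK B B (A (cJ f)) (\<Lambda> (cJ f)) (idm B) *[Mor2 KK B (A (cJ f))] N2 q f) \<longleftrightarrow>
   (ALL f:Ar J. ALL i:Ob Q. ALL y:Ob (Fb B i). cel q' f i y *[Fb (A (cJ f)) i] FA (HH (H f) i) (snd (snd (\<Lambda> (dJ f))) i y)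
   = snd (snd (\<Lambda> (cJ f))) i y *[Fb (A (cJ f)) i] cel q f i y)"
   by (intro ball_cong[OF refl e]) blast+
 qed
qed

end

end

end

section \<open>Whiskering of cells with morphisms\<close>

context T_algebra
begin

lemma pcell_whisk_r:
 assumes A: "prealg A" and B: "prealg B" and D: "prealg D" and H: "premor A B H" and K: "premor B D K" "premor B D K'" and \<tau>: "pcell B D K K' \<tau>"
 shows "pcell A D (cmor A B D K H) (cmor A B D K' H) (%i y. \<tau> i (FO (HH H i) y))"
proof (rule pcellI, goal_cases)
 case (1 i y)
 then show ?case unfolding comp_mor_FO[OF 1] by (intro pcellD(1)[OF \<tau>] functor_ob[OF premor_HH[OF H]])
next
 case (2 i f y z)
 show ?case
  unfolding comp_mor_FA[OF 2(1) homD[OF 2(2), THEN c1]] by (rule pcellD(2)[OF \<tau> 2(1) functor_hom[OF premor_HH[OF H 2(1)] 2(2)]])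
next
 case (3 i i' h y)
 then have "i : Ob Q" using hom_ob[OF category_P] by blast
 then show ?case unfolding premor_tr(1)[OF H 3] by (rule pcellD(3)[OF \<tau> 3(1) functor_ob[OF premor_HH[OF H] 3(2)]])
next
 case (4 m w ws q x ys)
 note a = 4(1,2) and ys = 4(3)
 note i = Theta_fib[OF a] and Hy = HO_ob[OF H fibs_ob[OF a] ys] and rH = isoh_hom[OF premor_rho(1)[OF H a ys]]
 have e: "map2 (%i y. \<tau> i (FO (HH H i) y)) (fibs ws x) ys = map2 \<tau> (fibs ws x) (HO H (fibs ws x) ys)"
  using ys unfolding E_ob by (intro nth_equalityI) simp_all
 show ?case
  unfolding e comp_mor_rho[OF a ys]
  by (rule comp_square[OF category_Fb[OF D i] functor_hom[OF premor_HH[OF K(1) i] rH] isoh_hom[OF premor_rho(1)[OF K(1) a Hy]]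
    functor_hom[OF premor_HH[OF K(2) i] rH] isoh_hom[OF premor_rho(1)[OF K(2) a Hy]]
    pcellD(1)[OF \<tau> i functor_ob[OF premor_HH[OF H i] functor_ob[OF functor_phi[OF A a] ys]]] pcellD(1)[OF \<tau> i functor_ob[OF functor_phi[OF B a] Hy]]
    functor_hom[OF functor_phi[OF D a] pcells_hom[OF \<tau> fibs_ob[OF a] Hy]] pcellD(2)[OF \<tau> i rH] pcellD(4)[OF \<tau> a Hy]])
qed

lemma pcell_whisk_l:
 assumes A: "prealg A" and B: "prealg B" and D: "prealg D" and H: "premor A B H" "premor A B H'" and K: "premor B D K" and \<sigma>: "pcell A B H H' \<sigma>"
 shows "pcell A D (cmor A B D K H) (cmor A B D K H') (%i y. FA (HH K i) (\<sigma> i y))"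
proof (rule pcellI, goal_cases)
 case (1 i y)
 then show ?case unfolding comp_mor_FO[OF 1] by (intro functor_hom[OF premor_HH[OF K]] pcellD(1)[OF \<sigma>])
next
 case (2 i f y z)
 have yz: "y : Ob (Fb A i)" "z : Ob (Fb A i)" using hom_ob[OF category_Fb[OF A 2(1)] 2(2)] by auto
 note s = pcellD(1)[OF \<sigma> 2(1) yz(1)] pcellD(1)[OF \<sigma> 2(1) yz(2)]
 show ?case
  unfolding comp_mor_FA[OF 2(1) homD[OF 2(2), THEN c1]] functor_comp[OF premor_HH[OF K 2(1)] functor_hom[OF premor_HH[OF H(1) 2(1)] 2(2)] s(2), symmetric]
   functor_comp[OF premor_HH[OF K 2(1)] s(1) functor_hom[OF premor_HH[OF H(2) 2(1)] 2(2)], symmetric] pcellD(2)[OF \<sigma> 2] ..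
next
 case (3 i i' h y)
 then have "i : Ob Q" using hom_ob[OF category_P] by blast
 from premor_tr(2)[OF K 3(1) pcellD(1)[OF \<sigma> this 3(2)]] show ?case unfolding pcellD(3)[OF \<sigma> 3, symmetric] by (rule sym)
next
 case (4 m w ws q x ys)
 note a = 4(1,2) and ys = 4(3)
 note i = Theta_fib[OF a] and Z = fibs_ob[OF 4(1,2)] and p = functor_ob[OF functor_phi[OF A a] ys] and K1 = functor_hom[OF premor_HH[OF K i]]
 note rH = isoh_hom[OF premor_rho(1)[OF H(1) a ys]] and rH' = isoh_hom[OF premor_rho(1)[OF H(2) a ys]]
 note s = pcellD(1)[OF \<sigma> i p] and \<sigma>s = pcells_hom[OF \<sigma> Z ys]
 note B\<sigma> = functor_hom[OF functor_phi[OF B a] \<sigma>s]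
 have e: "map2 (%i y. FA (HH K i) (\<sigma> i y)) (fibs ws x) ys = map2 (%i. FA (HH K i)) (fibs ws x) (map2 \<sigma> (fibs ws x) ys)"
  using ys unfolding E_ob by (intro nth_equalityI) simp_all
 have "FA (HH K (fib w x)) (FA (phi B m q x) (map2 \<sigma> (fibs ws x) ys)) *[Fb D (fib w x)] FA (HH K (fib w x)) (rho H m q x ys)
   = FA (HH K (fib w x)) (rho H' m q x ys) *[Fb D (fib w x)] FA (HH K (fib w x)) (\<sigma> (fib w x) (FO (phi A m q x) ys))"
  using functor_comp[OF premor_HH[OF K i] rH B\<sigma>] functor_comp[OF premor_HH[OF K i] s rH'] pcellD(4)[OF \<sigma> a ys] by simp
 from comp_square[OF category_Fb[OF D i] K1[OF rH] isoh_hom[OF premor_rho(1)[OF K a HO_ob[OF H(1) Z ys]]] K1[OF rH']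
   isoh_hom[OF premor_rho(1)[OF K a HO_ob[OF H(2) Z ys]]] K1[OF s] K1[OF B\<sigma>] functor_hom[OF functor_phi[OF D a] HA_hom[OF K Z \<sigma>s]] this
   premor_rho(2)[OF K a \<sigma>s, symmetric]]
 show ?case unfolding e comp_mor_rho[OF a ys] .
qed

end

section \<open>Morphisms into the limit correspond to cones\<close>

context diagram
begin

context
 fixes B :: "('io, 'ia, 't, 'h, 'u) alg"
 assumes B: "palgebra B"
begin

lemmas preB = alg_prealg[OF B]

abbreviation "pc_mor j b == cmor B Wa (A j) (pi j) b"

text \<open>The composite of the universal cone with \<open>b\<close>, with the whiskerings
  computed; \<open>cone_comp1_eq\<close> makes the connection.\<close>

definition cone_of where
 "cone_of b = \<lparr>N1 = (\<lambda>j\<in>Ob J. pc_mor j b), N2 = (\<lambda>f\<in>Ar J.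
  (cmor B (A (dJ f)) (A (cJ f)) (H f) (pc_mor (dJ f) b), pc_mor (cJ f) b, \<lambda>i\<in>Ob Q. \<lambda>y\<in>Ob (Fb B i). prE f (FO (HH b i) y)))\<rparr>"

lemma mor_Wa:
 assumes "amor B Wa b"
 shows "premor B Wa b" "mor_ext B b"
 using alg_mor_premor[OF B pseudo_algebra_Wa assms] alg_mor_ext[OF B pseudo_algebra_Wa assms] .

lemma mor_WO: "premor B Wa b ==> i : Ob Q ==> y : Ob (Fb B i) ==> FO (HH b i) y : WO i"
 using functor_ob[OF premor_HH, of B Wa b i y] by simp

lemma mor_WF: "premor B Wa b ==> i : Ob Q ==> t : hom (Fb B i) y z ==> FA (HH b i) t : hom (WF i) (FO (HH b i) y) (FO (HH b i) z)"
 using functor_hom[OF premor_HH, of B Wa b i t y z] by simp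

lemma mor_EW: "premor B Wa b ==> set Z <= Ob Q ==> ys : Ob (E B Z) ==> HO b Z ys : Ob (EW Z)"
 using HO_ob[of B Wa b Z ys] unfolding E_Wa .

lemma mor_rho:
 assumes b: "premor B Wa b" and a: "q : TH m w ws" "x : Ob (P m)" "ys : Ob (E B (fibs ws x))"
 shows "rho b m q x ys : hom (WF (fib w x)) (FO (HH b (fib w x)) (FO (phi B m q x) ys)) (phiO m q x (HO b (fibs ws x) ys))"
 using isoh_hom[OF premor_rho(1)[OF b a]] by (simp only: Wa_simps catfun.simps phiW_FO)

lemma pc_mor_FO: "premor B Wa b ==> i : Ob Q ==> y : Ob (Fb B i) ==> FO (HH (pc_mor j b) i) y = prO j (FO (HH b i) y)"
 by (simp add: comp_mor_FO pi_FO mor_WO)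

lemma pc_mor_FA: "premor B Wa b ==> i : Ob Q ==> t : hom (Fb B i) y z ==> FA (HH (pc_mor j b) i) t = prA j (FA (HH b i) t)"
 using pi_FA[OF _ mor_WF] by (simp add: comp_mor_FA homD)

lemma pc_mor_rho:
 assumes j: "j : Ob J" and b: "premor B Wa b" and a: "q : TH m w ws" "x : Ob (P m)" and ys: "ys : Ob (E B (fibs ws x))"
 shows "rho (pc_mor j b) m q x ys = prA j (rho b m q x ys)"
proof -
 note i = Theta_fib[OF a] and Z = fibs_ob[OF a] and r = mor_rho[OF b a ys]
 note o = mor_EW[OF b Z ys]
 have p: "prA j (rho b m q x ys) : hom (Fb (A j) (fib w x)) (prO j (FO (HH b (fib w x)) (FO (phi B m q x) ys))) (FO (phi (A j) m q x) (map (prO j) (HO b (fibs ws x) ys)))"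
  using arrD(3)[OF WF_hom(1)[OF i r] j] unfolding phiO(2)[OF a o j] .
 show ?thesis
  unfolding comp_mor_rho[OF a ys] pi_rho[OF a o] pi_FA[OF i r] by (rule comp_ident_left[OF catA[OF j i] p])
qed

lemma alg_pc_mor: "amor B Wa b ==> j : Ob J ==> amor B (A j) (pc_mor j b)"
 using alg_mor_comp[OF B pseudo_algebra_Wa alg_A _ alg_mor_pi] by blast

lemma pc_mor_assoc:
 assumes f: "f : Ar J" and b: "premor B Wa b"
 shows "cmor B Wa (A (cJ f)) (cmor Wa (A (dJ f)) (A (cJ f)) (H f) (pi (dJ f))) b
  = cmor B (A (dJ f)) (A (cJ f)) (H f) (pc_mor (dJ f) b)"
 by (rule comp_mor_assoc[OF preB prealg_Wa preA preA b premor_pi preH[OF f]]) (use J_ob[OF f] in auto)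

lemma nat_cone_of:
 assumes m: "amor B Wa b"
 shows "nat_cone B (cone_of b)"
proof -
 note b = mor_Wa(1)[OF m]
 have 1: "pcell B (A (cJ f)) (cmor B (A (dJ f)) (A (cJ f)) (H f) (pc_mor (dJ f) b)) (pc_mor (cJ f) b) (%i y. prE f (FO (HH b i) y))"
  if f: "f : Ar J" for f
  unfolding pc_mor_assoc[OF f b, symmetric]
  by (rule pcell_whisk_r[OF preB prealg_Wa preA b premor_comp premor_pi pcell_prE[OF f]])
   (use J_ob[OF f] prealg_Wa preA premor_pi preH[OF f] in auto)
 have 2: "cone i (%j. FO (HH (N1 (cone_of b) j) i) y) (%f. cel (cone_of b) f i y)" if i: "i : Ob Q" and y: "y : Ob (Fb B i)" for i y
  using WO_cone(1)[OF i mor_WO[OF b i y]] i y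
   cone_cong[of "%j. FO (HH (N1 (cone_of b) j) i) y" "%j. prO j (FO (HH b i) y)" "%f. cel (cone_of b) f i y" "%f. prE f (FO (HH b i) y)"]
  by (simp add: cone_of_def pc_mor_FO[OF b])
 note r = pcell_restrict[OF preB 1]
 show ?thesis
  unfolding nat_cone_def
 proof (intro conjI ballI 2)
  fix f assume f: "f : Ar J"
  show "N2 (cone_of b) f = (cmor B (A (dJ f)) (A (cJ f)) (H f) (N1 (cone_of b) (dJ f)), N1 (cone_of b) (cJ f), cel (cone_of b) f)"
   "pcell B (A (cJ f)) (cmor B (A (dJ f)) (A (cJ f)) (H f) (N1 (cone_of b) (dJ f))) (N1 (cone_of b) (cJ f)) (cel (cone_of b) f)"
   "cell_ext B (cel (cone_of b) f)"
   using f J_ob[OF f] r[OF f] by (simp_all add: cone_of_def)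
 qed (simp_all add: cone_of_def alg_pc_mor[OF m])
qed

text \<open>An object of the limit is known from its components and structure arrows, an arrow from
  its ends and components. The composites with the projections and the 2-cells of the cone show all
  of these.\<close>

lemma cone_of_inj:
 assumes b: "amor B Wa b" "amor B Wa c" and e: "cone_of b = cone_of c"
 shows "b = c"
proof -
 note m = mor_Wa[OF b(1)] and n = mor_Wa[OF b(2)]
 have p: "pc_mor j b = pc_mor j c" if "j : Ob J" for j
  using arg_cong[OF e, of N1, THEN fun_cong, of j] that by (simp add: cone_of_def)
 have q0: "prE f (FO (HH b i) y) = prE f (FO (HH c i) y)" if "f : Ar J" "i : Ob Q" "y : Ob (Fb B i)" for f i y
  using arg_cong[OF e, of "%q. cel q f i y"] that by (simp add: cone_of_def)
 have o: "FO (HH b i) y = FO (HH c i) y" if i: "i : Ob Q" and y: "y : Ob (Fb B i)" for i y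
  by (rule WO_eqI[OF i mor_WO[OF m(1) i y] mor_WO[OF n(1) i y] _ q0[OF _ i y]])
   (use p pc_mor_FO[OF m(1) i y] pc_mor_FO[OF n(1) i y] in metis)
 show ?thesis
 proof (rule mor_eqI[OF m(2) n(2) o])
  fix i t assume i: "i : Ob Q" and "t : Ar (Fb B i)"
  then have t: "t : hom (Fb B i) (Dom (Fb B i) t) (Cod (Fb B i) t)" by (intro homI)
  note s = hom_ob[OF category_Fb[OF preB i] t]
  show "FA (HH b i) t = FA (HH c i) t"
  proof (rule WF_eqI[OF i mor_WF[OF m(1) i t]])
   show "FA (HH c i) t : hom (WF i) (FO (HH b i) (Dom (Fb B i) t)) (FO (HH b i) (Cod (Fb B i) t))"
    using mor_WF[OF n(1) i t] o[OF i] s by simp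
   show "prA j (FA (HH b i) t) = prA j (FA (HH c i) t)" if "j : Ob J" for j
    using p[OF that] pc_mor_FA[OF m(1) i t, of j] pc_mor_FA[OF n(1) i t, of j] by simp
  qed
 next
  fix k w ws q x ys assume a: "q : TH k w ws" "x : Ob (P k)" and ys: "ys : Ob (E B (fibs ws x))"
  note i = Theta_fib[OF a] and Z = fibs_ob[OF a]
  have h: "HO b (fibs ws x) ys = HO c (fibs ws x) ys" using ys o Z unfolding E_ob by (intro nth_equalityI) (auto simp: subset_iff)
  show "rho b k q x ys = rho c k q x ys"
  proof (rule WF_eqI[OF i mor_rho[OF m(1) a ys]])
   show "rho c k q x ys : hom (WF (fib w x)) (FO (HH b (fib w x)) (FO (phi B k q x) ys)) (phiO k q x (HO b (fibs ws x) ys))"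
    unfolding h o[OF i functor_ob[OF functor_phi[OF preB a] ys]] by (rule mor_rho[OF n(1) a ys])
   show "prA j (rho b k q x ys) = prA j (rho c k q x ys)" if "j : Ob J" for j
    using p[OF that] pc_mor_rho[OF that m(1) a ys] pc_mor_rho[OF that n(1) a ys] by simp
  qed
 qed
qed

definition liftO where
 "liftO q i y = mkO (%j. FO (HH (N1 q j) i) y) (%f. cel q f i y)"

text \<open>The values of \<open>q\<close> at an object are a cone, hence an object of the limit.
  Arrows and \<open>\<rho>\<close> are assembled from those of the \<open>N1 q j\<close>, with the
  ends that a morphism into the limit must have.\<close>

definition lift where
 "lift q = \<lparr>HH = (\<lambda>i\<in>Ob Q. \<lparr>FO = (\<lambda>y\<in>Ob (Fb B i). liftO q i y),
   FA = (\<lambda>t\<in>Ar (Fb B i). mkA (liftO q i (Dom (Fb B i) t)) (liftO q i (Cod (Fb B i) t)) (%j. FA (HH (N1 q j) i) t))\<rparr>),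
  rho = (%m q' x ys. if rho_index \<Theta> I B m q' x ys then
   mkA (liftO q (fib (out \<Theta> m q') x) (FO (phi B m q' x) ys)) (phiO m q' x (map2 (liftO q) (fibs (ins \<Theta> m q') x) ys)) (%j. rho (N1 q j) m q' x ys)
   else undefined)\<rparr>"

context
 fixes q :: "('jo, 'ja, ('io, 'h, 'u) mor, ('io, 'h, 'u) mor \<times> ('io, 'h, 'u) mor \<times> ('io list => 'u => 'u)) pnt"
 assumes q: "nat_cone B q"
begin

lemmas D = nat_coneD[OF q]

lemma N1_premor: "j : Ob J ==> premor B (A j) (N1 q j)"
 using alg_mor_premor[OF B alg_A D(3)] by blast

lemma lift_O:
 assumes i: "i : Ob Q" and y: "y : Ob (Fb B i)"
 shows "FO (HH (lift q) i) y : WO i" "j : Ob J ==> prO j (FO (HH (lift q) i) y) = FO (HH (N1 q j) i) y"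
  "f : Ar J ==> prE f (FO (HH (lift q) i) y) = cel q f i y"
 using mkO_WO[OF D(7)[OF i y]] pr_mkO[OF i D(7)[OF i y]] i y by (simp_all add: lift_def liftO_def)

text \<open>The square is naturality of the 2-cell of \<open>q\<close> at \<open>f\<close>,
  evaluated at \<open>t\<close>.\<close>

lemma lift_arr:
 assumes i: "i : Ob Q" and t: "t : hom (Fb B i) y z"
 shows "arr i (FO (HH (lift q) i) y) (FO (HH (lift q) i) z) (%j. FA (HH (N1 q j) i) t)"
proof -
 have yz: "y : Ob (Fb B i)" "z : Ob (Fb B i)" using hom_ob[OF category_Fb[OF preB i] t] by auto
 show ?thesis
  unfolding arr_def
 proof (intro conjI ballI lift_O(1)[OF i] yz)
  show "FA (HH (N1 q j) i) t : hom (Fb (A j) i) (prO j (FO (HH (lift q) i) y)) (prO j (FO (HH (lift q) i) z))" if j: "j : Ob J" for j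
   unfolding lift_O(2)[OF i yz(1) j] lift_O(2)[OF i yz(2) j] by (rule functor_hom[OF premor_HH[OF N1_premor[OF j] i] t])
  fix f assume f: "f : Ar J"
  show "prE f (FO (HH (lift q) i) z) *[Fb (A (cJ f)) i] FA (HH (H f) i) (FA (HH (N1 q (dJ f)) i) t)
   = FA (HH (N1 q (cJ f)) i) t *[Fb (A (cJ f)) i] prE f (FO (HH (lift q) i) y)"
   using pcellD(2)[OF D(5)[OF f] i t] unfolding lift_O(3)[OF i yz(1) f] lift_O(3)[OF i yz(2) f] comp_mor_FA[OF i homD[OF t, THEN c1]] .
 qed
qed

lemma lift_A:
 assumes i: "i : Ob Q" and t: "t : hom (Fb B i) y z"
 shows "FA (HH (lift q) i) t : hom (WF i) (FO (HH (lift q) i) y) (FO (HH (lift q) i) z)"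
  "j : Ob J ==> prA j (FA (HH (lift q) i) t) = FA (HH (N1 q j) i) t"
proof -
 have yz: "y : Ob (Fb B i)" "z : Ob (Fb B i)" using hom_ob[OF category_Fb[OF preB i] t] by auto
 have "FA (HH (lift q) i) t = mkA (FO (HH (lift q) i) y) (FO (HH (lift q) i) z) (%j. FA (HH (N1 q j) i) t)"
  using i yz homD[OF t] by (simp add: lift_def)
 then show "FA (HH (lift q) i) t : hom (WF i) (FO (HH (lift q) i) y) (FO (HH (lift q) i) z)"
  "j : Ob J ==> prA j (FA (HH (lift q) i) t) = FA (HH (N1 q j) i) t"
  using mkA_hom[OF i lift_arr[OF i t]] pr_mkA(3)[OF i lift_arr[OF i t]] by auto
qed

lemma lift_HO:
 assumes Z: "set Z <= Ob Q" and ys: "ys : Ob (E B Z)"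
 shows "HO (lift q) Z ys : Ob (EW Z)" "j : Ob J ==> map (prO j) (HO (lift q) Z ys) = HO (N1 q j) Z ys"
  "f : Ar J ==> map (prE f) (HO (lift q) Z ys) = map2 (cel q f) Z ys"
proof -
 have n: "!!n. n < length Z ==> Z ! n : Ob Q & ys ! n : Ob (Fb B (Z ! n))" and l: "length ys = length Z"
  using ys Z unfolding E_ob by (auto simp: subset_iff)
 show "HO (lift q) Z ys : Ob (EW Z)" using n l lift_O(1) unfolding EW_ob by simp
 show "j : Ob J ==> map (prO j) (HO (lift q) Z ys) = HO (N1 q j) Z ys"
  by (rule nth_equalityI) (use n l lift_O(2) in simp_all)
 show "f : Ar J ==> map (prE f) (HO (lift q) Z ys) = map2 (cel q f) Z ys"
  by (rule nth_equalityI) (use n l lift_O(3) in simp_all)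
qed

text \<open>The square is the axiom that relates the 2-cell of \<open>q\<close> at \<open>f\<close>
  to \<open>\<rho>\<close>, once the structure arrow of \<open>phiO\<close> is written out.\<close>

lemma lift_rho_arr:
 assumes a: "q' : TH m w ws" "x : Ob (P m)" and ys: "ys : Ob (E B (fibs ws x))"
 shows "arr (fib w x) (FO (HH (lift q) (fib w x)) (FO (phi B m q' x) ys)) (phiO m q' x (HO (lift q) (fibs ws x) ys)) (%j. rho (N1 q j) m q' x ys)"
proof -
 let ?i = "fib w x" and ?\<Delta> = "fibs ws x"
 note i = Theta_fib[OF a] and Z = fibs_ob[OF a] and p = functor_ob[OF functor_phi[OF preB a] ys]
 note h = lift_HO[OF Z ys]
 note r = isoh_hom[OF premor_rho(1)[OF N1_premor a ys]]
 show ?thesis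
  unfolding arr_def
 proof (intro conjI ballI lift_O(1)[OF i p] phiO(1)[OF a h(1)])
  show "rho (N1 q j) m q' x ys : hom (Fb (A j) ?i) (prO j (FO (HH (lift q) ?i) (FO (phi B m q' x) ys))) (prO j (phiO m q' x (HO (lift q) ?\<Delta> ys)))"
   if j: "j : Ob J" for j
   unfolding lift_O(2)[OF i p j] phiO(2)[OF a h(1) j] h(2)[OF j] by (rule r[OF j])
  fix f assume f: "f : Ar J"
  note c = J_ob(2)[OF f] and d = J_ob(1)[OF f]
  note R = functor_hom[OF premor_HH[OF preH[OF f] i] r[OF d]]
   and S = isoh_hom[OF premor_rho(1)[OF preH[OF f] a HO_ob[OF N1_premor[OF d] Z ys]]]
  have T: "FA (phi (A (cJ f)) m q' x) (map2 (cel q f) ?\<Delta> ys) : hom (Fb (A (cJ f)) ?i) (FO (phi (A (cJ f)) m q' x) (HO (H f) ?\<Delta> (HO (N1 q (dJ f)) ?\<Delta> ys)))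
    (FO (phi (A (cJ f)) m q' x) (HO (N1 q (cJ f)) ?\<Delta> ys))"
   using functor_hom[OF functor_phi[OF preA[OF c] a] pcells_hom[OF D(5)[OF f] Z ys]] unfolding comp_mor_HO[OF Z ys] .
  show "prE f (phiO m q' x (HO (lift q) ?\<Delta> ys)) *[Fb (A (cJ f)) ?i] FA (HH (H f) ?i) (rho (N1 q (dJ f)) m q' x ys)
   = rho (N1 q (cJ f)) m q' x ys *[Fb (A (cJ f)) ?i] prE f (FO (HH (lift q) ?i) (FO (phi B m q' x) ys))"
   using pcellD(4)[OF D(5)[OF f] a ys]
   unfolding phiO(3)[OF a h(1) f] h(2)[OF d] h(3)[OF f] lift_O(3)[OF i p f] comp_mor_rho[OF a ys] comp_assoc[OF catA[OF c i] R S T] .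
 qed
qed

lemma lift_rho:
 assumes a: "q' : TH m w ws" "x : Ob (P m)" and ys: "ys : Ob (E B (fibs ws x))"
 shows "rho (lift q) m q' x ys = mkA (FO (HH (lift q) (fib w x)) (FO (phi B m q' x) ys)) (phiO m q' x (HO (lift q) (fibs ws x) ys)) (%j. rho (N1 q j) m q' x ys)"
  "rho (lift q) m q' x ys : hom (WF (fib w x)) (FO (HH (lift q) (fib w x)) (FO (phi B m q' x) ys)) (phiO m q' x (HO (lift q) (fibs ws x) ys))"
  "j : Ob J ==> prA j (rho (lift q) m q' x ys) = rho (N1 q j) m q' x ys"
proof -
 note i = Theta_fib[OF a] and Z = fibs_ob[OF a] and p = functor_ob[OF functor_phi[OF preB a] ys]
 have h: "map2 (liftO q) (fibs ws x) ys = HO (lift q) (fibs ws x) ys"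
  using ys Z unfolding E_ob by (intro nth_equalityI) (auto simp: lift_def subset_iff)
 have "rho (lift q) m q' x ys = mkA (liftO q (fib w x) (FO (phi B m q' x) ys)) (phiO m q' x (map2 (liftO q) (fibs ws x) ys)) (%j. rho (N1 q j) m q' x ys)"
  unfolding lift_def using a(2) ys by (simp only: mor.simps rho_index_iff[OF a(1)] out_eq[OF a(1)] ins_eq[OF a(1)] simp_thms if_True)
 also have "liftO q (fib w x) (FO (phi B m q' x) ys) = FO (HH (lift q) (fib w x)) (FO (phi B m q' x) ys)"
  using i p by (simp add: lift_def)
 finally show e: "rho (lift q) m q' x ys = mkA (FO (HH (lift q) (fib w x)) (FO (phi B m q' x) ys)) (phiO m q' x (HO (lift q) (fibs ws x) ys)) (%j. rho (N1 q j) m q' x ys)"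
  unfolding h .
 show "rho (lift q) m q' x ys : hom (WF (fib w x)) (FO (HH (lift q) (fib w x)) (FO (phi B m q' x) ys)) (phiO m q' x (HO (lift q) (fibs ws x) ys))"
  "j : Ob J ==> prA j (rho (lift q) m q' x ys) = rho (N1 q j) m q' x ys"
  unfolding e using mkA_hom[OF i lift_rho_arr[OF a ys]] pr_mkA(3)[OF i lift_rho_arr[OF a ys]] by auto
qed

lemma lift_ext: "mor_ext B (lift q)"
 by (auto simp: mor_ext_def lift_def func_ext_def)

lemma premor_lift: "premor B Wa (lift q)"
proof (rule premorI, unfold Wa_simps catfun.simps, goal_cases)
 case (1 i)
 note i = 1
 show ?case
  by (rule functor_to_WF[OF category_Fb[OF preB i] i lift_A(1)[OF i] premor_HH[OF N1_premor i] lift_A(2)[OF i] lift_O(2)[OF i]])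
next
 case (2 h i i' y)
 note h = 2(1) and y = 2(2)
 have i: "i : Ob Q" "i' : Ob Q" using hom_ob[OF category_P h] by auto
 note y' = functor_ob[OF functor_tr[OF preB h] y] and o = lift_O(1)[OF i(1) y]
 have "FO (HH (lift q) i') (FO (tr B h) y) = trO h (FO (HH (lift q) i) y)"
  by (rule WO_eqI[OF i(2) lift_O(1)[OF i(2) y'] trO(1)[OF h o]])
   (simp_all only: lift_O(2,3)[OF i(2) y'] trO(2,3)[OF h o] lift_O(2,3)[OF i(1) y] premor_tr(1)[OF N1_premor h y] pcellD(3)[OF D(5) h y])
 then show ?case by simp
next
 case (3 h i i' t y z)
 note h = 3(1) and t = 3(2)
 have i: "i : Ob Q" "i' : Ob Q" using hom_ob[OF category_P h] by auto
 have yz: "y : Ob (Fb B i)" "z : Ob (Fb B i)" using hom_ob[OF category_Fb[OF preB i(1)] t] by auto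
 note t' = functor_hom[OF functor_tr[OF preB h] t] and l = lift_A(1)[OF i(1) t]
 have o: "FO (HH (lift q) i') (FO (tr B h) y) = trO h (FO (HH (lift q) i) y)" if y: "y : Ob (Fb B i)" for y
  by (rule WO_eqI[OF i(2) lift_O(1)[OF i(2) functor_ob[OF functor_tr[OF preB h] y]] trO(1)[OF h lift_O(1)[OF i(1) y]]])
   (simp_all only: lift_O(2,3)[OF i(2) functor_ob[OF functor_tr[OF preB h] y]] trO(2,3)[OF h lift_O(1)[OF i(1) y]] lift_O(2,3)[OF i(1) y]
    premor_tr(1)[OF N1_premor h y] pcellD(3)[OF D(5) h y])
 show ?case
  by (rule WF_eqI[OF i(2) lift_A(1)[OF i(2) t'] trW(1)[OF h l, folded o[OF yz(1)] o[OF yz(2)]]])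
   (simp only: lift_A(2)[OF i(2) t'] trW(2)[OF h l] lift_A(2)[OF i(1) t] premor_tr(2)[OF N1_premor h t])
next
 case (4 m w ws q' x ys)
 note a = 4(1,2) and ys = 4(3)
 note i = Theta_fib[OF a] and Z = fibs_ob[OF a] and p = functor_ob[OF functor_phi[OF preB a] ys] and h = lift_HO[OF Z ys]
 show ?case
  unfolding lift_rho(1)[OF a ys] phiW_FO
 proof (rule isoh_WF[OF i lift_rho_arr[OF a ys]])
  fix j assume j: "j : Ob J"
  show "isoh (Fb (A j) (fib w x)) (rho (N1 q j) m q' x ys) (prO j (FO (HH (lift q) (fib w x)) (FO (phi B m q' x) ys))) (prO j (phiO m q' x (HO (lift q) (fibs ws x) ys)))"
   unfolding lift_O(2)[OF i p j] phiO(2)[OF a h(1) j] h(2)[OF j] by (rule premor_rho(1)[OF N1_premor[OF j] a ys])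
 qed
next
 case (5 m w ws q' x fs as bs)
 note a = 5(1,2) and fs = 5(3)
 let ?i = "fib w x" and ?\<Delta> = "fibs ws x" and ?fs = "map2 (%i. FA (HH (lift q) i)) (fibs ws x) fs"
 note i = Theta_fib[OF a] and Z = fibs_ob[OF a]
 have ab: "as : Ob (E B ?\<Delta>)" "bs : Ob (E B ?\<Delta>)" using hom_ob[OF category_E[OF preB Z] fs] by auto
 note C = category_WF[OF i] and p = functor_hom[OF functor_phi[OF preB a] fs]
 have F: "?fs : hom (EW ?\<Delta>) (HO (lift q) ?\<Delta> as) (HO (lift q) ?\<Delta> bs)"
  using fs lift_A(1) Z unfolding E_hom EW_hom by (simp add: subset_iff)
 have Fp: "map (prA j) ?fs = map2 (%i. FA (HH (N1 q j) i)) ?\<Delta> fs" if "j : Ob J" for j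
  using fs lift_A(2)[OF _ _ that] Z unfolding E_hom by (intro nth_equalityI) (auto simp: subset_iff)
 note P1 = lift_A(1)[OF i p] and P2 = phiW(1)[OF a F] and R1 = lift_rho(2)[OF a ab(1)] and R2 = lift_rho(2)[OF a ab(2)]
 show ?case
 proof (rule WF_eqI[OF i comp_hom[OF C P1 R2] comp_hom[OF C R1 P2]])
  fix j assume j: "j : Ob J"
  show "prA j (rho (lift q) m q' x bs *[WF ?i] FA (HH (lift q) ?i) (FA (phi B m q' x) fs)) = prA j (FA (phiW m q' x) ?fs *[WF ?i] rho (lift q) m q' x as)"
   unfolding prA_comp[OF i P1 R2 j] prA_comp[OF i R1 P2 j] lift_rho(3)[OF a ab(1) j] lift_rho(3)[OF a ab(2) j] phiW(2)[OF a F j] lift_A(2)[OF i p j] Fp[OF j]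
   by (rule premor_rho(2)[OF N1_premor[OF j] a fs])
 qed
next
 case (6 m w ws q' h x y ys)
 note q' = 6(1) and h = 6(2) and ys = 6(3)
 have x: "x : Ob (P m)" "y : Ob (P m)" using hom_ob[OF category_P h] by auto
 have hw: "fibA w h : hom Q (fib w x) (fib w y)" using fibA_hom[OF _ h] ThetaHomD[OF q'] by blast
 have hv: "fibA v h : hom Q (fib v x) (fib v y)" if "v : set ws" for v using fibA_hom[OF _ h] ThetaHomD[OF q'] that by blast
 have ys': "trs B ws h ys : Ob (E B (fibs ws y))"
  using ys functor_ob[OF functor_tr[OF preB hv]] unfolding E_ob by simp
 note a = q' x(1) and b = q' x(2)
 note L = trW(1)[OF hw lift_rho(2)[OF a ys]] and R = lift_rho(2)[OF b ys']
 note i = Theta_fib[OF b]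
 \<comment> \<open>Equality in the limit takes ends into account: \<open>c\<close> matches the
   targets of the two arrows and \<open>d\<close> their sources.\<close>
 have c: "trO (fibA w h) (phiO m q' x (HO (lift q) (fibs ws x) ys)) = phiO m q' y (HO (lift q) (fibs ws y) (trs B ws h ys))"
  unfolding phiO_nat[OF q' h lift_HO(1)[OF fibs_ob[OF a] ys], symmetric]
 proof (rule arg_cong[of _ _ "phiO m q' y"], rule nth_equalityI)
  fix n assume "n < length (map2 (%w. trO (fibA w h)) ws (HO (lift q) (fibs ws x) ys))"
  then have n: "n < length ws" "n < length ys" by auto
  have v: "fibA (ws ! n) h : hom Q (fib (ws ! n) x) (fib (ws ! n) y)" using hv n by simp
  have i: "fib (ws ! n) x : Ob Q" "fib (ws ! n) y : Ob Q" using hom_ob[OF category_P v] by auto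
  have z: "ys ! n : Ob (Fb B (fib (ws ! n) x))" using ys n unfolding E_ob by simp
  note z' = functor_ob[OF functor_tr[OF preB v] z] and o = lift_O(1)[OF i(1) z]
  have "trO (fibA (ws ! n) h) (FO (HH (lift q) (fib (ws ! n) x)) (ys ! n)) = FO (HH (lift q) (fib (ws ! n) y)) (FO (tr B (fibA (ws ! n) h)) (ys ! n))"
   by (rule WO_eqI[OF i(2) trO(1)[OF v o] lift_O(1)[OF i(2) z']])
    (simp_all only: lift_O(2,3)[OF i(2) z'] trO(2,3)[OF v o] lift_O(2,3)[OF i(1) z] premor_tr(1)[OF N1_premor v z] pcellD(3)[OF D(5) v z])
  then show "map2 (%w. trO (fibA w h)) ws (HO (lift q) (fibs ws x) ys) ! n = HO (lift q) (fibs ws y) (trs B ws h ys) ! n" using n by simp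
 qed simp
 note p = functor_ob[OF functor_phi[OF preB a] ys]
 have d: "trO (fibA w h) (FO (HH (lift q) (fib w x)) (FO (phi B m q' x) ys)) = FO (HH (lift q) (fib w y)) (FO (phi B m q' y) (trs B ws h ys))"
  unfolding phi_nat(1)[OF preB q' h ys]
  by (rule WO_eqI[OF i trO(1)[OF hw lift_O(1)[OF Theta_fib[OF a] p]] lift_O(1)[OF i functor_ob[OF functor_tr[OF preB hw] p]]])
   (simp_all only: lift_O(2,3)[OF i functor_ob[OF functor_tr[OF preB hw] p]] trO(2,3)[OF hw lift_O(1)[OF Theta_fib[OF a] p]] lift_O(2,3)[OF Theta_fib[OF a] p]
    premor_tr(1)[OF N1_premor hw p] pcellD(3)[OF D(5) hw p])
 show ?case
  by (rule WF_eqI[OF i L[unfolded c d] R])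
   (simp only: trW(2)[OF hw lift_rho(2)[OF a ys]] lift_rho(3)[OF a ys] lift_rho(3)[OF b ys'] premor_rho(3)[OF N1_premor q' h ys])
qed

lemma pc_mor_lift:
 assumes j: "j : Ob J"
 shows "pc_mor j (lift q) = N1 q j"
proof (rule mor_eqI[OF comp_mor_ext alg_mor_ext[OF B alg_A[OF j] D(3)[OF j]]])
 fix i assume i: "i : Ob Q"
 show "FO (HH (pc_mor j (lift q)) i) y = FO (HH (N1 q j) i) y" if "y : Ob (Fb B i)" for y
  unfolding pc_mor_FO[OF premor_lift i that] by (rule lift_O(2)[OF i that j])
 show "FA (HH (pc_mor j (lift q)) i) t = FA (HH (N1 q j) i) t" if "t : Ar (Fb B i)" for t
  unfolding pc_mor_FA[OF premor_lift i homI[OF that]] by (rule lift_A(2)[OF i homI[OF that] j])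
next
 fix m w ws q' x ys assume a: "q' : TH m w ws" "x : Ob (P m)" and ys: "ys : Ob (E B (fibs ws x))"
 show "rho (pc_mor j (lift q)) m q' x ys = rho (N1 q j) m q' x ys"
  unfolding pc_mor_rho[OF j premor_lift a ys] by (rule lift_rho(3)[OF a ys j])
qed

text \<open>Composition with the projection gives back \<open>N1 q j\<close>, and in
  \<open>rhoT\<close> of that composite the projection contributes an identity.\<close>

lemma prA_rhoT_lift:
 assumes j: "j : Ob J" and t: "wt Z t i" and Z: "set Z <= Ob Q" and ys: "ys : Ob (E B Z)"
 shows "prA j (rhoT B Wa (lift q) ys t) = rhoT B (A j) (N1 q j) ys t"
proof -
 note i = wt_ob[OF t] and h = lift_HO[OF Z ys]
 have r: "rhoT B Wa (lift q) ys t : hom (WF i) (FO (HH (lift q) i) (FO (evF B t) ys)) (FO (evF Wa t) (HO (lift q) Z ys))"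
  using isoh_hom[OF rhoT_isoh[OF preB prealg_Wa premor_lift t ys]] by (simp only: Wa_simps catfun.simps)
 have p: "prA j (rhoT B Wa (lift q) ys t) : hom (Fb (A j) i) (prO j (FO (HH (lift q) i) (FO (evF B t) ys))) (FO (evF (A j) t) (map (prO j) (HO (lift q) Z ys)))"
  using arrD(3)[OF WF_hom(1)[OF i r] j] evW[OF t Z h(1)[folded E_Wa]] j by simp
 have "rhoT B (A j) (pc_mor j (lift q)) ys t = prA j (rhoT B Wa (lift q) ys t)"
  unfolding rhoT_comp[OF preB prealg_Wa preA[OF j] premor_lift premor_pi[OF j] t Z ys] rhoT_pi[OF j t Z h(1)] pi_FA[OF i r]
  by (rule comp_ident_left[OF catA[OF j i] p])
 then show ?thesis by (simp add: pc_mor_lift[OF j])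
qed

text \<open>For each kind the condition equates parallel arrows of the limit, and its component at
  \<open>j\<close> is the condition for \<open>N1 q j\<close>.\<close>

lemma alg_mor_lift: "amor B Wa (lift q)"
 unfolding alg_mor_iff[OF preB alg_kinds[OF B] prealg_Wa] mor_kinds_def mor_kind_def
proof (intro conjI allI impI premor_lift lift_ext)
 fix Z i s t ys and e :: "('io, 'ia, 't, 'h, 'u) alg => 'u list => 'u"
 assume k: "kind Z i s t e" and ys: "ys : Ob (E B Z)"
 have Z: "set Z <= Ob Q" and s: "wt Z s i" and t: "wt Z t i" using kind_wt[OF k] by auto
 note i = wt_ob[OF s] and h = lift_HO[OF Z ys] and C = category_WF[OF wt_ob[OF s]]
 have r: "rhoT B Wa (lift q) ys t : hom (WF i) (FO (HH (lift q) i) (FO (evF B t) ys)) (FO (evF Wa t) (HO (lift q) Z ys))" if "wt Z t i" for t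
  using isoh_hom[OF rhoT_isoh[OF preB prealg_Wa premor_lift that ys]] by (simp only: Wa_simps catfun.simps)
 note eB = isoh_hom[OF kinds_isoD(1)[OF alg_kinds[OF B] k ys]]
 note l = lift_A(1)[OF i eB] and w = Wa_kind_hom(1)[OF k h(1)]
 have "e Wa (HO (lift q) Z ys) *[WF i] rhoT B Wa (lift q) ys s = rhoT B Wa (lift q) ys t *[WF i] FA (HH (lift q) i) (e B ys)"
 proof (rule WF_eqI[OF i comp_hom[OF C r[OF s] w] comp_hom[OF C l r[OF t]]])
  fix j assume j: "j : Ob J"
  have "mor_kinds B (A j) (N1 q j)" using D(3)[OF j] alg_mor_iff[OF preB alg_kinds[OF B] preA[OF j]] by blast
  then have "e (A j) (HO (N1 q j) Z ys) *[Fb (A j) i] rhoT B (A j) (N1 q j) ys s = rhoT B (A j) (N1 q j) ys t *[Fb (A j) i] FA (HH (N1 q j) i) (e B ys)"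
   using k ys unfolding mor_kinds_def mor_kind_def by blast
  then show "prA j (e Wa (HO (lift q) Z ys) *[WF i] rhoT B Wa (lift q) ys s) = prA j (rhoT B Wa (lift q) ys t *[WF i] FA (HH (lift q) i) (e B ys))"
   unfolding prA_comp[OF i r[OF s] w j] prA_comp[OF i l r[OF t] j] prA_rhoT_lift[OF j s Z ys] prA_rhoT_lift[OF j t Z ys]
    lift_A(2)[OF i eB j] Wa_kind_hom(2)[OF k h(1) j] h(2)[OF j] .
 qed
 then show "e Wa (HO (lift q) Z ys) *[Fb Wa i] rhoT B Wa (lift q) ys s = rhoT B Wa (lift q) ys t *[Fb Wa i] FA (HH (lift q) i) (e B ys)"
  by (simp only: Wa_simps catfun.simps)
qed

lemma cone_of_lift: "cone_of (lift q) = q"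
proof (rule pnt.equality)
 show "N1 (cone_of (lift q)) = N1 q"
  by (rule extensionalityI[OF _ D(1)]) (auto simp: cone_of_def pc_mor_lift)
 have "cel (cone_of (lift q)) f = cel q f" if f: "f : Ar J" for f
  using nat_coneD(6)[OF nat_cone_of[OF alg_mor_lift] f] D(6)[OF f] by (rule cell_eqI) (simp add: cone_of_def f lift_O(3))
 then have "N2 (cone_of (lift q)) f = N2 q f" if f: "f : Ar J" for f
  using D(4)[OF f] f J_ob[OF f] by (metis nat_coneD(4)[OF nat_cone_of[OF alg_mor_lift] f] \<open>N1 (cone_of (lift q)) = N1 q\<close>)
 then show "N2 (cone_of (lift q)) = N2 q"
  by (intro extensionalityI[OF _ D(2)]) (auto simp: cone_of_def)
qed simp

end

end

end

section \<open>2-cells into the limit correspond to modifications\<close>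

context T_algebra
begin

lemma pcell_vcomp:
 assumes A: "prealg A" and B: "prealg B" and G: "premor A B G" and H: "premor A B H" and L: "premor A B L"
  and \<sigma>: "pcell A B G H \<sigma>" and \<tau>: "pcell A B H L \<tau>"
 shows "pcell A B G L (%i y. \<tau> i y *[Fb B i] \<sigma> i y)"
proof (rule pcellI, goal_cases)
 case (1 i y)
 note i = 1(1) and y = 1(2)
 show ?case
  by (rule comp_hom[OF category_Fb[OF B i] pcellD(1)[OF \<sigma> i y] pcellD(1)[OF \<tau> i y]])
next
 case (2 i f y z)
 note i = 2(1) and f = 2(2)
 have yz: "y : Ob (Fb A i)" "z : Ob (Fb A i)" using hom_ob[OF category_Fb[OF A i] f] by auto
 show ?case
  by (rule comp_square[OF category_Fb[OF B i] pcellD(1)[OF \<sigma> i yz(1)] pcellD(1)[OF \<tau> i yz(1)] pcellD(1)[OF \<sigma> i yz(2)] pcellD(1)[OF \<tau> i yz(2)]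
    functor_hom[OF premor_HH[OF G i] f] functor_hom[OF premor_HH[OF H i] f] functor_hom[OF premor_HH[OF L i] f]
    pcellD(2)[OF \<sigma> i f, symmetric] pcellD(2)[OF \<tau> i f, symmetric], symmetric])
next
 case (3 i i' h y)
 note h = 3(1) and y = 3(2)
 have i: "i : Ob Q" using hom_ob[OF category_P h] by blast
 show ?case
  unfolding pcellD(3)[OF \<sigma> h y, symmetric] pcellD(3)[OF \<tau> h y, symmetric]
  by (rule functor_comp[OF functor_tr[OF B h] pcellD(1)[OF \<sigma> i y] pcellD(1)[OF \<tau> i y]])
next
 case (4 m w ws q x ys)
 note a = 4(1,2) and ys = 4(3)
 let ?i = "fib w x" and ?\<Delta> = "fibs ws x"
 note i = Theta_fib[OF a] and Z = fibs_ob[OF a] and p = functor_ob[OF functor_phi[OF A a] ys] and F = functor_phi[OF B a]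
 note s = pcells_hom[OF \<sigma> Z ys] and t = pcells_hom[OF \<tau> Z ys]
 have e: "map2 (%i y. \<tau> i y *[Fb B i] \<sigma> i y) ?\<Delta> ys = map2 \<tau> ?\<Delta> ys *[E B ?\<Delta>] map2 \<sigma> ?\<Delta> ys"
  using ys unfolding E_ob by (intro nth_equalityI) simp_all
 show ?case
  unfolding e functor_comp[OF F s t]
  by (rule comp_square[OF category_Fb[OF B i] pcellD(1)[OF \<sigma> i p] pcellD(1)[OF \<tau> i p] functor_hom[OF F s] functor_hom[OF F t]
    isoh_hom[OF premor_rho(1)[OF G a ys]] isoh_hom[OF premor_rho(1)[OF H a ys]] isoh_hom[OF premor_rho(1)[OF L a ys]]
    pcellD(4)[OF \<sigma> a ys, symmetric] pcellD(4)[OF \<tau> a ys, symmetric], symmetric])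
qed

end

context diagram
begin

context
 fixes F :: "('jo, 'ja, ('io, 'ia, 't, 'h, 'u) alg, ('io, 'h, 'u) mor, ('io, 'h, 'u) mor \<times> ('io, 'h, 'u) mor \<times> ('io list => 'u => 'u)) pseudo"
  and B :: "('io, 'ia, 't, 'h, 'u) alg"
 assumes F: "P0 F = A" "P1 F = H" "!!j. j : Ob J ==> Pu F j = (idm (A j), H (Ident J j), pu j)"
  "!!f g. f : Ar J ==> g : Ar J ==> cJ f = dJ g ==>
   Pc F g f = (cmor (A (dJ f)) (A (cJ f)) (A (cJ g)) (H g) (H f), H (g *[J] f), pc g f)"
  and B: "palgebra B"
begin

lemma cone_iff: "pseudo_nat J KK (const_pseudo KK B) F q \<longleftrightarrow> nat_cone B q"
 by (rule pseudo_nat_iff[OF F(1,2) _ _ B]) (simp_all add: F)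

lemmas PC_simps = PseudoCone_def[of J KK B F, unfolded Let_def cone_iff F(1)]

lemmas pB' = alg_prealg[OF B] and mWa = mor_Wa[OF B] and mWO = mor_WO[OF B] and mWF = mor_WF[OF B]

lemma cone_comp1_eq:
 assumes "amor B Wa b"
 shows "cone_comp1 J KK F Wa cone_pnt B b = cone_of B b"
proof -
 note b = mWa(1)[OF assms]
 have "whisk_r KK B Wa (A (cJ f)) (cmor Wa (A (dJ f)) (A (cJ f)) (H f) (pi (dJ f)), pi (cJ f), \<lambda>i\<in>Ob Q. \<lambda>y\<in>Ob (Fb Wa i). prE f y) b
  = (cmor B (A (dJ f)) (A (cJ f)) (H f) (pc_mor B (dJ f) b), pc_mor B (cJ f) b, \<lambda>i\<in>Ob Q. \<lambda>y\<in>Ob (Fb B i). prE f (FO (HH b i) y))"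
  if f: "f : Ar J" for f
 proof -
  note c = J_ob(2)[OF f] and d = J_ob(1)[OF f]
  show ?thesis
   unfolding whisk_r_KK[OF preA[OF c] b premor_comp[OF prealg_Wa preA[OF d] preA[OF c] premor_pi[OF d] preH[OF f]] pcell_restrict(1)[OF prealg_Wa pcell_prE[OF f]]]
    pc_mor_assoc[OF B f b] using mWO[OF b] by (auto intro!: restrict_ext)
 qed
 then show ?thesis
  by (auto simp: cone_comp1_def cone_of_def[OF B] cone_pnt_def F(1) KK_simps(3) J_ob intro!: restrict_ext)
qed

text \<open>The modification obtained from \<open>\<sigma>\<close> by whiskering with the
  projections, computed; see \<open>cone_comp_FA\<close>.\<close>

definition cells_of where
 "cells_of G L \<sigma> = (\<lambda>j\<in>Ob J. (pc_mor B j G, pc_mor B j L, \<lambda>i\<in>Ob Q. \<lambda>y\<in>Ob (Fb B i). prA j (\<sigma> i y)))"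

lemma cone_comp_FA:
 assumes "amor B Wa G" "amor B Wa L" "pcell B Wa G L \<sigma>"
 shows "FA (cone_comp J KK F Wa cone_pnt B) (G, L, \<sigma>) = (cone_of B G, cone_of B L, cells_of G L \<sigma>)"
proof -
 have "whisk_l KK B Wa (A j) (N1 cone_pnt j) (G, L, \<sigma>) = (pc_mor B j G, pc_mor B j L, \<lambda>i\<in>Ob Q. \<lambda>y\<in>Ob (Fb B i). prA j (\<sigma> i y))"
  if j: "j : Ob J" for j
 proof -
  have "FA (HH (pi j) i) (\<sigma> i y) = prA j (\<sigma> i y)" if "i : Ob Q" "y : Ob (Fb B i)" for i y
   using pi_FA[OF that(1)] pcellD(1)[OF assms(3) that] by simp
  then show ?thesis
   using j whisk_l_KK[OF preA[OF j] premor_pi[OF j] mWa(1)[OF assms(2)] assms(3)] by (auto simp: cone_pnt_def intro!: restrict_ext)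
 qed
 then show ?thesis
  unfolding cone_comp_def func.simps KK_simps(6,7) cone_comp1_eq[OF assms(1)] cone_comp1_eq[OF assms(2)] F(1)
  by (auto simp: cells_of_def intro!: restrict_ext)
qed

lemma pcell_WF: "pcell B Wa G L \<sigma> ==> i : Ob Q ==> y : Ob (Fb B i) ==> \<sigma> i y : hom (WF i) (FO (HH G i) y) (FO (HH L i) y)"
 using pcellD(1)[of B Wa G L \<sigma> i y] by simp

text \<open>The modification axiom holds because each \<open>\<sigma> i y\<close> is an arrow of the
  limit, that is, a morphism of cones.\<close>

lemma modification_cells_of:
 assumes m: "amor B Wa G" "amor B Wa L" and \<sigma>: "pcell B Wa G L \<sigma>"
 shows "modification J KK (const_pseudo KK B) F (cone_of B G) (cone_of B L) (cells_of G L \<sigma>)"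
proof -
 have "modification J KK (const_pseudo KK B) F (cone_of B G) (cone_of B L) (cells_of G L \<sigma>) \<longleftrightarrow> cells_of G L \<sigma> : extensional (Ob J) &
  (ALL j:Ob J. cells_of G L \<sigma> j = (N1 (cone_of B G) j, N1 (cone_of B L) j, snd (snd (cells_of G L \<sigma> j))) &
   pcell B (A j) (N1 (cone_of B G) j) (N1 (cone_of B L) j) (snd (snd (cells_of G L \<sigma> j))) & cell_ext B (snd (snd (cells_of G L \<sigma> j)))) &
  (ALL f:Ar J. ALL i:Ob Q. ALL y:Ob (Fb B i). cel (cone_of B L) f i y *[Fb (A (cJ f)) i] FA (HH (H f) i) (snd (snd (cells_of G L \<sigma> (dJ f))) i y)
   = snd (snd (cells_of G L \<sigma> (cJ f))) i y *[Fb (A (cJ f)) i] cel (cone_of B G) f i y)"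
  by (rule modification_iff[OF F(1,2) _ _ B nat_cone_of[OF B m(1)] nat_cone_of[OF B m(2)]]) (simp_all add: F)
 moreover have "pcell B (A j) (pc_mor B j G) (pc_mor B j L) (\<lambda>i\<in>Ob Q. \<lambda>y\<in>Ob (Fb B i). prA j (\<sigma> i y)) & cell_ext B (\<lambda>i\<in>Ob Q. \<lambda>y\<in>Ob (Fb B i). prA j (\<sigma> i y))"
  if j: "j : Ob J" for j
 proof (intro conjI pcell_restrict[OF pB'])
  show "pcell B (A j) (pc_mor B j G) (pc_mor B j L) (%i y. prA j (\<sigma> i y))"
   by (rule pcell_cong[OF pB' pcell_whisk_l[OF pB' prealg_Wa preA[OF j] mWa(1)[OF m(1)] mWa(1)[OF m(2)] premor_pi[OF j] \<sigma>]])
    (rule pi_FA[OF _ pcell_WF[OF \<sigma>]])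
  then show "pcell B (A j) (pc_mor B j G) (pc_mor B j L) (%i y. prA j (\<sigma> i y))" .
 qed
 moreover have "prE f (FO (HH L i) y) *[Fb (A (cJ f)) i] FA (HH (H f) i) (prA (dJ f) (\<sigma> i y)) = prA (cJ f) (\<sigma> i y) *[Fb (A (cJ f)) i] prE f (FO (HH G i) y)"
  if "f : Ar J" "i : Ob Q" "y : Ob (Fb B i)" for f i y
  by (rule arrD(4)[OF WF_hom(1)[OF that(2) pcell_WF[OF \<sigma> that(2,3)]] that(1)])
 ultimately show ?thesis by (simp add: cells_of_def cone_of_def[OF B] J_ob)
qed

definition lift_cell where
 "lift_cell q q' \<Lambda> = (\<lambda>i\<in>Ob Q. \<lambda>y\<in>Ob (Fb B i). mkA (FO (HH (lift B q) i) y) (FO (HH (lift B q') i) y) (%j. snd (snd (\<Lambda> j)) i y))"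

text \<open>By the modification axiom the values at \<open>y\<close> form a morphism of cones. The
  conditions on a 2-cell are then equations in the limit, and they hold in each component because
  the entries of \<open>\<Lambda>\<close> are 2-cells.\<close>

lemma lift_cell:
 assumes q: "nat_cone B q" and q': "nat_cone B q'" and \<Lambda>: "modification J KK (const_pseudo KK B) F q q' \<Lambda>"
 shows "pcell B Wa (lift B q) (lift B q') (lift_cell q q' \<Lambda>)" "cell_ext B (lift_cell q q' \<Lambda>)" "cells_of (lift B q) (lift B q') (lift_cell q q' \<Lambda>) = \<Lambda>"
proof -
 have "modification J KK (const_pseudo KK B) F q q' \<Lambda> \<longleftrightarrow> \<Lambda> : extensional (Ob J) &
  (ALL j:Ob J. \<Lambda> j = (N1 q j, N1 q' j, snd (snd (\<Lambda> j))) & pcell B (A j) (N1 q j) (N1 q' j) (snd (snd (\<Lambda> j))) & cell_ext B (snd (snd (\<Lambda> j)))) &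
  (ALL f:Ar J. ALL i:Ob Q. ALL y:Ob (Fb B i). cel q' f i y *[Fb (A (cJ f)) i] FA (HH (H f) i) (snd (snd (\<Lambda> (dJ f))) i y)
   = snd (snd (\<Lambda> (cJ f))) i y *[Fb (A (cJ f)) i] cel q f i y)"
  by (rule modification_iff[OF F(1,2) _ _ B q q']) (simp_all add: F)
 with \<Lambda> have L: "\<Lambda> : extensional (Ob J)" "!!j. j : Ob J ==> \<Lambda> j = (N1 q j, N1 q' j, snd (snd (\<Lambda> j)))"
   "!!j. j : Ob J ==> pcell B (A j) (N1 q j) (N1 q' j) (snd (snd (\<Lambda> j)))" "!!j. j : Ob J ==> cell_ext B (snd (snd (\<Lambda> j)))"
   "!!f i y. f : Ar J ==> i : Ob Q ==> y : Ob (Fb B i) ==> cel q' f i y *[Fb (A (cJ f)) i] FA (HH (H f) i) (snd (snd (\<Lambda> (dJ f))) i y)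
   = snd (snd (\<Lambda> (cJ f))) i y *[Fb (A (cJ f)) i] cel q f i y"
  by blast+
 let ?s = "%i y. mkA (FO (HH (lift B q) i) y) (FO (HH (lift B q') i) y) (%j. snd (snd (\<Lambda> j)) i y)"
 note a = premor_lift[OF B q] and b = premor_lift[OF B q']
 have ar: "arr i (FO (HH (lift B q) i) y) (FO (HH (lift B q') i) y) (%j. snd (snd (\<Lambda> j)) i y)" if i: "i : Ob Q" and y: "y : Ob (Fb B i)" for i y
  unfolding arr_def
  using lift_O[OF B q i y] lift_O[OF B q' i y] pcellD(1)[OF L(3) i y] L(5)[OF _ i y] by simp
 have h: "?s i y : hom (WF i) (FO (HH (lift B q) i) y) (FO (HH (lift B q') i) y)" and p: "!!j. j : Ob J ==> prA j (?s i y) = snd (snd (\<Lambda> j)) i y"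
  if "i : Ob Q" "y : Ob (Fb B i)" for i y
  using mkA_hom[OF that(1) ar[OF that]] pr_mkA(3)[OF that(1) ar[OF that]] by auto
 have "pcell B Wa (lift B q) (lift B q') ?s"
 proof (rule pcellI, unfold Wa_simps catfun.simps, goal_cases)
  case (1 i y)
  from 1 show ?case by (rule h)
 next
  case (2 i t y z)
  note i = 2(1) and t = 2(2)
  have yz: "y : Ob (Fb B i)" "z : Ob (Fb B i)" using hom_ob[OF category_Fb[OF pB' i] t] by auto
  note C = category_WF[OF i] and ta = lift_A[OF B q i t] and tb = lift_A[OF B q' i t] and hy = h[OF i yz(1)] and hz = h[OF i yz(2)]
  show ?case
  proof (rule WF_eqI[OF i comp_hom[OF C ta(1) hz] comp_hom[OF C hy tb(1)]])
   fix j assume j: "j : Ob J"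
   show "prA j (?s i z *[WF i] FA (HH (lift B q) i) t) = prA j (FA (HH (lift B q') i) t *[WF i] ?s i y)"
    unfolding prA_comp[OF i ta(1) hz j] prA_comp[OF i hy tb(1) j] p[OF i yz(1) j] p[OF i yz(2) j] ta(2)[OF j] tb(2)[OF j]
    by (rule pcellD(2)[OF L(3)[OF j] i t])
  qed
 next
  case (3 i i' k y)
  note k = 3(1) and y = 3(2)
  have i: "i : Ob Q" "i' : Ob Q" using hom_ob[OF category_P k] by auto
  note y' = functor_ob[OF functor_tr[OF pB' k] y]
  have o: "trO k (FO (HH (lift B q) i) y) = FO (HH (lift B q) i') (FO (tr B k) y)" "trO k (FO (HH (lift B q') i) y) = FO (HH (lift B q') i') (FO (tr B k) y)"
   using premor_tr(1)[OF a k y] premor_tr(1)[OF b k y] by simp_all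
  note l = trW[OF k h[OF i(1) y]]
  show ?case
   by (rule WF_eqI[OF i(2) l(1)[unfolded o] h[OF i(2) y']]) (simp only: l(2) p[OF i(1) y] p[OF i(2) y'] pcellD(3)[OF L(3) k y])
 next
  case (4 m w ws \<gamma> x ys)
  note g = 4(1,2) and ys = 4(3)
  let ?i = "fib w x" and ?\<Delta> = "fibs ws x" and ?y = "FO (phi B m \<gamma> x) ys"
  note i = Theta_fib[OF g] and Z = fibs_ob[OF g] and py = functor_ob[OF functor_phi[OF pB' g] ys]
  note C = category_WF[OF i]
  have n: "!!n. n < length ?\<Delta> ==> ?\<Delta> ! n : Ob Q & ys ! n : Ob (Fb B (?\<Delta> ! n))" and l: "length ys = length ?\<Delta>"
   using ys Z unfolding E_ob by (auto simp: subset_iff)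
  have hs: "map2 ?s ?\<Delta> ys : hom (EW ?\<Delta>) (HO (lift B q) ?\<Delta> ys) (HO (lift B q') ?\<Delta> ys)"
   unfolding EW_hom using n l h by simp
  have ps: "map (prA j) (map2 ?s ?\<Delta> ys) = map2 (snd (snd (\<Lambda> j))) ?\<Delta> ys" if j: "j : Ob J" for j
   by (rule nth_equalityI) (use n l p[OF _ _ j] in simp_all)
  note ra = lift_rho[OF B q g ys] and rb = lift_rho[OF B q' g ys] and P1 = phiW[OF g hs] and hy = h[OF i py]
  show ?case
  proof (rule WF_eqI[OF i comp_hom[OF C ra(2) P1(1)] comp_hom[OF C hy rb(2)]])
   fix j assume j: "j : Ob J"
   show "prA j (FA (phiW m \<gamma> x) (map2 ?s ?\<Delta> ys) *[WF ?i] rho (lift B q) m \<gamma> x ys) = prA j (rho (lift B q') m \<gamma> x ys *[WF ?i] ?s ?i ?y)"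
    unfolding prA_comp[OF i ra(2) P1(1) j] prA_comp[OF i hy rb(2) j] P1(2)[OF j] ps[OF j] ra(3)[OF j] rb(3)[OF j] p[OF i py j]
    by (rule pcellD(4)[OF L(3)[OF j] g ys])
  qed
 qed
 from pcell_restrict[OF pB' this] show "pcell B Wa (lift B q) (lift B q') (lift_cell q q' \<Lambda>)" "cell_ext B (lift_cell q q' \<Lambda>)"
  unfolding lift_cell_def .
 have "(\<lambda>i\<in>Ob Q. \<lambda>y\<in>Ob (Fb B i). prA j (lift_cell q q' \<Lambda> i y)) = snd (snd (\<Lambda> j))" if j: "j : Ob J" for j
  by (rule cell_eqI[OF _ L(4)[OF j]]) (auto simp: cell_ext_def lift_cell_def p[OF _ _ j])
 then have "cells_of (lift B q) (lift B q') (lift_cell q q' \<Lambda>) j = \<Lambda> j" if j: "j : Ob J" for j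
  using j L(2)[OF j] pc_mor_lift[OF B q j] pc_mor_lift[OF B q' j] by (simp add: cells_of_def)
 then show "cells_of (lift B q) (lift B q') (lift_cell q q' \<Lambda>) = \<Lambda>"
  by (intro extensionalityI[OF _ L(1)]) (auto simp: cells_of_def)
qed

lemma cells_of_inj:
 assumes \<sigma>: "pcell B Wa G L \<sigma>" "cell_ext B \<sigma>" and \<tau>: "pcell B Wa G L \<tau>" "cell_ext B \<tau>" and e: "cells_of G L \<sigma> = cells_of G L \<tau>"
 shows "\<sigma> = \<tau>"
proof (rule cell_eqI[OF \<sigma>(2) \<tau>(2)])
 fix i y assume i: "i : Ob Q" and y: "y : Ob (Fb B i)"
 show "\<sigma> i y = \<tau> i y"
 proof (rule WF_eqI[OF i pcell_WF[OF \<sigma>(1) i y] pcell_WF[OF \<tau>(1) i y]])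
  show "prA j (\<sigma> i y) = prA j (\<tau> i y)" if "j : Ob J" for j
   using arg_cong[OF e, of "%l. snd (snd (l j)) i y"] that i y by (simp add: cells_of_def)
 qed
qed

text \<open>Bijectivity comes with an explicit inverse: \<open>lift\<close> on objects and
  \<open>lift_cell\<close> on arrows.\<close>

lemma cone_comp_iso: "iso_of_cats (Mor2 KK B Wa) (PseudoCone J KK B F) (cone_comp J KK F Wa cone_pnt B)"
proof -
 let ?M = "Mor2 KK B Wa" and ?C = "cone_comp J KK F Wa cone_pnt B" and ?PC = "PseudoCone J KK B F"
 have FO: "FO ?C b = cone_of B b" if "amor B Wa b" for b
  using cone_comp1_eq[OF that] by (simp add: cone_comp_def)
 have Ar: "t : Ar ?M \<longleftrightarrow> (EX G L \<sigma>. t = (G, L, \<sigma>) & amor B Wa G & amor B Wa L & pcell B Wa G L \<sigma> & cell_ext B \<sigma>)" for t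
  by (auto simp: KK_simps(5) alg_cell_iff)
 have Ob: "b : Ob ?M \<longleftrightarrow> amor B Wa b" for b by (simp add: KK_simps(4))
 have PO: "Ob ?PC = {q. nat_cone B q}" and PA: "Ar ?PC = {(q, q', \<Lambda>). nat_cone B q & nat_cone B q' & modification J KK (const_pseudo KK B) F q q' \<Lambda>}"
  by (simp_all add: PC_simps)
 have func: "is_functor ?M ?PC ?C"
  unfolding is_functor_def
 proof (intro conjI ballI impI)
  fix b assume "b : Ob ?M"
  then have b: "amor B Wa b" by (simp add: Ob)
  show "FO ?C b : Ob ?PC" unfolding FO[OF b] PO using nat_cone_of[OF B b] by simp
  note m = mWa(1)[OF b]
  have i: "(b, b, \<lambda>i\<in>Ob Q. \<lambda>y\<in>Ob (Fb B i). Ident (Fb Wa i) (FO (HH b i) y)) = Ident ?M b" by (simp add: KK_simps(8))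
  have "(\<lambda>i\<in>Ob Q. \<lambda>y\<in>Ob (Fb B i). prA j ((\<lambda>i\<in>Ob Q. \<lambda>y\<in>Ob (Fb B i). Ident (Fb Wa i) (FO (HH b i) y)) i y))
   = (\<lambda>i\<in>Ob Q. \<lambda>y\<in>Ob (Fb B i). Ident (Fb (A j) i) (FO (HH (pc_mor B j b) i) y))" if j: "j : Ob J" for j
   using prA_ident[OF _ mWO[OF m] j] pc_mor_FO[OF B m] by (auto intro!: restrict_ext simp del: WF_simps(5))
  note k = this
  have "cells_of b b (\<lambda>i\<in>Ob Q. \<lambda>y\<in>Ob (Fb B i). Ident (Fb Wa i) (FO (HH b i) y))
   = (\<lambda>j\<in>Ob J. Ident (Mor2 KK B (A j)) (N1 (cone_of B b) j))"
   unfolding cells_of_def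
  proof (rule restrict_ext)
   fix j assume j: "j : Ob J"
   show "(pc_mor B j b, pc_mor B j b, \<lambda>i\<in>Ob Q. \<lambda>y\<in>Ob (Fb B i). prA j ((\<lambda>i\<in>Ob Q. \<lambda>y\<in>Ob (Fb B i). Ident (Fb Wa i) (FO (HH b i) y)) i y))
    = Ident (Mor2 KK B (A j)) (N1 (cone_of B b) j)"
    by (simp only: k[OF j] KK_simps(8) cone_of_def[OF B] pnt.simps restrict_apply'[OF j])
  qed
  then show "FA ?C (Ident ?M b) = Ident ?PC (FO ?C b)"
   using cone_comp_FA[OF b b pcell_restrict(1)[OF pB' pcell_ident[OF pB' prealg_Wa m]]] unfolding FO[OF b] i by (simp add: PC_simps)
 next
  fix t assume "t : Ar ?M"
  then obtain G L \<sigma> where t: "t = (G, L, \<sigma>)" "amor B Wa G" "amor B Wa L" "pcell B Wa G L \<sigma>" unfolding Ar by blast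
  show "FA ?C t : hom ?PC (FO ?C (Dom ?M t)) (FO ?C (Cod ?M t))"
   unfolding t(1) KK_simps(6,7) cone_comp_FA[OF t(2-4)] FO[OF t(2)] FO[OF t(3)]
   using nat_cone_of[OF B t(2)] nat_cone_of[OF B t(3)] modification_cells_of[OF t(2-4)] by (simp add: hom_def PC_simps)
 next
  fix t u assume "t : Ar ?M" "u : Ar ?M" and d: "Cod ?M t = Dom ?M u"
  then obtain G L \<sigma> L' N \<tau> where t: "t = (G, L, \<sigma>)" "amor B Wa G" "amor B Wa L" "pcell B Wa G L \<sigma>"
   and u: "u = (L', N, \<tau>)" "amor B Wa N" "pcell B Wa L' N \<tau>" unfolding Ar by blast
  have L': "L' = L" using d by (simp add: t(1) u(1) KK_simps(6,7))
  note u' = u(3)[unfolded L']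
  let ?c = "\<lambda>i\<in>Ob Q. \<lambda>y\<in>Ob (Fb B i). \<tau> i y *[Fb Wa i] \<sigma> i y"
  have ut: "u *[?M] t = (G, N, ?c)" by (simp add: t(1) u(1) KK_simps(9))
  note c = pcell_restrict(1)[OF pB' pcell_vcomp[OF pB' prealg_Wa mWa(1)[OF t(2)] mWa(1)[OF t(3)] mWa(1)[OF u(2)] t(4) u']]
  have "prA j (?c i y) = prA j (\<tau> i y) *[Fb (A j) i] prA j (\<sigma> i y)" if "j : Ob J" "i : Ob Q" "y : Ob (Fb B i)" for j i y
   using prA_comp[OF that(2) pcell_WF[OF t(4) that(2,3)] pcell_WF[OF u' that(2,3)] that(1)] that(2,3) by (simp del: WF_simps(6))
  note e = this
  have "cells_of G N ?c = (\<lambda>j\<in>Ob J. cells_of L N \<tau> j *[Mor2 KK B (A j)] cells_of G L \<sigma> j)"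
   unfolding cells_of_def
  proof (rule restrict_ext)
   fix j assume j: "j : Ob J"
   have "(\<lambda>i\<in>Ob Q. \<lambda>y\<in>Ob (Fb B i). prA j (?c i y)) = (\<lambda>i\<in>Ob Q. \<lambda>y\<in>Ob (Fb B i).
     (\<lambda>i\<in>Ob Q. \<lambda>y\<in>Ob (Fb B i). prA j (\<tau> i y)) i y *[Fb (A j) i] (\<lambda>i\<in>Ob Q. \<lambda>y\<in>Ob (Fb B i). prA j (\<sigma> i y)) i y)"
   proof (intro restrict_ext)
    fix i y assume i: "i : Ob Q" and y: "y : Ob (Fb B i)"
    show "prA j (?c i y) = (\<lambda>i\<in>Ob Q. \<lambda>y\<in>Ob (Fb B i). prA j (\<tau> i y)) i y *[Fb (A j) i] (\<lambda>i\<in>Ob Q. \<lambda>y\<in>Ob (Fb B i). prA j (\<sigma> i y)) i y"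
     unfolding e[OF j i y] by (simp only: restrict_apply'[OF i] restrict_apply'[OF y])
   qed
   then show "(pc_mor B j G, pc_mor B j N, \<lambda>i\<in>Ob Q. \<lambda>y\<in>Ob (Fb B i). prA j (?c i y)) =
     (\<lambda>j\<in>Ob J. (pc_mor B j L, pc_mor B j N, \<lambda>i\<in>Ob Q. \<lambda>y\<in>Ob (Fb B i). prA j (\<tau> i y))) j *[Mor2 KK B (A j)]
     (\<lambda>j\<in>Ob J. (pc_mor B j G, pc_mor B j L, \<lambda>i\<in>Ob Q. \<lambda>y\<in>Ob (Fb B i). prA j (\<sigma> i y))) j"
    by (simp only: KK_simps(9) restrict_apply'[OF j])
  qed
  then show "FA ?C (u *[?M] t) = FA ?C u *[?PC] FA ?C t"
   unfolding ut cone_comp_FA[OF t(2) u(2) c] unfolding t(1) u(1) L' cone_comp_FA[OF t(2-4)] cone_comp_FA[OF t(3) u(2) u'] by (simp add: PC_simps)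
 qed
 moreover have "bij_betw (FO ?C) (Ob ?M) (Ob ?PC)"
  unfolding PO
 proof (rule bij_betwI')
  fix b c assume "b : Ob ?M" "c : Ob ?M"
  then show "FO ?C b = FO ?C c \<longleftrightarrow> b = c" using cone_of_inj[OF B, of b c] FO by (auto simp: Ob)
 next
  fix b assume "b : Ob ?M"
  then show "FO ?C b : {q. nat_cone B q}" using FO nat_cone_of[OF B] by (simp add: Ob)
 next
  fix q :: "('jo, 'ja, ('io, 'h, 'u) mor, ('io, 'h, 'u) mor \<times> ('io, 'h, 'u) mor \<times> ('io list => 'u => 'u)) pnt"
  assume "q : {q. nat_cone B q}"
  then have a: "nat_cone B q" by simp
  show "EX b:Ob ?M. q = FO ?C b" using FO alg_mor_lift[OF B a] cone_of_lift[OF B a] by (intro bexI[of _ "lift B q"]) (simp_all add: Ob)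
 qed
 moreover have "bij_betw (FA ?C) (Ar ?M) (Ar ?PC)"
  unfolding PA
 proof (rule bij_betwI')
  fix t u assume "t : Ar ?M" "u : Ar ?M"
  then obtain G L \<sigma> G' L' \<tau> where t: "t = (G, L, \<sigma>)" "amor B Wa G" "amor B Wa L" "pcell B Wa G L \<sigma>" "cell_ext B \<sigma>"
   and u: "u = (G', L', \<tau>)" "amor B Wa G'" "amor B Wa L'" "pcell B Wa G' L' \<tau>" "cell_ext B \<tau>" unfolding Ar by blast
  have "t = u" if "FA ?C t = FA ?C u"
  proof -
   have e: "cone_of B G = cone_of B G'" "cone_of B L = cone_of B L'" "cells_of G L \<sigma> = cells_of G' L' \<tau>"
    using that unfolding t(1) u(1) cone_comp_FA[OF t(2-4)] cone_comp_FA[OF u(2-4)] by auto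
   note g = cone_of_inj[OF B t(2) u(2) e(1)] cone_of_inj[OF B t(3) u(3) e(2)]
   show ?thesis using cells_of_inj[OF t(4,5), of \<tau>] u(4,5) e(3) by (simp add: t(1) u(1) g)
  qed
  then show "FA ?C t = FA ?C u \<longleftrightarrow> t = u" by blast
 next
  fix t assume "t : Ar ?M"
  then obtain G L \<sigma> where t: "t = (G, L, \<sigma>)" "amor B Wa G" "amor B Wa L" "pcell B Wa G L \<sigma>" unfolding Ar by blast
  show "FA ?C t : {(q, q', \<Lambda>). nat_cone B q & nat_cone B q' & modification J KK (const_pseudo KK B) F q q' \<Lambda>}"
   unfolding t(1) cone_comp_FA[OF t(2-4)] using nat_cone_of[OF B t(2)] nat_cone_of[OF B t(3)] modification_cells_of[OF t(2-4)] by simp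
 next
  fix l assume "l : {(q, q', \<Lambda>). nat_cone B q & nat_cone B q' & modification J KK (const_pseudo KK B) F q q' \<Lambda>}"
  then obtain q q' \<Lambda> where l: "l = (q, q', \<Lambda>)" and a: "nat_cone B q" and b: "nat_cone B q'" and m: "modification J KK (const_pseudo KK B) F q q' \<Lambda>" by blast
  note c = lift_cell[OF a b m] and ma = alg_mor_lift[OF B a] and mb = alg_mor_lift[OF B b]
  have "l = FA ?C (lift B q, lift B q', lift_cell q q' \<Lambda>)"
   unfolding l cone_comp_FA[OF ma mb c(1)] c(3) cone_of_lift[OF B a] cone_of_lift[OF B b] ..
  then show "EX t:Ar ?M. l = FA ?C t" using ma mb c(1,2) Ar by blast
 qed
 ultimately show ?thesis by (simp add: iso_of_cats_def)
qed

end

lemma is_pseudo_limit_Wa: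
 fixes F :: "('jo, 'ja, ('io, 'ia, 't, 'h, 'u) alg, ('io, 'h, 'u) mor, ('io, 'h, 'u) mor \<times> ('io, 'h, 'u) mor \<times> ('io list => 'u => 'u)) pseudo"
 assumes F: "P0 F = A" "P1 F = H" "!!j. j : Ob J ==> Pu F j = (idm (A j), H (Ident J j), pu j)"
  "!!f g. f : Ar J ==> g : Ar J ==> cJ f = dJ g ==>
   Pc F g f = (cmor (A (dJ f)) (A (cJ f)) (A (cJ g)) (H g) (H f), H (g *[J] f), pc g f)"
 shows "is_pseudo_limit J KK F Wa cone_pnt"
 unfolding is_pseudo_limit_def KK_simps(1)
proof (intro conjI ballI)
 show "Wa : {A. palgebra A}" using pseudo_algebra_Wa by simp
 have "pseudo_nat J KK (const_pseudo KK Wa) F cone_pnt \<longleftrightarrow> nat_cone Wa cone_pnt"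
  by (rule cone_iff[OF F(1,2) _ _ pseudo_algebra_Wa]) (simp_all add: F)
 then show "pseudo_nat J KK (const_pseudo KK Wa) F cone_pnt" using nat_cone_pi by simp
 fix B assume "B : {A. palgebra A}"
 then have B: "palgebra B" by simp
 show "iso_of_cats (Mor2 KK B Wa) (PseudoCone J KK B F) (cone_comp J KK F Wa cone_pnt B)"
  by (rule cone_comp_iso[OF F(1,2) _ _ B]) (simp_all add: F)
qed

end

theorem theorem13p9:
  fixes \<Theta> :: "('t, 'h) thy2"
    and I :: "('t, 'io, 'ia) palg"
    and J :: "('jo, 'ja) cat"
    and F :: "('jo, 'ja, ('io, 'ia, 't, 'h, 'u) alg, ('io, 'h, 'u) mor,
               ('io, 'h, 'u) mor \<times> ('io, 'h, 'u) mor \<times> ('io list \<Rightarrow> 'u \<Rightarrow> 'u)) pseudo"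
  assumes "inaccessible TYPE('u)"
    and "two_theory TYPE('u) \<Theta>"
    and "pseudo_T_algebra (Th \<Theta>) I" and "small_category TYPE('u) (car I)"
    and "small_category TYPE('u) J"
    and "pseudo_functor J (Alg2 TYPE('u) \<Theta> I) F"
  shows "\<exists>W \<pi>. is_pseudo_limit J (Alg2 TYPE('u) \<Theta> I) F W \<pi>"
proof -
 interpret T_algebra \<Theta> "TYPE('u)" I
  using assms(2,3) by unfold_locales
 \<comment> \<open>A 2-cell is a triple; its first two entries are the source and target prescribed
   by the pseudo functor, so the third carries the data.\<close>
 let ?A = "P0 F" and ?H = "P1 F" and ?u = "%j. snd (snd (Pu F j))" and ?c = "%g f. snd (snd (Pc F g f))"
 note PF = assms(6)[unfolded pseudo_functor_def Let_def KK_simps(2,3)]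
 have J: "category J" "small TYPE('u) (Ob J)" "small TYPE('u) (Ar J)" using assms(5) by (auto simp: small_category_def)
 have Jo: "Dom J f : Ob J" "Cod J f : Ob J" if "f : Ar J" for f using J(1) that by (auto simp: category_def)
 have A: "pseudo_algebra TYPE('u) \<Theta> I (?A j)" if "j : Ob J" for j using PF that by (simp add: KK_simps(1))
 have H: "amor (?A (Dom J f)) (?A (Cod J f)) (?H f)" if "f : Ar J" for f using PF that by (simp add: KK_simps(4))
 have I: "Dom J (Ident J j) = j" "Cod J (Ident J j) = j" if "j : Ob J" for j
  using homD[OF ident_hom[OF J(1) that]] by auto
 have uh: "Pu F j : hom (Mor2 KK (?A j) (?A j)) (idm (?A j)) (?H (Ident J j))" "iso_in (Mor2 KK (?A j) (?A j)) (Pu F j)"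
  if "j : Ob J" for j using PF that by auto
 have ch: "Pc F g f : hom (Mor2 KK (?A (Dom J f)) (?A (Cod J g)))
   (cmor (?A (Dom J f)) (?A (Cod J f)) (?A (Cod J g)) (?H g) (?H f)) (?H (g *[J] f))"
   "iso_in (Mor2 KK (?A (Dom J f)) (?A (Cod J g))) (Pc F g f)"
  if "f : Ar J" "g : Ar J" "Cod J f = Dom J g" for f g
  using PF[THEN c2, THEN c2, THEN c2, THEN c1, rule_format, OF that] by auto
 have u: "Pu F j = (idm (?A j), ?H (Ident J j), ?u j)" "pcell (?A j) (?A j) (idm (?A j)) (?H (Ident J j)) (?u j)"
  if "j : Ob J" for j using uh(1)[OF that] unfolding KK_hom by auto
 have c: "Pc F g f = (cmor (?A (Dom J f)) (?A (Cod J f)) (?A (Cod J g)) (?H g) (?H f), ?H (g *[J] f), ?c g f)"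
   "pcell (?A (Dom J f)) (?A (Cod J g)) (cmor (?A (Dom J f)) (?A (Cod J f)) (?A (Cod J g)) (?H g) (?H f)) (?H (g *[J] f)) (?c g f)"
  if "f : Ar J" "g : Ar J" "Cod J f = Dom J g" for f g using ch(1)[OF that] unfolding KK_hom by auto
 interpret D: diagram \<Theta> "TYPE('u)" I J ?A ?H ?u ?c
 proof
  show "inaccessible TYPE('u)" "category J" "small TYPE('u) (Ob J)" "small TYPE('u) (Ar J)" using assms(1) J by auto
  show "small TYPE('u) (Ob (car I))" using assms(4) by (simp add: small_category_def)
  fix j assume j: "j : Ob J"
  obtain \<sigma> where s: "Pu F j = (idm (?A j), ?H (Ident J j), \<sigma>)" using u(1)[OF j] by blast
  show "isoh (Fb (?A j) i) (?u j i y) y (FO (HH (?H (Ident J j)) i) y)" if i: "i : Ob Q" and y: "y : Ob (Fb (?A j) i)" for i y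
   using KK_iso[OF A[OF j] A[OF j] uh(1)[OF j, unfolded s]] uh(2)[OF j, unfolded s] i y by (simp add: s id_mor_FO)
 next
  fix f g i y assume fg: "f : Ar J" "g : Ar J" "Cod J f = Dom J g" and i: "i : Ob Q" and y: "y : Ob (Fb (?A (Dom J f)) i)"
  obtain \<sigma> where s: "Pc F g f = (cmor (?A (Dom J f)) (?A (Cod J f)) (?A (Cod J g)) (?H g) (?H f), ?H (g *[J] f), \<sigma>)" using c(1)[OF fg] by blast
  from iffD1[OF KK_iso[OF A[OF Jo(1)[OF fg(1)]] A[OF Jo(2)[OF fg(2)]] ch(1)[OF fg, unfolded s]] ch(2)[OF fg, unfolded s], rule_format, OF i y]
  show "isoh (Fb (?A (Cod J g)) i) (?c g f i y) (FO (HH (?H g) i) (FO (HH (?H f) i) y)) (FO (HH (?H (g *[J] f)) i) y)"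
   by (simp add: s comp_mor_FO[OF i y])
 qed (use A H u(2) c(2) in auto)
 have "is_pseudo_limit J KK F D.Wa D.cone_pnt"
  by (rule D.is_pseudo_limit_Wa[OF refl refl]) (use u(1) c(1) in auto)
 then show ?thesis by blast
qed

end
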